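(* Let $d\ge1$. For each shifted skew shape $\lambda/\mu$ with $d$ boxes, $H^{\lambda/\mu}$ is an irreducible $\mathcal H(d)$-module. Every irreducible, calibrated $\mathcal H(d)$-module is isomorphic to exactly one such $H^{\lambda/\mu}$.
   Context: Conventions: everything is over $\mathbb C$ and $\mathbb Z_2$-graded; modules are finite dimensional supermodules; homomorphisms may be even or odd. $\mathcal H(d)$ is the degenerate affine Hecke-Clifford algebra: even generators $s_1,\dots,s_{d-1},x_1,\dots,x_d$, odd generators $c_1,\dots,c_d$; as a vector space $\mathbb C[x_1,\dots,x_d]\otimes\mathcal C\ell(d)\otimes\mathbb CS_d$; the $x_i$ commute, the $s_i$ satisfy the Coxeter relations of $S_d$, $c_i^2=-1$, $c_ic_j=-c_jc_i$ ($i\neq j$), $s_ic_i=c_{i+1}s_i$, $s_ic_{i+1}=c_is_i$, $s_ic_j=c_js_i$ ($j\ne i,i+1$), $c_ix_i=-x_ic_i$, $c_jx_i=x_ic_j$ ($j\neq i$), $s_ix_i=x_{i+1}s_i-1+c_ic_{i+1}$, $s_ix_j=x_js_i$ ($j\ne i,i+1$). Put $q(a)=a(a+1)$. All $\mathcal H(d)$-modules are assumed integral: the (generalized) eigenvalues of all $x_i^2$ are of the form $q(a)$, $a\in\mathbb Z$. A module is calibrated if $\mathbb C[x_1,\dots,x_d]$ acts semisimply. $\mathcal A(d)$ is the subalgebra generated by the $x_i$ and $c_i$. Shifted skew shapes: let $\lambda=(\lambda_1>\dots>\lambda_r>0)$ and $\mu=(\mu_1\ge\dots\ge\mu_r\geq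 0)$ be integer sequences such that $\mu_i=\mu_{i+1}$ implies $\mu_i=0$, and $\lambda_i\ge\mu_i$ for all $i$ ($r$ arbitrary). The shifted skew shape $\lambda/\mu$ has in row $i$ boxes in columns $i+\mu_i,\dots,i+\lambda_i-1$; the content of a box is (column)$-$(row), so row $i$ has contents $\mu_i,\dots,\lambda_i-1$. Pairs that become equal after deleting empty rows (indices with $\lambda_i=\mu_i$) are regarded as the same shape. If there are $d$ boxes, a standard filling (tableau) $L$ is a bijective filling by $1,\dots,d$ increasing along rows (left to right) and down columns; $c(L_i)$ is the content of the box labelled $i$, and $c(L)=(c(L_1),\dots,c(L_d))$. $s_iL$ is obtained by interchanging $i$ and $i+1$. Put $\kappa_{i,L}=\sqrt{q(c(L_i))}\ge0$ and $\mathcal Y_{i,L}=\sqrt{1-\frac1{(\kappa_{i+1,L}-\kappa_{i,L})^2}-\frac1{(\kappa_{i+1,L}+\kappa_{i,L})^2}}$. Let $\widehat H^{\lambda/\mu}=\bigoplus_L\mathcal C\ell(d)v_L$ (free $\mathcal C\ell(d)$-module over all standard tableaux $L$); it is an $\mathcal H(d)$-module via $x_iv_L=\kappa_{i,L}v_L$ and $s_iv_L=\frac1{\kappa_{i+1,L}-\kappa_{i,L}}v_L+\frac1{\kappa_{i+1,L}+\kappa_{i,L}}c_ic_{i+1}v_L+\mathcal Y_{i,L}v_{s_iL}$, where $v_{s_iL}=0$ if $s_iL$ is not standard. Let $\phi_i=s_i(x_i^2-x_{i+1}^2)+(x_i+x_{i+1})-c_ic_{i+1}(x_i-x_{i+1})$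 and $\phi_w=\phi_{i_1}\cdots\phi_{i_k}$ for a reduced expression $w=s_{i_1}\cdots s_{i_k}\in S_d$. Fix a standard filling $L$ of $\lambda/\mu$, let $\mathcal L(c(L))$ be an irreducible $\mathcal A(d)$-submodule of $\mathcal C\ell(d)v_L$, and set $H^{\lambda/\mu}=\sum_{w\in S_d}\phi_w\mathcal L(c(L))\subseteq\widehat H^{\lambda/\mu}$. *)

theory Defs
  imports Complex_Main "HOL-Library.Function_Algebras" "HOL-Combinatorics.Permutations"
begin

section \<open>Supermodules over the degenerate affine Hecke-Clifford algebra\<close>

text \<open>
  The algebra is given by generators and relations, so a supermodule over it is a
  \<open>\<int>\<^sub>2\<close>-graded complex vector space with operators for the generators that satisfy the
  defining relations. The space \<open>carr M\<close> is a subspace of the ambient type \<open>'v\<close> and the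
  operators only matter on \<open>carr M\<close>. In rank \<open>d\<close> the operators \<open>sact M i\<close> are used for
  \<open>1 \<le> i < d\<close>, and \<open>xact M i\<close>, \<open>cact M i\<close> for \<open>1 \<le> i \<le> d\<close>.
\<close>

record 'v hc_data =
  smul :: "complex \<Rightarrow> 'v \<Rightarrow> 'v"
  carr :: "'v set"
  evn :: "'v set"
  odd_part :: "'v set"
  sact :: "nat \<Rightarrow> 'v \<Rightarrow> 'v"
  xact :: "nat \<Rightarrow> 'v \<Rightarrow> 'v"
  cact :: "nat \<Rightarrow> 'v \<Rightarrow> 'v"

definition super_space :: "('v::ab_group_add) hc_data \<Rightarrow> bool" where
  "super_space M \<longleftrightarrow>
     vector_space (smul M) \<and>
     module.subspace (smul M) (evn M) \<and>
     module.subspace (smul M) (odd_part M) \<and>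
     evn M \<inter> odd_part M = {0} \<and>
     carr M = {u + v | u v. u \<in> evn M \<and> v \<in> odd_part M} \<and>
     (\<exists>B. finite B \<and> carr M = module.span (smul M) B)"

definition linear_map :: "('v::ab_group_add) hc_data \<Rightarrow> ('w::ab_group_add) hc_data \<Rightarrow> ('v \<Rightarrow> 'w) \<Rightarrow> bool" where
  "linear_map M N f \<longleftrightarrow>
     f ` carr M \<subseteq> carr N \<and>
     (\<forall>u\<in>carr M. \<forall>v\<in>carr M. f (u + v) = f u + f v) \<and>
     (\<forall>a. \<forall>v\<in>carr M. f (smul M a v) = smul N a (f v))"

definition even_map :: "('v::ab_group_add) hc_data \<Rightarrow> ('w::ab_group_add) hc_data \<Rightarrow> ('v \<Rightarrow> 'w) \<Rightarrow> bool" where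
  "even_map M N f \<longleftrightarrow> linear_map M N f \<and> f ` evn M \<subseteq> evn N \<and> f ` odd_part M \<subseteq> odd_part N"

definition odd_map :: "('v::ab_group_add) hc_data \<Rightarrow> ('w::ab_group_add) hc_data \<Rightarrow> ('v \<Rightarrow> 'w) \<Rightarrow> bool" where
  "odd_map M N f \<longleftrightarrow> linear_map M N f \<and> f ` evn M \<subseteq> odd_part N \<and> f ` odd_part M \<subseteq> evn N"

definition hc_relations :: "nat \<Rightarrow> ('v::ab_group_add) hc_data \<Rightarrow> bool" where
  "hc_relations d M \<longleftrightarrow> (\<forall>v\<in>carr M.
     (\<forall>i\<in>{1..<d}. sact M i (sact M i v) = v) \<and>
     (\<forall>i. 1 \<le> i \<and> i + 1 < d \<longrightarrow>
        sact M i (sact M (i+1) (sact M i v)) = sact M (i+1) (sact M i (sact M (i+1) v))) \<and>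
     (\<forall>i\<in>{1..<d}. \<forall>j\<in>{1..<d}. i + 1 < j \<or> j + 1 < i \<longrightarrow>
        sact M i (sact M j v) = sact M j (sact M i v)) \<and>
     (\<forall>i\<in>{1..d}. \<forall>j\<in>{1..d}. xact M i (xact M j v) = xact M j (xact M i v)) \<and>
     (\<forall>i\<in>{1..d}. cact M i (cact M i v) = - v) \<and>
     (\<forall>i\<in>{1..d}. \<forall>j\<in>{1..d}. i \<noteq> j \<longrightarrow> cact M i (cact M j v) = - cact M j (cact M i v)) \<and>
     (\<forall>i\<in>{1..<d}. sact M i (cact M i v) = cact M (i+1) (sact M i v)) \<and>
     (\<forall>i\<in>{1..<d}. sact M i (cact M (i+1) v) = cact M i (sact M i v)) \<and>
     (\<forall>i\<in>{1..<d}. \<forall>j\<in>{1..d}. j \<noteq> i \<and> j \<noteq> i + 1 \<longrightarrow>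
        sact M i (cact M j v) = cact M j (sact M i v)) \<and>
     (\<forall>i\<in>{1..d}. cact M i (xact M i v) = - xact M i (cact M i v)) \<and>
     (\<forall>i\<in>{1..d}. \<forall>j\<in>{1..d}. i \<noteq> j \<longrightarrow> cact M j (xact M i v) = xact M i (cact M j v)) \<and>
     (\<forall>i\<in>{1..<d}. sact M i (xact M i v)
        = xact M (i+1) (sact M i v) - v + cact M i (cact M (i+1) v)) \<and>
     (\<forall>i\<in>{1..<d}. \<forall>j\<in>{1..d}. j \<noteq> i \<and> j \<noteq> i + 1 \<longrightarrow>
        sact M i (xact M j v) = xact M j (sact M i v)))"

definition q :: "int \<Rightarrow> int" where
  "q a = a * (a + 1)"

definition integral_hc :: "nat \<Rightarrow> ('v::ab_group_add) hc_data \<Rightarrow> bool" where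
  "integral_hc d M \<longleftrightarrow>
     (\<forall>i\<in>{1..d}. \<forall>z n. \<forall>v\<in>carr M.
        v \<noteq> 0 \<and> ((\<lambda>u. xact M i (xact M i u) - smul M z u) ^^ n) v = 0
          \<longrightarrow> (\<exists>a. z = of_int (q a)))"

definition hc_module :: "nat \<Rightarrow> ('v::ab_group_add) hc_data \<Rightarrow> bool" where
  "hc_module d M \<longleftrightarrow>
     super_space M \<and>
     (\<forall>i\<in>{1..<d}. even_map M M (sact M i)) \<and>
     (\<forall>i\<in>{1..d}. even_map M M (xact M i)) \<and>
     (\<forall>i\<in>{1..d}. odd_map M M (cact M i)) \<and>
     hc_relations d M \<and>
     integral_hc d M"

definition graded_subspace :: "('v::ab_group_add) hc_data \<Rightarrow> 'v set \<Rightarrow> bool" where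
  "graded_subspace M W \<longleftrightarrow>
     W \<subseteq> carr M \<and> module.subspace (smul M) W \<and>
     W = {u + v | u v. u \<in> W \<inter> evn M \<and> v \<in> W \<inter> odd_part M}"

definition x_invariant :: "nat \<Rightarrow> 'v hc_data \<Rightarrow> 'v set \<Rightarrow> bool" where
  "x_invariant d M W \<longleftrightarrow> (\<forall>i\<in>{1..d}. xact M i ` W \<subseteq> W)"

definition A_submodule :: "nat \<Rightarrow> ('v::ab_group_add) hc_data \<Rightarrow> 'v set \<Rightarrow> bool" where
  "A_submodule d M W \<longleftrightarrow>
     graded_subspace M W \<and> x_invariant d M W \<and> (\<forall>i\<in>{1..d}. cact M i ` W \<subseteq> W)"

definition hc_submodule :: "nat \<Rightarrow> ('v::ab_group_add) hc_data \<Rightarrow> 'v set \<Rightarrow> bool" where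
  "hc_submodule d M W \<longleftrightarrow> A_submodule d M W \<and> (\<forall>i\<in>{1..<d}. sact M i ` W \<subseteq> W)"

definition irreducible_A_submodule :: "nat \<Rightarrow> ('v::ab_group_add) hc_data \<Rightarrow> 'v set \<Rightarrow> bool" where
  "irreducible_A_submodule d M U \<longleftrightarrow>
     A_submodule d M U \<and> U \<noteq> {0} \<and>
     (\<forall>W. A_submodule d M W \<and> W \<subseteq> U \<longrightarrow> W = {0} \<or> W = U)"

definition irreducible_hc :: "nat \<Rightarrow> ('v::ab_group_add) hc_data \<Rightarrow> bool" where
  "irreducible_hc d M \<longleftrightarrow>
     hc_module d M \<and> carr M \<noteq> {0} \<and>
     (\<forall>W. hc_submodule d M W \<longrightarrow> W = {0} \<or> W = carr M)"

text \<open>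
  Semisimplicity of the restriction to \<open>\<complex>[x\<^sub>1,\<dots>,x\<^sub>d]\<close>: every submodule is a direct summand.
\<close>

definition calibrated :: "nat \<Rightarrow> ('v::ab_group_add) hc_data \<Rightarrow> bool" where
  "calibrated d M \<longleftrightarrow>
     (\<forall>W. W \<subseteq> carr M \<and> module.subspace (smul M) W \<and> x_invariant d M W \<longrightarrow>
       (\<exists>W'. W' \<subseteq> carr M \<and> module.subspace (smul M) W' \<and> x_invariant d M W' \<and>
          W \<inter> W' = {0} \<and> carr M = {u + v | u v. u \<in> W \<and> v \<in> W'}))"

text \<open>
  Homomorphisms are homogeneous; an odd one picks up the sign \<open>f (a v) = (-1)\<^bsup>|a|\<^esup> a (f v)\<close>,
  which is visible only on the odd generators.
\<close>

definition even_hom :: "nat \<Rightarrow> ('v::ab_group_add) hc_data \<Rightarrow> ('w::ab_group_add) hc_data \<Rightarrow> ('v \<Rightarrow> 'w) \<Rightarrow> bool" where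
  "even_hom d M N f \<longleftrightarrow> even_map M N f \<and> (\<forall>v\<in>carr M.
     (\<forall>i\<in>{1..<d}. f (sact M i v) = sact N i (f v)) \<and>
     (\<forall>i\<in>{1..d}. f (xact M i v) = xact N i (f v)) \<and>
     (\<forall>i\<in>{1..d}. f (cact M i v) = cact N i (f v)))"

definition odd_hom :: "nat \<Rightarrow> ('v::ab_group_add) hc_data \<Rightarrow> ('w::ab_group_add) hc_data \<Rightarrow> ('v \<Rightarrow> 'w) \<Rightarrow> bool" where
  "odd_hom d M N f \<longleftrightarrow> odd_map M N f \<and> (\<forall>v\<in>carr M.
     (\<forall>i\<in>{1..<d}. f (sact M i v) = sact N i (f v)) \<and>
     (\<forall>i\<in>{1..d}. f (xact M i v) = xact N i (f v)) \<and>
     (\<forall>i\<in>{1..d}. f (cact M i v) = - cact N i (f v)))"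

definition hc_iso :: "nat \<Rightarrow> ('v::ab_group_add) hc_data \<Rightarrow> ('w::ab_group_add) hc_data \<Rightarrow> bool" where
  "hc_iso d M N \<longleftrightarrow>
     (\<exists>f. (even_hom d M N f \<or> odd_hom d M N f) \<and> bij_betw f (carr M) (carr N))"

definition restrict_to :: "'v hc_data \<Rightarrow> 'v set \<Rightarrow> 'v hc_data" where
  "restrict_to M W = M\<lparr>carr := W, evn := W \<inter> evn M, odd_part := W \<inter> odd_part M\<rparr>"

section \<open>Intertwiners\<close>

definition phi :: "('v::ab_group_add) hc_data \<Rightarrow> nat \<Rightarrow> 'v \<Rightarrow> 'v" where
  "phi M i v =
     sact M i (xact M i (xact M i v) - xact M (i+1) (xact M (i+1) v))
     + (xact M i v + xact M (i+1) v)
     - cact M i (cact M (i+1) (xact M i v - xact M (i+1) v))"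

definition phi_word :: "('v::ab_group_add) hc_data \<Rightarrow> nat list \<Rightarrow> 'v \<Rightarrow> 'v" where
  "phi_word M ws = foldr (\<lambda>i f. phi M i \<circ> f) ws id"

definition word_perm :: "nat list \<Rightarrow> nat \<Rightarrow> nat" where
  "word_perm ws = foldr (\<lambda>i p. transpose i (i+1) \<circ> p) ws id"

definition reduced_expression :: "nat \<Rightarrow> (nat \<Rightarrow> nat) \<Rightarrow> nat list \<Rightarrow> bool" where
  "reduced_expression d w ws \<longleftrightarrow>
     set ws \<subseteq> {1..<d} \<and> word_perm ws = w \<and>
     (\<forall>ws'. set ws' \<subseteq> {1..<d} \<and> word_perm ws' = w \<longrightarrow> length ws \<le> length ws')"

definition phi_perm :: "nat \<Rightarrow> ('v::ab_group_add) hc_data \<Rightarrow> (nat \<Rightarrow> nat) \<Rightarrow> 'v \<Rightarrow> 'v" where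
  "phi_perm d M w = phi_word M (SOME ws. reduced_expression d w ws)"

section \<open>Shifted skew shapes and standard fillings\<close>

text \<open>
  Rows are numbered from 0 here, and both coordinates of a box are shifted by one against
  the convention with rows \<open>1,\<dots>,r\<close>; contents do not change.
\<close>

definition skew_pair :: "nat list \<Rightarrow> nat list \<Rightarrow> bool" where
  "skew_pair lam mu \<longleftrightarrow>
     length lam = length mu \<and>
     sorted_wrt (>) lam \<and> (\<forall>i<length lam. lam ! i > 0) \<and>
     sorted_wrt (\<ge>) mu \<and>
     (\<forall>i. Suc i < length mu \<and> mu ! i = mu ! Suc i \<longrightarrow> mu ! i = 0) \<and>
     (\<forall>i<length lam. mu ! i \<le> lam ! i)"

definition same_shape :: "nat list \<Rightarrow> nat list \<Rightarrow> nat list \<Rightarrow> nat list \<Rightarrow> bool" where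
  "same_shape lam mu lam' mu' \<longleftrightarrow>
     filter (\<lambda>(l, m). l \<noteq> m) (zip lam mu) = filter (\<lambda>(l, m). l \<noteq> m) (zip lam' mu')"

definition boxes :: "nat list \<Rightarrow> nat list \<Rightarrow> (nat \<times> nat) set" where
  "boxes lam mu = {(i, j). i < length lam \<and> i + mu ! i \<le> j \<and> j < i + lam ! i}"

definition content :: "nat \<times> nat \<Rightarrow> int" where
  "content b = int (snd b) - int (fst b)"

text \<open>
  A filling is \<open>0\<close> off the shape, so that interchanging \<open>i\<close> and \<open>i + 1\<close> (for \<open>i \<ge> 1\<close>) is
  composition with a transposition.
\<close>

type_synonym filling = "nat \<times> nat \<Rightarrow> nat"

definition standard_filling :: "nat \<Rightarrow> nat list \<Rightarrow> nat list \<Rightarrow> filling \<Rightarrow> bool" where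
  "standard_filling d lam mu L \<longleftrightarrow>
     bij_betw L (boxes lam mu) {1..d} \<and>
     (\<forall>b. b \<notin> boxes lam mu \<longrightarrow> L b = 0) \<and>
     (\<forall>i j j'. (i, j) \<in> boxes lam mu \<and> (i, j') \<in> boxes lam mu \<and> j < j' \<longrightarrow> L (i, j) < L (i, j')) \<and>
     (\<forall>i i' j. (i, j) \<in> boxes lam mu \<and> (i', j) \<in> boxes lam mu \<and> i < i' \<longrightarrow> L (i, j) < L (i', j))"

definition swap_labels :: "nat \<Rightarrow> filling \<Rightarrow> filling" where
  "swap_labels i L = transpose i (i+1) \<circ> L"

definition box_of :: "nat list \<Rightarrow> nat list \<Rightarrow> filling \<Rightarrow> nat \<Rightarrow> nat \<times> nat" where
  "box_of lam mu L i = inv_into (boxes lam mu) L i"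

definition kappa :: "nat list \<Rightarrow> nat list \<Rightarrow> filling \<Rightarrow> nat \<Rightarrow> real" where
  "kappa lam mu L i = sqrt (of_int (q (content (box_of lam mu L i))))"

definition Ycoeff :: "nat list \<Rightarrow> nat list \<Rightarrow> filling \<Rightarrow> nat \<Rightarrow> real" where
  "Ycoeff lam mu L i =
     sqrt (1 - 1 / (kappa lam mu L (i+1) - kappa lam mu L i)\<^sup>2
             - 1 / (kappa lam mu L (i+1) + kappa lam mu L i)\<^sup>2)"

section \<open>The module on all standard fillings and its irreducible submodule\<close>

text \<open>
  For \<open>S \<subseteq> {1..d}\<close> let \<open>c\<^sub>S\<close> be the product of the \<open>c\<^sub>j\<close>, \<open>j \<in> S\<close>, in increasing order; these
  form a basis of the Clifford algebra. An element \<open>f\<close> stands for the sum of all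
  \<open>f L S c\<^sub>S v\<^sub>L\<close>. Since \<open>c\<^sub>j\<^sup>2 = -1\<close>, sorting gives
  \<open>c\<^sub>S c\<^sub>T = cl_sgn S T c\<^bsub>sym_diff S T\<^esub>\<close>: one sign for each pair out of order and one for each
  repeated index.
\<close>

type_synonym hvec = "filling \<Rightarrow> nat set \<Rightarrow> complex"

definition cl_sgn :: "nat set \<Rightarrow> nat set \<Rightarrow> complex" where
  "cl_sgn S T = (-1) ^ (card {(a, b). a \<in> S \<and> b \<in> T \<and> b < a} + card (S \<inter> T))"

definition hscale :: "complex \<Rightarrow> hvec \<Rightarrow> hvec" where
  "hscale a f = (\<lambda>L S. a * f L S)"

definition cv :: "nat set \<Rightarrow> filling \<Rightarrow> hvec" where
  "cv S L = (\<lambda>L' S'. if L' = L \<and> S' = S then 1 else 0)"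

text \<open>Linear extension of a map given on the basis vectors \<open>c\<^sub>S v\<^sub>L\<close>.\<close>

definition lin_ext ::
  "nat \<Rightarrow> nat list \<Rightarrow> nat list \<Rightarrow> (nat set \<Rightarrow> filling \<Rightarrow> hvec) \<Rightarrow> hvec \<Rightarrow> hvec" where
  "lin_ext d lam mu T f =
     (\<Sum>L\<in>{L. standard_filling d lam mu L}. \<Sum>S\<in>Pow {1..d}. hscale (f L S) (T S L))"

text \<open>The operators on the basis follow by moving the generators past \<open>c\<^sub>S\<close>, starting from
  \<open>x\<^sub>i v\<^sub>L = \<kappa> v\<^sub>L\<close> and the formula for \<open>s\<^sub>i v\<^sub>L\<close>.\<close>

definition hat_c :: "nat \<Rightarrow> nat set \<Rightarrow> filling \<Rightarrow> hvec" where
  "hat_c i S L = hscale (cl_sgn {i} S) (cv (sym_diff {i} S) L)"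

definition hat_x :: "nat list \<Rightarrow> nat list \<Rightarrow> nat \<Rightarrow> nat set \<Rightarrow> filling \<Rightarrow> hvec" where
  "hat_x lam mu i S L =
     hscale ((if i \<in> S then -1 else 1) * of_real (kappa lam mu L i)) (cv S L)"

text \<open>
  We have \<open>s\<^sub>i c\<^sub>S = \<plusminus> c\<^sub>S\<^sub>' s\<^sub>i\<close> where \<open>S'\<close> is the image of \<open>S\<close> under the transposition; the sign is
  \<open>-1\<close> exactly when both \<open>i\<close> and \<open>i + 1\<close> lie in \<open>S\<close>, because then \<open>c\<^sub>i c\<^bsub>i+1\<^esub>\<close> becomes
  \<open>c\<^bsub>i+1\<^esub> c\<^sub>i\<close>.
\<close>

definition hat_s :: "nat \<Rightarrow> nat list \<Rightarrow> nat list \<Rightarrow> nat \<Rightarrow> nat set \<Rightarrow> filling \<Rightarrow> hvec" where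
  "hat_s d lam mu i S L =
     (let S' = transpose i (i+1) ` S;
          k = kappa lam mu L i;
          k' = kappa lam mu L (i+1)
      in hscale (if i \<in> S \<and> i + 1 \<in> S then -1 else 1)
          (hscale (of_real (1 / (k' - k))) (cv S' L)
           + hscale (of_real (1 / (k' + k)))
               (hscale (cl_sgn S' {i, i+1}) (cv (sym_diff S' {i, i+1}) L))
           + hscale (of_real (Ycoeff lam mu L i))
               (if standard_filling d lam mu (swap_labels i L) then cv S' (swap_labels i L) else 0)))"

definition supported :: "nat \<Rightarrow> nat list \<Rightarrow> nat list \<Rightarrow> (filling \<Rightarrow> nat set \<Rightarrow> bool) \<Rightarrow> hvec set" where
  "supported d lam mu P =
     {f. \<forall>L S. f L S \<noteq> 0 \<longrightarrow> standard_filling d lam mu L \<and> S \<subseteq> {1..d} \<and> P L S}"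

definition Hhat :: "nat \<Rightarrow> nat list \<Rightarrow> nat list \<Rightarrow> hvec hc_data" where
  "Hhat d lam mu =
     \<lparr> smul = hscale,
       carr = supported d lam mu (\<lambda>L S. True),
       evn = supported d lam mu (\<lambda>L S. even (card S)),
       odd_part = supported d lam mu (\<lambda>L S. odd (card S)),
       sact = (\<lambda>i. lin_ext d lam mu (hat_s d lam mu i)),
       xact = (\<lambda>i. lin_ext d lam mu (hat_x lam mu i)),
       cact = (\<lambda>i. lin_ext d lam mu (hat_c i)) \<rparr>"

definition Cl_v :: "nat \<Rightarrow> nat list \<Rightarrow> nat list \<Rightarrow> filling \<Rightarrow> hvec set" where
  "Cl_v d lam mu L = supported d lam mu (\<lambda>L' S. L' = L)"

definition Hmod :: "nat \<Rightarrow> nat list \<Rightarrow> nat list \<Rightarrow> hvec set \<Rightarrow> hvec hc_data" where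
  "Hmod d lam mu U =
     restrict_to (Hhat d lam mu)
       {\<Sum>w\<in>{w. w permutes {1..d}}. phi_perm d (Hhat d lam mu) w (u w) | u. \<forall>w. u w \<in> U}"

definition shape_with_boxes :: "nat \<Rightarrow> nat list \<Rightarrow> nat list \<Rightarrow> bool" where
  "shape_with_boxes d lam mu \<longleftrightarrow> skew_pair lam mu \<and> card (boxes lam mu) = d"

text \<open>The choices entering the construction: a standard filling \<open>L\<close> and an irreducible
  submodule \<open>U\<close> of \<open>Cl(d) v\<^sub>L\<close>.\<close>

definition H_choice :: "nat \<Rightarrow> nat list \<Rightarrow> nat list \<Rightarrow> filling \<Rightarrow> hvec set \<Rightarrow> bool" where
  "H_choice d lam mu L U \<longleftrightarrow>
     standard_filling d lam mu L \<and>
     U \<subseteq> Cl_v d lam mu L \<and> irreducible_A_submodule d (Hhat d lam mu) U"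

end

theory Submission
  imports Defs "HOL-Computational_Algebra.Fundamental_Theorem_Algebra"
begin

text \<open>
  Call a sequence \<open>a\<^sub>1, \<dots>, a\<^sub>d\<close> of natural numbers a weight of a module if some nonzero vector
  satisfies \<open>x\<^sub>j\<^sup>2 v = q(a\<^sub>j) v\<close> for all \<open>j\<close>; since \<open>q(a) = q(-a-1)\<close>, non-negative entries suffice. The
  intertwiner \<open>\<phi>\<^sub>i\<close> exchanges the entries \<open>a\<close>, \<open>b\<close> at the places \<open>i\<close>, \<open>i + 1\<close>, and \<open>\<phi>\<^sub>i\<^sup>2\<close> is the scalar
  \<open>2(q(a) + q(b)) - (q(a) - q(b))\<^sup>2\<close>, which for \<open>a \<noteq> b\<close> vanishes exactly if \<open>\<bar>a - b\<bar> = 1\<close>. So \<open>\<phi>\<^sub>i\<close> is invertible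
  between contents that differ by at least two. For a standard filling this is the condition under
  which \<open>i\<close> and \<open>i + 1\<close> may be interchanged (\<open>standard_swap_iff_far\<close>).

  In a calibrated module, semisimplicity forces neighbouring entries of a weight to differ
  (\<open>equal_entries\<close>), and the braid relation allows equal entries at distance two only in the pattern
  \<open>0, 1, 0\<close> (\<open>repeated_entries\<close>). Moving entries by invertible intertwiners gives the general condition
  (\<open>weight_admissible\<close>): between two equal entries \<open>a\<close> both \<open>a + 1\<close> and, if \<open>a > 0\<close>, \<open>a - 1\<close> occur. The
  sequences with this property are the content sequences of the standard fillings of shifted
  skew shapes (\<open>admissible_cont\<close>, \<open>admissible_sequence_shape\<close>), and the sequence determines the shape up
  to empty rows (\<open>same_contents_same_shape\<close>).

  In the module on all standard fillings, \<open>\<phi>\<^sub>i v\<^sub>L\<close> is a multiple of \<open>v\<^bsub>s\<^sub>i L\<^esub>\<close>, and the square roots in the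
  definition of \<open>s\<^sub>i\<close> are what makes the square of this multiple agree with \<open>\<phi>\<^sub>i\<^sup>2\<close> up to sign. The braid
  relation need only be checked on \<open>v\<^sub>L\<close>. If the three contents concerned differ, it is equivalent to
  the braid relation for the intertwiners (\<open>braid_iff\<close>), and otherwise they are \<open>0, 1, 0\<close>. The
  submodule generated by \<open>U \<subseteq> Cl(d) v\<^sub>L\<close> is a direct sum of copies of \<open>U\<close>, one for each standard
  filling, which lie in different weight spaces. A nonzero submodule contains a nonzero element of
  one copy, hence this whole copy because \<open>U\<close> is irreducible, hence all copies because the intertwiners
  between standard fillings are invertible (\<open>Hmod_irreducible\<close>).

  An irreducible calibrated module \<open>M\<close> has a weight, which is the content sequence of some filling \<open>L\<close>.
  Given a homogeneous vector \<open>v\<close> of this weight, sending \<open>v\<^sub>L\<close> to \<open>v\<close> and \<open>v\<^bsub>g L\<^esub>\<close> to the matching multiple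
  of \<open>\<phi>\<^sub>g v\<close> defines a homomorphism to \<open>M\<close>. For this one needs that \<open>\<phi>\<^sub>i\<close> is zero, not merely nilpotent,
  between neighbouring contents, and this is where the irreducibility of \<open>M\<close> enters
  (\<open>phi_near_zero\<close>). The homomorphism depends on \<open>v\<close>, and for some \<open>v\<close> it does not vanish on \<open>U\<close>
  (\<open>homogeneous_combination_detected\<close>), so it restricts to an isomorphism by Schur's lemma. An
  isomorphic module has the same weights, and therefore the shape is determined by \<open>M\<close>.
\<close>

section \<open>Standard fillings as linear extensions\<close>

text \<open>
  Since \<open>\<mu>\<^sub>i \<ge> 0\<close>, contents are natural numbers, and the truncated difference is the content for every box of a
  shape.
\<close>

definition diag :: "nat \<times> nat \<Rightarrow> nat" where
  "diag b = snd b - fst b"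

definition precedes :: "nat \<times> nat \<Rightarrow> nat \<times> nat \<Rightarrow> bool" where
  "precedes b b' \<longleftrightarrow>
     fst b = fst b' \<and> snd b < snd b' \<or> fst b < fst b' \<and> diag b \<le> Suc (diag b')"

lemma skew_pair_length: "skew_pair lam mu \<Longrightarrow> length mu = length lam"
  by (simp add: skew_pair_def)

lemma skew_pair_lam_gap:
  assumes "skew_pair lam mu" "i < i'" "i' < length lam"
  shows "lam ! i' + (i' - i) \<le> lam ! i"
  using assms(2,3)
proof (induction i')
  case (Suc k)
  have "lam ! Suc k < lam ! k"
    using assms(1) Suc.prems by (auto simp: skew_pair_def sorted_wrt_iff_nth_less)
  moreover have "i < k \<Longrightarrow> lam ! k + (k - i) \<le> lam ! i"
    using Suc by simp
  ultimately show ?case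
    using Suc.prems by (cases "i = k") auto
qed simp

lemma skew_pair_mu_mono:
  assumes "skew_pair lam mu" "i < i'" "i' < length lam"
  shows "mu ! i' \<le> mu ! i"
  using assms by (auto simp: skew_pair_def sorted_wrt_iff_nth_less)

lemma skew_pair_mu_gap:
  assumes "skew_pair lam mu" "i < i'" "i' < length lam" "mu ! i' > 0"
  shows "mu ! i' + (i' - i) \<le> mu ! i"
  using assms(2-)
proof (induction i')
  case (Suc k)
  have le: "mu ! Suc k \<le> mu ! k"
    using skew_pair_mu_mono[OF assms(1), of k "Suc k"] Suc.prems by simp
  have "mu ! Suc k \<noteq> mu ! k"
    using assms(1) Suc.prems by (metis bot_nat_0.not_eq_extremum skew_pair_def)
  with le have "mu ! Suc k < mu ! k" by simp
  moreover have "i < k \<Longrightarrow> mu ! k + (k - i) \<le> mu ! i"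
    using Suc calculation by simp
  ultimately show ?case
    using Suc.prems by (cases "i = k") auto
qed simp

lemma boxes_iff:
  "(i, j) \<in> boxes lam mu \<longleftrightarrow> i < length lam \<and> i + mu ! i \<le> j \<and> j < i + lam ! i"
  by (simp add: boxes_def)

lemma boxes_iff_diag:
  "b \<in> boxes lam mu \<longleftrightarrow>
     fst b < length lam \<and> fst b \<le> snd b \<and> mu ! fst b \<le> diag b \<and> diag b < lam ! fst b"
  by (cases b) (auto simp: boxes_def diag_def)

lemma cell_in_boxes:
  "(i, i + a) \<in> boxes lam mu \<longleftrightarrow> i < length lam \<and> mu ! i \<le> a \<and> a < lam ! i"
  by (auto simp: boxes_def)

lemma diag_cell [simp]: "diag (i, i + a) = a"
  by (simp add: diag_def)

lemma box_eq_cell: "b \<in> boxes lam mu \<Longrightarrow> b = (fst b, fst b + diag b)"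
  by (cases b) (auto simp: boxes_def diag_def)

lemma content_eq_diag: "b \<in> boxes lam mu \<Longrightarrow> Defs.content b = int (diag b)"
  by (cases b) (auto simp: boxes_def diag_def Defs.content_def)

lemma finite_boxes: "finite (boxes lam mu)"
proof (rule finite_subset)
  show "boxes lam mu \<subseteq> (\<Union>i<length lam. {i} \<times> {..<i + lam ! i})"
    by (auto simp: boxes_def)
qed auto

definition extends_order :: "nat list \<Rightarrow> nat list \<Rightarrow> filling \<Rightarrow> bool" where
  "extends_order lam mu L \<longleftrightarrow>
     (\<forall>b\<in>boxes lam mu. \<forall>b'\<in>boxes lam mu. precedes b b' \<longrightarrow> L b < L b')"

lemma column_convex:
  assumes "skew_pair lam mu" "(i, j) \<in> boxes lam mu" "(i', j) \<in> boxes lam mu" "i < k" "k < i'"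
  shows "(k, j) \<in> boxes lam mu"
proof -
  have "lam ! i' + (i' - k) \<le> lam ! k"
    using skew_pair_lam_gap[OF assms(1), of k i'] assms by (auto simp: boxes_iff)
  moreover have "mu ! k > 0 \<Longrightarrow> mu ! k + (k - i) \<le> mu ! i"
    using skew_pair_mu_gap[OF assms(1), of i k] assms by (auto simp: boxes_iff)
  ultimately show ?thesis
    using assms by (cases "mu ! k > 0") (auto simp: boxes_iff)
qed

text \<open>
  A step to the next box on the right or below is an instance of \<open>precedes\<close>, which mentions the rows
  only through their order and so is insensitive to empty rows. Conversely, a box that precedes
  another one is joined to it inside the shape by steps to the right followed by steps down.
\<close>

lemma standard_filling_iff:
  assumes "skew_pair lam mu"
  shows "standard_filling d lam mu L \<longleftrightarrow>
     bij_betw L (boxes lam mu) {1..d} \<and> (\<forall>b. b \<notin> boxes lam mu \<longrightarrow> L b = 0) \<and>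
     extends_order lam mu L"
proof
  assume std: "standard_filling d lam mu L"
  have row: "L (i, j) < L (i, j')"
    if "(i, j) \<in> boxes lam mu" "(i, j') \<in> boxes lam mu" "j < j'" for i j j'
    using std that unfolding standard_filling_def by blast
  have col: "L (i, j) < L (i', j)"
    if "(i, j) \<in> boxes lam mu" "(i', j) \<in> boxes lam mu" "i < i'" for i i' j
    using std that unfolding standard_filling_def by blast
  have "L (i, j) < L (i', j')"
    if b: "(i, j) \<in> boxes lam mu" and b': "(i', j') \<in> boxes lam mu"
      and r: "precedes (i, j) (i', j')" for i j i' j'
  proof (cases "i = i'")
    case True
    with r row[of i j j'] b b' show ?thesis by (auto simp: precedes_def)
  next
    case False
    with r b b' have ii: "i < i'" and jj: "j \<le> j'"
      by (auto simp: precedes_def diag_def boxes_iff)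
    have "lam ! i' + (i' - i) \<le> lam ! i"
      using skew_pair_lam_gap[OF assms ii] b' by (simp add: boxes_iff)
    with b b' ii jj have mid: "(i, j') \<in> boxes lam mu"
      by (auto simp: boxes_iff)
    have "L (i, j) \<le> L (i, j')"
      using row[OF b mid] jj by (cases "j = j'") auto
    also have "\<dots> < L (i', j')" using col[OF mid b' ii] .
    finally show ?thesis .
  qed
  with std show "bij_betw L (boxes lam mu) {1..d} \<and> (\<forall>b. b \<notin> boxes lam mu \<longrightarrow> L b = 0) \<and>
     extends_order lam mu L"
    by (auto simp: standard_filling_def extends_order_def)
next
  assume R: "bij_betw L (boxes lam mu) {1..d} \<and> (\<forall>b. b \<notin> boxes lam mu \<longrightarrow> L b = 0) \<and>
     extends_order lam mu L"
  have col: "L (i, j) < L (i', j)"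
    if "(i, j) \<in> boxes lam mu" "(i', j) \<in> boxes lam mu" "i < i'" for i i' j
    using that
  proof (induction i')
    case (Suc k)
    have step: "L (k, j) < L (Suc k, j)" if "(k, j) \<in> boxes lam mu"
    proof -
      have "precedes (k, j) (Suc k, j)"
        using that Suc.prems by (auto simp: precedes_def diag_def boxes_iff)
      thus ?thesis using R that Suc.prems by (auto simp: extends_order_def)
    qed
    show ?case
    proof (cases "i = k")
      case True
      with step Suc.prems show ?thesis by simp
    next
      case False
      hence "(k, j) \<in> boxes lam mu" and "i < k"
        using column_convex[OF assms, of i j "Suc k" k] Suc.prems by auto
      with Suc step show ?thesis by (meson less_trans)
    qed
  qed simp
  have row: "L (i, j) < L (i, j')"
    if "(i, j) \<in> boxes lam mu" "(i, j') \<in> boxes lam mu" "j < j'" for i j j'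
    using R that by (auto simp: extends_order_def precedes_def)
  show "standard_filling d lam mu L"
    using R row col unfolding standard_filling_def by blast
qed

lemma near_diagonals_comparable:
  assumes "b \<in> boxes lam mu" "b' \<in> boxes lam mu" "b \<noteq> b'"
    and "diag b \<le> Suc (diag b')" "diag b' \<le> Suc (diag b)"
  shows "precedes b b' \<or> precedes b' b"
  using assms by (cases b; cases b') (auto simp: precedes_def)

lemma distant_diagonals_not_covering:
  assumes sk: "skew_pair lam mu" and b: "b \<in> boxes lam mu" and b': "b' \<in> boxes lam mu"
    and p: "precedes b b'" and far: "diag b + 2 \<le> diag b' \<or> diag b' + 2 \<le> diag b"
  obtains b'' where "b'' \<in> boxes lam mu" "precedes b b''" "precedes b'' b'"
proof -
  obtain i a where bb: "b = (i, i + a)" using box_eq_cell[OF b] by metis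
  obtain i' a' where bb': "b' = (i', i' + a')" using box_eq_cell[OF b'] by metis
  have far': "a + 2 \<le> a' \<or> a' + 2 \<le> a" using far by (simp add: bb bb')
  show thesis
  proof (cases "i = i'")
    case True
    with p bb bb' have "a < a'" by (simp add: precedes_def)
    with far' True b b' show thesis
      by (intro that[of "(i, i + Suc a)"])
        (auto simp: precedes_def bb bb' cell_in_boxes simp del: add_Suc_right)
  next
    case False
    with p have ii: "i < i'" "a \<le> Suc a'" by (auto simp: precedes_def bb bb')
    with far' have aa: "a + 2 \<le> a'" by simp
    have "lam ! i' + (i' - i) \<le> lam ! i"
      using skew_pair_lam_gap[OF sk ii(1)] b' by (simp add: bb' cell_in_boxes)
    with ii aa b b' show thesis
      by (intro that[of "(i, i + Suc a)"])
        (auto simp: precedes_def bb bb' cell_in_boxes simp del: add_Suc_right)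
  qed
qed

section \<open>Content sequences\<close>

definition cont :: "nat list \<Rightarrow> nat list \<Rightarrow> filling \<Rightarrow> nat \<Rightarrow> nat" where
  "cont lam mu L k = diag (box_of lam mu L k)"

definition bij_filling :: "nat \<Rightarrow> nat list \<Rightarrow> nat list \<Rightarrow> filling \<Rightarrow> bool" where
  "bij_filling d lam mu L \<longleftrightarrow>
     bij_betw L (boxes lam mu) {1..d} \<and> (\<forall>b. b \<notin> boxes lam mu \<longrightarrow> L b = 0)"

lemma standard_bij: "standard_filling d lam mu L \<Longrightarrow> bij_filling d lam mu L"
  by (simp add: standard_filling_def bij_filling_def)

lemma box_of_in:
  assumes "bij_filling d lam mu L" "k \<in> {1..d}"
  shows "box_of lam mu L k \<in> boxes lam mu" "L (box_of lam mu L k) = k"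
  using assms inv_into_into[of k L "boxes lam mu"] f_inv_into_f[of k L "boxes lam mu"]
  by (auto simp: bij_filling_def box_of_def bij_betw_def)

lemma box_of_L:
  assumes "bij_filling d lam mu L" "b \<in> boxes lam mu"
  shows "box_of lam mu L (L b) = b"
  using assms by (auto simp: bij_filling_def box_of_def bij_betw_def)

lemma label_in:
  assumes "bij_filling d lam mu L" "b \<in> boxes lam mu"
  shows "L b \<in> {1..d}"
  using assms by (auto simp: bij_filling_def bij_betw_def)

lemma content_box_of:
  assumes "bij_filling d lam mu L" "k \<in> {1..d}"
  shows "Defs.content (box_of lam mu L k) = int (cont lam mu L k)"
  using box_of_in(1)[OF assms] content_eq_diag by (simp add: cont_def)

text \<open>
  The content sequences that occur as weights: between two equal entries both neighbouring
  contents appear, except that content zero has only the neighbour one.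
\<close>

definition admissible :: "nat \<Rightarrow> (nat \<Rightarrow> nat) \<Rightarrow> bool" where
  "admissible d c \<longleftrightarrow> (\<forall>i j. 1 \<le> i \<and> i < j \<and> j \<le> d \<and> c i = c j \<longrightarrow>
     (\<exists>k. i < k \<and> k < j \<and> c k = Suc (c i)) \<and>
     (c i > 0 \<longrightarrow> (\<exists>k. i < k \<and> k < j \<and> Suc (c k) = c i)))"

lemma standard_less:
  assumes "skew_pair lam mu" "standard_filling d lam mu L"
    and "b \<in> boxes lam mu" "b' \<in> boxes lam mu" "precedes b b'"
  shows "L b < L b'"
  using assms standard_filling_iff[of lam mu d L] by (auto simp: extends_order_def)

lemma standard_precedes:
  assumes "skew_pair lam mu" "standard_filling d lam mu L"
    and "b \<in> boxes lam mu" "b' \<in> boxes lam mu" "L b < L b'"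
    and "diag b \<le> Suc (diag b')" "diag b' \<le> Suc (diag b)"
  shows "precedes b b'"
proof -
  have "b \<noteq> b'" using assms(5) by auto
  hence "precedes b b' \<or> precedes b' b"
    using near_diagonals_comparable[of b lam mu b'] assms by blast
  thus ?thesis
    using standard_less[OF assms(1,2,4,3)] assms(5) by auto
qed

text \<open>
  Two boxes on one diagonal bound a region of the shape that contains the box to the right of the
  upper one and, unless the diagonal is the main one, the box to the left of the lower one. Their
  labels lie in between.
\<close>

lemma admissible_cont:
  assumes sk: "skew_pair lam mu" and std: "standard_filling d lam mu L"
  shows "admissible d (cont lam mu L)"
  unfolding admissible_def
proof (intro allI impI)
  fix k k' assume H: "1 \<le> k \<and> k < k' \<and> k' \<le> d \<and> cont lam mu L k = cont lam mu L k'"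
  note bij = standard_bij[OF std]
  define b b' where "b = box_of lam mu L k" and "b' = box_of lam mu L k'"
  have b: "b \<in> boxes lam mu" "L b = k" and b': "b' \<in> boxes lam mu" "L b' = k'"
    using box_of_in[OF bij] H by (auto simp: b_def b'_def)
  define a where "a = cont lam mu L k"
  have da: "diag b = a" "diag b' = a" using H by (auto simp: a_def cont_def b_def b'_def)
  have "precedes b b'"
    using standard_precedes[OF sk std b(1) b'(1)] b b' H da by simp
  hence "fst b < fst b'"
    using box_eq_cell[OF b(1)] box_eq_cell[OF b'(1)] da unfolding precedes_def
    by (metis less_irrefl)
  then obtain i i' where ii: "b = (i, i + a)" "b' = (i', i' + a)" "i < i'"
    using box_eq_cell[OF b(1)] box_eq_cell[OF b'(1)] da by metis
  have gap: "lam ! i' + (i' - i) \<le> lam ! i"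
    using skew_pair_lam_gap[OF sk ii(3)] b' ii by (simp add: cell_in_boxes)
  have "(i, i + Suc a) \<in> boxes lam mu"
    using gap b b' ii by (auto simp: cell_in_boxes simp del: add_Suc_right)
  hence "\<exists>m. k < m \<and> m < k' \<and> cont lam mu L m = Suc a"
    using standard_less[OF sk std b(1), of "(i, i + Suc a)"]
      standard_less[OF sk std _ b'(1), of "(i, i + Suc a)"] b b' ii box_of_L[OF bij]
    by (intro exI[of _ "L (i, i + Suc a)"]) (auto simp: precedes_def cont_def simp del: add_Suc_right)
  moreover have "\<exists>m. k < m \<and> m < k' \<and> Suc (cont lam mu L m) = a" if "a > 0"
  proof -
    obtain a' where a': "a = Suc a'" using \<open>a > 0\<close> gr0_conv_Suc by blast
    have "mu ! i' > 0 \<Longrightarrow> mu ! i' + (i' - i) \<le> mu ! i"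
      using skew_pair_mu_gap[OF sk ii(3)] b' ii by (simp add: cell_in_boxes)
    hence "mu ! i' \<le> a'" using a' b ii by (cases "mu ! i' > 0") (auto simp: cell_in_boxes simp del: add_Suc_right)
    hence "(i', i' + a') \<in> boxes lam mu"
      using b b' ii a' by (auto simp: cell_in_boxes simp del: add_Suc_right)
    hence c: "(i', i' + a') \<in> boxes lam mu" (is "?c \<in> _") .
    have "precedes b ?c" "precedes ?c b'"
      using ii a' by (auto simp: precedes_def diag_def)
    hence "L b < L ?c" "L ?c < L b'"
      using standard_less[OF sk std] b(1) b'(1) c by blast+
    moreover have "cont lam mu L (L ?c) = a'"
      using box_of_L[OF bij c] by (simp add: cont_def)
    ultimately show ?thesis
      using b(2) b'(2) a' by (intro exI[of _ "L ?c"]) simp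
  qed
  ultimately show "(\<exists>m. k < m \<and> m < k' \<and> cont lam mu L m = Suc (cont lam mu L k)) \<and>
     (cont lam mu L k > 0 \<longrightarrow> (\<exists>m. k < m \<and> m < k' \<and> Suc (cont lam mu L m) = cont lam mu L k))"
    by (simp add: a_def)
qed

subsection \<open>Recovering the rows from the contents\<close>

text \<open>
  In a standard filling the right neighbour of the box labelled \<open>k\<close> carries the first later
  label whose content is one larger. Following these neighbours leads to the end of the row, so
  the function below gives the entry of \<open>lam\<close> that belongs to the row of \<open>k\<close>.
\<close>

definition next_label :: "nat \<Rightarrow> (nat \<Rightarrow> nat) \<Rightarrow> nat \<Rightarrow> nat \<Rightarrow> bool" where
  "next_label d c k k' \<longleftrightarrow> k < k' \<and> k' \<le> d \<and> c k' = Suc (c k) \<and>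
     (\<forall>m. k < m \<and> m < k' \<longrightarrow> c m \<noteq> Suc (c k))"

lemma next_label_unique: "next_label d c k m \<Longrightarrow> next_label d c k m' \<Longrightarrow> m = m'"
  unfolding next_label_def by (metis linorder_neqE_nat)

lemma next_label_exists:
  assumes "k < m" "m \<le> d" "c m = Suc (c k)"
  obtains m' where "next_label d c k m'" "m' \<le> m"
proof -
  define n where "n = (LEAST n. k < n \<and> n \<le> d \<and> c n = Suc (c k))"
  have n: "k < n \<and> n \<le> d \<and> c n = Suc (c k)" "n \<le> m"
    unfolding n_def using assms LeastI[of "\<lambda>n. k < n \<and> n \<le> d \<and> c n = Suc (c k)" m]
      Least_le[of "\<lambda>n. k < n \<and> n \<le> d \<and> c n = Suc (c k)" m] by auto
  have "c p \<noteq> Suc (c k)" if "k < p" "p < n" for p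
    using not_less_Least[of p "\<lambda>n. k < n \<and> n \<le> d \<and> c n = Suc (c k)"] that n
    unfolding n_def[symmetric] by auto
  with n that show thesis by (auto simp: next_label_def)
qed

function row_end :: "nat \<Rightarrow> (nat \<Rightarrow> nat) \<Rightarrow> nat \<Rightarrow> nat" where
  "row_end d c k =
     (if \<exists>k'. next_label d c k k' then row_end d c (SOME k'. next_label d c k k') else Suc (c k))"
  by auto
termination
proof (relation "measure (\<lambda>(d, c, k). d - k)")
  fix d c k assume "\<exists>k'. next_label d c k k'"
  moreover define n where "n = (SOME k'. next_label d c k k')"
  ultimately have "next_label d c k n" by (metis someI_ex)
  hence "d - n < d - k" by (auto simp: next_label_def)
  thus "((d, c, SOME k'. next_label d c k k'), (d, c, k)) \<in> measure (\<lambda>(d, c, k). d - k)"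
    unfolding n_def[symmetric] by simp
qed simp

declare row_end.simps [simp del]

lemma row_end_next: "next_label d c k k' \<Longrightarrow> row_end d c k = row_end d c k'"
proof -
  assume n: "next_label d c k k'"
  hence eq: "(SOME k'. next_label d c k k') = k'"
    by (meson next_label_unique someI)
  have "\<exists>k'. next_label d c k k'" using n by blast
  thus ?thesis using row_end.simps[of d c k] eq by argo
qed

lemma row_end_last: "\<nexists>k'. next_label d c k k' \<Longrightarrow> row_end d c k = Suc (c k)"
  using row_end.simps[of d c k] by argo

text \<open>
  All later boxes on the next diagonal lie in the same or a lower row, and those in a lower row are
  preceded by the right neighbour of the given box.
\<close>

lemma row_end_eq_lam:
  assumes sk: "skew_pair lam mu" and std: "standard_filling d lam mu L"
    and "k \<in> {1..d}"
  shows "row_end d (cont lam mu L) k = lam ! fst (box_of lam mu L k)"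
  using assms(3)
proof (induction "d - k" arbitrary: k rule: less_induct)
  case less
  note bij = standard_bij[OF std]
  define b i a where "b = box_of lam mu L k" and "i = fst b" and "a = cont lam mu L k"
  have b: "b \<in> boxes lam mu" "L b = k" using box_of_in[OF bij] less.prems by (auto simp: b_def)
  have bi: "b = (i, i + a)" using box_eq_cell[OF b(1)] by (simp add: i_def a_def cont_def b_def)
  have later: "i \<le> fst (box_of lam mu L m) \<and>
      (fst (box_of lam mu L m) \<noteq> i \<longrightarrow> precedes (i, i + Suc a) (box_of lam mu L m)) \<and>
      (i, i + Suc a) \<in> boxes lam mu"
    if m: "k < m" "m \<le> d" "cont lam mu L m = Suc a" for m
  proof -
    define b' where "b' = box_of lam mu L m"
    have b': "b' \<in> boxes lam mu" "L b' = m" using box_of_in[OF bij] m by (auto simp: b'_def)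
    have d': "diag b' = Suc a" using m by (simp add: cont_def b'_def)
    have le: "i \<le> fst b'"
      using standard_precedes[OF sk std b(1) b'(1)] b b' m bi d' by (auto simp: precedes_def)
    have "Suc a < lam ! fst b'" "fst b' < length lam" using b'(1) d' by (auto simp: boxes_iff_diag)
    hence "Suc a < lam ! i"
      using skew_pair_lam_gap[OF sk, of i "fst b'"] le by (cases "i = fst b'") auto
    hence "(i, i + Suc a) \<in> boxes lam mu" using b(1) bi by (auto simp: cell_in_boxes simp del: add_Suc_right)
    thus ?thesis
      using le d' unfolding b'_def[symmetric] by (auto simp: precedes_def simp del: add_Suc_right)
  qed
  show ?case
  proof (cases "Suc a < lam ! i")
    case True
    define b' m where "b' = (i, i + Suc a)" and "m = L b'"
    have b': "b' \<in> boxes lam mu"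
      using True b(1) by (auto simp: bi b'_def cell_in_boxes simp del: add_Suc_right)
    have m: "m \<in> {1..d}" "k < m" "cont lam mu L m = Suc a"
      using label_in[OF bij b'] standard_less[OF sk std b(1) b'] b(2) box_of_L[OF bij b']
      by (auto simp: m_def precedes_def bi b'_def cont_def simp del: add_Suc_right)
    have "cont lam mu L p \<noteq> Suc a" if p: "k < p" "p < m" for p
    proof
      assume c: "cont lam mu L p = Suc a"
      have pd: "p \<in> {1..d}" using p m by auto
      have bp: "box_of lam mu L p \<in> boxes lam mu" "L (box_of lam mu L p) = p"
        using box_of_in[OF bij pd] by auto
      have "fst (box_of lam mu L p) \<noteq> i"
      proof
        assume "fst (box_of lam mu L p) = i"
        hence "box_of lam mu L p = b'"
          using box_eq_cell[OF bp(1)] c by (simp add: b'_def cont_def)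
        with bp p show False by (simp add: m_def)
      qed
      hence "precedes b' (box_of lam mu L p)" using later[of p] p pd c by (simp add: b'_def)
      hence "m < p" using standard_less[OF sk std b' bp(1)] bp by (simp add: m_def)
      with p show False by simp
    qed
    hence nx: "next_label d (cont lam mu L) k m"
      using m by (auto simp: next_label_def a_def)
    have "row_end d (cont lam mu L) m = lam ! fst (box_of lam mu L m)"
      using less.hyps[of m] m less.prems by auto
    thus ?thesis
      using row_end_next[OF nx] box_of_L[OF bij b'] by (simp add: m_def b'_def b_def[symmetric] i_def)
  next
    case False
    have "lam ! i = Suc a" using False b(1) by (auto simp: bi cell_in_boxes)
    moreover have "\<nexists>m. next_label d (cont lam mu L) k m"
    proof
      assume "\<exists>m. next_label d (cont lam mu L) k m"
      then obtain m where "k < m" "m \<le> d" "cont lam mu L m = Suc a"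
        by (auto simp: next_label_def a_def)
      hence "(i, i + Suc a) \<in> boxes lam mu" using later by blast
      with False show False by (auto simp: cell_in_boxes simp del: add_Suc_right)
    qed
    ultimately show ?thesis
      using row_end_last by (simp add: b_def[symmetric] i_def[symmetric] a_def)
  qed
qed

definition rows :: "nat list \<Rightarrow> nat list \<Rightarrow> (nat \<times> nat) set" where
  "rows lam mu = {(lam ! i, mu ! i) | i. i < length lam \<and> mu ! i < lam ! i}"

lemma lam_inj:
  assumes "skew_pair lam mu" "i < length lam" "i' < length lam" "lam ! i = lam ! i'"
  shows "i = i'"
  using skew_pair_lam_gap[OF assms(1), of i i'] skew_pair_lam_gap[OF assms(1), of i' i] assms
  by (cases i i' rule: linorder_cases) auto

lemma lam_order_iff:
  assumes "skew_pair lam mu" "i < length lam" "i' < length lam"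
  shows "i < i' \<longleftrightarrow> lam ! i' < lam ! i"
  using skew_pair_lam_gap[OF assms(1), of i i'] skew_pair_lam_gap[OF assms(1), of i' i] assms
  by (cases i i' rule: linorder_cases) auto

lemma sorted_wrt_set_unique:
  assumes "\<And>x y. R x y \<Longrightarrow> \<not> R y x"
  shows "sorted_wrt R xs \<Longrightarrow> sorted_wrt R ys \<Longrightarrow> set xs = set ys \<Longrightarrow> xs = ys"
proof (induction xs arbitrary: ys)
  case (Cons x xs)
  then obtain y ys' where ys: "ys = y # ys'" by (cases ys) auto
  have irr: "\<not> R z z" for z using assms by blast
  have "x = y"
  proof (rule ccontr)
    assume "x \<noteq> y"
    moreover have "x \<in> insert y (set ys')" "y \<in> insert x (set xs)"
      using Cons.prems(3) ys by auto
    ultimately have "x \<in> set ys'" "y \<in> set xs" by auto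
    hence "R y x" "R x y" using Cons.prems ys by auto
    with assms show False by blast
  qed
  moreover have "x \<notin> set xs" "y \<notin> set ys'" using Cons.prems ys irr by auto
  ultimately have "set xs = set ys'" using Cons.prems ys by auto
  with Cons \<open>x = y\<close> ys show ?case by auto
qed simp

text \<open>
  The list of nonempty rows is strictly decreasing in \<open>\<lambda>\<^sub>i\<close>, so it is determined by its set of entries.
\<close>

lemma same_shape_iff_rows:
  assumes "skew_pair lam mu" "skew_pair lam' mu'"
  shows "same_shape lam mu lam' mu' \<longleftrightarrow> rows lam mu = rows lam' mu'"
proof -
  have set: "set (filter (\<lambda>(l, m). l \<noteq> m) (zip l0 m0)) = rows l0 m0" if "skew_pair l0 m0" for l0 m0
  proof -
    have "m0 ! i \<le> l0 ! i" if "i < length l0" for i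
      using \<open>skew_pair l0 m0\<close> that by (simp add: skew_pair_def)
    thus ?thesis
      using skew_pair_length[OF that] by (fastforce simp: rows_def set_zip)
  qed
  have srt: "sorted_wrt (\<lambda>p q. fst q < fst p) (filter (\<lambda>(l, m). l \<noteq> m) (zip l0 m0))"
    if "skew_pair l0 m0" for l0 m0 :: "nat list"
  proof (rule sorted_wrt_filter)
    have "sorted_wrt (>) (map fst (zip l0 m0))"
      using that by (simp add: skew_pair_def)
    thus "sorted_wrt (\<lambda>p q. fst q < fst p) (zip l0 m0)"
      by (simp add: sorted_wrt_map)
  qed
  have "filter (\<lambda>(l, m). l \<noteq> m) (zip lam mu) = filter (\<lambda>(l, m). l \<noteq> m) (zip lam' mu')"
    if "rows lam mu = rows lam' mu'"
    by (rule sorted_wrt_set_unique[where R = "\<lambda>p q. fst q < fst p"])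
      (use that set[OF assms(1)] set[OF assms(2)] srt[OF assms(1)] srt[OF assms(2)] in auto)
  thus ?thesis
    unfolding same_shape_def using set[OF assms(1)] set[OF assms(2)] by metis
qed

lemma row_end_cong:
  assumes "\<And>k. k \<in> {1..d} \<Longrightarrow> c k = c' k" "k \<in> {1..d}"
  shows "row_end d c k = row_end d c' k"
  using assms(2)
proof (induction "d - k" arbitrary: k rule: less_induct)
  case less
  have nl: "next_label d c k k' \<longleftrightarrow> next_label d c' k k'" for k'
  proof -
    have eq: "c k = c' k" "\<And>m. k < m \<Longrightarrow> m \<le> d \<Longrightarrow> c m = c' m"
      using assms(1) less.prems by auto
    show ?thesis
      unfolding next_label_def eq(1) using eq(2) by (cases "k < k' \<and> k' \<le> d") auto
  qed
  show ?case
  proof (cases "\<exists>k'. next_label d c k k'")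
    case True
    then obtain k' where k': "next_label d c k k'" by blast
    hence "row_end d c k' = row_end d c' k'"
      using less.prems by (intro less.hyps) (auto simp: next_label_def)
    with k' nl row_end_next show ?thesis by metis
  next
    case False
    with nl row_end_last assms(1) less.prems show ?thesis by metis
  qed
qed

text \<open>
  The pairs \<open>(\<lambda>\<^sub>i, \<mu>\<^sub>i)\<close> of the nonempty rows, expressed through the contents alone.
\<close>

definition content_rows :: "nat \<Rightarrow> (nat \<Rightarrow> nat) \<Rightarrow> (nat \<times> nat) set" where
  "content_rows d c =
     (\<lambda>k. (row_end d c k, Min (c ` {k'\<in>{1..d}. row_end d c k' = row_end d c k}))) ` {1..d}"

lemma content_rows_cong:
  assumes "\<And>k. k \<in> {1..d} \<Longrightarrow> c k = c' k"
  shows "content_rows d c = content_rows d c'"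
proof -
  have e: "row_end d c k = row_end d c' k" if "k \<in> {1..d}" for k
    using row_end_cong[of d c c'] assms that by blast
  have s: "{k'\<in>{1..d}. row_end d c k' = row_end d c k} = {k'\<in>{1..d}. row_end d c' k' = row_end d c' k}"
    if "k \<in> {1..d}" for k using e that by auto
  have im: "c ` {k'\<in>{1..d}. row_end d c' k' = x} = c' ` {k'\<in>{1..d}. row_end d c' k' = x}" for x
    using assms by (intro image_cong) auto
  show ?thesis
    unfolding content_rows_def
  proof (rule image_cong)
    fix k assume k: "k \<in> {1..d}"
    show "(row_end d c k, Min (c ` {k' \<in> {1..d}. row_end d c k' = row_end d c k})) =
      (row_end d c' k, Min (c' ` {k' \<in> {1..d}. row_end d c' k' = row_end d c' k}))"
      unfolding s[OF k] im using e[OF k] by simp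
  qed simp
qed

lemma rows_eq_content_rows:
  assumes sk: "skew_pair lam mu" and std: "standard_filling d lam mu L"
  shows "rows lam mu = content_rows d (cont lam mu L)"
proof -
  note bij = standard_bij[OF std]
  let ?c = "cont lam mu L"
  have re: "row_end d ?c k = lam ! fst (box_of lam mu L k)" if "k \<in> {1..d}" for k
    using row_end_eq_lam[OF sk std that] .
  have mn: "Min (?c ` {k'\<in>{1..d}. row_end d ?c k' = lam ! i}) = mu ! i"
    if i: "i < length lam" "mu ! i < lam ! i" for i
  proof (rule Min_eqI)
    fix y assume "y \<in> ?c ` {k'\<in>{1..d}. row_end d ?c k' = lam ! i}"
    then obtain k where k: "k \<in> {1..d}" "lam ! fst (box_of lam mu L k) = lam ! i" "y = ?c k"
      using re by auto
    have "fst (box_of lam mu L k) = i"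
      using lam_inj[OF sk _ i(1) k(2)] box_of_in(1)[OF bij k(1)] by (auto simp: boxes_iff_diag)
    thus "mu ! i \<le> y"
      using box_of_in(1)[OF bij k(1)] k(3) by (auto simp: boxes_iff_diag cont_def)
  next
    have b: "(i, i + mu ! i) \<in> boxes lam mu" using i by (simp add: cell_in_boxes)
    show "mu ! i \<in> ?c ` {k'\<in>{1..d}. row_end d ?c k' = lam ! i}"
      using label_in[OF bij b] re[of "L (i, i + mu ! i)"] box_of_L[OF bij b]
      by (intro image_eqI[of _ _ "L (i, i + mu ! i)"]) (auto simp: cont_def)
  qed auto
  show ?thesis
  proof (intro subset_antisym subsetI)
    fix x assume "x \<in> rows lam mu"
    then obtain i where i: "i < length lam" "mu ! i < lam ! i" "x = (lam ! i, mu ! i)"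
      by (auto simp: rows_def)
    have b: "(i, i + mu ! i) \<in> boxes lam mu" using i by (simp add: cell_in_boxes)
    show "x \<in> content_rows d ?c"
      unfolding content_rows_def
      using label_in[OF bij b] re[of "L (i, i + mu ! i)"] box_of_L[OF bij b] mn[OF i(1,2)] i(3)
      by (intro image_eqI[of _ _ "L (i, i + mu ! i)"]) auto
  next
    fix x assume "x \<in> content_rows d ?c"
    then obtain k where k: "k \<in> {1..d}"
      "x = (row_end d ?c k, Min (?c ` {k'\<in>{1..d}. row_end d ?c k' = row_end d ?c k}))"
      unfolding content_rows_def by blast
    define i where "i = fst (box_of lam mu L k)"
    have i: "i < length lam" "mu ! i < lam ! i"
      using box_of_in(1)[OF bij k(1)] by (auto simp: boxes_iff_diag i_def)
    show "x \<in> rows lam mu"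
      using k(2) re[OF k(1)] mn[OF i] i unfolding i_def[symmetric] by (auto simp: rows_def)
  qed
qed

theorem same_contents_same_shape:
  assumes "skew_pair lam mu" "standard_filling d lam mu L"
    and "skew_pair lam' mu'" "standard_filling d lam' mu' L'"
    and "\<And>k. k \<in> {1..d} \<Longrightarrow> cont lam mu L k = cont lam' mu' L' k"
  shows "same_shape lam mu lam' mu'"
  using rows_eq_content_rows[OF assms(1,2)] rows_eq_content_rows[OF assms(3,4)]
    content_rows_cong[of d "cont lam mu L" "cont lam' mu' L'"] assms(5)
    same_shape_iff_rows[OF assms(1,3)] by simp

lemma filling_determined_by_contents:
  assumes sk: "skew_pair lam mu" and "standard_filling d lam mu L" "standard_filling d lam mu L'"
    and c: "\<And>k. k \<in> {1..d} \<Longrightarrow> cont lam mu L k = cont lam mu L' k"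
  shows "L = L'"
proof
  fix b
  note bij = standard_bij[OF assms(2)] and bij' = standard_bij[OF assms(3)]
  show "L b = L' b"
  proof (cases "b \<in> boxes lam mu")
    case True
    define k where "k = L b"
    have k: "k \<in> {1..d}" using label_in[OF bij True] by (simp add: k_def)
    define b' where "b' = box_of lam mu L' k"
    have b': "b' \<in> boxes lam mu" "L' b' = k" using box_of_in[OF bij' k] by (auto simp: b'_def)
    have "lam ! fst b = lam ! fst b'"
      using row_end_eq_lam[OF sk assms(2) k] row_end_eq_lam[OF sk assms(3) k]
        row_end_cong[of d "cont lam mu L" "cont lam mu L'"] c k box_of_L[OF bij True]
      by (simp add: k_def b'_def)
    hence "fst b = fst b'"
      using lam_inj[OF sk] True b' by (auto simp: boxes_iff_diag)
    moreover have "diag b = diag b'"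
      using c[OF k] box_of_L[OF bij True] by (simp add: cont_def b'_def k_def)
    ultimately have "b = b'" using box_eq_cell[OF True] box_eq_cell[OF b'(1)] by metis
    with b' k_def show ?thesis by simp
  next
    case False
    thus ?thesis using bij bij' unfolding bij_filling_def by metis
  qed
qed

subsection \<open>Every admissible sequence comes from a shape\<close>

lemma row_end_gt: "c k < row_end d c k"
proof (induction "d - k" arbitrary: k rule: less_induct)
  case less
  show ?case
  proof (cases "\<exists>k'. next_label d c k k'")
    case True
    then obtain k' where k': "next_label d c k k'" by blast
    hence "c k' < row_end d c k'"
      by (intro less) (auto simp: next_label_def)
    moreover have "c k' = Suc (c k)" using k' by (simp add: next_label_def)
    ultimately show ?thesis using row_end_next[OF k'] by simp
  qed (simp add: row_end_last)
qed

text \<open>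
  Of two labels with the same content the earlier one lies in the row that ends further right: the rows run in
  parallel, since by admissibility the next larger content occurs between them, and the row of
  the later label stops first.
\<close>

lemma row_end_decreasing:
  assumes adm: "admissible d c" and "1 \<le> k" "k < k'" "k' \<le> d" "c k = c k'"
  shows "row_end d c k' < row_end d c k"
  using assms(2-)
proof (induction "d - k'" arbitrary: k k' rule: less_induct)
  case less
  obtain m where m: "k < m" "m < k'" "c m = Suc (c k)"
    using adm less.prems unfolding admissible_def by blast
  then obtain n where n: "next_label d c k n" "n \<le> m"
    using next_label_exists[of k m d c] less.prems by auto
  show ?case
  proof (cases "\<exists>n'. next_label d c k' n'")
    case True
    then obtain n' where n': "next_label d c k' n'" by blast
    have "row_end d c n' < row_end d c n"
      using n n' m less.prems by (intro less.hyps) (auto simp: next_label_def)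
    thus ?thesis using row_end_next n(1) n' by metis
  next
    case False
    have "Suc (c k) < row_end d c n"
      using row_end_gt[of c n d] n(1) by (simp add: next_label_def)
    thus ?thesis using False row_end_last row_end_next[OF n(1)] less.prems by metis
  qed
qed

lemma row_end_inj:
  assumes "admissible d c" "k \<in> {1..d}" "k' \<in> {1..d}" "c k = c k'" "row_end d c k = row_end d c k'"
  shows "k = k'"
  using row_end_decreasing[OF assms(1), of k k'] row_end_decreasing[OF assms(1), of k' k] assms
  by (cases k k' rule: linorder_cases) auto

lemma row_reaches:
  assumes "k \<in> {1..d}" "c k \<le> a" "a < row_end d c k"
  obtains k' where "k' \<in> {1..d}" "k \<le> k'" "c k' = a" "row_end d c k' = row_end d c k"
  using assms
proof (induction "d - k" arbitrary: k thesis rule: less_induct)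
  case less
  show ?case
  proof (cases "c k = a")
    case True with less.prems show ?thesis by blast
  next
    case False
    with less.prems have "\<exists>n. next_label d c k n" using row_end_last[of d c k] by force
    then obtain n where n: "next_label d c k n" by blast
    have e: "row_end d c n = row_end d c k" using row_end_next[OF n] by simp
    have *: "d - n < d - k" "n \<in> {1..d}" "c n \<le> a" "a < row_end d c n" "k \<le> n"
      using n less.prems False e by (auto simp: next_label_def)
    obtain k' where "k' \<in> {1..d}" "n \<le> k'" "c k' = a" "row_end d c k' = row_end d c n"
      using less.hyps[OF *(1) _ *(2-4)] by blast
    with * e less.prems(1)[of k'] show ?thesis by auto
  qed
qed

lemma row_increasing:
  assumes adm: "admissible d c" and k: "k \<in> {1..d}" "k' \<in> {1..d}"
    and "row_end d c k = row_end d c k'" "c k < c k'"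
  shows "k < k'"
proof -
  obtain k2 where "k2 \<in> {1..d}" "k \<le> k2" "c k2 = c k'" "row_end d c k2 = row_end d c k"
    using row_reaches[OF k(1), of c "c k'"] assms row_end_gt[of c k' d] by (metis less_imp_le)
  with row_end_inj[OF adm, of k2 k'] assms show ?thesis by (cases "k = k'") auto
qed

text \<open>
  Rows that end further right come first, and the labels increase along the order \<open>precedes\<close>.
\<close>

lemma earlier_row_earlier_label:
  assumes adm: "admissible d c" and k: "k \<in> {1..d}" "k' \<in> {1..d}"
    and e: "row_end d c k' < row_end d c k" and c: "c k \<le> Suc (c k')"
  shows "k < k'"
proof (cases "c k \<le> c k'")
  case True
  obtain k2 where k2: "k2 \<in> {1..d}" "k \<le> k2" "c k2 = c k'" "row_end d c k2 = row_end d c k"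
    using row_reaches[of k d c "c k'"] True k(1) e row_end_gt[of c k' d] by (metis less_trans)
  with row_end_decreasing[OF adm, of k' k2] k e show ?thesis
    by (cases k2 k' rule: linorder_cases) auto
next
  case False
  with c have ck: "c k = Suc (c k')" by simp
  show ?thesis
  proof (rule ccontr)
    assume "\<not> k < k'"
    with ck have "k' < k" by (cases "k = k'") auto
    then obtain n where n: "next_label d c k' n" "n \<le> k"
      using next_label_exists[of k' k d c] k ck by auto
    have "row_end d c k \<le> row_end d c n"
      using row_end_decreasing[OF adm, of n k] n k ck by (cases "n = k") (auto simp: next_label_def)
    with e row_end_next[OF n(1)] show False by simp
  qed
qed

text \<open>
  Suppose that a smaller neighbour of the content of \<open>k\<close> occurs before \<open>k\<close>, and let \<open>m\<close> be the last one.
  If \<open>k\<close> were not the next label after \<open>m\<close> in its row, an equal entry between \<open>m\<close> and \<open>k\<close> would force,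
  by admissibility, a still later smaller neighbour. So \<open>k\<close> continues the row of \<open>m\<close>.
\<close>

lemma row_start_no_left:
  assumes adm: "admissible d c" and k: "k \<in> {1..d}"
    and start: "\<And>k'. k' \<in> {1..d} \<Longrightarrow> row_end d c k' = row_end d c k \<Longrightarrow> c k \<le> c k'"
    and j: "1 \<le> j" "j < k" "Suc (c j) = c k"
  shows False
proof -
  define J where "J = {j. 1 \<le> j \<and> j < k \<and> Suc (c j) = c k}"
  have J: "finite J" "J \<noteq> {}" using j by (auto simp: J_def)
  define m where "m = Max J"
  have m: "1 \<le> m" "m < k" "Suc (c m) = c k" using Max_in[OF J] by (auto simp: m_def J_def)
  obtain n where n: "next_label d c m n" "n \<le> k"
    using next_label_exists[of m k d c] m k by auto
  have "n = k"
  proof (rule ccontr)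
    assume "n \<noteq> k"
    with n m have nk: "1 \<le> n" "n < k" "k \<le> d" "c n = c k" "m < n"
      using k by (auto simp: next_label_def)
    have pos: "c n > 0" using nk(4) m(3) by simp
    obtain p where p: "n < p" "p < k" "Suc (c p) = c n"
      using adm nk(1-4) pos unfolding admissible_def by blast
    hence "p \<in> J" using nk by (auto simp: J_def)
    hence "p \<le> m" using J by (auto simp: m_def)
    with p nk show False by simp
  qed
  hence "row_end d c m = row_end d c k" using row_end_next n by metis
  with start[of m] m k show False by simp
qed

text \<open>
  The classes of labels with a common row end are the rows. Each class is an interval of contents;
  its end gives \<open>\<lambda>\<^sub>i\<close> and its least content gives \<open>\<mu>\<^sub>i\<close>. Two rows cannot start with the same positive
  content, because admissibility would place a smaller neighbour before the later start.
\<close>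

theorem admissible_sequence_shape:
  assumes adm: "admissible d c"
  obtains lam mu L where "shape_with_boxes d lam mu" "standard_filling d lam mu L"
    "\<And>k. k \<in> {1..d} \<Longrightarrow> cont lam mu L k = c k"
proof -
  define e where "e = row_end d c"
  define E where "E = e ` {1..d}"
  define st where "st l = Min (c ` {k\<in>{1..d}. e k = l})" for l
  define lam where "lam = rev (sorted_list_of_set E)"
  define mu where "mu = map st lam"
  have setlam: "set lam = E" by (simp add: lam_def E_def)
  have srt: "sorted_wrt (>) lam"
    by (simp add: lam_def sorted_wrt_rev)
  have len: "length mu = length lam" by (simp add: mu_def)
  have desc: "lam ! i' < lam ! i" if "i < i'" "i' < length lam" for i i'
    using srt that by (auto simp: sorted_wrt_iff_nth_less)
  have st_in: "\<exists>k\<in>{1..d}. e k = l \<and> c k = st l" if "l \<in> E" for l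
  proof -
    have "st l \<in> c ` {k\<in>{1..d}. e k = l}"
      unfolding st_def using that by (intro Min_in) (auto simp: E_def)
    thus ?thesis by auto
  qed
  have st_le: "st (e k) \<le> c k" if "k \<in> {1..d}" for k
    unfolding st_def using that by (intro Min_le) auto
  have st_lt: "st l < l" if "l \<in> E" for l
    using st_in[OF that] row_end_gt[of c _ d] unfolding e_def by metis
  have mu_step: "st l' \<le> st l \<and> (st l = st l' \<longrightarrow> st l = 0)"
    if l: "l \<in> E" "l' \<in> E" "l' < l" for l l'
  proof (cases "st l' = 0")
    case False
    have "st l' < st l"
    proof (rule ccontr)
      assume "\<not> st l' < st l"
      obtain k' where k': "k' \<in> {1..d}" "e k' = l'" "c k' = st l'" using st_in l by blast
      obtain k0 where k0: "k0 \<in> {1..d}" "e k0 = l" "c k0 = st l" using st_in l by blast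
      have "c k0 \<le> st l'" "st l' < row_end d c k0"
        using k0 \<open>\<not> st l' < st l\<close> st_lt[OF l(2)] l(3) by (auto simp: e_def)
      then obtain k where k: "k \<in> {1..d}" "c k = st l'" "e k = l"
        using row_reaches[OF k0(1), of c "st l'"] k0(2) unfolding e_def by metis
      have "k < k'"
        using earlier_row_earlier_label[OF adm k(1) k'(1)] k k' l by (auto simp: e_def)
      moreover have "c k = c k'" "c k > 0" using k k' False by auto
      ultimately obtain j where j: "k < j" "j < k'" "Suc (c j) = c k'"
        using adm k(1) k'(1) unfolding admissible_def by (metis atLeastAtMost_iff)
      show False
      proof (rule row_start_no_left[OF adm k'(1) _ _ j(2,3)])
        fix m assume "m \<in> {1..d}" "row_end d c m = row_end d c k'"
        thus "c k' \<le> c m" using st_le[of m] k' by (auto simp: e_def)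
      qed (use j k in auto)
    qed
    thus ?thesis by simp
  qed auto
  have inE: "i < length lam \<Longrightarrow> lam ! i \<in> E" for i using setlam nth_mem by blast
  have sk: "skew_pair lam mu"
    unfolding skew_pair_def
  proof (intro conjI allI impI)
    show "sorted_wrt (\<ge>) mu"
      using mu_step desc inE by (auto simp: sorted_wrt_iff_nth_less mu_def)
    fix i
    assume i: "Suc i < length mu \<and> mu ! i = mu ! Suc i"
    show "mu ! i = 0"
      using i mu_step[OF inE inE desc, of i "Suc i"] by (auto simp: mu_def)
  next
    fix i assume "i < length lam"
    thus "0 < lam ! i" "mu ! i \<le> lam ! i" using st_lt[OF inE] by (fastforce simp: mu_def)+
  qed (use len srt in auto)
  have "\<forall>k. \<exists>i. k \<in> {1..d} \<longrightarrow> i < length lam \<and> lam ! i = e k"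
    using setlam by (metis E_def imageI in_set_conv_nth)
  then obtain p where p: "\<And>k. k \<in> {1..d} \<Longrightarrow> p k < length lam \<and> lam ! p k = e k" by metis
  define f where "f k = (p k, p k + c k)" for k
  have f_in: "f k \<in> boxes lam mu" if "k \<in> {1..d}" for k
    using p[OF that] st_le[OF that] row_end_gt[of c k d]
    by (auto simp: f_def cell_in_boxes mu_def e_def)
  have bijf: "bij_betw f {1..d} (boxes lam mu)"
  proof (rule bij_betwI')
    fix k k' assume kk: "k \<in> {1..d}" "k' \<in> {1..d}"
    show "(f k = f k') = (k = k')"
      using row_end_inj[OF adm kk] p[OF kk(1)] p[OF kk(2)] by (auto simp: f_def e_def)
  next
    fix b assume b: "b \<in> boxes lam mu"
    define i a where "i = fst b" and "a = diag b"
    have bi: "b = (i, i + a)" using box_eq_cell[OF b] by (simp add: i_def a_def)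
    hence i: "i < length lam" "st (lam ! i) \<le> a" "a < lam ! i"
      using b by (auto simp: cell_in_boxes mu_def)
    obtain k0 where k0: "k0 \<in> {1..d}" "e k0 = lam ! i" "c k0 = st (lam ! i)"
      using st_in inE i by metis
    obtain k where k: "k \<in> {1..d}" "c k = a" "e k = lam ! i"
      using row_reaches[OF k0(1), of c a] k0(2,3) i unfolding e_def by metis
    have "p k = i" using p[OF k(1)] k i lam_inj[OF sk] by auto
    with k bi show "\<exists>k\<in>{1..d}. b = f k" by (auto simp: f_def)
  qed (use f_in in auto)
  define L where "L b = (if b \<in> boxes lam mu then inv_into {1..d} f b else 0)" for b
  have Lf: "L (f k) = k" if "k \<in> {1..d}" for k
    using bijf f_in[OF that] that by (simp add: L_def bij_betw_inv_into_left)
  have bijL: "bij_betw L (boxes lam mu) {1..d}"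
    using bij_betw_inv_into[OF bijf] by (rule bij_betw_cong[THEN iffD1, rotated]) (simp add: L_def)
  have ext: "extends_order lam mu L"
    unfolding extends_order_def
  proof (intro ballI impI)
    fix b b' assume bb: "b \<in> boxes lam mu" "b' \<in> boxes lam mu" "precedes b b'"
    then obtain k k' where k: "k \<in> {1..d}" "b = f k" and k': "k' \<in> {1..d}" "b' = f k'"
      using bijf by (metis bij_betw_def imageE)
    from bb(3) have "k < k'"
      unfolding precedes_def
    proof
      assume "fst b = fst b' \<and> snd b < snd b'"
      thus ?thesis
        using row_increasing[OF adm k(1) k'(1)] k k' p[OF k(1)] p[OF k'(1)]
        by (auto simp: f_def e_def)
    next
      assume "fst b < fst b' \<and> diag b \<le> Suc (diag b')"
      thus ?thesis
        using earlier_row_earlier_label[OF adm k(1) k'(1)] k k' p[OF k(1)] p[OF k'(1)]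
          lam_order_iff[OF sk, of "p k" "p k'"] by (auto simp: f_def e_def)
    qed
    thus "L b < L b'" using Lf k k' by simp
  qed
  have std: "standard_filling d lam mu L"
    using standard_filling_iff[OF sk] bijL ext by (simp add: L_def)
  have "card (boxes lam mu) = d" using bij_betw_same_card[OF bijf] by simp
  with sk have "shape_with_boxes d lam mu" by (simp add: shape_with_boxes_def)
  moreover have "cont lam mu L k = c k" if "k \<in> {1..d}" for k
    using box_of_L[OF standard_bij[OF std] f_in[OF that]] Lf[OF that] by (simp add: cont_def f_def)
  ultimately show thesis using std that by blast
qed

subsection \<open>Standard fillings of one shape\<close>

text \<open>
  Matching the nonempty rows in order preserves contents and the order of rows, hence \<open>precedes\<close>.
\<close>

lemma same_shape_transfer_filling:
  assumes sk: "skew_pair lam mu" and sk': "skew_pair lam' mu'"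
    and shape: "same_shape lam mu lam' mu'" and std: "standard_filling d lam mu L"
  obtains L' where "standard_filling d lam' mu' L'"
    "\<And>k. k \<in> {1..d} \<Longrightarrow> cont lam' mu' L' k = cont lam mu L k"
proof -
  note bij = standard_bij[OF std]
  have rows: "rows lam mu = rows lam' mu'"
    using shape same_shape_iff_rows[OF sk sk'] by simp
  have "\<exists>i. i < length lam \<and> lam ! i = lam' ! i' \<and> mu ! i = mu' ! i'"
    if "i' < length lam'" "mu' ! i' < lam' ! i'" for i'
  proof -
    have "(lam' ! i', mu' ! i') \<in> rows lam mu"
      unfolding rows using that by (auto simp: rows_def)
    thus ?thesis by (auto simp: rows_def)
  qed
  then obtain p where p: "\<And>i'. i' < length lam' \<Longrightarrow> mu' ! i' < lam' ! i' \<Longrightarrow>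
      p i' < length lam \<and> lam ! p i' = lam' ! i' \<and> mu ! p i' = mu' ! i'" by metis
  define h where "h b = (p (fst b), p (fst b) + diag b)" for b
  have h_in: "h b \<in> boxes lam mu" and h_row: "lam ! fst (h b) = lam' ! fst b"
    and h_diag: "diag (h b) = diag b" if "b \<in> boxes lam' mu'" for b
  proof -
    have b: "fst b < length lam'" "mu' ! fst b \<le> diag b" "diag b < lam' ! fst b"
      using that by (auto simp: boxes_iff_diag)
    hence "p (fst b) < length lam \<and> lam ! p (fst b) = lam' ! fst b \<and> mu ! p (fst b) = mu' ! fst b"
      using p by simp
    thus "h b \<in> boxes lam mu" "lam ! fst (h b) = lam' ! fst b" "diag (h b) = diag b"
      using b by (auto simp: h_def cell_in_boxes)
  qed
  have bijh: "bij_betw h (boxes lam' mu') (boxes lam mu)"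
  proof (rule bij_betwI')
    fix b b' assume bb: "b \<in> boxes lam' mu'" "b' \<in> boxes lam' mu'"
    show "(h b = h b') = (b = b')"
    proof
      assume eq: "h b = h b'"
      hence "lam' ! fst b = lam' ! fst b'" "diag b = diag b'"
        using h_row h_diag bb by metis+
      thus "b = b'"
        using lam_inj[OF sk', of "fst b" "fst b'"] bb box_eq_cell[OF bb(1)] box_eq_cell[OF bb(2)]
        by (metis boxes_iff_diag)
    qed simp
  next
    fix b assume b: "b \<in> boxes lam mu"
    hence "(lam ! fst b, mu ! fst b) \<in> rows lam' mu'"
      unfolding rows[symmetric] by (auto simp: rows_def boxes_iff_diag)
    then obtain i' where i': "i' < length lam'" "mu' ! i' < lam' ! i'"
      "lam' ! i' = lam ! fst b" "mu' ! i' = mu ! fst b" by (auto simp: rows_def)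
    define b' where "b' = (i', i' + diag b)"
    have b': "b' \<in> boxes lam' mu'" using b i' by (auto simp: b'_def cell_in_boxes boxes_iff_diag)
    have "lam ! fst (h b') = lam ! fst b" "diag (h b') = diag b"
      using h_row[OF b'] h_diag[OF b'] i' by (auto simp: b'_def)
    hence "h b' = b"
      using lam_inj[OF sk, of "fst (h b')" "fst b"] b h_in[OF b'] box_eq_cell[OF b]
        box_eq_cell[OF h_in[OF b']] by (metis boxes_iff_diag)
    with b' show "\<exists>b'\<in>boxes lam' mu'. b = h b'" by blast
  qed (use h_in in auto)
  define L' where "L' b = (if b \<in> boxes lam' mu' then L (h b) else 0)" for b
  have bijL': "bij_betw L' (boxes lam' mu') {1..d}"
  proof (rule bij_betw_cong[THEN iffD1])
    show "bij_betw (L \<circ> h) (boxes lam' mu') {1..d}"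
      using bij_betw_trans[OF bijh] bij by (auto simp: bij_filling_def)
  qed (simp add: L'_def)
  have "extends_order lam' mu' L'"
    unfolding extends_order_def
  proof (intro ballI impI)
    fix b b' assume bb: "b \<in> boxes lam' mu'" "b' \<in> boxes lam' mu'" "precedes b b'"
    have lt: "fst b < length lam'" "fst b' < length lam'"
      "fst (h b) < length lam" "fst (h b') < length lam"
      using bb h_in by (auto simp: boxes_iff_diag)
    have "fst b = fst b' \<longleftrightarrow> fst (h b) = fst (h b')" "fst b < fst b' \<longleftrightarrow> fst (h b) < fst (h b')"
      using lam_order_iff[OF sk' lt(1,2)] lam_order_iff[OF sk lt(3,4)] h_row[OF bb(1)]
        h_row[OF bb(2)] lam_inj[OF sk' lt(1,2)] lam_inj[OF sk lt(3,4)] by metis+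
    moreover have "snd x < snd y \<longleftrightarrow> diag x < diag y"
      if "fst x = fst y" "x \<in> boxes l0 m0" "y \<in> boxes l0 m0" for x y l0 m0
      using that by (cases x; cases y) (auto simp: diag_def boxes_iff)
    ultimately have "precedes (h b) (h b')"
      using bb h_in[OF bb(1)] h_in[OF bb(2)] h_diag[OF bb(1)] h_diag[OF bb(2)]
      unfolding precedes_def by metis
    thus "L' b < L' b'"
      using standard_less[OF sk std h_in[OF bb(1)] h_in[OF bb(2)]] bb by (simp add: L'_def)
  qed
  with bijL' have std': "standard_filling d lam' mu' L'"
    using standard_filling_iff[OF sk'] by (simp add: L'_def)
  moreover have "cont lam' mu' L' k = cont lam mu L k" if k: "k \<in> {1..d}" for k
  proof -
    define b where "b = box_of lam' mu' L' k"
    have b: "b \<in> boxes lam' mu'" "L' b = k"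
      using box_of_in[OF standard_bij[OF std'] k] by (auto simp: b_def)
    hence "box_of lam mu L k = h b"
      using box_of_L[OF bij h_in[OF b(1)]] by (simp add: L'_def)
    thus ?thesis using h_diag[OF b(1)] by (simp add: cont_def b_def)
  qed
  ultimately show thesis using that by blast
qed

text \<open>
  Numbering the boxes row by row gives a standard filling.
\<close>

lemma standard_filling_exists:
  assumes sh: "shape_with_boxes d lam mu"
  obtains L where "standard_filling d lam mu L"
proof -
  have sk: "skew_pair lam mu" and card: "card (boxes lam mu) = d"
    using sh by (auto simp: shape_with_boxes_def)
  define B where "B = boxes lam mu"
  define le where "le b b' \<longleftrightarrow> fst b < fst b' \<or> fst b = fst b' \<and> snd b \<le> snd b'"
    for b b' :: "nat \<times> nat"
  define R where "R b = {x \<in> B. le x b}" for b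
  define L where "L b = (if b \<in> B then card (R b) else 0)" for b
  have fin: "finite B" by (simp add: B_def finite_boxes)
  have finR: "finite (R b)" for b using fin by (simp add: R_def)
  have less: "L b < L b'" if "b \<in> B" "b' \<in> B" "le b b'" "b \<noteq> b'" for b b'
  proof -
    have "R b \<subseteq> R b'" using that by (auto simp: R_def le_def)
    moreover have "b' \<in> R b'" "b' \<notin> R b"
      using that by (auto simp: R_def le_def prod_eq_iff)
    ultimately have "R b \<subset> R b'" by blast
    thus ?thesis using psubset_card_mono[OF finR] that by (simp add: L_def)
  qed
  have inj: "inj_on L B"
  proof (rule inj_onI, rule ccontr)
    fix b b' assume b: "b \<in> B" "b' \<in> B" "L b = L b'" "b \<noteq> b'"
    have "le b b' \<or> le b' b" by (auto simp: le_def)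
    with less[of b b'] less[of b' b] b show False by auto
  qed
  have sub: "L ` B \<subseteq> {1..d}"
  proof
    fix k assume "k \<in> L ` B"
    then obtain b where b: "b \<in> B" "k = card (R b)" by (auto simp: L_def)
    have "b \<in> R b" using b by (simp add: R_def le_def)
    hence "card (R b) \<ge> 1" using finR[of b] by (metis card_gt_0_iff empty_iff Suc_leI One_nat_def)
    moreover have "card (R b) \<le> d"
      using card_mono[OF fin, of "R b"] card by (auto simp: R_def B_def)
    ultimately show "k \<in> {1..d}" using b by simp
  qed
  have "L ` B = {1..d}"
    using card_subset_eq[OF _ sub] card_image[OF inj] card by (simp add: B_def)
  with inj have "bij_betw L (boxes lam mu) {1..d}" by (simp add: bij_betw_def B_def)
  moreover have "extends_order lam mu L"
    unfolding extends_order_def B_def[symmetric]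
  proof (intro ballI impI)
    fix b b' assume "b \<in> B" "b' \<in> B" "precedes b b'"
    thus "L b < L b'" by (intro less) (auto simp: precedes_def le_def)
  qed
  ultimately have "standard_filling d lam mu L"
    using standard_filling_iff[OF sk] by (simp add: L_def B_def)
  thus thesis by (rule that)
qed

lemma finite_standard_fillings: "finite {L. standard_filling d lam mu L}"
proof (rule finite_subset)
  show "{L. standard_filling d lam mu L} \<subseteq>
      {L. \<forall>b. (b \<in> boxes lam mu \<longrightarrow> L b \<in> {1..d}) \<and> (b \<notin> boxes lam mu \<longrightarrow> L b = 0)}"
  proof
    fix L assume "L \<in> {L. standard_filling d lam mu L}"
    hence "bij_filling d lam mu L" using standard_bij by blast
    thus "L \<in> {L. \<forall>b. (b \<in> boxes lam mu \<longrightarrow> L b \<in> {1..d}) \<and> (b \<notin> boxes lam mu \<longrightarrow> L b = 0)}"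
      using label_in unfolding bij_filling_def by blast
  qed
  show "finite {L. \<forall>b. (b \<in> boxes lam mu \<longrightarrow> L b \<in> {1..d}) \<and> (b \<notin> boxes lam mu \<longrightarrow> L b = 0)}"
    by (rule finite_set_of_finite_funs) (auto intro: finite_boxes)
qed

section \<open>Inversions and paths of ascents in the symmetric group\<close>

abbreviation adj :: "nat \<Rightarrow> nat \<Rightarrow> nat" where
  "adj i \<equiv> transpose i (Suc i)"

definition Inversions :: "nat \<Rightarrow> (nat \<Rightarrow> nat) \<Rightarrow> (nat \<times> nat) set" where
  "Inversions d g = {(p, q). p \<in> {1..d} \<and> q \<in> {1..d} \<and> p < q \<and> g q < g p}"

text \<open>
  The label \<open>i\<close> of the filling \<open>g L\<close> was called \<open>g\<^sup>-\<^sup>1 i\<close> in \<open>L\<close>, so at an ascent the interchange of \<open>i\<close> and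
  \<open>i + 1\<close> creates an inversion.
\<close>

definition ascent :: "(nat \<Rightarrow> nat) \<Rightarrow> nat \<Rightarrow> bool" where
  "ascent g i \<longleftrightarrow> inv g i < inv g (Suc i)"

lemma finite_Inversions: "finite (Inversions d g)"
  by (rule finite_subset[of _ "{1..d} \<times> {1..d}"]) (auto simp: Inversions_def)

lemma adj_permutes: "1 \<le> i \<Longrightarrow> i < d \<Longrightarrow> adj i permutes {1..d}"
  by (rule permutes_swap_id) auto

lemma adj_comp_permutes:
  "g permutes {1..d} \<Longrightarrow> 1 \<le> i \<Longrightarrow> i < d \<Longrightarrow> (adj i \<circ> g) permutes {1..d}"
  by (rule permutes_compose[OF _ adj_permutes])

lemma adj_adj_comp [simp]: "adj i \<circ> (adj i \<circ> g) = g"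
  by (simp add: fun_eq_iff)

lemma inv_adj_comp:
  assumes "g permutes {1..d}"
  shows "inv (adj i \<circ> g) k = inv g (adj i k)"
proof -
  have "bij (adj i)" by (rule o_bij[of "adj i"]) (simp_all add: fun_eq_iff)
  from o_inv_distrib[OF this permutes_bij[OF assms]] show ?thesis by (simp add: fun_eq_iff)
qed

lemma ascent_adj:
  assumes "g permutes {1..d}"
  shows "ascent (adj i \<circ> g) i \<longleftrightarrow> \<not> ascent g i"
proof -
  have "inv g i \<noteq> inv g (Suc i)"
    using permutes_inj[OF permutes_inv[OF assms]] by (metis inj_eq n_not_Suc_n)
  thus ?thesis by (auto simp: ascent_def inv_adj_comp[OF assms])
qed

lemma not_ascent_iff:
  assumes "g permutes {1..d}"
  shows "\<not> ascent g i \<longleftrightarrow> inv g (Suc i) < inv g i"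
proof -
  have "inv g i \<noteq> inv g (Suc i)"
    using permutes_inj[OF permutes_inv[OF assms]] by (metis inj_eq n_not_Suc_n)
  thus ?thesis by (auto simp: ascent_def)
qed

lemma permutes_inv_mem:
  "g permutes {1..d} \<Longrightarrow> k \<in> {1..d} \<Longrightarrow> inv g k \<in> {1..d}"
  by (simp add: permutes_in_image[OF permutes_inv] del: atLeastAtMost_iff)

lemma Inversions_adj:
  assumes g: "g permutes {1..d}" and i: "1 \<le> i" "i < d" and asc: "ascent g i"
  shows "Inversions d (adj i \<circ> g) = insert (inv g i, inv g (Suc i)) (Inversions d g)"
    and "(inv g i, inv g (Suc i)) \<notin> Inversions d g"
proof -
  define p q where "p = inv g i" and "q = inv g (Suc i)"
  have pq: "g p = i" "g q = Suc i" "p < q" "p \<in> {1..d}" "q \<in> {1..d}"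
    using permutes_inverses[OF g] asc permutes_inv_mem[OF g] i by (auto simp: p_def q_def ascent_def)
  have gp: "g x = i \<longleftrightarrow> x = p" "g x = Suc i \<longleftrightarrow> x = q" for x
    using permutes_inj[OF g] pq by (metis injD)+
  show "Inversions d (adj i \<circ> g) = insert (inv g i, inv g (Suc i)) (Inversions d g)"
  proof (intro set_eqI, clarify)
    fix x y
    have "adj i (g y) < adj i (g x) \<longleftrightarrow> (x = p \<and> y = q) \<or> g y < g x" if "x < y"
      using that pq gp[of x] gp[of y] by (auto simp: transpose_def split: if_splits)
    thus "((x, y) \<in> Inversions d (adj i \<circ> g)) \<longleftrightarrow>
        (x, y) \<in> insert (inv g i, inv g (Suc i)) (Inversions d g)"
      using pq by (auto simp: Inversions_def p_def[symmetric] q_def[symmetric])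
  qed
  show "(inv g i, inv g (Suc i)) \<notin> Inversions d g"
    using pq by (simp add: Inversions_def p_def[symmetric] q_def[symmetric])
qed

lemma card_Inversions_adj:
  assumes "g permutes {1..d}" "1 \<le> i" "i < d" "ascent g i"
  shows "card (Inversions d (adj i \<circ> g)) = Suc (card (Inversions d g))"
  using Inversions_adj[OF assms] finite_Inversions by simp

lemma no_descent_id:
  assumes g: "g permutes {1..d}" and asc: "\<And>i. 1 \<le> i \<Longrightarrow> i < d \<Longrightarrow> ascent g i"
  shows "g = id"
proof -
  let ?h = "inv g"
  have h: "?h permutes {1..d}" using permutes_inv[OF g] .
  have mono: "?h i < ?h j" if "1 \<le> i" "i < j" "j \<le> d" for i j
    using that(2,3)
  proof (induction j)
    case (Suc j)
    have "?h j < ?h (Suc j)" using asc[of j] Suc.prems that by (simp add: ascent_def)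
    with Suc show ?case by (cases "i = j") auto
  qed simp
  have ge: "j \<le> ?h j" if "1 \<le> j" "j \<le> d" for j
    using that
  proof (induction j)
    case (Suc j)
    show ?case
    proof (cases "j = 0")
      case True
      thus ?thesis using permutes_in_image[OF h, of 1] Suc.prems by auto
    next
      case False
      with Suc mono[of j "Suc j"] show ?thesis by auto
    qed
  qed simp
  have eq: "?h j = j" if "j \<in> {1..d}" for j
  proof -
    have "\<forall>j\<in>{1..d}. j \<le> ?h j" using ge by auto
    moreover have "sum ?h {1..d} = sum id {1..d}"
      using sum.permute[OF h, of id] by simp
    ultimately show ?thesis
      using that sum_strict_mono_ex1[of "{1..d}" id ?h] by (metis finite_atLeastAtMost id_apply
          le_neq_implies_less less_irrefl)
  qed
  have "?h j = j" for j
    using eq permutes_not_in[OF h, of j] by (cases "j \<in> {1..d}") auto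
  hence "?h = id" by auto
  thus ?thesis using inv_inv_eq[OF permutes_bij[OF g]] by (metis inv_id)
qed

text \<open>
  A permutation other than the identity has a descent, and undoing it removes one inversion.
\<close>

lemma permutes_ascent_induct [consumes 1, case_names id step]:
  assumes "g permutes {1..d}" "P id"
    and "\<And>g i. g permutes {1..d} \<Longrightarrow> 1 \<le> i \<Longrightarrow> i < d \<Longrightarrow> ascent g i \<Longrightarrow> P g \<Longrightarrow> P (adj i \<circ> g)"
  shows "P g"
  using assms(1)
proof (induction "card (Inversions d g)" arbitrary: g rule: less_induct)
  case less
  show ?case
  proof (cases "g = id")
    case False
    then obtain i where i: "1 \<le> i" "i < d" "\<not> ascent g i" using no_descent_id[OF less.prems] by blast
    let ?h = "adj i \<circ> g"
    have h: "?h permutes {1..d}" "ascent ?h i"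
      using adj_comp_permutes[OF less.prems i(1,2)] ascent_adj[OF less.prems] i(3) by auto
    have "card (Inversions d g) = Suc (card (Inversions d ?h))"
      using card_Inversions_adj[OF h(1) i(1,2) h(2)] by simp
    hence "P ?h" using less.hyps h(1) by simp
    thus ?thesis using assms(3)[OF h(1) i(1,2) h(2)] by simp
  qed (simp add: assms(2))
qed

lemma Inversions_id: "Inversions d id = {}"
  by (auto simp: Inversions_def)

subsection \<open>Families compatible with all ascents\<close>

inductive reaches :: "nat \<Rightarrow> (nat \<Rightarrow> 'a \<Rightarrow> 'a) \<Rightarrow> 'a \<Rightarrow> (nat \<Rightarrow> nat) \<Rightarrow> 'a \<Rightarrow> bool"
  for d f v where
  start: "reaches d f v id v"
| step: "reaches d f v g u \<Longrightarrow> 1 \<le> i \<Longrightarrow> i < d \<Longrightarrow> ascent g i \<Longrightarrow> reaches d f v (adj i \<circ> g) (f i u)"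

lemma reaches_permutes: "reaches d f v g u \<Longrightarrow> g permutes {1..d}"
proof (induction rule: reaches.induct)
  case start show ?case by (rule permutes_id)
next
  case step thus ?case by (intro adj_comp_permutes)
qed

lemma adj_braid: "adj i \<circ> (adj (Suc i) \<circ> (adj i \<circ> g)) = adj (Suc i) \<circ> (adj i \<circ> (adj (Suc i) \<circ> g))"
  by (auto simp: fun_eq_iff transpose_def)

lemma adj_commute: "Suc i < j \<Longrightarrow> adj i \<circ> (adj j \<circ> g) = adj j \<circ> (adj i \<circ> g)"
  by (auto simp: fun_eq_iff transpose_def)

text \<open>
  The result of applying the operators \<open>f i\<close> along a path of ascents depends only on the end
  point: two last steps \<open>i\<close> and \<open>j\<close> into the same permutation can be continued downwards to a
  common permutation through one commutation or braid square, and induction on the number of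
  inversions applies to the sides.
\<close>

lemma exists_ascent_family:
  fixes f :: "nat \<Rightarrow> 'a \<Rightarrow> 'a"
  assumes v: "v \<in> V" and closed: "\<And>i u. 1 \<le> i \<Longrightarrow> i < d \<Longrightarrow> u \<in> V \<Longrightarrow> f i u \<in> V"
    and comm: "\<And>i j u. 1 \<le> i \<Longrightarrow> Suc i < j \<Longrightarrow> j < d \<Longrightarrow> u \<in> V \<Longrightarrow> f i (f j u) = f j (f i u)"
    and braid: "\<And>i u. 1 \<le> i \<Longrightarrow> Suc i < d \<Longrightarrow> u \<in> V \<Longrightarrow>
      f i (f (Suc i) (f i u)) = f (Suc i) (f i (f (Suc i) u))"
  obtains \<Phi> where "\<Phi> id = v"
    "\<And>g i. g permutes {1..d} \<Longrightarrow> 1 \<le> i \<Longrightarrow> i < d \<Longrightarrow> ascent g i \<Longrightarrow> \<Phi> (adj i \<circ> g) = f i (\<Phi> g)"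
proof -
  have inV: "u \<in> V" if "reaches d f v g u" for g u
    using that by (induction rule: reaches.induct) (auto intro: v closed)
  have ex: "\<exists>u. reaches d f v g u" if "g permutes {1..d}" for g
    using that
  proof (induction rule: permutes_ascent_induct)
    case id show ?case by (rule exI, rule reaches.start)
  next
    case step thus ?case by (metis reaches.step)
  qed
  have uniq: "u = u'" if "reaches d f v g u" "reaches d f v g u'" for g u u'
    using that
  proof (induction "card (Inversions d g)" arbitrary: g u u' rule: less_induct)
    case less
    have sq: "f i u1 = f j u2"
      if ij: "i < j" and i: "1 \<le> i" "i < d" and j: "1 \<le> j" "j < d"
        and g1: "g = adj i \<circ> g1" "reaches d f v g1 u1" "ascent g1 i"
        and g2: "g = adj j \<circ> g2" "reaches d f v g2 u2" "ascent g2 j" for i j g1 g2 u1 u2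
    proof -
      have p1: "g1 permutes {1..d}" and p2: "g2 permutes {1..d}"
        using g1(2) g2(2) reaches_permutes by auto
      have p: "g permutes {1..d}" using adj_comp_permutes[OF p1 i] g1 by simp
      have g1': "g1 = adj i \<circ> g" unfolding g1(1) adj_adj_comp ..
      have g2': "g2 = adj j \<circ> g" unfolding g2(1) adj_adj_comp ..
      have desc: "\<not> ascent g i" "\<not> ascent g j"
        using ascent_adj[OF p] g1(3) g2(3) g1' g2' by auto
      have le: "inv g (Suc i) < inv g i" "inv g (Suc j) < inv g j"
        using desc not_ascent_iff[OF p] by auto
      have IH1: "u = u1" if "reaches d f v g1 u" for u
        using less.hyps[OF _ that g1(2)] card_Inversions_adj[OF p1 i g1(3)] g1(1) by simp
      have IH2: "u = u2" if "reaches d f v g2 u" for u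
        using less.hyps[OF _ that g2(2)] card_Inversions_adj[OF p2 j g2(3)] g2(1) by simp
      show ?thesis
      proof (cases "j = Suc i")
        case False
        define h where "h = adj j \<circ> g1"
        have h: "h permutes {1..d}" using adj_comp_permutes[OF p1 j] by (simp add: h_def)
        have inv: "inv h k = inv g (adj i (adj j k))" for k
          using inv_adj_comp[OF p1, of j k] inv_adj_comp[OF p, of i "adj j k"]
          by (simp only: h_def g1'[symmetric])
        have asc: "ascent h i" "ascent h j"
          using le ij False by (auto simp: ascent_def inv transpose_def)
        obtain u0 where u0: "reaches d f v h u0" using ex[OF h] by blast
        have "adj j \<circ> h = g1" by (simp add: h_def)
        hence "u1 = f j u0" using IH1 reaches.step[OF u0 j asc(2)] by simp
        moreover have "adj i \<circ> h = g2"
          using adj_commute[of i j "adj i \<circ> g"] ij False by (simp add: h_def g1' g2')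
        hence "u2 = f i u0" using IH2 reaches.step[OF u0 i asc(1)] by simp
        ultimately show ?thesis using comm[of i j u0] ij False i j inV[OF u0] by simp
      next
        case True
        define h1 h where "h1 = adj j \<circ> g1" and "h = adj i \<circ> h1"
        define h2 where "h2 = adj i \<circ> g2"
        have h1: "h1 permutes {1..d}" using adj_comp_permutes[OF p1 j] by (simp add: h1_def)
        have h2: "h2 permutes {1..d}" using adj_comp_permutes[OF p2 i] by (simp add: h2_def)
        have h: "h permutes {1..d}" using adj_comp_permutes[OF h1 i] by (simp add: h_def)
        have h_alt: "h = adj j \<circ> h2"
          using adj_braid[of i g] True by (simp add: h_def h1_def h2_def g1' g2')
        have inv1: "inv h1 k = inv g (adj i (adj j k))" for k
          using inv_adj_comp[OF p1, of j k] inv_adj_comp[OF p, of i "adj j k"]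
          by (simp only: h1_def g1'[symmetric])
        have inv2: "inv h2 k = inv g (adj j (adj i k))" for k
          using inv_adj_comp[OF p2, of i k] inv_adj_comp[OF p, of j "adj i k"]
          by (simp only: h2_def g2'[symmetric])
        have inv: "inv h k = inv g (adj i (adj j (adj i k)))" for k
          using inv_adj_comp[OF h1, of i k] by (simp only: h_def inv1)
        have asc: "ascent h i" "ascent h j" "ascent h1 j" "ascent h2 i"
          using le True by (auto simp: ascent_def inv inv1 inv2 transpose_def)
        obtain u0 where u0: "reaches d f v h u0" using ex[OF h] by blast
        have "reaches d f v h1 (f i u0)"
          using reaches.step[OF u0 i asc(1)] by (simp add: h_def)
        hence "reaches d f v g1 (f j (f i u0))"
          using reaches.step[OF _ j asc(3)] by (fastforce simp: h1_def)
        hence "u1 = f j (f i u0)" using IH1 by simp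
        moreover have "reaches d f v h2 (f j u0)"
          using reaches.step[OF u0 j asc(2)] by (simp add: h_alt)
        hence "reaches d f v g2 (f i (f j u0))"
          using reaches.step[OF _ i asc(4)] by (fastforce simp: h2_def)
        hence "u2 = f i (f j u0)" using IH2 by simp
        ultimately show ?thesis using braid[of i u0] True i j inV[OF u0] by simp
      qed
    qed
    have not_id: "g \<noteq> id" if "g = adj i \<circ> g1" "g1 permutes {1..d}" "1 \<le> i" "i < d" "ascent g1 i" for i g1
      using card_Inversions_adj[OF that(2-5)] that(1) Inversions_id[of d] by auto
    from less.prems(1) show ?case
    proof cases
      case start
      from less.prems(2) show ?thesis
      proof cases
        case (step g2 u2 j)
        with not_id[OF step(1) reaches_permutes[OF step(3)] step(4,5,6)] start show ?thesis by simp
      qed (use start in simp)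
    next
      case (step g1 u1 i)
      note s1 = step
      from less.prems(2) show ?thesis
      proof cases
        case start
        with not_id[OF s1(1) reaches_permutes[OF s1(3)] s1(4,5,6)] show ?thesis by simp
      next
        case (step g2 u2 j)
        consider "i < j" | "j < i" | "i = j" by linarith
        thus ?thesis
        proof cases
          case 1
          with sq[OF 1 s1(4,5) step(4,5) s1(1) s1(3) s1(6) step(1) step(3) step(6)] s1(2) step(2)
          show ?thesis by simp
        next
          case 2
          with sq[OF 2 step(4,5) s1(4,5) step(1) step(3) step(6) s1(1) s1(3) s1(6)] s1(2) step(2)
          show ?thesis by simp
        next
          case 3
          have "g1 = adj i \<circ> g" unfolding s1(1) adj_adj_comp ..
          moreover have "g2 = adj i \<circ> g" unfolding 3 step(1) adj_adj_comp ..
          ultimately have "g1 = g2" by simp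
          moreover have "card (Inversions d g1) < card (Inversions d g)"
            using card_Inversions_adj[OF reaches_permutes[OF s1(3)] s1(4,5,6)] s1(1) by simp
          ultimately have "u1 = u2" using less.hyps s1(3) step(3) by blast
          with 3 s1 step show ?thesis by simp
        qed
      qed
    qed
  qed
  define \<Phi> where "\<Phi> g = (THE u. reaches d f v g u)" for g
  have \<Phi>: "\<Phi> g = u" if "reaches d f v g u" for g u
    unfolding \<Phi>_def using that uniq by blast
  show thesis
  proof (rule that)
    show "\<Phi> id = v" by (rule \<Phi>[OF reaches.start])
    fix g i assume g: "g permutes {1..d}" and i: "1 \<le> i" "i < d" "ascent g i"
    obtain u where u: "reaches d f v g u" using ex[OF g] by blast
    show "\<Phi> (adj i \<circ> g) = f i (\<Phi> g)"
      using \<Phi>[OF u] \<Phi>[OF reaches.step[OF u i]] by simp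
  qed
qed

subsection \<open>Permuting the labels of a filling\<close>

lemma bij_filling_comp:
  assumes "bij_filling d lam mu L" "g permutes {1..d}"
  shows "bij_filling d lam mu (g \<circ> L)"
proof -
  have "bij_betw (g \<circ> L) (boxes lam mu) {1..d}"
    using assms bij_betw_trans[OF _ permutes_imp_bij[OF assms(2)]] by (auto simp: bij_filling_def)
  moreover have "g 0 = 0" using permutes_not_in[OF assms(2), of 0] by simp
  ultimately show ?thesis using assms(1) by (simp add: bij_filling_def)
qed

lemma box_of_comp:
  assumes L: "bij_filling d lam mu L" and g: "g permutes {1..d}" and k: "k \<in> {1..d}"
  shows "box_of lam mu (g \<circ> L) k = box_of lam mu L (inv g k)"
proof -
  have k': "inv g k \<in> {1..d}" using permutes_inv_mem[OF g k] .
  have "(g \<circ> L) (box_of lam mu L (inv g k)) = k"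
    using box_of_in(2)[OF L k'] permutes_inverses(1)[OF g] by simp
  thus ?thesis
    using box_of_L[OF bij_filling_comp[OF L g] box_of_in(1)[OF L k']] by simp
qed

lemma cont_comp:
  assumes "bij_filling d lam mu L" "g permutes {1..d}" "k \<in> {1..d}"
  shows "cont lam mu (g \<circ> L) k = cont lam mu L (inv g k)"
  using box_of_comp[OF assms] by (simp add: cont_def)

lemma fillings_differ_by_permutation:
  assumes L: "bij_filling d lam mu L" and L': "bij_filling d lam mu L'"
  obtains g where "g permutes {1..d}" "L' = g \<circ> L"
proof -
  define g where "g k = (if k \<in> {1..d} then L' (box_of lam mu L k) else k)" for k
  have "bij_betw (box_of lam mu L) {1..d} (boxes lam mu)"
    using L bij_betw_inv_into[of L] by (auto simp: bij_filling_def box_of_def[abs_def])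
  hence "bij_betw (L' \<circ> box_of lam mu L) {1..d} {1..d}"
    using L' by (auto simp: bij_filling_def intro: bij_betw_trans)
  hence "bij_betw g {1..d} {1..d}"
    by (rule bij_betw_cong[THEN iffD1, rotated]) (simp add: g_def)
  hence g: "g permutes {1..d}"
    by (rule bij_imp_permutes) (auto simp: g_def)
  have "L' b = g (L b)" for b
  proof (cases "b \<in> boxes lam mu")
    case True
    thus ?thesis using label_in[OF L True] box_of_L[OF L True] by (simp add: g_def)
  next
    case False
    hence "L b = 0" "L' b = 0" using L L' unfolding bij_filling_def by blast+
    thus ?thesis by (simp add: g_def)
  qed
  with g that show thesis by (auto simp: fun_eq_iff)
qed

lemma comp_filling_inj:
  assumes L: "bij_filling d lam mu L" and g: "g permutes {1..d}" and h: "h permutes {1..d}"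
    and eq: "g \<circ> L = h \<circ> L"
  shows "g = h"
proof
  fix k
  show "g k = h k"
  proof (cases "k \<in> {1..d}")
    case True
    with fun_cong[OF eq, of "box_of lam mu L k"] box_of_in(2)[OF L True] show ?thesis by simp
  next
    case False
    with permutes_not_in[OF g] permutes_not_in[OF h] show ?thesis by metis
  qed
qed

lemma swap_labels_eq: "swap_labels i L = adj i \<circ> L"
  by (simp add: swap_labels_def)

lemma adj_apply_comp: "adj i \<circ> (g \<circ> L) = (adj i \<circ> g) \<circ> L"
  by (simp add: comp_assoc)

lemma standard_swap_iff:
  assumes sk: "skew_pair lam mu" and std: "standard_filling d lam mu L" and i: "1 \<le> i" "i < d"
  shows "standard_filling d lam mu (adj i \<circ> L) \<longleftrightarrow>
     \<not> precedes (box_of lam mu L i) (box_of lam mu L (Suc i))"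
proof -
  note bij = standard_bij[OF std]
  note bij' = bij_filling_comp[OF bij adj_permutes[OF i]]
  define b b' where "b = box_of lam mu L i" and "b' = box_of lam mu L (Suc i)"
  have b: "b \<in> boxes lam mu" "L b = i" and b': "b' \<in> boxes lam mu" "L b' = Suc i"
    using box_of_in[OF bij] i by (auto simp: b_def b'_def)
  have "extends_order lam mu (adj i \<circ> L) \<longleftrightarrow> \<not> precedes b b'"
  proof
    assume "extends_order lam mu (adj i \<circ> L)"
    with b b' show "\<not> precedes b b'" by (force simp: extends_order_def)
  next
    assume np: "\<not> precedes b b'"
    show "extends_order lam mu (adj i \<circ> L)"
      unfolding extends_order_def
    proof (intro ballI impI)
      fix x y assume xy: "x \<in> boxes lam mu" "y \<in> boxes lam mu" "precedes x y"
      have "L x < L y" using standard_less[OF sk std xy] .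
      moreover have "\<not> (L x = i \<and> L y = Suc i)"
        using np xy box_of_L[OF bij] b_def b'_def by metis
      ultimately show "(adj i \<circ> L) x < (adj i \<circ> L) y"
        by (auto simp: transpose_def)
    qed
  qed
  thus ?thesis
    using standard_filling_iff[OF sk] bij' by (simp add: bij_filling_def b_def b'_def)
qed

definition far :: "nat \<Rightarrow> nat \<Rightarrow> bool" where
  "far a b \<longleftrightarrow> a + 2 \<le> b \<or> b + 2 \<le> a"

lemma far_sym: "far a b \<longleftrightarrow> far b a"
  by (auto simp: far_def)

lemma standard_swap_iff_far:
  assumes sk: "skew_pair lam mu" and std: "standard_filling d lam mu L" and i: "1 \<le> i" "i < d"
  shows "standard_filling d lam mu (adj i \<circ> L) \<longleftrightarrow> far (cont lam mu L i) (cont lam mu L (Suc i))"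
proof -
  note bij = standard_bij[OF std]
  define b b' where "b = box_of lam mu L i" and "b' = box_of lam mu L (Suc i)"
  have b: "b \<in> boxes lam mu" "L b = i" and b': "b' \<in> boxes lam mu" "L b' = Suc i"
    using box_of_in[OF bij] i by (auto simp: b_def b'_def)
  have "precedes b b' \<longleftrightarrow> \<not> far (diag b) (diag b')"
  proof
    assume p: "precedes b b'"
    show "\<not> far (diag b) (diag b')"
    proof
      assume "far (diag b) (diag b')"
      then obtain x where "x \<in> boxes lam mu" "precedes b x" "precedes x b'"
        using distant_diagonals_not_covering[OF sk b(1) b'(1) p] by (auto simp: far_def)
      hence "L b < L x" "L x < L b'" using standard_less[OF sk std] b(1) b'(1) by auto
      with b b' show False by simp
    qed
  next
    assume "\<not> far (diag b) (diag b')"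
    thus "precedes b b'"
      using standard_precedes[OF sk std b(1) b'(1)] b b' by (auto simp: far_def)
  qed
  thus ?thesis
    using standard_swap_iff[OF sk std i] by (simp add: cont_def b_def b'_def)
qed

lemma standard_adjacent_contents:
  assumes "skew_pair lam mu" "standard_filling d lam mu L" "1 \<le> i" "i < d"
  shows "cont lam mu L i \<noteq> cont lam mu L (Suc i)"
  using admissible_cont[OF assms(1,2)] assms(3,4) unfolding admissible_def
  by (metis Suc_leI lessI not_less_eq)

lemma standard_repeated_contents:
  assumes "skew_pair lam mu" "standard_filling d lam mu L" "1 \<le> i" "Suc i < d"
    and eq: "cont lam mu L i = cont lam mu L (Suc (Suc i))"
  shows "cont lam mu L i = 0" "cont lam mu L (Suc i) = 1"
proof -
  let ?c = "cont lam mu L"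
  have k: "k = Suc i" if "i < k" "k < Suc (Suc i)" for k using that by simp
  have *: "(\<exists>k. i < k \<and> k < Suc (Suc i) \<and> ?c k = Suc (?c i)) \<and>
     (?c i > 0 \<longrightarrow> (\<exists>k. i < k \<and> k < Suc (Suc i) \<and> Suc (?c k) = ?c i))"
    using admissible_cont[OF assms(1,2)] assms(3-) unfolding admissible_def
    by (metis Suc_leI lessI less_SucI)
  have "?c (Suc i) = Suc (?c i)" using * k by metis
  moreover have "\<not> ?c i > 0"
  proof
    assume "?c i > 0"
    hence "Suc (?c (Suc i)) = ?c i" using * k by metis
    with calculation show False by simp
  qed
  ultimately show "?c i = 0" "?c (Suc i) = 1" by auto
qed

text \<open>
  The criterion for interchanging neighbouring labels, applied to the standard one of the two fillings.
\<close>

lemma nonstandard_swap: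
  assumes sk: "skew_pair lam mu" and bij: "bij_filling d lam mu L" and i: "1 \<le> i" "i < d"
    and ns: "\<not> standard_filling d lam mu L" and std: "standard_filling d lam mu (adj i \<circ> L)"
  shows "cont lam mu L i \<noteq> cont lam mu L (Suc i)" "\<not> far (cont lam mu L i) (cont lam mu L (Suc i))"
proof -
  have c: "cont lam mu (adj i \<circ> L) k = cont lam mu L (adj i k)" if "k \<in> {1..d}" for k
    using cont_comp[OF bij adj_permutes[OF i] that]
    by (simp add: inv_unique_comp[of "adj i" "adj i"] fun_eq_iff)
  have e: "cont lam mu (adj i \<circ> L) i = cont lam mu L (Suc i)"
    "cont lam mu (adj i \<circ> L) (Suc i) = cont lam mu L i"
    using c[of i] c[of "Suc i"] i by auto
  show "cont lam mu L i \<noteq> cont lam mu L (Suc i)"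
    using standard_adjacent_contents[OF sk std i] e by simp
  show "\<not> far (cont lam mu L i) (cont lam mu L (Suc i))"
    using standard_swap_iff_far[OF sk std i] ns e by (simp add: far_sym)
qed

text \<open>
  After an ascent the two boxes carry their labels in the order opposite to that in \<open>L\<close>. Both fillings are
  standard, so the boxes are not comparable and may be interchanged back.
\<close>

lemma standard_before_ascent:
  assumes sk: "skew_pair lam mu" and L: "standard_filling d lam mu L"
    and g: "g permutes {1..d}" and i: "1 \<le> i" "i < d" and asc: "ascent g i"
    and std: "standard_filling d lam mu ((adj i \<circ> g) \<circ> L)"
  shows "standard_filling d lam mu (g \<circ> L)"
proof -
  note bij = standard_bij[OF L]
  let ?K = "(adj i \<circ> g) \<circ> L"
  have h: "(adj i \<circ> g) permutes {1..d}" using adj_comp_permutes[OF g i] .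
  have "box_of lam mu ?K i = box_of lam mu L (inv g (Suc i))"
    "box_of lam mu ?K (Suc i) = box_of lam mu L (inv g i)"
    using box_of_comp[OF bij h] i inv_adj_comp[OF g] by auto
  moreover have "\<not> precedes (box_of lam mu L (inv g (Suc i))) (box_of lam mu L (inv g i))"
  proof
    assume "precedes (box_of lam mu L (inv g (Suc i))) (box_of lam mu L (inv g i))"
    moreover have "inv g i \<in> {1..d}" "inv g (Suc i) \<in> {1..d}"
      using permutes_inv_mem[OF g] i by auto
    ultimately have "inv g (Suc i) < inv g i"
      using standard_less[OF sk L] box_of_in[OF bij] by metis
    with asc show False by (simp add: ascent_def)
  qed
  ultimately have "standard_filling d lam mu (adj i \<circ> ?K)"
    using standard_swap_iff[OF sk std i] by simp
  thus ?thesis by (simp add: comp_assoc[symmetric] adj_adj_comp[unfolded comp_assoc[symmetric]])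
qed

text \<open>
  Boxes on equal or neighbouring diagonals are comparable, so no standard filling inverts their labels.
\<close>

lemma standard_inversions_far:
  assumes sk: "skew_pair lam mu" and L: "standard_filling d lam mu L"
    and g: "g permutes {1..d}" and std: "standard_filling d lam mu (g \<circ> L)"
    and pr: "(p, r) \<in> Inversions d g"
  shows "far (cont lam mu L p) (cont lam mu L r)"
proof (rule ccontr)
  assume nf: "\<not> far (cont lam mu L p) (cont lam mu L r)"
  have p: "p \<in> {1..d}" "r \<in> {1..d}" "p < r" "g r < g p" using pr by (auto simp: Inversions_def)
  note bij = standard_bij[OF L]
  define b b' where "b = box_of lam mu L p" and "b' = box_of lam mu L r"
  have b: "b \<in> boxes lam mu" "L b = p" and b': "b' \<in> boxes lam mu" "L b' = r"
    using box_of_in[OF bij] p by (auto simp: b_def b'_def)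
  have "precedes b b'"
    using standard_precedes[OF sk L b(1) b'(1)] b b' p nf by (auto simp: far_def cont_def b_def b'_def)
  hence "(g \<circ> L) b < (g \<circ> L) b'" using standard_less[OF sk std b(1) b'(1)] by simp
  with b b' p show False by simp
qed

text \<open>
  The path of ascents to \<open>g\<close> stays inside the standard fillings, because the filling before an ascent is
  standard if the one after it is.
\<close>

lemma standard_fillings_induct [consumes 4, case_names id step]:
  assumes sk: "skew_pair lam mu" and L: "standard_filling d lam mu L" and g: "g permutes {1..d}"
    and std: "standard_filling d lam mu (g \<circ> L)" and P0: "P id"
    and Pstep: "\<And>g i. g permutes {1..d} \<Longrightarrow> 1 \<le> i \<Longrightarrow> i < d \<Longrightarrow> ascent g i \<Longrightarrow>
       standard_filling d lam mu (g \<circ> L) \<Longrightarrow> standard_filling d lam mu ((adj i \<circ> g) \<circ> L) \<Longrightarrow>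
       far (cont lam mu (g \<circ> L) i) (cont lam mu (g \<circ> L) (Suc i)) \<Longrightarrow> P g \<Longrightarrow> P (adj i \<circ> g)"
  shows "P g"
proof -
  have "standard_filling d lam mu (g \<circ> L) \<longrightarrow> P g"
    using g
  proof (induction rule: permutes_ascent_induct)
    case id
    show ?case using P0 by blast
  next
    case (step g i)
    show ?case
    proof
      assume s: "standard_filling d lam mu ((adj i \<circ> g) \<circ> L)"
      have s': "standard_filling d lam mu (g \<circ> L)"
        using standard_before_ascent[OF sk L step(1-4) s] .
      have "far (cont lam mu (g \<circ> L) i) (cont lam mu (g \<circ> L) (Suc i))"
        using standard_swap_iff_far[OF sk s' step(2,3)] s by (simp add: comp_assoc)
      thus "P (adj i \<circ> g)" using Pstep[OF step(1-4) s' s] step(5) s' by blast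
    qed
  qed
  with std show ?thesis by blast
qed

subsection \<open>Reduced words\<close>

lemma word_perm_Cons: "word_perm (i # ws) = adj i \<circ> word_perm ws"
  by (simp add: word_perm_def)

lemma word_perm_Nil: "word_perm [] = id"
  by (simp add: word_perm_def)

lemma word_perm_permutes: "set ws \<subseteq> {1..<d} \<Longrightarrow> word_perm ws permutes {1..d}"
proof (induction ws)
  case Nil show ?case unfolding word_perm_Nil by (rule permutes_id)
next
  case (Cons i ws)
  hence "word_perm ws permutes {1..d}" "1 \<le> i" "i < d" by auto
  thus ?case unfolding word_perm_Cons by (intro adj_comp_permutes)
qed

lemma card_Inversions_word_Cons:
  assumes "set (i # ws) \<subseteq> {1..<d}"
  shows "ascent (word_perm ws) i \<Longrightarrow>
      card (Inversions d (word_perm (i # ws))) = Suc (card (Inversions d (word_perm ws)))"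
    and "\<not> ascent (word_perm ws) i \<Longrightarrow>
      Suc (card (Inversions d (word_perm (i # ws)))) = card (Inversions d (word_perm ws))"
proof -
  have i: "1 \<le> i" "i < d" using assms by auto
  have p: "word_perm ws permutes {1..d}" using word_perm_permutes assms by simp
  show "ascent (word_perm ws) i \<Longrightarrow>
      card (Inversions d (word_perm (i # ws))) = Suc (card (Inversions d (word_perm ws)))"
    unfolding word_perm_Cons by (rule card_Inversions_adj[OF p i])
  assume na: "\<not> ascent (word_perm ws) i"
  have "ascent (adj i \<circ> word_perm ws) i" using na ascent_adj[OF p] by blast
  from card_Inversions_adj[OF adj_comp_permutes[OF p i] i this]
  show "Suc (card (Inversions d (word_perm (i # ws)))) = card (Inversions d (word_perm ws))"
    unfolding word_perm_Cons adj_adj_comp by simp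
qed

text \<open>
  The number of inversions is the length of a reduced word, and every letter of a reduced word is an
  ascent of the permutation to its right.
\<close>

lemma card_Inversions_le_length:
  "set ws \<subseteq> {1..<d} \<Longrightarrow> card (Inversions d (word_perm ws)) \<le> length ws"
proof (induction ws)
  case (Cons i ws)
  thus ?case
    using card_Inversions_word_Cons[OF Cons.prems] by (cases "ascent (word_perm ws) i") auto
qed (simp add: word_perm_Nil Inversions_id)

lemma exists_tight_word:
  assumes "g permutes {1..d}"
  shows "\<exists>ws. set ws \<subseteq> {1..<d} \<and> word_perm ws = g \<and> length ws = card (Inversions d g)"
  using assms
proof (induction rule: permutes_ascent_induct)
  case id
  show ?case
    by (intro exI[of _ "[]"]) (simp only: word_perm_Nil Inversions_id, simp)
next
  case (step g i)
  then obtain ws where ws: "set ws \<subseteq> {1..<d}" "word_perm ws = g" "length ws = card (Inversions d g)"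
    by blast
  have "set (i # ws) \<subseteq> {1..<d}" using ws(1) step(2,3) by simp
  moreover have "word_perm (i # ws) = adj i \<circ> g" by (simp only: word_perm_Cons ws(2))
  moreover have "length (i # ws) = card (Inversions d (adj i \<circ> g))"
    by (simp only: card_Inversions_adj[OF step(1-4)] ws(3) list.size(4))
  ultimately show ?case by blast
qed

lemma chosen_reduced_word:
  assumes g: "g permutes {1..d}"
  defines "ws \<equiv> SOME ws. reduced_expression d g ws"
  shows "set ws \<subseteq> {1..<d}" "word_perm ws = g" "length ws = card (Inversions d g)"
proof -
  obtain ws0 where ws0: "set ws0 \<subseteq> {1..<d}" "word_perm ws0 = g" "length ws0 = card (Inversions d g)"
    using exists_tight_word[OF g] by blast
  have "reduced_expression d g ws0"
    unfolding reduced_expression_def using ws0 card_Inversions_le_length by metis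
  hence "reduced_expression d g ws" unfolding ws_def by (rule someI)
  thus "set ws \<subseteq> {1..<d}" "word_perm ws = g" "length ws = card (Inversions d g)"
    using card_Inversions_le_length[of ws d] ws0 by (auto simp: reduced_expression_def intro: le_antisym)
qed

lemma tight_word_Cons:
  assumes "set (i # ws) \<subseteq> {1..<d}" "length (i # ws) = card (Inversions d (word_perm (i # ws)))"
  shows "ascent (word_perm ws) i" "length ws = card (Inversions d (word_perm ws))"
proof -
  have "card (Inversions d (word_perm ws)) \<le> length ws"
    using card_Inversions_le_length assms(1) by simp
  with card_Inversions_word_Cons[OF assms(1)] assms(2)
  show "ascent (word_perm ws) i" "length ws = card (Inversions d (word_perm ws))"
    by (cases "ascent (word_perm ws) i"; simp)+
qed

text \<open>
  On each class such a permutation is the order isomorphism onto the class with the same value of \<open>c'\<close>,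
  so it preserves ranks.
\<close>

lemma monotone_on_classes_unique:
  fixes f h :: "nat \<Rightarrow> nat"
  assumes f: "f permutes {1..d}" and h: "h permutes {1..d}"
    and c: "\<And>k. k \<in> {1..d} \<Longrightarrow> c' (f k) = c k" "\<And>k. k \<in> {1..d} \<Longrightarrow> c' (h k) = c k"
    and mono: "\<And>p q. p \<in> {1..d} \<Longrightarrow> q \<in> {1..d} \<Longrightarrow> p < q \<Longrightarrow> c p = c q \<Longrightarrow> f p < f q"
      "\<And>p q. p \<in> {1..d} \<Longrightarrow> q \<in> {1..d} \<Longrightarrow> p < q \<Longrightarrow> c p = c q \<Longrightarrow> h p < h q"
  shows "f = h"
proof -
  have rank: "card {y \<in> {1..d}. c' y = c k \<and> y < f k} = card {x \<in> {1..d}. c x = c k \<and> x < k}"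
    if k: "k \<in> {1..d}" and f: "f permutes {1..d}"
      and c: "\<And>k. k \<in> {1..d} \<Longrightarrow> c' (f k) = c k"
      and mono: "\<And>p q. p \<in> {1..d} \<Longrightarrow> q \<in> {1..d} \<Longrightarrow> p < q \<Longrightarrow> c p = c q \<Longrightarrow> f p < f q"
    for k and f :: "nat \<Rightarrow> nat"
  proof -
    have "{y \<in> {1..d}. c' y = c k \<and> y < f k} = f ` {x \<in> {1..d}. c x = c k \<and> x < k}"
    proof (intro subset_antisym subsetI)
      fix y assume y: "y \<in> {y \<in> {1..d}. c' y = c k \<and> y < f k}"
      then obtain x where x: "x \<in> {1..d}" "y = f x" using permutes_image[OF f] by blast
      have "c x = c k" using c[OF x(1)] x y by simp
      moreover have "x < k"
      proof (rule ccontr)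
        assume "\<not> x < k"
        hence "f k \<le> f x" using mono[of k x] k x calculation by (cases "x = k") auto
        with x y show False by simp
      qed
      ultimately show "y \<in> f ` {x \<in> {1..d}. c x = c k \<and> x < k}" using x by blast
    next
      fix y assume "y \<in> f ` {x \<in> {1..d}. c x = c k \<and> x < k}"
      then obtain x where x: "x \<in> {1..d}" "c x = c k" "x < k" "y = f x" by blast
      have "f x \<in> {1..d}" by (simp only: permutes_in_image[OF f] x(1))
      thus "y \<in> {y \<in> {1..d}. c' y = c k \<and> y < f k}"
        using mono[OF x(1) k x(3,2)] c[OF x(1)] x(2,4) by simp
    qed
    moreover have "inj_on f {x \<in> {1..d}. c x = c k \<and> x < k}"
      using permutes_inj[OF f] by (auto simp: inj_on_def)
    ultimately show ?thesis by (simp only: card_image)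
  qed
  have "f k = h k" if k: "k \<in> {1..d}" for k
  proof (rule ccontr)
    assume ne: "f k \<noteq> h k"
    have r: "card {y \<in> {1..d}. c' y = c k \<and> y < f k} = card {y \<in> {1..d}. c' y = c k \<and> y < h k}"
      by (rule trans[OF rank[OF k f c(1) mono(1)] rank[OF k h c(2) mono(2), symmetric]])
    have in': "f k \<in> {1..d}" "h k \<in> {1..d}"
      by (simp_all only: permutes_in_image[OF f] permutes_in_image[OF h] k)
    have less: "card {y \<in> {1..d}. c' y = c k \<and> y < a} < card {y \<in> {1..d}. c' y = c k \<and> y < b}"
      if "a < b" "a \<in> {1..d}" "c' a = c k" for a b
    proof (rule psubset_card_mono)
      have "a \<in> {y \<in> {1..d}. c' y = c k \<and> y < b}" "a \<notin> {y \<in> {1..d}. c' y = c k \<and> y < a}"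
        using that by auto
      moreover have "{y \<in> {1..d}. c' y = c k \<and> y < a} \<subseteq> {y \<in> {1..d}. c' y = c k \<and> y < b}"
        using that by auto
      ultimately show "{y \<in> {1..d}. c' y = c k \<and> y < a} \<subset> {y \<in> {1..d}. c' y = c k \<and> y < b}"
        by blast
    qed simp
    from ne show False
      using less[of "f k" "h k"] less[of "h k" "f k"] in' c[OF k] r
      by (cases "f k" "h k" rule: linorder_cases) auto
  qed
  moreover have "f k = h k" if "k \<notin> {1..d}" for k
    using that permutes_not_in[OF f] permutes_not_in[OF h] by metis
  ultimately show ?thesis by blast
qed

section \<open>Eigenvectors on a finite-dimensional subspace\<close>

context vector_space
begin

lemma powers_linearly_dependent:
  assumes fin: "finite B" and w: "\<And>i. w i \<in> span B"
  obtains a :: "nat \<Rightarrow> 'a" where "\<exists>i\<le>card B. a i \<noteq> 0" "(\<Sum>i\<le>card B. scale (a i) (w i)) = 0"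
proof (cases "inj_on w {..card B}")
  case True
  let ?S = "w ` {..card B}"
  have "card ?S = Suc (card B)" using card_image[OF True] by simp
  hence "dependent ?S"
    using independent_span_bound[OF fin, of ?S] w by fastforce
  then obtain u where u: "\<exists>x\<in>?S. u x \<noteq> 0" "(\<Sum>x\<in>?S. scale (u x) x) = 0"
    using dependent_finite[of ?S] by auto
  show thesis
  proof (rule that[of "\<lambda>i. u (w i)"])
    show "\<exists>i\<le>card B. u (w i) \<noteq> 0" using u(1) by auto
    show "(\<Sum>i\<le>card B. scale (u (w i)) (w i)) = 0"
      using u(2) by (simp add: sum.reindex[OF True])
  qed
next
  case False
  then obtain i j where ij: "i \<le> card B" "j \<le> card B" "i \<noteq> j" "w i = w j"
    by (auto simp: inj_on_def)
  define a :: "nat \<Rightarrow> 'a" where "a k = (if k = i then 1 else 0) - (if k = j then 1 else 0)" for k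
  have "(\<Sum>k\<le>card B. scale (a k) (w k)) =
      (\<Sum>k\<le>card B. if k = i then w k else 0) - (\<Sum>k\<le>card B. if k = j then w k else 0)"
    unfolding sum_subtractf[symmetric] by (rule sum.cong) (auto simp: a_def scale_left_diff_distrib)
  also have "\<dots> = 0" using ij by (simp add: sum.delta)
  finally have "(\<Sum>k\<le>card B. scale (a k) (w k)) = 0" .
  moreover have "a i \<noteq> 0" using ij by (simp add: a_def)
  ultimately show thesis using ij(1) by (intro that[of a]) auto
qed

end

text \<open>
  An operator on a finite-dimensional complex space annihilates a vector by some polynomial; a
  linear factor of it that can be split off last produces an eigenvector.
\<close>

lemma exists_eigenvector:
  fixes sm :: "complex \<Rightarrow> 'v::ab_group_add \<Rightarrow> 'v"
  assumes vs: "vector_space sm" and V: "module.subspace sm V" and fin: "finite B"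
    and VB: "V \<subseteq> module.span sm B" and ne: "V \<noteq> {0}"
    and T: "\<And>v. v \<in> V \<Longrightarrow> T v \<in> V" "\<And>u v. u \<in> V \<Longrightarrow> v \<in> V \<Longrightarrow> T (u + v) = T u + T v"
      "\<And>a v. v \<in> V \<Longrightarrow> T (sm a v) = sm a (T v)"
  obtains z v where "v \<in> V" "v \<noteq> 0" "T v = sm z v"
proof -
  interpret vector_space sm by (rule vs)
  obtain v where v: "v \<in> V" "v \<noteq> 0" using ne subspace_0[OF V] by blast
  define w where "w i = (T ^^ i) v" for i
  have w: "w i \<in> V" for i
    unfolding w_def by (induction i) (simp_all add: v(1) T(1))
  have T0: "T 0 = 0" using T(3)[OF v(1), of 0] by simp
  have Tsum: "T (sum f A) = (\<Sum>i\<in>A. T (f i))" if "\<And>i. i \<in> A \<Longrightarrow> f i \<in> V" for f and A :: "nat set"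
    using that
  proof (induction A rule: infinite_finite_induct)
    case (insert x F)
    thus ?case using T(2)[of "f x" "sum f F"] subspace_sum[OF V, of F f] by simp
  qed (simp_all add: T0)
  define ev where "ev n p = (\<Sum>i\<le>n. sm (coeff p i) (w i))" for n and p :: "complex poly"
  have evV: "ev n p \<in> V" for n p
    unfolding ev_def by (intro subspace_sum[OF V] subspace_scale[OF V] w)
  have shift: "ev (Suc n) (pCons 0 r) = T (ev n r)" for n r
  proof -
    have "T (ev n r) = (\<Sum>i\<le>n. sm (coeff r i) (w (Suc i)))"
      unfolding ev_def using w subspace_scale[OF V]
      by (subst Tsum) (auto simp: T(3) w_def intro!: sum.cong)
    thus ?thesis
      unfolding ev_def by (subst sum.atMost_Suc_shift) simp
  qed
  have main: "\<exists>z u. u \<in> V \<and> u \<noteq> 0 \<and> T u = sm z u" if "p \<noteq> 0" "ev (degree p) p = 0" for p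
    using that
  proof (induction "degree p" arbitrary: p)
    case 0
    hence "coeff p 0 \<noteq> 0" using leading_coeff_neq_0[of p] by simp
    moreover have "sm (coeff p 0) v = 0" using 0 by (simp add: ev_def w_def)
    ultimately show ?case using v by simp
  next
    case (Suc n)
    have "\<not> constant (poly p)" using Suc(2) constant_degree[of p] by simp
    then obtain z where "poly p z = 0" using fundamental_theorem_of_algebra by blast
    then obtain r where r: "p = [:-z, 1:] * r" by (metis dvdE poly_eq_0_iff_dvd)
    have "r \<noteq> 0" using Suc(3) r by auto
    hence "degree p = degree [:-z, 1:] + degree r"
      unfolding r by (intro degree_mult_eq) auto
    hence deg: "degree r = n" using Suc(2) by simp
    have "ev (Suc n) p = ev (Suc n) (pCons 0 r) - sm z (ev (Suc n) r)"
      unfolding r ev_def scale_sum_right sum_subtractf[symmetric]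
      by (intro sum.cong) (simp_all add: scale_left_diff_distrib)
    also have "ev (Suc n) r = ev n r"
      using coeff_eq_0[of r "Suc n"] deg by (simp add: ev_def)
    finally have eq: "T (ev n r) = sm z (ev n r)" using shift[of n r] Suc by simp
    show ?case
    proof (cases "ev n r = 0")
      case True
      with Suc(1)[of r] deg \<open>r \<noteq> 0\<close> show ?thesis by simp
    qed (use eq evV in blast)
  qed
  obtain a where a: "\<exists>i\<le>card B. a i \<noteq> 0" "(\<Sum>i\<le>card B. sm (a i) (w i)) = 0"
    using powers_linearly_dependent[OF fin, of w] w VB by blast
  define p where "p = (\<Sum>i\<le>card B. monom (a i) i)"
  have coeff: "coeff p i = (if i \<le> card B then a i else 0)" for i
    by (simp add: p_def coeff_sum if_distrib cong: if_cong)
  have "p \<noteq> 0" using a(1) coeff by (metis coeff_0)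
  moreover have "degree p \<le> card B" by (rule degree_le) (simp add: coeff)
  hence "ev (degree p) p = ev (card B) p"
    unfolding ev_def by (intro sum.mono_neutral_left) (auto simp: coeff_eq_0)
  hence "ev (degree p) p = 0" using a(2) by (simp add: ev_def coeff)
  ultimately show thesis using main that by blast
qed

section \<open>Operator identities in ranks two and three\<close>

locale clifford_ops =
  fixes V :: "'v::ab_group_add set" and sm :: "complex \<Rightarrow> 'v \<Rightarrow> 'v"
  assumes vs: "vector_space sm"
    and V_add [simp]: "\<And>u v. u \<in> V \<Longrightarrow> v \<in> V \<Longrightarrow> u + v \<in> V"
    and V_sm [simp]: "\<And>a v. v \<in> V \<Longrightarrow> sm a v \<in> V"
begin

sublocale vector_space sm by (rule vs)

lemma V_minus [simp]: "v \<in> V \<Longrightarrow> - v \<in> V"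
  using V_sm[of v "-1"] by simp

lemma V_diff [simp]: "u \<in> V \<Longrightarrow> v \<in> V \<Longrightarrow> u - v \<in> V"
  using V_add[of u "- v"] by simp

definition lin :: "('v \<Rightarrow> 'v) \<Rightarrow> bool" where
  "lin f \<longleftrightarrow> (\<forall>v\<in>V. f v \<in> V) \<and> (\<forall>u\<in>V. \<forall>v\<in>V. f (u + v) = f u + f v) \<and>
     (\<forall>a. \<forall>v\<in>V. f (sm a v) = sm a (f v))"

lemma lin_rules:
  assumes "lin f"
  shows "v \<in> V \<Longrightarrow> f v \<in> V" "u \<in> V \<Longrightarrow> v \<in> V \<Longrightarrow> f (u + v) = f u + f v"
    "v \<in> V \<Longrightarrow> f (sm a v) = sm a (f v)" "v \<in> V \<Longrightarrow> f (- v) = - f v"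
    "u \<in> V \<Longrightarrow> v \<in> V \<Longrightarrow> f (u - v) = f u - f v"
proof -
  show 1: "u \<in> V \<Longrightarrow> v \<in> V \<Longrightarrow> f (u + v) = f u + f v" for u v using assms by (simp add: lin_def)
  show 2: "v \<in> V \<Longrightarrow> f (sm a v) = sm a (f v)" for a v using assms by (simp add: lin_def)
  show 3: "v \<in> V \<Longrightarrow> f (- v) = - f v" for v using 2[of v "-1"] by simp
  show "u \<in> V \<Longrightarrow> v \<in> V \<Longrightarrow> f (u - v) = f u - f v" for u v
    using 1[of u "- v"] 3[of v] by simp
qed (use assms in \<open>simp add: lin_def\<close>)

end

text \<open>
  The generators \<open>s\<^sub>i\<close>, \<open>x\<^sub>i\<close>, \<open>x\<^bsub>i+1\<^esub>\<close>, \<open>c\<^sub>i\<close>, \<open>c\<^bsub>i+1\<^esub>\<close> under single-letter names, with every relation oriented so that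
  rewriting moves \<open>s\<close> to the right, then \<open>c\<close> past \<open>x\<close>. Identities between words in them follow by
  normalization.
\<close>

locale rank2_ops = clifford_ops V sm
  for V :: "'v::ab_group_add set" and sm +
  fixes s x y c e :: "'v \<Rightarrow> 'v"
  assumes lins: "lin s" "lin x" "lin y" "lin c" "lin e"
    and ss [simp]: "v \<in> V \<Longrightarrow> s (s v) = v"
    and yx [simp]: "v \<in> V \<Longrightarrow> y (x v) = x (y v)"
    and cc [simp]: "v \<in> V \<Longrightarrow> c (c v) = - v"
    and ee [simp]: "v \<in> V \<Longrightarrow> e (e v) = - v"
    and ec [simp]: "v \<in> V \<Longrightarrow> e (c v) = - c (e v)"
    and sc [simp]: "v \<in> V \<Longrightarrow> s (c v) = e (s v)"
    and se [simp]: "v \<in> V \<Longrightarrow> s (e v) = c (s v)"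
    and cx [simp]: "v \<in> V \<Longrightarrow> c (x v) = - x (c v)"
    and cy [simp]: "v \<in> V \<Longrightarrow> c (y v) = y (c v)"
    and ex [simp]: "v \<in> V \<Longrightarrow> e (x v) = x (e v)"
    and ey [simp]: "v \<in> V \<Longrightarrow> e (y v) = - y (e v)"
    and sx [simp]: "v \<in> V \<Longrightarrow> s (x v) = y (s v) - v + c (e v)"
begin

lemmas [simp] = lins[THEN lin_rules(1)] lins[THEN lin_rules(2)] lins[THEN lin_rules(3)]
  lins[THEN lin_rules(4)] lins[THEN lin_rules(5)]

lemma sy [simp]: "v \<in> V \<Longrightarrow> s (y v) = x (s v) + v + c (e v)"
proof -
  assume v: "v \<in> V"
  have "s (x (s v)) = y v - s v + c (e (s v))" using v by simp
  hence "x (s v) = s (y v - s v + c (e (s v)))" using ss[of "x (s v)"] v by (simp del: sx)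
  hence "x (s v) = s (y v) - v - c (e v)" using v by simp
  thus ?thesis by (simp add: algebra_simps)
qed

text \<open>
  The operator \<open>\<phi>\<^sub>i\<close>.
\<close>

definition phi_op :: "'v \<Rightarrow> 'v" where
  "phi_op v = s (x (x v) - y (y v)) + (x v + y v) - c (e (x v - y v))"

lemma phi_x: "v \<in> V \<Longrightarrow> phi_op (x v) = y (phi_op v)"
  unfolding phi_op_def by (simp add: algebra_simps)

lemma phi_y: "v \<in> V \<Longrightarrow> phi_op (y v) = x (phi_op v)"
  unfolding phi_op_def by (simp add: algebra_simps)

lemma phi_c: "v \<in> V \<Longrightarrow> phi_op (c v) = e (phi_op v)"
  unfolding phi_op_def by (simp add: algebra_simps)

lemma phi_e: "v \<in> V \<Longrightarrow> phi_op (e v) = c (phi_op v)"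
  unfolding phi_op_def by (simp add: algebra_simps)

lemma phi_phi: "v \<in> V \<Longrightarrow> phi_op (phi_op v) =
    x (x v) + x (x v) + y (y v) + y (y v)
    - (x (x (x (x v))) + y (y (y (y v))) - x (x (y (y v))) - x (x (y (y v))))"
  unfolding phi_op_def by (simp add: algebra_simps)

end

text \<open>
  The operators for three consecutive places, where \<open>s = s\<^sub>i\<close> and \<open>t = s\<^bsub>i+1\<^esub>\<close>. The braid relation is left out
  because its defect is the object of study.
\<close>

locale rank3_ops = clifford_ops V sm
  for V :: "'v::ab_group_add set" and sm +
  fixes s t x y z c e f :: "'v \<Rightarrow> 'v"
  assumes st: "rank2_ops V sm s x y c e" and tt: "rank2_ops V sm t y z e f"
    and sz [simp]: "v \<in> V \<Longrightarrow> s (z v) = z (s v)"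
    and sf [simp]: "v \<in> V \<Longrightarrow> s (f v) = f (s v)"
    and tx [simp]: "v \<in> V \<Longrightarrow> t (x v) = x (t v)"
    and tc [simp]: "v \<in> V \<Longrightarrow> t (c v) = c (t v)"
    and zx [simp]: "v \<in> V \<Longrightarrow> z (x v) = x (z v)"
    and fc [simp]: "v \<in> V \<Longrightarrow> f (c v) = - c (f v)"
    and cz [simp]: "v \<in> V \<Longrightarrow> c (z v) = z (c v)"
    and fx [simp]: "v \<in> V \<Longrightarrow> f (x v) = x (f v)"
begin

sublocale S: rank2_ops V sm s x y c e by (rule st)
sublocale T: rank2_ops V sm t y z e f by (rule tt)

definition braid_defect :: "'v \<Rightarrow> 'v" where
  "braid_defect v = s (t (s v)) - t (s (t v))"

text \<open>The braid relation is compatible with the other relations: the defect moves \<open>x\<close> to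
  \<open>z\<close> and \<open>z\<close> to \<open>x\<close> without lower terms.\<close>

lemma braid_defect_x: "v \<in> V \<Longrightarrow> braid_defect (x v) = z (braid_defect v)"
  unfolding braid_defect_def by (simp add: algebra_simps)

lemma braid_defect_z: "v \<in> V \<Longrightarrow> braid_defect (z v) = x (braid_defect v)"
  unfolding braid_defect_def by (simp add: algebra_simps)

lemma braid_defect_c: "v \<in> V \<Longrightarrow> braid_defect (c v) = f (braid_defect v)"
  unfolding braid_defect_def by (simp add: algebra_simps)

lemma braid_defect_e: "v \<in> V \<Longrightarrow> braid_defect (e v) = e (braid_defect v)"
  unfolding braid_defect_def by (simp add: algebra_simps)

lemma braid_defect_f: "v \<in> V \<Longrightarrow> braid_defect (f v) = c (braid_defect v)"
  unfolding braid_defect_def by (simp add: algebra_simps)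

text \<open>If neither generator leaves the Clifford module of \<open>v\<close>, and the weights at the outer
  positions agree, then \<open>s\<close> and \<open>t\<close> act on \<open>v\<close> by the two Clifford elements below.\<close>

lemma braid_defect_Clifford:
  assumes v: "v \<in> V" and s: "s v = sm a v + sm b (c (e v))" and t: "t v = - sm a v + sm b (e (f v))"
  shows "braid_defect v = sm (2 * (b * b * b - a * a * a)) v"
proof -
  have "braid_defect v = sm (b * b * b) v + sm (b * b * b) v - sm (a * a * a) v - sm (a * a * a) v"
    unfolding braid_defect_def using v by (simp add: s t algebra_simps)
  also have "\<dots> = sm (2 * (b * b * b - a * a * a)) v"
    by (simp only: scale_left_distrib[symmetric] scale_left_diff_distrib[symmetric])
      (rule arg_cong[of _ _ "\<lambda>z. sm z v"], simp)
  finally show ?thesis .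
qed

end

section \<open>Weights and intertwiners\<close>

text \<open>
  With \<open>a\<close> replaced by \<open>-a-1\<close> if necessary, every eigenvalue \<open>q(a)\<close> has the form \<open>n (n + 1)\<close> with \<open>n\<close> a natural
  number, and \<open>kap n\<close> is its non-negative root. The number \<open>phi_square a b\<close> is the value of \<open>\<phi>\<^sub>i\<^sup>2\<close> on vectors
  with the entries \<open>a\<close>, \<open>b\<close> at the places \<open>i\<close>, \<open>i + 1\<close>.
\<close>

definition qc :: "nat \<Rightarrow> complex" where
  "qc n = of_nat (n * Suc n)"

definition kap :: "nat \<Rightarrow> complex" where
  "kap n = complex_of_real (sqrt (real (n * Suc n)))"

definition phi_square :: "nat \<Rightarrow> nat \<Rightarrow> complex" where
  "phi_square a b = 2 * (qc a + qc b) - (qc a - qc b) ^ 2"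

lemma kap_sq: "kap n * kap n = qc n"
proof -
  have "kap n * kap n = complex_of_real (sqrt (real (n * Suc n)) * sqrt (real (n * Suc n)))"
    unfolding kap_def of_real_mult ..
  also have "sqrt (real (n * Suc n)) * sqrt (real (n * Suc n)) = real (n * Suc n)" by simp
  finally show ?thesis unfolding qc_def by (simp only: of_real_of_nat_eq)
qed

lemma pronic_less: "(a::nat) < b \<Longrightarrow> a * Suc a < b * Suc b"
  by (rule mult_strict_mono) auto

lemma pronic_inj: "(a::nat) * Suc a = b * Suc b \<longleftrightarrow> a = b"
  using pronic_less[of a b] pronic_less[of b a] by (cases a b rule: linorder_cases) auto

lemma qc_eq_iff [simp]: "qc a = qc b \<longleftrightarrow> a = b"
  unfolding qc_def of_nat_eq_iff by (rule pronic_inj)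

lemma kap_eq_0 [simp]: "kap n = 0 \<longleftrightarrow> n = 0"
proof -
  have "kap n = 0 \<longleftrightarrow> real (n * Suc n) = 0" unfolding kap_def of_real_eq_0_iff real_sqrt_eq_0_iff ..
  thus ?thesis unfolding of_nat_eq_0_iff by simp
qed

lemma kap_eq_iff [simp]: "kap a = kap b \<longleftrightarrow> a = b"
  using kap_sq qc_eq_iff by metis

lemma kap_add_nonzero: "a \<noteq> b \<Longrightarrow> kap a + kap b \<noteq> 0"
proof -
  assume ne: "a \<noteq> b"
  have "(kap a + kap b) * (kap a - kap b) = qc a - qc b"
    by (simp add: kap_sq[symmetric] algebra_simps)
  with ne show ?thesis using qc_eq_iff[of a b] by auto
qed

lemma phi_square_factor:
  "phi_square a b = - of_int (((int a - int b)\<^sup>2 - 1) * ((int a + int b + 1)\<^sup>2 - 1))"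
proof -
  have "qc n = of_int (int n * (int n + 1))" for n by (simp add: qc_def algebra_simps)
  hence "phi_square a b = of_int (2 * (int a * (int a + 1) + int b * (int b + 1))
      - (int a * (int a + 1) - int b * (int b + 1))\<^sup>2)"
    unfolding phi_square_def by simp
  also have "2 * (int a * (int a + 1) + int b * (int b + 1))
      - (int a * (int a + 1) - int b * (int b + 1))\<^sup>2
      = - (((int a - int b)\<^sup>2 - 1) * ((int a + int b + 1)\<^sup>2 - 1))"
    by (simp add: power2_eq_square algebra_simps)
  finally show ?thesis by simp
qed

lemma phi_square_eq_0_iff:
  assumes "a \<noteq> b"
  shows "phi_square a b = 0 \<longleftrightarrow> \<not> far a b"
proof -
  have "(int a + int b + 1)\<^sup>2 \<noteq> 1"
    using assms by (auto simp: power2_eq_1_iff)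
  moreover have "(int a - int b)\<^sup>2 = 1 \<longleftrightarrow> \<not> far a b"
    using assms by (auto simp: power2_eq_1_iff far_def)
  ultimately show ?thesis
    unfolding phi_square_factor neg_equal_0_iff_equal of_int_eq_0_iff by auto
qed

text \<open>
  The braid relation is left out, so that the results on weights and intertwiners can be used to
  establish it on the standard fillings.
\<close>

locale weak_hc =
  fixes d :: nat and M :: "('v::ab_group_add) hc_data"
  assumes super: "super_space M"
    and s_even: "1 \<le> i \<Longrightarrow> i < d \<Longrightarrow> even_map M M (sact M i)"
    and x_even: "1 \<le> i \<Longrightarrow> i \<le> d \<Longrightarrow> even_map M M (xact M i)"
    and c_odd: "1 \<le> i \<Longrightarrow> i \<le> d \<Longrightarrow> odd_map M M (cact M i)"
    and s_s: "v \<in> carr M \<Longrightarrow> 1 \<le> i \<Longrightarrow> i < d \<Longrightarrow> sact M i (sact M i v) = v"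
    and s_far: "v \<in> carr M \<Longrightarrow> 1 \<le> i \<Longrightarrow> Suc i < j \<Longrightarrow> j < d \<Longrightarrow>
      sact M i (sact M j v) = sact M j (sact M i v)"
    and x_x: "v \<in> carr M \<Longrightarrow> 1 \<le> i \<Longrightarrow> i \<le> d \<Longrightarrow> 1 \<le> j \<Longrightarrow> j \<le> d \<Longrightarrow>
      xact M i (xact M j v) = xact M j (xact M i v)"
    and c_sq: "v \<in> carr M \<Longrightarrow> 1 \<le> i \<Longrightarrow> i \<le> d \<Longrightarrow> cact M i (cact M i v) = - v"
    and c_c: "v \<in> carr M \<Longrightarrow> 1 \<le> i \<Longrightarrow> i \<le> d \<Longrightarrow> 1 \<le> j \<Longrightarrow> j \<le> d \<Longrightarrow> i \<noteq> j \<Longrightarrow>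
      cact M i (cact M j v) = - cact M j (cact M i v)"
    and s_c_left: "v \<in> carr M \<Longrightarrow> 1 \<le> i \<Longrightarrow> i < d \<Longrightarrow>
      sact M i (cact M i v) = cact M (Suc i) (sact M i v)"
    and s_c_right: "v \<in> carr M \<Longrightarrow> 1 \<le> i \<Longrightarrow> i < d \<Longrightarrow>
      sact M i (cact M (Suc i) v) = cact M i (sact M i v)"
    and s_c_other: "v \<in> carr M \<Longrightarrow> 1 \<le> i \<Longrightarrow> i < d \<Longrightarrow> 1 \<le> j \<Longrightarrow> j \<le> d \<Longrightarrow> j \<noteq> i \<Longrightarrow> j \<noteq> Suc i \<Longrightarrow>
      sact M i (cact M j v) = cact M j (sact M i v)"
    and c_x_same: "v \<in> carr M \<Longrightarrow> 1 \<le> i \<Longrightarrow> i \<le> d \<Longrightarrow> cact M i (xact M i v) = - xact M i (cact M i v)"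
    and c_x_other: "v \<in> carr M \<Longrightarrow> 1 \<le> i \<Longrightarrow> i \<le> d \<Longrightarrow> 1 \<le> j \<Longrightarrow> j \<le> d \<Longrightarrow> i \<noteq> j \<Longrightarrow>
      cact M j (xact M i v) = xact M i (cact M j v)"
    and s_x_left: "v \<in> carr M \<Longrightarrow> 1 \<le> i \<Longrightarrow> i < d \<Longrightarrow>
      sact M i (xact M i v) = xact M (Suc i) (sact M i v) - v + cact M i (cact M (Suc i) v)"
    and s_x_other: "v \<in> carr M \<Longrightarrow> 1 \<le> i \<Longrightarrow> i < d \<Longrightarrow> 1 \<le> j \<Longrightarrow> j \<le> d \<Longrightarrow> j \<noteq> i \<Longrightarrow> j \<noteq> Suc i \<Longrightarrow>
      sact M i (xact M j v) = xact M j (sact M i v)"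
begin

lemma subspace_evn: "module.subspace (smul M) (evn M)"
  and subspace_odd: "module.subspace (smul M) (odd_part M)"
  and evn_odd: "evn M \<inter> odd_part M = {0}"
  and carr_eq: "carr M = {u + v | u v. u \<in> evn M \<and> v \<in> odd_part M}"
  and finite_dim: "\<exists>B. finite B \<and> carr M = module.span (smul M) B"
  using super unfolding super_space_def by blast+

lemma vector_space_smul: "vector_space (smul M)"
  using super by (simp add: super_space_def)

lemma subspace_carr: "module.subspace (smul M) (carr M)"
proof -
  interpret vector_space "smul M" by (rule vector_space_smul)
  show ?thesis
    unfolding carr_eq by (rule subspace_sums[OF subspace_evn subspace_odd])
qed

sublocale clifford_ops "carr M" "smul M"
proof -
  interpret vector_space "smul M" by (rule vector_space_smul)
  show "clifford_ops (carr M) (smul M)"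
    by unfold_locales (simp_all add: subspace_add[OF subspace_carr] subspace_scale[OF subspace_carr])
qed

abbreviation "S \<equiv> sact M"
abbreviation "X \<equiv> xact M"
abbreviation "C \<equiv> cact M"
abbreviation "\<phi> \<equiv> phi M"

lemma carr_0 [simp]: "0 \<in> carr M"
  by (rule subspace_0[OF subspace_carr])

lemma linear_map_lin: "linear_map M M f \<Longrightarrow> lin f"
  by (simp add: linear_map_def lin_def image_subset_iff)

lemma lin_S: "1 \<le> i \<Longrightarrow> i < d \<Longrightarrow> lin (S i)"
  and lin_X: "1 \<le> i \<Longrightarrow> i \<le> d \<Longrightarrow> lin (X i)"
  and lin_C: "1 \<le> i \<Longrightarrow> i \<le> d \<Longrightarrow> lin (C i)"
  using s_even[of i] x_even[of i] c_odd[of i]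
  by (simp_all add: even_map_def odd_map_def linear_map_lin)

lemma lin_0: "lin f \<Longrightarrow> f 0 = 0"
  using lin_rules(3)[of f 0 0] by simp

lemma lin_sum: "lin f \<Longrightarrow> (\<And>x. x \<in> A \<Longrightarrow> g x \<in> carr M) \<Longrightarrow> f (sum g A) = (\<Sum>x\<in>A. f (g x))"
proof (induction A rule: infinite_finite_induct)
  case (insert x A)
  thus ?case using subspace_sum[OF subspace_carr, of A g] by (simp add: lin_rules)
qed (simp_all add: lin_0)

lemma carr_sum: "(\<And>x. x \<in> A \<Longrightarrow> g x \<in> carr M) \<Longrightarrow> sum g A \<in> carr M"
  by (rule subspace_sum[OF subspace_carr])

lemma lin_comp: "lin f \<Longrightarrow> lin g \<Longrightarrow> lin (\<lambda>v. f (g v))"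
  by (simp add: lin_def)

lemma lin_add: "lin f \<Longrightarrow> lin g \<Longrightarrow> lin (\<lambda>v. f v + g v)"
  by (auto simp: lin_def scale_right_distrib)

lemma lin_diff: "lin f \<Longrightarrow> lin g \<Longrightarrow> lin (\<lambda>v. f v - g v)"
  by (auto simp: lin_def scale_right_diff_distrib)

lemma lin_id: "lin (\<lambda>v. v)"
  by (simp add: lin_def)

lemma lin_sm: "lin f \<Longrightarrow> lin (\<lambda>v. smul M a (f v))"
  by (auto simp: lin_def scale_right_distrib scale_left_commute)

lemma lin_phi: assumes "1 \<le> i" "i < d" shows "lin (\<phi> i)"
proof -
  have l: "lin (S i)" "lin (X i)" "lin (X (i + 1))" "lin (C i)" "lin (C (i + 1))"
    using assms by (auto intro: lin_S lin_X lin_C)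
  show ?thesis
    unfolding phi_def[abs_def]
    using lin_diff[OF lin_add[OF lin_comp[OF l(1) lin_diff[OF lin_comp[OF l(2,2)] lin_comp[OF l(3,3)]]]
          lin_add[OF l(2,3)]] lin_comp[OF l(4) lin_comp[OF l(5) lin_diff[OF l(2,3)]]]] .
qed

lemmas S_carr [simp] = lin_S[THEN lin_rules(1)]
lemmas X_carr [simp] = lin_X[THEN lin_rules(1)]
lemmas C_carr [simp] = lin_C[THEN lin_rules(1)]
lemmas phi_carr [simp] = lin_phi[THEN lin_rules(1)]

lemma rank2: "1 \<le> i \<Longrightarrow> i < d \<Longrightarrow>
    rank2_ops (carr M) (smul M) (S i) (X i) (X (Suc i)) (C i) (C (Suc i))"
  by unfold_locales
    (auto intro: lin_S lin_X lin_C s_s x_x c_sq c_c s_c_left s_c_right c_x_same c_x_other s_x_left)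

lemma rank3: "1 \<le> i \<Longrightarrow> Suc i < d \<Longrightarrow>
    rank3_ops (carr M) (smul M) (S i) (S (Suc i)) (X i) (X (Suc i)) (X (Suc (Suc i)))
      (C i) (C (Suc i)) (C (Suc (Suc i)))"
  by (intro rank3_ops.intro rank3_ops_axioms.intro clifford_ops_axioms)
    (auto intro: rank2 x_x c_c c_x_other s_c_other s_x_other)

lemma phi_eq: "1 \<le> i \<Longrightarrow> i < d \<Longrightarrow>
    \<phi> i v = rank2_ops.phi_op (S i) (X i) (X (Suc i)) (C i) (C (Suc i)) v"
  by (simp add: rank2_ops.phi_op_def[OF rank2] phi_def)

lemma phi_X:
  assumes v: "v \<in> carr M" and i: "1 \<le> i" "i < d" and j: "1 \<le> j" "j \<le> d"
  shows "\<phi> i (X j v) = X (adj i j) (\<phi> i v)"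
proof -
  interpret R: rank2_ops "carr M" "smul M" "S i" "X i" "X (Suc i)" "C i" "C (Suc i)"
    by (rule rank2[OF i])
  consider "j = i" | "j = Suc i" | "j \<noteq> i" "j \<noteq> Suc i" by blast
  thus ?thesis
  proof cases
    case 3
    note lX = lin_X[OF j, THEN lin_rules(2)] lin_X[OF j, THEN lin_rules(5)]
    have xx: "X k (X j u) = X j (X k u)" and cx: "C k (X j u) = X j (C k u)"
      if "k = i \<or> k = Suc i" "u \<in> carr M" for k u
      using x_x[of u k j] c_x_other[of u j k] that i j 3 by auto
    have "\<phi> i (X j v) = X j (\<phi> i v)"
      unfolding phi_def using v i j 3 by (simp add: xx cx lX[symmetric] s_x_other)
    with 3 show ?thesis by simp
  qed (use v i in \<open>simp_all add: phi_eq R.phi_x R.phi_y\<close>)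
qed

lemma phi_C:
  assumes v: "v \<in> carr M" and i: "1 \<le> i" "i < d" and j: "1 \<le> j" "j \<le> d"
  shows "\<phi> i (C j v) = C (adj i j) (\<phi> i v)"
proof -
  interpret R: rank2_ops "carr M" "smul M" "S i" "X i" "X (Suc i)" "C i" "C (Suc i)"
    by (rule rank2[OF i])
  consider "j = i" | "j = Suc i" | "j \<noteq> i" "j \<noteq> Suc i" by blast
  thus ?thesis
  proof cases
    case 3
    note lC = lin_C[OF j, THEN lin_rules(2)] lin_C[OF j, THEN lin_rules(5)] lin_C[OF j, THEN lin_rules(4)]
    have xc: "X k (C j u) = C j (X k u)" if "k = i \<or> k = Suc i" "u \<in> carr M" for k u
      using c_x_other[of u k j] that i j 3 by auto
    have cc: "C i (C (Suc i) (C j u)) = C j (C i (C (Suc i) u))" if "u \<in> carr M" for u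
    proof -
      have "C i (C (Suc i) (C j u)) = C i (- C j (C (Suc i) u))"
        using c_c[of u "Suc i" j] that i j 3 by simp
      also have "\<dots> = - C i (C j (C (Suc i) u))"
        using lin_C[THEN lin_rules(4)] that i j by simp
      also have "\<dots> = C j (C i (C (Suc i) u))"
        using c_c[of "C (Suc i) u" i j] that i j 3 by simp
      finally show ?thesis .
    qed
    have "\<phi> i (C j v) = C j (\<phi> i v)"
      unfolding phi_def using v i j 3
      by (simp add: xc lC[symmetric] s_c_other cc)
    with 3 show ?thesis by simp
  qed (use v i in \<open>simp_all add: phi_eq R.phi_c R.phi_e\<close>)
qed

lemma phi_S_far:
  assumes v: "v \<in> carr M" and i: "1 \<le> i" "i < d" and j: "1 \<le> j" "j < d"
    and ij: "Suc i < j \<or> Suc j < i"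
  shows "\<phi> i (S j v) = S j (\<phi> i v)"
proof -
  note lS = lin_S[OF j, THEN lin_rules(2)] lin_S[OF j, THEN lin_rules(5)]
  have x: "X k (S j u) = S j (X k u)" and c: "C k (S j u) = S j (C k u)"
    if "k = i \<or> k = Suc i" "u \<in> carr M" for k u
    using that s_x_other[of u j k] s_c_other[of u j k] i j ij by auto
  have s: "S i (S j u) = S j (S i u)" if "u \<in> carr M" for u
    using ij s_far[of u i j] s_far[of u j i] that i j by auto
  show ?thesis
    unfolding phi_def using v i j by (simp add: x c s lS[symmetric])
qed

lemma phi_phi_far:
  assumes v: "v \<in> carr M" and ij: "1 \<le> i" "Suc i < j" "j < d"
  shows "\<phi> i (\<phi> j v) = \<phi> j (\<phi> i v)"
proof -
  have i: "1 \<le> i" "i < d" and j: "1 \<le> j" "j < d" using ij by auto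
  note lp = lin_phi[OF i, THEN lin_rules(2)] lin_phi[OF i, THEN lin_rules(5)]
  have x: "\<phi> i (X k u) = X k (\<phi> i u)" and c: "\<phi> i (C k u) = C k (\<phi> i u)"
    if "k = j \<or> k = Suc j" "u \<in> carr M" for k u
    using that phi_X[of u i k] phi_C[of u i k] i j ij by auto
  have s: "\<phi> i (S j u) = S j (\<phi> i u)" if "u \<in> carr M" for u
    using phi_S_far[OF that i j] ij by auto
  show ?thesis
    unfolding phi_def[of _ j] using v i j by (simp add: x c s lp)
qed

lemma phi_parity:
  assumes i: "1 \<le> i" "i < d"
  shows "v \<in> evn M \<Longrightarrow> \<phi> i v \<in> evn M" "v \<in> odd_part M \<Longrightarrow> \<phi> i v \<in> odd_part M"
proof -
  have e: "u \<in> evn M \<Longrightarrow> S i u \<in> evn M" "u \<in> evn M \<Longrightarrow> X i u \<in> evn M" "u \<in> evn M \<Longrightarrow> X (Suc i) u \<in> evn M"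
    "u \<in> odd_part M \<Longrightarrow> S i u \<in> odd_part M" "u \<in> odd_part M \<Longrightarrow> X i u \<in> odd_part M"
    "u \<in> odd_part M \<Longrightarrow> X (Suc i) u \<in> odd_part M"
    "u \<in> evn M \<Longrightarrow> C i u \<in> odd_part M" "u \<in> odd_part M \<Longrightarrow> C i u \<in> evn M"
    "u \<in> evn M \<Longrightarrow> C (Suc i) u \<in> odd_part M" "u \<in> odd_part M \<Longrightarrow> C (Suc i) u \<in> evn M" for u
    using s_even[of i] x_even[of i] x_even[of "Suc i"] c_odd[of i] c_odd[of "Suc i"] i
    by (auto simp: even_map_def odd_map_def)
  show "v \<in> evn M \<Longrightarrow> \<phi> i v \<in> evn M"
    unfolding phi_def using e
    by (simp add: subspace_add[OF subspace_evn] subspace_diff[OF subspace_evn])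
  show "v \<in> odd_part M \<Longrightarrow> \<phi> i v \<in> odd_part M"
    unfolding phi_def using e
    by (simp add: subspace_add[OF subspace_odd] subspace_diff[OF subspace_odd])
qed

text \<open>
  \<open>wt c\<close> describes the joint eigenspace of the squares \<open>x\<^sub>j\<^sup>2\<close>, which the Clifford
  generators preserve; \<open>eig c\<close> describes the part on which every \<open>x\<^sub>j\<close> has the non-negative
  square root as eigenvalue.
\<close>

definition wt :: "(nat \<Rightarrow> nat) \<Rightarrow> 'v \<Rightarrow> bool" where
  "wt c v \<longleftrightarrow> v \<in> carr M \<and> (\<forall>j. 1 \<le> j \<and> j \<le> d \<longrightarrow> X j (X j v) = smul M (qc (c j)) v)"

definition eig :: "(nat \<Rightarrow> nat) \<Rightarrow> 'v \<Rightarrow> bool" where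
  "eig c v \<longleftrightarrow> v \<in> carr M \<and> (\<forall>j. 1 \<le> j \<and> j \<le> d \<longrightarrow> X j v = smul M (kap (c j)) v)"

lemma wt_carr: "wt c v \<Longrightarrow> v \<in> carr M"
  and eig_carr: "eig c v \<Longrightarrow> v \<in> carr M"
  by (auto simp: wt_def eig_def)

lemma eig_wt: "eig c v \<Longrightarrow> wt c v"
  by (auto simp: eig_def wt_def lin_X[THEN lin_rules(3)] kap_sq[symmetric])

lemma eig_cong: "(\<And>j. 1 \<le> j \<Longrightarrow> j \<le> d \<Longrightarrow> c j = c' j) \<Longrightarrow> eig c v \<Longrightarrow> eig c' v"
  by (auto simp: eig_def)

lemma wt_0: "wt c 0"
  by (auto simp: wt_def lin_0[OF lin_X])

lemma wt_add: "wt c u \<Longrightarrow> wt c v \<Longrightarrow> wt c (u + v)"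
  by (auto simp: wt_def lin_X[THEN lin_rules(2)] scale_right_distrib)

lemma wt_sm: "wt c v \<Longrightarrow> wt c (smul M a v)"
  by (auto simp: wt_def lin_X[THEN lin_rules(3)] scale_left_commute)

lemma wt_diff: "wt c u \<Longrightarrow> wt c v \<Longrightarrow> wt c (u - v)"
  by (auto simp: wt_def lin_X[THEN lin_rules(5)] scale_right_diff_distrib)

lemma wt_sum: "(\<And>x. x \<in> A \<Longrightarrow> wt c (g x)) \<Longrightarrow> wt c (sum g A)"
  by (induction A rule: infinite_finite_induct) (auto intro: wt_0 wt_add)

lemma eig_sm: "eig c v \<Longrightarrow> eig c (smul M a v)"
  by (auto simp: eig_def lin_X[THEN lin_rules(3)] scale_left_commute)

lemma wt_X: "wt c v \<Longrightarrow> 1 \<le> k \<Longrightarrow> k \<le> d \<Longrightarrow> wt c (X k v)"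
proof -
  assume w: "wt c v" and k: "1 \<le> k" "k \<le> d"
  have "X j (X j (X k v)) = X k (X j (X j v))" if j: "1 \<le> j" "j \<le> d" for j
    using x_x[of v j k] x_x[of "X j v" j k] w j k by (simp add: wt_carr)
  with w k show ?thesis by (simp add: wt_def lin_X[THEN lin_rules(3)])
qed

lemma wt_C: "wt c v \<Longrightarrow> 1 \<le> k \<Longrightarrow> k \<le> d \<Longrightarrow> wt c (C k v)"
proof -
  assume w: "wt c v" and k: "1 \<le> k" "k \<le> d"
  have "X j (X j (C k v)) = C k (X j (X j v))" if j: "1 \<le> j" "j \<le> d" for j
  proof (cases "j = k")
    case True
    have "C k (X k (X k v)) = - X k (C k (X k v))" using w k by (simp add: c_x_same wt_carr)
    also have "\<dots> = - X k (- X k (C k v))" using w k by (simp add: c_x_same wt_carr)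
    also have "\<dots> = X k (X k (C k v))" using w k lin_X[THEN lin_rules(4)] by (simp add: wt_carr)
    finally show ?thesis using True by simp
  next
    case False
    thus ?thesis using w j k by (simp add: c_x_other[symmetric] wt_carr)
  qed
  with w k show ?thesis by (simp add: wt_def lin_C[THEN lin_rules(3)])
qed

lemma adj_range: "1 \<le> i \<Longrightarrow> i < d \<Longrightarrow> 1 \<le> j \<Longrightarrow> j \<le> d \<Longrightarrow> 1 \<le> adj i j \<and> adj i j \<le> d"
  by (auto simp: transpose_def)

lemma wt_phi:
  assumes w: "wt c v" and i: "1 \<le> i" "i < d"
  shows "wt (c \<circ> adj i) (\<phi> i v)"
proof -
  have v: "v \<in> carr M" using w by (simp add: wt_def)
  have "X j (X j (\<phi> i v)) = smul M (qc (c (adj i j))) (\<phi> i v)" if j: "1 \<le> j" "j \<le> d" for j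
  proof -
    let ?k = "adj i j"
    have k: "1 \<le> ?k" "?k \<le> d" using adj_range[OF i j] by auto
    have "\<phi> i (X ?k (X ?k v)) = X j (X j (\<phi> i v))"
      using phi_X[OF _ i k] v k by simp
    moreover have "\<phi> i (X ?k (X ?k v)) = smul M (qc (c ?k)) (\<phi> i v)"
      using w k v lin_phi[OF i, THEN lin_rules(3)] by (simp add: wt_def)
    ultimately show ?thesis by simp
  qed
  with v i show ?thesis by (simp add: wt_def)
qed

lemma eig_phi:
  assumes w: "eig c v" and i: "1 \<le> i" "i < d"
  shows "eig (c \<circ> adj i) (\<phi> i v)"
proof -
  have v: "v \<in> carr M" using w by (simp add: eig_def)
  have "X j (\<phi> i v) = smul M (kap (c (adj i j))) (\<phi> i v)" if j: "1 \<le> j" "j \<le> d" for j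
  proof -
    let ?k = "adj i j"
    have k: "1 \<le> ?k" "?k \<le> d" using adj_range[OF i j] by auto
    have "\<phi> i (X ?k v) = X j (\<phi> i v)"
      using phi_X[OF _ i k] v k by simp
    moreover have "\<phi> i (X ?k v) = smul M (kap (c ?k)) (\<phi> i v)"
      using w k v lin_phi[OF i, THEN lin_rules(3)] by (simp add: eig_def)
    ultimately show ?thesis by simp
  qed
  with v i show ?thesis by (simp add: eig_def)
qed

lemma phi_phi:
  assumes w: "wt c v" and i: "1 \<le> i" "i < d"
  shows "\<phi> i (\<phi> i v) = smul M (phi_square (c i) (c (Suc i))) v"
proof -
  interpret R: rank2_ops "carr M" "smul M" "S i" "X i" "X (Suc i)" "C i" "C (Suc i)"
    by (rule rank2[OF i])
  have v: "v \<in> carr M" and x: "X i (X i v) = smul M (qc (c i)) v"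
    "X (Suc i) (X (Suc i) v) = smul M (qc (c (Suc i))) v"
    using w i by (auto simp: wt_def)
  have "\<phi> i (\<phi> i v) = smul M (qc (c i)) v + smul M (qc (c i)) v + smul M (qc (c (Suc i))) v
      + smul M (qc (c (Suc i))) v
      - (smul M (qc (c i) * qc (c i)) v + smul M (qc (c (Suc i)) * qc (c (Suc i))) v
         - smul M (qc (c i) * qc (c (Suc i))) v - smul M (qc (c i) * qc (c (Suc i))) v)"
    using v by (simp add: phi_eq[OF i] R.phi_phi x mult.commute)
  also have "\<dots> = smul M (phi_square (c i) (c (Suc i))) v"
    unfolding phi_square_def scale_left_distrib[symmetric] scale_left_diff_distrib[symmetric]
    by (rule arg_cong[of _ _ "\<lambda>z. smul M z v"]) (simp add: power2_eq_square algebra_simps)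
  finally show ?thesis .
qed

definition lower :: "nat \<Rightarrow> 'v \<Rightarrow> 'v" where
  "lower i v = (X i v + X (Suc i) v) - C i (C (Suc i) (X i v - X (Suc i) v))"

lemma wt_lower: "wt c v \<Longrightarrow> 1 \<le> i \<Longrightarrow> i < d \<Longrightarrow> wt c (lower i v)"
  unfolding lower_def by (intro wt_diff wt_add wt_C wt_X) auto

lemma S_eq:
  assumes w: "wt c v" and i: "1 \<le> i" "i < d" and ne: "c i \<noteq> c (Suc i)"
  shows "S i v = smul M (1 / (qc (c i) - qc (c (Suc i)))) (\<phi> i v - lower i v)"
proof -
  have v: "v \<in> carr M" using w by (simp add: wt_def)
  have "\<phi> i v = S i (smul M (qc (c i) - qc (c (Suc i))) v) + lower i v"
    using w i by (simp add: phi_def lower_def wt_def scale_left_diff_distrib)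
  hence "\<phi> i v - lower i v = smul M (qc (c i) - qc (c (Suc i))) (S i v)"
    using lin_S[OF i, THEN lin_rules(3)] v by simp
  thus ?thesis using ne by simp
qed

text \<open>
  Where the two entries differ, the operator \<open>s\<^sub>i\<close> is a multiple of \<open>\<phi>\<^sub>i\<close> up to a term that preserves the weight.
\<close>

lemma S_split:
  assumes w: "wt c v" and i: "1 \<le> i" "i < d" and ne: "c i \<noteq> c (Suc i)"
  obtains u where "S i v = smul M (1 / (qc (c i) - qc (c (Suc i)))) (\<phi> i v) + u" "wt c u"
proof
  let ?k = "1 / (qc (c i) - qc (c (Suc i)))"
  show "S i v = smul M ?k (\<phi> i v) + smul M (- ?k) (lower i v)"
    using S_eq[OF assms] by (simp add: scale_right_diff_distrib)
  show "wt c (smul M (- ?k) (lower i v))" using wt_sm wt_lower w i by blast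
qed

lemma S_split':
  assumes "wt c v" "1 \<le> i" "i < d" "c i \<noteq> c (Suc i)"
  obtains u u' where "S i v = u + u'" "wt (c \<circ> adj i) u" "wt c u'"
proof -
  obtain u' where u': "S i v = smul M (1 / (qc (c i) - qc (c (Suc i)))) (\<phi> i v) + u'" "wt c u'"
    using S_split[OF assms] .
  have "wt (c \<circ> adj i) (smul M (1 / (qc (c i) - qc (c (Suc i)))) (\<phi> i v))"
    using wt_sm wt_phi assms by blast
  with u' that show thesis by blast
qed

text \<open>An operator that kills all weights between \<open>c\<close> and its reversal sees only the leading
  term of a product of three generators.\<close>

lemma leading_term:
  assumes w: "wt c v" and i: "1 \<le> i" "i < d" and j: "1 \<le> j" "j < d"
    and E: "lin E" "\<And>c' u. c' \<in> K \<Longrightarrow> wt c' u \<Longrightarrow> E u = 0"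
    and K: "c \<in> K" "c \<circ> adj i \<in> K" "c \<circ> adj j \<in> K" "c \<circ> adj i \<circ> adj j \<in> K" "c \<circ> adj j \<circ> adj i \<in> K"
    and ne: "c i \<noteq> c (Suc i)" "c j \<noteq> c (Suc j)" "(c \<circ> adj i) j \<noteq> (c \<circ> adj i) (Suc j)"
      "(c \<circ> adj j) i \<noteq> (c \<circ> adj j) (Suc i)"
      "(c \<circ> adj i \<circ> adj j) i \<noteq> (c \<circ> adj i \<circ> adj j) (Suc i)"
  shows "E (S i (S j (S i v))) =
     smul M (1 / (qc (c i) - qc (c (Suc i)))
         * (1 / (qc ((c \<circ> adj i) j) - qc ((c \<circ> adj i) (Suc j))))
         * (1 / (qc ((c \<circ> adj i \<circ> adj j) i) - qc ((c \<circ> adj i \<circ> adj j) (Suc i)))))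
       (E (\<phi> i (\<phi> j (\<phi> i v))))"
proof -
  let ?c1 = "c \<circ> adj i" and ?c2 = "c \<circ> adj i \<circ> adj j" and ?c3 = "c \<circ> adj j"
  let ?k1 = "1 / (qc (c i) - qc (c (Suc i)))"
  let ?k2 = "1 / (qc (?c1 j) - qc (?c1 (Suc j)))"
  let ?k3 = "1 / (qc (?c2 i) - qc (?c2 (Suc i)))"
  have w1: "wt ?c1 (\<phi> i v)" using wt_phi[OF w i] .
  have w2: "wt ?c2 (\<phi> j (\<phi> i v))" using wt_phi[OF w1 j] .
  obtain r0 where r0: "S i v = smul M ?k1 (\<phi> i v) + r0" "wt c r0" using S_split[OF w i ne(1)] .
  obtain r1 where r1: "S j (\<phi> i v) = smul M ?k2 (\<phi> j (\<phi> i v)) + r1" "wt ?c1 r1"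
    using S_split[OF w1 j ne(3)] .
  obtain r2 where r2: "S i (\<phi> j (\<phi> i v)) = smul M ?k3 (\<phi> i (\<phi> j (\<phi> i v))) + r2" "wt ?c2 r2"
    using S_split[OF w2 i ne(5)] .
  have nec1: "?c1 i \<noteq> ?c1 (Suc i)" using ne(1) by (auto simp: transpose_def)
  obtain r1a r1b where r1': "S i r1 = r1a + r1b" "wt (?c1 \<circ> adj i) r1a" "wt ?c1 r1b"
    using S_split'[OF r1(2) i nec1] .
  obtain r0a r0b where r0': "S j r0 = r0a + r0b" "wt ?c3 r0a" "wt c r0b"
    using S_split'[OF r0(2) j ne(2)] .
  obtain a1 a2 where a: "S i r0a = a1 + a2" "wt (?c3 \<circ> adj i) a1" "wt ?c3 a2"
    using S_split'[OF r0'(2) i ne(4)] .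
  obtain b1 b2 where b: "S i r0b = b1 + b2" "wt ?c1 b1" "wt c b2"
    using S_split'[OF r0'(3) i ne(1)] .
  have cc: "?c1 \<circ> adj i = c" by (simp add: fun_eq_iff)
  note carrs = wt_carr[OF w] wt_carr[OF w1] wt_carr[OF w2] wt_carr[OF r0(2)] wt_carr[OF r1(2)]
    wt_carr[OF r2(2)] wt_carr[OF r0'(2)] wt_carr[OF r0'(3)] wt_carr[OF a(2)] wt_carr[OF a(3)]
    wt_carr[OF b(2)] wt_carr[OF b(3)] wt_carr[OF r1'(2)] wt_carr[OF r1'(3)]
  note lS = lin_S[OF i, THEN lin_rules(2)] lin_S[OF i, THEN lin_rules(3)]
    lin_S[OF j, THEN lin_rules(2)] lin_S[OF j, THEN lin_rules(3)]
  have F: "\<phi> i (\<phi> j (\<phi> i v)) \<in> carr M" using carrs i by simp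
  have "S j (S i v) = smul M ?k1 (smul M ?k2 (\<phi> j (\<phi> i v)) + r1) + (r0a + r0b)"
    unfolding r0(1) using carrs i j by (simp only: lS r1(1) r0'(1) V_sm)
  hence expand: "S i (S j (S i v)) = smul M ?k1 (smul M ?k2 (smul M ?k3 (\<phi> i (\<phi> j (\<phi> i v))) + r2)
      + (r1a + r1b)) + (a1 + a2 + (b1 + b2))"
    using carrs i j by (simp only: lS r2(1) r1'(1) a(1) b(1) V_sm V_add S_carr phi_carr)
  have kill: "E r2 = 0" "E r1a = 0" "E r1b = 0" "E a1 = 0" "E a2 = 0" "E b1 = 0" "E b2 = 0"
    using E(2)[OF K(4) r2(2)] E(2)[OF K(1) r1'(2)[unfolded cc]] E(2)[OF K(2) r1'(3)]
      E(2)[OF K(5) a(2)] E(2)[OF K(3) a(3)] E(2)[OF K(2) b(2)] E(2)[OF K(1) b(3)] by auto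
  show ?thesis
    unfolding expand using carrs F
    by (simp add: lin_rules(2,3)[OF E(1)] kill mult.assoc del: comp_apply)
qed

definition defect :: "nat \<Rightarrow> 'v \<Rightarrow> 'v" where
  "defect i v = S i (S (Suc i) (S i v)) - S (Suc i) (S i (S (Suc i) v))"

text \<open>
  On a weight vector whose three entries differ, the braid relation for the generators and the
  one for the intertwiners imply each other: the difference of the two sides lies in the reversed
  weight space, where only the leading terms contribute.
\<close>

lemma braid_iff:
  assumes w: "wt c v" and i: "1 \<le> i" "Suc i < d"
    and ne: "c i \<noteq> c (Suc i)" "c i \<noteq> c (Suc (Suc i))" "c (Suc i) \<noteq> c (Suc (Suc i))"
  shows "defect i v = 0 \<longleftrightarrow> \<phi> i (\<phi> (Suc i) (\<phi> i v)) = \<phi> (Suc i) (\<phi> i (\<phi> (Suc i) v))"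
proof -
  let ?j = "Suc i" and ?k = "Suc (Suc i)"
  have i': "1 \<le> i" "i < d" and j': "1 \<le> ?j" "?j < d" and k': "1 \<le> ?k" "?k \<le> d" using i by auto
  have v: "v \<in> carr M" using w by (simp add: wt_def)
  interpret R: rank3_ops "carr M" "smul M" "S i" "S ?j" "X i" "X ?j" "X ?k" "C i" "C ?j" "C ?k"
    by (rule rank3[OF i])
  define A where "A m z u = X m (X m u) - smul M z u" for m z u
  define E where "E u = A i (qc (c i)) (A i (qc (c ?j)) (A ?k (qc (c ?j)) u))" for u
  have linA: "lin (A m z)" if "1 \<le> m" "m \<le> d" for m z
    unfolding A_def[abs_def]
    using lin_diff[OF lin_comp[OF lin_X[OF that] lin_X[OF that]] lin_sm[OF lin_id]] .
  have linE: "lin E"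
    unfolding E_def[abs_def]
    using lin_comp[OF linA lin_comp[OF linA linA]] i' k' by simp
  have Aeig: "A m z u = smul M (y - z) u" if "X m (X m u) = smul M y u" for m z y u
    using that by (simp add: A_def scale_left_diff_distrib)
  have Eeig: "E u = smul M ((y - qc (c i)) * (y - qc (c ?j)) * (y' - qc (c ?j))) u"
    if u: "u \<in> carr M" "X i (X i u) = smul M y u" "X ?k (X ?k u) = smul M y' u" for u y y'
  proof -
    have "A ?k (qc (c ?j)) u = smul M (y' - qc (c ?j)) u" using Aeig[OF u(3)] .
    moreover have "A i (qc (c ?j)) u = smul M (y - qc (c ?j)) u"
      "A i (qc (c i)) u = smul M (y - qc (c i)) u" using Aeig[OF u(2)] by auto
    ultimately show ?thesis
      using linA[of i, THEN lin_rules(3)] u(1) i' by (simp add: E_def mult_ac)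
  qed
  have Ewt: "E u = smul M ((qc (c' i) - qc (c i)) * (qc (c' i) - qc (c ?j)) * (qc (c' ?k) - qc (c ?j))) u"
    if "wt c' u" for c' u
    using that i' k' by (intro Eeig) (auto simp: wt_def)
  define K where "K = {c' :: nat \<Rightarrow> nat. c' i = c i \<or> c' i = c ?j \<or> c' ?k = c ?j}"
  have kill: "E u = 0" if "c' \<in> K" "wt c' u" for c' u
    using Ewt[OF that(2)] that(1) by (auto simp: K_def)
  have inK: "c \<in> K" "c \<circ> adj i \<in> K" "c \<circ> adj ?j \<in> K" "c \<circ> adj i \<circ> adj ?j \<in> K"
    "c \<circ> adj ?j \<circ> adj i \<in> K"
    by (auto simp: K_def transpose_def)
  define z where "z = 1 / (qc (c i) - qc (c ?j)) * (1 / (qc (c i) - qc (c ?k)))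
      * (1 / (qc (c ?j) - qc (c ?k)))"
  have z0: "z \<noteq> 0" using ne by (simp add: z_def)
  let ?F = "\<phi> i (\<phi> ?j (\<phi> i v))" and ?G = "\<phi> ?j (\<phi> i (\<phi> ?j v))"
  have "E (S i (S ?j (S i v))) = smul M z (E ?F)"
    using leading_term[OF w i' j' linE kill inK] ne
    by (simp add: transpose_def z_def)
  moreover have "E (S ?j (S i (S ?j v))) = smul M z (E ?G)"
    using leading_term[OF w j' i' linE kill inK(1,3,2,5,4)] ne
    by (simp add: transpose_def z_def mult_ac)
  moreover have carrs: "S i (S ?j (S i v)) \<in> carr M" "S ?j (S i (S ?j v)) \<in> carr M"
    "?F \<in> carr M" "?G \<in> carr M" using v i' j' by auto
  ultimately have Edef: "E (defect i v) = smul M z (E (?F - ?G))"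
    by (simp add: defect_def lin_rules(5)[OF linE] scale_right_diff_distrib)
  define e where "e = (qc (c ?k) - qc (c i)) * (qc (c ?k) - qc (c ?j)) * (qc (c i) - qc (c ?j))"
  have e0: "e \<noteq> 0" using ne by (simp add: e_def)
  have "wt (c \<circ> adj i \<circ> adj ?j \<circ> adj i) ?F" "wt (c \<circ> adj ?j \<circ> adj i \<circ> adj ?j) ?G"
    using w i' j' by (auto intro!: wt_phi)
  moreover have "c \<circ> adj ?j \<circ> adj i \<circ> adj ?j = c \<circ> adj i \<circ> adj ?j \<circ> adj i"
    by (auto simp: fun_eq_iff transpose_def)
  ultimately have "wt (c \<circ> adj i \<circ> adj ?j \<circ> adj i) (?F - ?G)"
    by (auto intro: wt_diff)
  from Ewt[OF this] have EF: "E (?F - ?G) = smul M e (?F - ?G)"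
    by (simp add: transpose_def e_def)
  have dv: "defect i v = R.braid_defect v" by (simp add: defect_def R.braid_defect_def)
  have bd: "R.braid_defect u \<in> carr M" if "u \<in> carr M" for u
    using that i' j' by (simp add: R.braid_defect_def)
  have bl: "R.braid_defect (smul M a u) = smul M a (R.braid_defect u)" if "u \<in> carr M" for a u
    using that i' j' by (simp add: R.braid_defect_def scale_right_diff_distrib)
  have "X i (X i (defect i v)) = R.braid_defect (X ?k (X ?k v))"
    using R.braid_defect_z v k' by (simp add: dv)
  also have "\<dots> = smul M (qc (c ?k)) (defect i v)"
    using w k' v bl by (simp add: wt_def dv)
  finally have d1: "X i (X i (defect i v)) = smul M (qc (c ?k)) (defect i v)" .
  have "X ?k (X ?k (defect i v)) = R.braid_defect (X i (X i v))"
    using R.braid_defect_x v i' by (simp add: dv)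
  also have "\<dots> = smul M (qc (c i)) (defect i v)"
    using w i' v bl by (simp add: wt_def dv)
  finally have d2: "X ?k (X ?k (defect i v)) = smul M (qc (c i)) (defect i v)" .
  have "E (defect i v) = smul M e (defect i v)"
    using Eeig[OF _ d1 d2] bd[OF v] by (simp add: dv e_def)
  hence "smul M e (defect i v) = smul M z (smul M e (?F - ?G))"
    using Edef EF by simp
  hence "smul M e (defect i v) = smul M e (smul M z (?F - ?G))"
    by (simp only: scale_left_commute[of z e])
  hence "defect i v = smul M z (?F - ?G)"
    by (rule scale_left_imp_eq[OF e0])
  with z0 show ?thesis by auto
qed

end

section \<open>Clifford monomials\<close>

text \<open>
  The sign in \<open>c\<^sub>j c\<^sub>S = \<plusminus> c\<^bsub>sym_diff {j} S\<^esub>\<close>: one factor for each element of \<open>S\<close> that \<open>c\<^sub>j\<close> passes, and one for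
  \<open>c\<^sub>j\<^sup>2 = -1\<close> if \<open>j \<in> S\<close>.
\<close>

definition csign :: "nat \<Rightarrow> nat set \<Rightarrow> complex" where
  "csign j S = (-1) ^ card {a \<in> S. a \<le> j}"

lemma cl_sgn_left: "cl_sgn {j} S = csign j S"
proof (cases "finite {a \<in> S. a \<le> j}")
  case True
  have "{(a, b). a \<in> {j} \<and> b \<in> S \<and> b < a} = Pair j ` {b \<in> S. b < j}" by auto
  hence "card {(a, b). a \<in> {j} \<and> b \<in> S \<and> b < a} = card {b \<in> S. b < j}"
    by (simp add: card_image inj_on_def)
  moreover have "card {b \<in> S. b < j} + card ({j} \<inter> S) = card ({b \<in> S. b < j} \<union> ({j} \<inter> S))"
    by (rule card_Un_disjoint[symmetric]) (auto intro: finite_subset[OF _ True])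
  moreover have "{b \<in> S. b < j} \<union> ({j} \<inter> S) = {a \<in> S. a \<le> j}" by auto
  ultimately show ?thesis unfolding cl_sgn_def csign_def by simp
qed simp

lemma csign_empty [simp]: "csign j {} = 1"
  by (simp add: csign_def)

lemma csign_insert:
  assumes "b \<notin> S" "finite S"
  shows "csign j (insert b S) = (if b \<le> j then - csign j S else csign j S)"
proof -
  have "{a \<in> insert b S. a \<le> j} = (if b \<le> j then insert b {a \<in> S. a \<le> j} else {a \<in> S. a \<le> j})"
    by auto
  thus ?thesis using assms by (simp add: csign_def)
qed

lemma csign_below: "(\<And>a. a \<in> S \<Longrightarrow> j < a) \<Longrightarrow> csign j S = 1"
proof -
  assume "\<And>a. a \<in> S \<Longrightarrow> j < a"
  hence "{a \<in> S. a \<le> j} = {}" by force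
  thus ?thesis unfolding csign_def by (simp only: card.empty power_0)
qed

context weak_hc
begin

definition cl :: "nat set \<Rightarrow> 'v \<Rightarrow> 'v" where
  "cl A v = foldr C (sorted_list_of_set A) v"

lemma cl_empty [simp]: "cl {} v = v"
  by (simp add: cl_def)

lemma cl_insert_min:
  assumes "finite A" "\<And>a. a \<in> A \<Longrightarrow> b < a"
  shows "cl (insert b A) v = C b (cl A v)"
proof -
  have "b \<notin> A" using assms(2) by blast
  have "sorted_list_of_set (insert b A) = insort b (sorted_list_of_set A)"
    using assms(1) \<open>b \<notin> A\<close> by (simp add: sorted_list_of_set_insert)
  also have "\<dots> = b # sorted_list_of_set A"
    using assms by (intro insort_is_Cons) (auto intro: less_imp_le)
  finally show ?thesis by (simp add: cl_def)
qed

lemma lin_foldr_C: "set js \<subseteq> {1..d} \<Longrightarrow> lin (foldr C js)"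
proof (induction js)
  case (Cons j js)
  hence "lin (C j)" "lin (foldr C js)" using lin_C[of j] by simp_all
  from lin_comp[OF this] show ?case by (simp only: foldr.simps comp_def)
next
  case Nil
  show ?case using lin_id by (simp only: foldr.simps id_def)
qed

lemma lin_cl: "A \<subseteq> {1..d} \<Longrightarrow> lin (cl A)"
  unfolding cl_def[abs_def] using lin_foldr_C[of "sorted_list_of_set A"]
  by (simp add: finite_subset)

lemma cl_carr [simp]: "A \<subseteq> {1..d} \<Longrightarrow> v \<in> carr M \<Longrightarrow> cl A v \<in> carr M"
  using lin_cl[THEN lin_rules(1)] .

lemma S_C: "v \<in> carr M \<Longrightarrow> 1 \<le> i \<Longrightarrow> i < d \<Longrightarrow> 1 \<le> j \<Longrightarrow> j \<le> d \<Longrightarrow>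
    S i (C j v) = C (adj i j) (S i v)"
  using s_c_left[of v i] s_c_right[of v i] s_c_other[of v i j]
  by (cases "j = i"; cases "j = Suc i") simp_all

lemma foldr_C_carr: "set js \<subseteq> {1..d} \<Longrightarrow> v \<in> carr M \<Longrightarrow> foldr C js v \<in> carr M"
  using lin_foldr_C[THEN lin_rules(1)] .

lemma phi_foldr:
  assumes "v \<in> carr M" "1 \<le> i" "i < d" "set js \<subseteq> {1..d}"
  shows "\<phi> i (foldr C js v) = foldr C (map (adj i) js) (\<phi> i v)"
  using assms(4)
proof (induction js)
  case (Cons j js)
  thus ?case using phi_C[of "foldr C js v" i j] assms foldr_C_carr by simp
qed simp

lemma S_foldr:
  assumes "v \<in> carr M" "1 \<le> i" "i < d" "set js \<subseteq> {1..d}"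
  shows "S i (foldr C js v) = foldr C (map (adj i) js) (S i v)"
  using assms(4)
proof (induction js)
  case (Cons j js)
  thus ?case using S_C[of "foldr C js v" i j] assms foldr_C_carr by simp
qed simp

lemma X_foldr:
  assumes "v \<in> carr M" "1 \<le> j" "j \<le> d" "set js \<subseteq> {1..d}" "distinct js"
  shows "X j (foldr C js v) = smul M (if j \<in> set js then -1 else 1) (foldr C js (X j v))"
  using assms(4,5)
proof (induction js)
  case (Cons k js)
  let ?u = "foldr C js v" and ?e = "if j \<in> set js then -1 else (1 :: complex)"
  have u: "?u \<in> carr M" "foldr C js (X j v) \<in> carr M" using foldr_C_carr Cons assms by auto
  have k: "1 \<le> k" "k \<le> d" using Cons by auto
  have IH: "X j ?u = smul M ?e (foldr C js (X j v))" using Cons by simp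
  show ?case
  proof (cases "k = j")
    case True
    have "X j (C j ?u) = - C j (X j ?u)" using c_x_same[OF u(1) assms(2,3)] by simp
    with True Cons.prems IH u k show ?thesis by simp
  next
    case False
    have "X j (C k ?u) = C k (X j ?u)" using c_x_other[OF u(1) assms(2,3) k] False by simp
    with False Cons.prems IH u k lin_C[THEN lin_rules(3)] lin_C[THEN lin_rules(4)]
    show ?thesis by simp
  qed
qed (use assms in simp)

lemma C_foldr:
  assumes "v \<in> carr M" "1 \<le> j" "j \<le> d" "set js \<subseteq> {1..d}" "distinct js"
  shows "C j (foldr C js v) =
    smul M ((-1) ^ length js * (if j \<in> set js then -1 else 1)) (foldr C js (C j v))"
  using assms(4,5)
proof (induction js)
  case (Cons k js)
  let ?u = "foldr C js v"
  have u: "?u \<in> carr M" "foldr C js (C j v) \<in> carr M" using foldr_C_carr Cons assms by auto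
  have k: "1 \<le> k" "k \<le> d" using Cons by auto
  have IH: "C j ?u = smul M ((-1) ^ length js * (if j \<in> set js then -1 else 1)) (foldr C js (C j v))"
    using Cons by simp
  show ?case
  proof (cases "k = j")
    case True
    have "C j (C j ?u) = C j (smul M ((-1) ^ length js) (foldr C js (C j v)))"
      using True IH Cons.prems by simp
    with True u k lin_C[THEN lin_rules(3)] show ?thesis by simp
  next
    case False
    have "C j (C k ?u) = - C k (C j ?u)" using c_c[OF u(1) assms(2,3) k] False by simp
    with False Cons.prems IH u k lin_C[THEN lin_rules(3)] lin_C[THEN lin_rules(4)]
    show ?thesis by simp
  qed
qed (use assms in simp)

lemma X_cl:
  assumes "v \<in> carr M" "1 \<le> j" "j \<le> d" "A \<subseteq> {1..d}"
  shows "X j (cl A v) = smul M (if j \<in> A then -1 else 1) (cl A (X j v))"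
  using X_foldr[OF assms(1-3), of "sorted_list_of_set A"] assms(4)
  by (simp add: cl_def finite_subset)

lemma cl_C:
  assumes "v \<in> carr M" "1 \<le> j" "j \<le> d" "A \<subseteq> {1..d}"
  shows "C j (cl A v) = smul M ((-1) ^ card A * (if j \<in> A then -1 else 1)) (cl A (C j v))"
  using C_foldr[OF assms(1-3), of "sorted_list_of_set A"] assms(4)
  by (simp add: cl_def finite_subset)

text \<open>Monomials in relabelled generators arise when an intertwiner is moved past a monomial.\<close>

definition clp :: "(nat \<Rightarrow> nat) \<Rightarrow> nat set \<Rightarrow> 'v \<Rightarrow> 'v" where
  "clp g A v = foldr C (map g (sorted_list_of_set A)) v"

lemma clp_empty [simp]: "clp g {} v = v"
  by (simp add: clp_def)

lemma clp_ident: "clp (\<lambda>a. a) A v = cl A v"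
  by (simp add: clp_def cl_def)

lemma clp_insert_min:
  assumes "finite A" "\<And>a. a \<in> A \<Longrightarrow> b < a"
  shows "clp g (insert b A) v = C (g b) (clp g A v)"
proof -
  have "b \<notin> A" using assms(2) by blast
  have "sorted_list_of_set (insert b A) = insort b (sorted_list_of_set A)"
    using assms(1) \<open>b \<notin> A\<close> by (simp add: sorted_list_of_set_insert)
  also have "\<dots> = b # sorted_list_of_set A"
    using assms by (intro insort_is_Cons) (auto intro: less_imp_le)
  finally show ?thesis by (simp add: clp_def)
qed

lemma lin_clp: "A \<subseteq> {1..d} \<Longrightarrow> g ` {1..d} \<subseteq> {1..d} \<Longrightarrow> lin (clp g A)"
proof -
  assume A: "A \<subseteq> {1..d}" and g: "g ` {1..d} \<subseteq> {1..d}"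
  have "finite A" by (rule finite_subset[OF A]) simp
  hence "set (map g (sorted_list_of_set A)) \<subseteq> {1..d}" using A g by auto
  from lin_foldr_C[OF this] show ?thesis unfolding clp_def[abs_def] .
qed

lemma C_clp:
  assumes v: "v \<in> carr M" and g: "g ` {1..d} \<subseteq> {1..d}" "inj g"
    and j: "1 \<le> j" "j \<le> d" and A: "A \<subseteq> {1..d}"
  shows "C (g j) (clp g A v) = smul M (csign j A) (clp g (sym_diff {j} A) v)"
proof -
  have gr: "1 \<le> g k" "g k \<le> d" if "1 \<le> k" "k \<le> d" for k using g(1) that by (auto simp: image_subset_iff)
  have "finite A" by (rule finite_subset[OF A]) simp
  thus ?thesis using A
  proof (induction rule: finite_linorder_min_induct)
    case empty
    have "clp g {j} v = C (g j) v" using clp_insert_min[of "{}" j g v] by simp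
    thus ?case by simp
  next
    case (insert b A)
    have A: "A \<subseteq> {1..d}" and b: "1 \<le> b" "b \<le> d" "b \<notin> A" using insert by auto
    have u: "clp g A v \<in> carr M" using lin_clp[OF A g(1), THEN lin_rules(1)] v by simp
    have ins: "clp g (insert b A) v = C (g b) (clp g A v)" using insert by (intro clp_insert_min) auto
    consider "j < b" | "j = b" | "b < j" by linarith
    thus ?case
    proof cases
      case 1
      hence lt: "\<And>a. a \<in> insert b A \<Longrightarrow> j < a" using insert.hyps by force
      hence "sym_diff {j} (insert b A) = insert j (insert b A)" by auto
      moreover have "csign j (insert b A) = 1" using csign_below lt by blast
      ultimately show ?thesis
        using clp_insert_min[of "insert b A" j g v] lt insert.hyps by simp
    next
      case 2
      hence lt: "\<And>a. a \<in> A \<Longrightarrow> j < a" using insert.hyps by force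
      have "sym_diff {j} (insert b A) = A" using 2 b by auto
      moreover have "csign j (insert b A) = - 1"
        using csign_insert[OF b(3) insert.hyps(1), of j] csign_below[OF lt] 2 by simp
      ultimately show ?thesis using ins c_sq[OF u gr[OF j]] 2 by simp
    next
      case 3
      have sub: "sym_diff {j} A \<subseteq> {1..d}" using A j by auto
      have ne: "g j \<noteq> g b" using 3 g(2) by (auto simp: inj_eq)
      have "C (g j) (C (g b) (clp g A v)) = - C (g b) (C (g j) (clp g A v))"
        using c_c[OF u gr[OF j] gr[OF b(1,2)] ne] .
      also have "\<dots> = - C (g b) (smul M (csign j A) (clp g (sym_diff {j} A) v))"
        using insert.IH A by simp
      also have "\<dots> = smul M (- csign j A) (C (g b) (clp g (sym_diff {j} A) v))"
        using lin_C[OF gr[OF b(1,2)], THEN lin_rules(3)] lin_clp[OF sub g(1), THEN lin_rules(1)] v by simp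
      also have "C (g b) (clp g (sym_diff {j} A) v) = clp g (insert b (sym_diff {j} A)) v"
        using insert.hyps 3 by (intro clp_insert_min[symmetric]) auto
      also have "insert b (sym_diff {j} A) = sym_diff {j} (insert b A)" using 3 b by auto
      also have "- csign j A = csign j (insert b A)"
        using csign_insert[OF b(3) insert.hyps(1), of j] 3 by simp
      finally show ?thesis using ins by simp
    qed
  qed
qed

lemma C_cl:
  assumes "v \<in> carr M" "1 \<le> j" "j \<le> d" "A \<subseteq> {1..d}"
  shows "C j (cl A v) = smul M (csign j A) (cl (sym_diff {j} A) v)"
  using C_clp[OF assms(1), of "\<lambda>a. a" j A] assms(2-4) by (simp add: clp_ident)

lemma cl_parity:
  assumes "A \<subseteq> {1..d}"
  shows "v \<in> evn M \<Longrightarrow> cl A v \<in> (if even (card A) then evn M else odd_part M)"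
    and "v \<in> odd_part M \<Longrightarrow> cl A v \<in> (if even (card A) then odd_part M else evn M)"
proof -
  have fin: "finite A" using assms finite_subset by blast
  have c: "u \<in> evn M \<Longrightarrow> C j u \<in> odd_part M" "u \<in> odd_part M \<Longrightarrow> C j u \<in> evn M"
    if "1 \<le> j" "j \<le> d" for j u
    using c_odd[OF that] by (auto simp: odd_map_def)
  have "(v \<in> evn M \<longrightarrow> cl A v \<in> (if even (card A) then evn M else odd_part M)) \<and>
     (v \<in> odd_part M \<longrightarrow> cl A v \<in> (if even (card A) then odd_part M else evn M))"
    using fin assms
  proof (induction rule: finite_linorder_min_induct)
    case (insert b A)
    have "cl (insert b A) v = C b (cl A v)" using insert by (intro cl_insert_min) auto
    moreover have "b \<notin> A" using insert by auto
    ultimately show ?case using insert c[of b] by (auto split: if_splits)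
  qed simp
  thus "v \<in> evn M \<Longrightarrow> cl A v \<in> (if even (card A) then evn M else odd_part M)"
    "v \<in> odd_part M \<Longrightarrow> cl A v \<in> (if even (card A) then odd_part M else evn M)" by blast+
qed

lemma wt_cl: "wt c v \<Longrightarrow> A \<subseteq> {1..d} \<Longrightarrow> wt c (cl A v)"
proof -
  assume w: "wt c v" and A: "A \<subseteq> {1..d}"
  have "finite A" using A finite_subset by blast
  thus ?thesis using A
  proof (induction rule: finite_linorder_min_induct)
    case (insert b A)
    have "cl (insert b A) v = C b (cl A v)" using insert by (intro cl_insert_min) auto
    with insert wt_C[of c "cl A v" b] show ?case by auto
  qed (simp add: w)
qed

lemma C_inj: "v \<in> carr M \<Longrightarrow> 1 \<le> j \<Longrightarrow> j \<le> d \<Longrightarrow> C j v = 0 \<Longrightarrow> v = 0"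
  using c_sq[of v j] lin_0[OF lin_C[of j]] by simp

lemma cl_inj: "v \<in> carr M \<Longrightarrow> A \<subseteq> {1..d} \<Longrightarrow> cl A v = 0 \<Longrightarrow> v = 0"
proof -
  assume v: "v \<in> carr M" and A: "A \<subseteq> {1..d}" and z: "cl A v = 0"
  have "finite A" using A finite_subset by blast
  thus ?thesis using A z
  proof (induction rule: finite_linorder_min_induct)
    case (insert b A)
    have "cl (insert b A) v = C b (cl A v)" using insert by (intro cl_insert_min) auto
    with insert C_inj[of "cl A v" b] v show ?case by auto
  qed simp
qed

subsection \<open>Projection to weights\<close>

text \<open>Polynomials in the \<open>x\<^sub>j\<^sup>2\<close> separate different weights, so a subspace they preserve contains
  the weight components of its elements.\<close>

lemma weight_component:
  assumes W: "module.subspace (smul M) W" and inv: "\<And>j u. 1 \<le> j \<Longrightarrow> j \<le> d \<Longrightarrow> u \<in> W \<Longrightarrow> X j (X j u) \<in> W"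
    and fin: "finite F" and f: "wt c0 f0" "\<And>r. r \<in> F \<Longrightarrow> wt (c r) (f r)"
    and ne: "\<And>r. r \<in> F \<Longrightarrow> \<exists>j. 1 \<le> j \<and> j \<le> d \<and> c r j \<noteq> c0 j"
    and sum: "f0 + sum f F \<in> W"
  shows "f0 \<in> W"
  using fin f ne sum
proof (induction F arbitrary: f f0 rule: finite_induct)
  case (insert r F)
  obtain j where j: "1 \<le> j" "j \<le> d" "c r j \<noteq> c0 j" using insert.prems(3) by blast
  define A where "A u = X j (X j u) - smul M (qc (c r j)) u" for u
  define g where "g t = smul M (qc (c t j) - qc (c r j)) (f t)" for t
  define g0 where "g0 = smul M (qc (c0 j) - qc (c r j)) f0"
  have linA: "lin A"
    unfolding A_def[abs_def] using lin_diff[OF lin_comp[OF lin_X[OF j(1,2)] lin_X[OF j(1,2)]] lin_sm[OF lin_id]] .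
  have Aw: "A u = smul M (qc (c' j) - qc (c r j)) u" if "wt c' u" for c' u
    using that j by (simp add: A_def wt_def scale_left_diff_distrib)
  have carrs: "f0 \<in> carr M" "f r \<in> carr M" "\<And>t. t \<in> F \<Longrightarrow> f t \<in> carr M"
    using insert.prems by (auto intro: wt_carr)
  have "A (f0 + sum f (insert r F)) \<in> W"
    using inv[OF j(1,2) insert.prems(4)] subspace_scale[OF W insert.prems(4)] subspace_diff[OF W]
    by (simp add: A_def)
  moreover have "A (f0 + sum f (insert r F)) = A f0 + (A (f r) + (\<Sum>t\<in>F. A (f t)))"
  proof -
    have F: "sum f F \<in> carr M" using carrs(3) by (rule carr_sum)
    have "A (sum f F) = (\<Sum>t\<in>F. A (f t))" using carrs(3) by (rule lin_sum[OF linA])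
    thus ?thesis using insert.hyps carrs(1,2) F by (simp add: lin_rules(2)[OF linA])
  qed
  moreover have "A f0 = g0" using Aw[OF insert.prems(1)] by (simp add: g0_def)
  moreover have "A (f r) = 0" using Aw[of "c r" "f r"] insert.prems(2) by simp
  moreover have "(\<Sum>t\<in>F. A (f t)) = sum g F"
    using Aw insert.prems(2) by (intro sum.cong) (auto simp: g_def)
  ultimately have "g0 + sum g F \<in> W" by simp
  moreover have "wt c0 g0" unfolding g0_def using insert.prems(1) by (rule wt_sm)
  moreover have "wt (c t) (g t)" if "t \<in> F" for t
    unfolding g_def using insert.prems(2) that by (intro wt_sm) auto
  ultimately have "g0 \<in> W" using insert.IH[of g0 g] insert.prems(3) by auto
  hence "smul M (1 / (qc (c0 j) - qc (c r j))) g0 \<in> W" by (rule subspace_scale[OF W])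
  thus ?case using j(3) by (simp add: g0_def)
qed simp

lemma eig_parts:
  assumes "eig c v"
  obtains v0 v1 where "v0 \<in> evn M" "v1 \<in> odd_part M" "v = v0 + v1" "eig c v0" "eig c v1"
proof -
  obtain v0 v1 where v: "v0 \<in> evn M" "v1 \<in> odd_part M" "v = v0 + v1"
    using assms carr_eq by (auto simp: eig_def)
  have in': "v0 \<in> carr M" "v1 \<in> carr M"
    using v subspace_0[OF subspace_evn] subspace_0[OF subspace_odd] unfolding carr_eq
    by (force intro: exI[of _ 0])+
  have "X j v0 = smul M (kap (c j)) v0 \<and> X j v1 = smul M (kap (c j)) v1" if j: "1 \<le> j" "j \<le> d" for j
  proof -
    let ?k = "kap (c j)"
    have x: "X j v0 \<in> evn M" "X j v1 \<in> odd_part M"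
      using x_even[OF j] v by (auto simp: even_map_def)
    have "X j v = smul M ?k v" using assms j by (simp add: eig_def)
    hence "X j v0 + X j v1 = smul M ?k v0 + smul M ?k v1"
      unfolding v(3) using in' lin_X[OF j, THEN lin_rules(2)] by (simp add: scale_right_distrib)
    hence eq: "X j v0 - smul M ?k v0 = smul M ?k v1 - X j v1" by (simp add: algebra_simps)
    have "X j v0 - smul M ?k v0 \<in> evn M"
      using x v subspace_diff[OF subspace_evn] subspace_scale[OF subspace_evn] by simp
    moreover have "smul M ?k v1 - X j v1 \<in> odd_part M"
      using x v subspace_diff[OF subspace_odd] subspace_scale[OF subspace_odd] by simp
    ultimately have "smul M ?k v1 - X j v1 \<in> evn M \<inter> odd_part M" using eq by simp
    thus ?thesis using eq unfolding evn_odd by simp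
  qed
  with v in' that show thesis by (auto simp: eig_def)
qed

text \<open>
  On a weight space \<open>x\<^sub>j\<close> has the eigenvalues \<open>\<plusminus>\<kappa>\<close>. If \<open>(x\<^sub>j + \<kappa>) u\<close> is zero, then \<open>c\<^sub>j u\<close> has the eigenvalue \<open>\<kappa>\<close>,
  and otherwise \<open>(x\<^sub>j + \<kappa>) u\<close> has it. Neither step affects the other places.
\<close>

lemma wt_to_eig:
  assumes "wt c v" "v \<noteq> 0"
  obtains u where "eig c u" "u \<noteq> 0"
proof -
  have "n \<le> d \<Longrightarrow> \<exists>u. wt c u \<and> u \<noteq> 0 \<and> (\<forall>j. 1 \<le> j \<and> j \<le> n \<longrightarrow> X j u = smul M (kap (c j)) u)" for n
  proof (induction n)
    case 0
    with assms show ?case by auto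
  next
    case (Suc n)
    then obtain u where u: "wt c u" "u \<noteq> 0" "\<And>j. 1 \<le> j \<Longrightarrow> j \<le> n \<Longrightarrow> X j u = smul M (kap (c j)) u"
      by auto
    let ?m = "Suc n" and ?k = "kap (c (Suc n))"
    have m: "1 \<le> ?m" "?m \<le> d" using Suc by auto
    have uc: "u \<in> carr M" using u by (simp add: wt_carr)
    have xx: "X ?m (X ?m u) = smul M (?k * ?k) u" using u m by (simp add: wt_def kap_sq)
    define w where "w = X ?m u + smul M ?k u"
    show ?case
    proof (cases "w = 0")
      case False
      have "X ?m w = smul M ?k w"
        using xx uc lin_X[OF m, THEN lin_rules(2)] lin_X[OF m, THEN lin_rules(3)] m
        by (simp add: w_def scale_right_distrib add.commute)
      moreover have "X j w = smul M (kap (c j)) w" if j: "1 \<le> j" "j \<le> n" for j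
      proof -
        have jd: "1 \<le> j" "j \<le> d" using j Suc.prems by auto
        have "X j (X ?m u) = smul M (kap (c j)) (X ?m u)"
          using x_x[OF uc jd m] u(3)[OF j] lin_X[OF m, THEN lin_rules(3)] uc by simp
        thus ?thesis
          using uc lin_X[OF jd, THEN lin_rules(2)] lin_X[OF jd, THEN lin_rules(3)] u(3)[OF j] m
          by (simp add: w_def scale_right_distrib scale_left_commute)
      qed
      moreover have "wt c w" unfolding w_def using u m by (intro wt_add wt_X wt_sm) auto
      ultimately show ?thesis using False le_Suc_eq by metis
    next
      case True
      hence neg: "X ?m u = - smul M ?k u" by (simp add: w_def eq_neg_iff_add_eq_0)
      have "X ?m (C ?m u) = - C ?m (X ?m u)" using c_x_same[OF uc m] by simp
      also have "\<dots> = smul M ?k (C ?m u)"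
        using neg uc lin_C[OF m, THEN lin_rules(4)] lin_C[OF m, THEN lin_rules(3)] by simp
      finally have "X ?m (C ?m u) = smul M ?k (C ?m u)" .
      moreover have "X j (C ?m u) = smul M (kap (c j)) (C ?m u)" if j: "1 \<le> j" "j \<le> n" for j
        using c_x_other[OF uc _ _ m, of j] u(3)[OF j] j Suc.prems lin_C[OF m, THEN lin_rules(3)] uc
        by simp
      moreover have "wt c (C ?m u)" using wt_C[OF u(1) m] .
      moreover have "C ?m u \<noteq> 0" using C_inj[OF uc m] u(2) by blast
      ultimately show ?thesis using le_Suc_eq by metis
    qed
  qed
  from this[of d] obtain u where u: "wt c u" "u \<noteq> 0"
    "\<forall>j. 1 \<le> j \<and> j \<le> d \<longrightarrow> X j u = smul M (kap (c j)) u" by blast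
  from wt_carr[OF u(1)] u(3) have "eig c u" unfolding eig_def by blast
  with u(2) that show thesis by blast
qed

lemma S_eig:
  assumes w: "eig c v" and i: "1 \<le> i" "i < d" and ne: "c i \<noteq> c (Suc i)"
  shows "S i v = smul M (1 / (kap (c (Suc i)) - kap (c i))) v
    + smul M (1 / (kap (c i) + kap (c (Suc i)))) (C i (C (Suc i) v))
    + smul M (1 / (qc (c i) - qc (c (Suc i)))) (\<phi> i v)"
proof -
  let ?j = "Suc i" and ?a = "kap (c i)" and ?b = "kap (c (Suc i))"
  have v: "v \<in> carr M" using w eig_carr by blast
  have i': "i \<le> d" and j: "1 \<le> ?j" "?j \<le> d" using i by auto
  have x: "X i v = smul M ?a v" "X ?j v = smul M ?b v" using w i i' j by (auto simp: eig_def)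
  have nz: "?a - ?b \<noteq> 0" "?a + ?b \<noteq> 0" using ne kap_add_nonzero[OF ne] by auto
  have qab: "qc (c i) - qc (c ?j) = (?a - ?b) * (?a + ?b)"
    by (simp add: kap_sq[symmetric] algebra_simps)
  have low: "lower i v = smul M (?a + ?b) v - smul M (?a - ?b) (C i (C ?j v))"
    unfolding lower_def using x v i i' j lin_C[OF j, THEN lin_rules(3)] lin_C[OF i(1) i', THEN lin_rules(3)]
    by (simp add: scale_left_distrib[symmetric] scale_left_diff_distrib[symmetric])
  have "1 / ((?a - ?b) * (?a + ?b)) * (?a + ?b) = - (1 / (?b - ?a))"
    "1 / ((?a - ?b) * (?a + ?b)) * (?a - ?b) = 1 / (?a + ?b)"
    using nz by (simp_all add: divide_simps)
  thus ?thesis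
    unfolding S_eq[OF eig_wt[OF w] i ne] qab low scale_right_diff_distrib scale_scale
    by (simp only:) simp
qed

lemma phi_nonzero:
  assumes "wt c v" "v \<noteq> 0" "1 \<le> i" "i < d" "far (c i) (c (Suc i))"
  shows "\<phi> i v \<noteq> 0"
proof
  assume "\<phi> i v = 0"
  hence "smul M (phi_square (c i) (c (Suc i))) v = 0"
    using phi_phi[OF assms(1,3,4)] lin_0[OF lin_phi[OF assms(3,4)]] by simp
  moreover have "c i \<noteq> c (Suc i)" using assms(5) by (auto simp: far_def)
  ultimately show False using assms(2,5) phi_square_eq_0_iff by simp
qed

end

locale hc = weak_hc d M for d and M :: "('v::ab_group_add) hc_data" +
  assumes braid: "v \<in> carr M \<Longrightarrow> 1 \<le> i \<Longrightarrow> Suc i < d \<Longrightarrow> defect i v = 0"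

section \<open>Weights of calibrated modules\<close>

locale calibrated_hc = hc d M for d and M :: "('v::ab_group_add) hc_data" +
  assumes integral: "integral_hc d M" and cal: "calibrated d M"
begin

lemma x_invariant_X: "x_invariant d M W \<Longrightarrow> 1 \<le> j \<Longrightarrow> j \<le> d \<Longrightarrow> u \<in> W \<Longrightarrow> X j u \<in> W"
  unfolding x_invariant_def by (metis atLeastAtMost_iff image_subset_iff)

text \<open>Semisimplicity enters only here: for an operator commuting with the \<open>x\<^sub>j\<close> the kernel has an
  invariant complement, so the operator and its square have the same kernel.\<close>

lemma kernel_of_square:
  assumes T: "lin T" "\<And>j v. 1 \<le> j \<Longrightarrow> j \<le> d \<Longrightarrow> v \<in> carr M \<Longrightarrow> T (X j v) = X j (T v)"
    and Tinv: "\<And>W v. W \<subseteq> carr M \<Longrightarrow> module.subspace (smul M) W \<Longrightarrow> x_invariant d M W \<Longrightarrow> v \<in> W \<Longrightarrow> T v \<in> W"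
    and v: "v \<in> carr M" "T (T v) = 0"
  shows "T v = 0"
proof -
  define K where "K = {u \<in> carr M. T u = 0}"
  have K: "module.subspace (smul M) K"
    by (rule subspaceI) (auto simp: K_def lin_0[OF T(1)] lin_rules[OF T(1)])
  have "x_invariant d M K"
    unfolding x_invariant_def K_def using T(2) by (auto simp: lin_0[OF lin_X])
  moreover have "K \<subseteq> carr M" by (auto simp: K_def)
  ultimately have "\<exists>W'. W' \<subseteq> carr M \<and> module.subspace (smul M) W' \<and> x_invariant d M W' \<and>
      K \<inter> W' = {0} \<and> carr M = {u + v | u v. u \<in> K \<and> v \<in> W'}"
    using cal K unfolding calibrated_def by simp
  then obtain W' where W': "W' \<subseteq> carr M" "module.subspace (smul M) W'" "x_invariant d M W'"
    "K \<inter> W' = {0}" "carr M = {u + v | u v. u \<in> K \<and> v \<in> W'}"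
    by (elim exE conjE)
  have "v \<in> {u + v | u v. u \<in> K \<and> v \<in> W'}" using v(1) unfolding W'(5) .
  then obtain k w where kw: "k \<in> K" "w \<in> W'" "v = k + w" by blast
  have "k \<in> carr M" "T k = 0" "w \<in> carr M" using kw W'(1) by (auto simp: K_def)
  hence "T v = T w" using kw(3) lin_rules(2)[OF T(1)] by simp
  moreover have "T w \<in> W'" using Tinv[OF W'(1-3) kw(2)] .
  moreover have "T v \<in> K" using v lin_rules(1)[OF T(1)] by (simp add: K_def)
  ultimately show ?thesis using W'(4) by auto
qed

lemma X_kernel_of_square:
  assumes "v \<in> carr M" "1 \<le> j" "j \<le> d" "X j (X j v) = 0"
  shows "X j v = 0"
proof (rule kernel_of_square[OF lin_X[OF assms(2,3)] _ _ assms(1,4)])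
  fix W v assume "x_invariant d M W" "v \<in> W"
  thus "X j v \<in> W" using assms(2,3) by (intro x_invariant_X)
qed (use x_x assms(2,3) in auto)

lemma XX_kernel_of_square:
  assumes v: "v \<in> carr M" and j: "1 \<le> j" "j \<le> d"
    and z: "\<And>T. T = (\<lambda>u. X j (X j u) - smul M z u) \<Longrightarrow> T (T v) = 0"
  shows "X j (X j v) = smul M z v"
proof -
  let ?T = "\<lambda>u. X j (X j u) - smul M z u"
  have lT: "lin ?T" using lin_diff[OF lin_comp[OF lin_X[OF j] lin_X[OF j]] lin_sm[OF lin_id]] .
  have "?T v = 0"
  proof (rule kernel_of_square[OF lT _ _ v z[OF refl]])
    fix k u assume k: "1 \<le> k" "k \<le> d" and u: "u \<in> carr M"
    have "X j (X j (X k u)) = X k (X j (X j u))"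
      using x_x[OF u j k] x_x[of "X j u" j k] u j k by simp
    thus "?T (X k u) = X k (?T u)"
      using lin_X[OF k, THEN lin_rules(5)] lin_X[OF k, THEN lin_rules(3)] u j by simp
  next
    fix W u assume W: "module.subspace (smul M) W" "x_invariant d M W" "u \<in> W"
    have "X j (X j u) \<in> W" using W(2,3) j by (intro x_invariant_X)
    thus "?T u \<in> W" using subspace_diff[OF W(1)] subspace_scale[OF W(1) W(3)] by simp
  qed
  thus ?thesis by simp
qed

text \<open>
  The vector \<open>s\<^sub>i v\<close> is annihilated by the square of \<open>x\<^bsub>i+1\<^esub>\<^sup>2 - \<kappa>\<^sup>2\<close>, but this operator itself sends it to \<open>2\<kappa> v\<close>.
  If \<open>\<kappa> = 0\<close>, then likewise \<open>x\<^bsub>i+1\<^esub>\<close> kills \<open>s\<^sub>i v\<close>, so that \<open>c\<^sub>i c\<^bsub>i+1\<^esub> v = v\<close>, and squaring gives \<open>v = -v\<close>.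
\<close>

lemma equal_entries_eig:
  assumes w: "eig c v" and i: "1 \<le> i" "i < d" and eq: "c i = c (Suc i)"
  shows "v = 0"
proof -
  let ?j = "Suc i" and ?k = "kap (c i)"
  have j: "1 \<le> ?j" "?j \<le> d" and i': "i \<le> d" using i by auto
  have v: "v \<in> carr M" using w by (rule eig_carr)
  interpret R: rank2_ops "carr M" "smul M" "S i" "X i" "X ?j" "C i" "C ?j" by (rule rank2[OF i])
  have x: "X i v = smul M ?k v" "X ?j v = smul M ?k v" using w i j i' eq by (auto simp: eig_def)
  have sx: "S i (X i v) = X ?j (S i v) - v + C i (C ?j v)" using v i by (intro s_x_left)
  hence X1: "X ?j (S i v) = smul M ?k (S i v) + v - C i (C ?j v)"
    using x lin_S[OF i, THEN lin_rules(3)] v by (simp add: algebra_simps)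
  have "X ?j (C i (C ?j v)) = C i (X ?j (C ?j v))" using R.cy[of "C ?j v"] v j by simp
  moreover have "X ?j (C ?j v) = - smul M ?k (C ?j v)"
    using c_x_same[OF v j] x lin_C[OF j, THEN lin_rules(3)] v by simp
  ultimately have XC: "X ?j (C i (C ?j v)) = - smul M ?k (C i (C ?j v))"
    using v i i' j lin_C[OF i(1) i', THEN lin_rules(4)] lin_C[OF i(1) i', THEN lin_rules(3)] by simp
  have "X ?j (X ?j (S i v)) = X ?j (smul M ?k (S i v) + v - C i (C ?j v))" by (simp only: X1)
  also have "\<dots> = smul M ?k (X ?j (S i v)) + X ?j v - X ?j (C i (C ?j v))"
    using v i i' j lin_X[OF j, THEN lin_rules(2)] lin_X[OF j, THEN lin_rules(5)]
      lin_X[OF j, THEN lin_rules(3)] by simp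
  also have "\<dots> = smul M ?k (smul M ?k (S i v) + v - C i (C ?j v)) + smul M ?k v
      - - smul M ?k (C i (C ?j v))"
    by (simp only: X1 XC x)
  also have "\<dots> = smul M (?k * ?k) (S i v) + smul M ?k v + smul M ?k v"
    by (simp add: scale_right_distrib scale_right_diff_distrib)
  finally have XX: "X ?j (X ?j (S i v)) = smul M (?k * ?k) (S i v) + smul M ?k v + smul M ?k v" .
  have xxv: "X ?j (X ?j v) = smul M (?k * ?k) v" using x v lin_X[OF j, THEN lin_rules(3)] by simp
  have "X ?j (X ?j (S i v)) = smul M (?k * ?k) (S i v)"
  proof (rule XX_kernel_of_square[OF _ j])
    fix T assume T: "T = (\<lambda>u. X ?j (X ?j u) - smul M (?k * ?k) u)"
    have lT: "lin T" unfolding T using lin_diff[OF lin_comp[OF lin_X[OF j] lin_X[OF j]] lin_sm[OF lin_id]] .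
    have "T v = 0" by (simp add: T xxv)
    moreover have "T (S i v) = smul M ?k v + smul M ?k v" by (simp add: T XX)
    ultimately show "T (T (S i v)) = 0" using v by (simp add: lin_rules[OF lT])
  qed (use v i in simp)
  hence "smul M ?k v + smul M ?k v = 0" using XX by simp
  hence "smul M (?k + ?k) v = 0" by (simp only: scale_left_distrib)
  hence "?k = 0 \<or> v = 0" unfolding scale_eq_0_iff by simp
  moreover have "v = 0" if k0: "?k = 0"
  proof -
    have "X ?j (X ?j (S i v)) = 0" using XX k0 by simp
    moreover have "S i v \<in> carr M" using v i by simp
    ultimately have "X ?j (S i v) = 0" using X_kernel_of_square[OF _ j] by blast
    hence "0 = v - C i (C ?j v)" using X1 k0 by simp
    hence vc: "C i (C ?j v) = v" by simp
    have "C ?j (C i (C ?j v)) = - C i (C ?j (C ?j v))" using v i i' j by (intro R.ec) simp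
    also have "\<dots> = C i v" using v j lin_C[OF i(1) i', THEN lin_rules(4)] c_sq[OF v j] by simp
    finally have "C i (C ?j (C i (C ?j v))) = - v" using c_sq[OF v i(1) i'] by simp
    hence "v = - v" unfolding vc .
    hence "smul M 2 v = 0" using scale_left_distrib[of 1 1 v] by (simp add: eq_neg_iff_add_eq_0)
    thus ?thesis by simp
  qed
  ultimately show ?thesis by blast
qed

lemma equal_entries:
  assumes w: "wt c v" and i: "1 \<le> i" "i < d" and eq: "c i = c (Suc i)"
  shows "v = 0"
  using wt_to_eig[OF w] equal_entries_eig[OF _ i eq] by metis

text \<open>
  Both intertwiners lead to weights with equal neighbouring entries and hence vanish. So both generators
  act on \<open>v\<close> by Clifford elements, and the braid relation becomes an equation between third powers of
  their coefficients, which forces \<open>\<kappa>\<^sub>i = 0\<close>.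
\<close>

lemma repeated_entries:
  assumes w: "eig c v" "v \<noteq> 0" and i: "1 \<le> i" "Suc i < d" and eq: "c i = c (Suc (Suc i))"
  shows "c i = 0 \<and> c (Suc i) = 1"
proof -
  let ?j = "Suc i" and ?m = "Suc (Suc i)"
  let ?a = "kap (c i)" and ?b = "kap (c ?j)"
  have i': "1 \<le> i" "i < d" "i \<le> d" and j: "1 \<le> ?j" "?j < d" "?j \<le> d" and m: "1 \<le> ?m" "?m \<le> d"
    using i by auto
  have v: "v \<in> carr M" using w eig_carr by blast
  interpret R: rank3_ops "carr M" "smul M" "S i" "S ?j" "X i" "X ?j" "X ?m" "C i" "C ?j" "C ?m"
    by (rule rank3[OF i])
  have ne: "c i \<noteq> c ?j" using equal_entries_eig[OF w(1) i'(1,2)] w(2) by blast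
  have p1: "\<phi> i v = 0"
    using equal_entries_eig[OF eig_phi[OF w(1) i'(1,2)] j(1,2)] eq by (simp add: transpose_def)
  have p2: "\<phi> ?j v = 0"
    using equal_entries_eig[OF eig_phi[OF w(1) j(1,2)] i'(1,2)] eq by (simp add: transpose_def)
  have near: "\<not> far (c i) (c ?j)"
    using phi_nonzero[OF eig_wt[OF w(1)] w(2) i'(1,2)] p1 by blast
  have nz: "?a - ?b \<noteq> 0" "?a + ?b \<noteq> 0" using ne kap_add_nonzero[OF ne] by auto
  let ?al = "1 / (?b - ?a)" and ?be = "1 / (?a + ?b)"
  have s1: "S i v = smul M ?al v + smul M ?be (C i (C ?j v))"
    using S_eig[OF w(1) i'(1,2) ne] p1 by simp
  have ne': "c ?j \<noteq> c ?m" using ne eq by simp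
  have "S ?j v = smul M (1 / (?a - ?b)) v + smul M ?be (C ?j (C ?m v))"
    using S_eig[OF w(1) j(1,2) ne'] p2 eq by (simp add: add.commute)
  moreover have "1 / (?a - ?b) = - ?al" by (simp add: divide_simps)
  ultimately have s2: "S ?j v = - smul M ?al v + smul M ?be (C ?j (C ?m v))"
    by (simp only: scale_minus_left)
  have "smul M (2 * (?be * ?be * ?be - ?al * ?al * ?al)) v = 0"
    using R.braid_defect_Clifford[OF v s1 s2] braid[OF v i]
    by (simp add: defect_def R.braid_defect_def)
  hence "?be ^ 3 = ?al ^ 3" using w(2) by (simp add: power3_eq_cube)
  hence cube: "(?b - ?a) ^ 3 = (?a + ?b) ^ 3" using nz by (simp add: power_divide divide_simps)
  define ra rb where "ra = sqrt (real (c i * Suc (c i)))" and "rb = sqrt (real (c ?j * Suc (c ?j)))"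
  have "complex_of_real ((rb - ra) ^ 3) = complex_of_real ((ra + rb) ^ 3)"
    using cube by (simp add: kap_def ra_def rb_def del: of_nat_mult mult_Suc_right)
  hence "(rb - ra) ^ 3 = (ra + rb) ^ 3" using of_real_eq_iff by blast
  hence "root 3 ((rb - ra) ^ 3) = root 3 ((ra + rb) ^ 3)" by simp
  hence "rb - ra = ra + rb" by (simp add: odd_real_root_power_cancel)
  hence "ra = 0" by simp
  hence "c i = 0" by (simp add: ra_def del: of_nat_mult mult_Suc_right)
  thus ?thesis using near ne by (auto simp: far_def)
qed

text \<open>
  Induction on the distance of the equal entries, between which no further equal entry may be
  assumed. If one of them is far from its inner neighbour, an
  invertible intertwiner moves it inwards. If both inner neighbours are near and distinct, they are the
  two required entries. If they are equal, either they coincide in position and the previous lemma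
  applies, or the induction hypothesis for them produces an equal entry between the given ones.
\<close>

theorem weight_admissible:
  assumes "eig c v" "v \<noteq> 0"
  shows "admissible d c"
proof -
  have "(\<exists>k. i < k \<and> k < j \<and> c k = Suc (c i)) \<and> (c i > 0 \<longrightarrow> (\<exists>k. i < k \<and> k < j \<and> Suc (c k) = c i))"
    if "eig c v" "v \<noteq> 0" "1 \<le> i" "i < j" "j \<le> d" "c i = c j" for c v i j
    using that
  proof (induction "j - i" arbitrary: c v i j rule: less_induct)
    case less
    note w = less.prems(1,2) and ij = less.prems(3-5) and eq = less.prems(6)
    have "i < d" using ij by simp
    hence ne1: "c i \<noteq> c (Suc i)" using equal_entries_eig[OF w(1) ij(1)] w(2) by blast
    have ij2: "Suc i < j" using ne1 eq ij by (cases "j = Suc i") auto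
    define p where "p = j - 1"
    have p: "Suc p = j" "i < p" "p < d" "1 \<le> p" using ij ij2 by (auto simp: p_def)
    consider (mid) k where "i < k" "k < j" "c k = c i"
      | (farl) "\<And>k. i < k \<Longrightarrow> k < j \<Longrightarrow> c k \<noteq> c i" "far (c i) (c (Suc i))"
      | (farr) "\<And>k. i < k \<Longrightarrow> k < j \<Longrightarrow> c k \<noteq> c i" "far (c p) (c j)"
      | (near) "\<And>k. i < k \<Longrightarrow> k < j \<Longrightarrow> c k \<noteq> c i" "\<not> far (c i) (c (Suc i))" "\<not> far (c p) (c j)"
      by blast
    thus ?case
    proof cases
      case mid
      hence IH: "(\<exists>m. i < m \<and> m < k \<and> c m = Suc (c i)) \<and>
          (c i > 0 \<longrightarrow> (\<exists>m. i < m \<and> m < k \<and> Suc (c m) = c i))"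
        using less.hyps[of k i c v] w ij by auto
      show ?thesis using IH mid(2) by (metis less_trans)
    next
      case farl
      let ?c = "c \<circ> adj i"
      have i: "1 \<le> i" "i < d" using ij by auto
      have "\<phi> i v \<noteq> 0" using phi_nonzero[OF eig_wt[OF w(1)] w(2) i farl(2)] .
      moreover have e: "?c (Suc i) = c i" "?c j = c j" using ij2 by auto
      moreover have k: "?c k = c k" if "Suc i < k" for k using that by auto
      ultimately have "(\<exists>k. Suc i < k \<and> k < j \<and> ?c k = Suc (c i)) \<and>
          (c i > 0 \<longrightarrow> (\<exists>k. Suc i < k \<and> k < j \<and> Suc (?c k) = c i))"
        using less.hyps[of j "Suc i" ?c "\<phi> i v"] eig_phi[OF w(1) i] ij ij2 eq by simp
      thus ?thesis using k by (metis Suc_lessD)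
    next
      case farr
      let ?c = "c \<circ> adj p"
      have pp: "1 \<le> p" "p < d" using p by auto
      have "\<phi> p v \<noteq> 0" using phi_nonzero[OF eig_wt[OF w(1)] w(2) pp] farr(2) p(1) by simp
      moreover have e: "?c p = c j" "?c i = c i" using p by auto
      moreover have k: "?c k = c k" if "k < p" for k using that by auto
      ultimately have "(\<exists>k. i < k \<and> k < p \<and> ?c k = Suc (c i)) \<and>
          (c i > 0 \<longrightarrow> (\<exists>k. i < k \<and> k < p \<and> Suc (?c k) = c i))"
        using less.hyps[of p i ?c "\<phi> p v"] eig_phi[OF w(1) pp] ij p eq by auto
      thus ?thesis using k p(1) by (metis less_SucI)
    next
      case near
      have n1: "c (Suc i) = Suc (c i) \<or> Suc (c (Suc i)) = c i"
        using near(1)[of "Suc i"] near(2) ij2 by (auto simp: far_def)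
      have n2: "c p = Suc (c i) \<or> Suc (c p) = c i"
        using near(1)[of p] near(3) p eq by (auto simp: far_def)
      show ?thesis
      proof (cases "p = Suc i")
        case True
        hence "j = Suc (Suc i)" using p by simp
        hence "c i = 0 \<and> c (Suc i) = 1" using repeated_entries[OF w, of i] ij eq by simp
        thus ?thesis using ij2 by (intro conjI exI[of _ "Suc i"]) auto
      next
        case False
        hence lt: "Suc i < p" using p by simp
        show ?thesis
        proof (cases "c (Suc i) = c p")
          case True
          have "(\<exists>k. Suc i < k \<and> k < p \<and> c k = Suc (c (Suc i))) \<and>
            (c (Suc i) > 0 \<longrightarrow> (\<exists>k. Suc i < k \<and> k < p \<and> Suc (c k) = c (Suc i)))"
            using less.hyps[of p "Suc i" c v] lt p ij w True by auto
          hence "\<exists>k. Suc i < k \<and> k < p \<and> c k = c i" using n1 by auto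
          thus ?thesis using near(1) p(1) by (metis Suc_lessD less_SucI)
        next
          case False
          thus ?thesis using n1 n2 lt p ij2 by (metis Suc_inject lessI)
        qed
      qed
    qed
  qed
  with assms show ?thesis unfolding admissible_def by blast
qed

text \<open>
  If two of the three entries agree, both sides are zero, because some vector on the way has equal
  neighbouring entries. Otherwise the relation is inherited from the generators.
\<close>

lemma phi_braid:
  assumes w: "wt c v" and i: "1 \<le> i" "Suc i < d"
  shows "\<phi> i (\<phi> (Suc i) (\<phi> i v)) = \<phi> (Suc i) (\<phi> i (\<phi> (Suc i) v))"
proof -
  let ?j = "Suc i"
  have i': "1 \<le> i" "i < d" and j: "1 \<le> ?j" "?j < d" using i by auto
  have z: "\<phi> i 0 = 0" "\<phi> ?j 0 = 0" using lin_0[OF lin_phi] i' j by auto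
  consider "c i = c ?j" | "c ?j = c (Suc ?j)" | "c i = c (Suc ?j)"
    | "c i \<noteq> c ?j" "c ?j \<noteq> c (Suc ?j)" "c i \<noteq> c (Suc ?j)" by blast
  thus ?thesis
  proof cases
    case 1
    with equal_entries[OF w i'] z show ?thesis by simp
  next
    case 2
    with equal_entries[OF w j] z show ?thesis by simp
  next
    case 3
    have "\<phi> i v = 0" using equal_entries[OF wt_phi[OF w i'] j] 3 by (simp add: transpose_def)
    moreover have "\<phi> ?j v = 0" using equal_entries[OF wt_phi[OF w j] i'] 3 by (simp add: transpose_def)
    ultimately show ?thesis using z by simp
  next
    case 4
    with braid_iff[OF w i] braid[OF wt_carr[OF w] i] show ?thesis by simp
  qed
qed

lemma pronic_of_q: "\<exists>n. of_int (q a) = qc n"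
proof (cases "a \<ge> 0")
  case True
  hence "q a = int (nat a * Suc (nat a))" by (simp add: q_def algebra_simps)
  hence "of_int (q a) = qc (nat a)" by (simp only: qc_def of_int_of_nat_eq)
  thus ?thesis by blast
next
  case False
  define n where "n = nat (- a - 1)"
  have "a = - int n - 1" using False by (simp add: n_def)
  have "q a = (- int n - 1) * (- int n)" by (simp add: q_def \<open>a = - int n - 1\<close>)
  hence "q a = int (n * Suc n)" by (simp add: algebra_simps)
  hence "of_int (q a) = qc n" by (simp only: qc_def of_int_of_nat_eq)
  thus ?thesis by blast
qed

text \<open>
  Commuting operators on a finite-dimensional space have a joint eigenvector. By integrality the squares
  of its eigenvalues are of the form \<open>q(a)\<close>.
\<close>

theorem weight_exists:
  assumes ne: "carr M \<noteq> {0}"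
  obtains c v where "eig c v" "v \<noteq> 0"
proof -
  obtain B where B: "finite B" "carr M = span B" using finite_dim by blast
  define Q where "Q n z W \<longleftrightarrow> subspace W \<and> W \<subseteq> carr M \<and> W \<noteq> {0} \<and>
     (\<forall>j. 1 \<le> j \<and> j \<le> d \<longrightarrow> X j ` W \<subseteq> W) \<and>
     (\<forall>j. 1 \<le> j \<and> j \<le> n \<longrightarrow> (\<forall>v\<in>W. X j v = smul M (z j) v))" for n z W
  have "n \<le> d \<Longrightarrow> \<exists>z W. Q n z W" for n
  proof (induction n)
    case 0
    have "\<forall>j. 1 \<le> j \<and> j \<le> d \<longrightarrow> X j ` carr M \<subseteq> carr M" by auto
    hence "Q 0 (\<lambda>_. 0) (carr M)" using ne subspace_carr by (simp add: Q_def)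
    thus ?case by blast
  next
    case (Suc n)
    then obtain z W where "Q n z W" using Suc_leD by blast
    hence W: "subspace W" "W \<subseteq> carr M" "W \<noteq> {0}"
      "\<And>j. 1 \<le> j \<Longrightarrow> j \<le> d \<Longrightarrow> X j ` W \<subseteq> W"
      "\<And>j v. 1 \<le> j \<Longrightarrow> j \<le> n \<Longrightarrow> v \<in> W \<Longrightarrow> X j v = smul M (z j) v"
      by (simp_all add: Q_def)
    have m: "1 \<le> Suc n" "Suc n \<le> d" using Suc.prems by auto
    note lm = lin_rules[OF lin_X[OF m]]
    have WB: "W \<subseteq> span B" using W(2) B by simp
    obtain y v where y: "v \<in> W" "v \<noteq> 0" "X (Suc n) v = smul M y v"
    proof (rule exists_eigenvector[OF vector_space_smul W(1) B(1) WB W(3), of "X (Suc n)"])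
      show "X (Suc n) v \<in> W" if "v \<in> W" for v using W(4)[OF m] that by blast
      show "X (Suc n) (u + v) = X (Suc n) u + X (Suc n) v" if "u \<in> W" "v \<in> W" for u v
        using that W(2) lm(2) by blast
      show "X (Suc n) (smul M a v) = smul M a (X (Suc n) v)" if "v \<in> W" for a v
        using that W(2) lm(3) by blast
    qed (use that in blast)
    define W' where "W' = {u \<in> W. X (Suc n) u = smul M y u}"
    have sub': "W' \<subseteq> carr M" using W(2) by (auto simp: W'_def)
    have "subspace W'"
    proof (rule subspaceI)
      show "0 \<in> W'" using subspace_0[OF W(1)] lin_0[OF lin_X[OF m]] by (simp add: W'_def)
      show "u + w \<in> W'" if "u \<in> W'" "w \<in> W'" for u w
        using that subspace_add[OF W(1)] lm(2) sub' by (auto simp: W'_def scale_right_distrib subset_iff)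
      show "smul M a u \<in> W'" if "u \<in> W'" for a u
        using that subspace_scale[OF W(1)] lm(3) sub' by (auto simp: W'_def scale_left_commute subset_iff)
    qed
    moreover have "W' \<noteq> {0}" using y by (auto simp: W'_def)
    moreover have "X j ` W' \<subseteq> W'" if j: "1 \<le> j" "j \<le> d" for j
    proof (rule image_subsetI)
      fix u assume u: "u \<in> W'"
      have "X (Suc n) (X j u) = X j (X (Suc n) u)" using x_x[OF _ m j] u sub' by blast
      also have "\<dots> = smul M y (X j u)"
        using u lin_X[OF j, THEN lin_rules(3)] sub' by (auto simp: W'_def)
      finally show "X j u \<in> W'" using u W(4)[OF j] by (auto simp: W'_def)
    qed
    moreover have "X j u = smul M ((z(Suc n := y)) j) u" if "1 \<le> j" "j \<le> Suc n" "u \<in> W'" for j u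
      using that W(5)[of j u] by (cases "j = Suc n") (auto simp: W'_def)
    ultimately have "Q (Suc n) (z(Suc n := y)) W'"
      unfolding Q_def using sub' by blast
    thus ?case by blast
  qed
  from this[of d] obtain z W where "Q d z W" by blast
  hence W: "subspace W" "W \<subseteq> carr M" "W \<noteq> {0}"
    "\<And>j v. 1 \<le> j \<Longrightarrow> j \<le> d \<Longrightarrow> v \<in> W \<Longrightarrow> X j v = smul M (z j) v"
    by (simp_all add: Q_def)
  obtain v where v: "v \<in> W" "v \<noteq> 0" using W(3) subspace_0[OF W(1)] by blast
  have vc: "v \<in> carr M" using v W(2) by blast
  have xx: "X j (X j v) = smul M (z j * z j) v" if "1 \<le> j" "j \<le> d" for j
    using W(4)[OF that v(1)] lin_X[OF that, THEN lin_rules(3)] vc by simp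
  have "\<exists>n. z j * z j = qc n" if j: "1 \<le> j" "j \<le> d" for j
  proof -
    have "((\<lambda>u. X j (X j u) - smul M (z j * z j) u) ^^ 1) v = 0" using xx[OF j] by simp
    then obtain a where "z j * z j = of_int (q a)"
      using integral j vc v(2) unfolding integral_hc_def
      by (metis atLeastAtMost_iff)
    thus ?thesis using pronic_of_q by metis
  qed
  then obtain c where "\<And>j. 1 \<le> j \<Longrightarrow> j \<le> d \<Longrightarrow> z j * z j = qc (c j)" by metis
  hence "wt c v" using xx vc by (simp add: wt_def)
  with wt_to_eig[OF this v(2)] that show thesis by blast
qed

end

section \<open>Families of intertwined weight vectors\<close>

context calibrated_hc
begin

definition chain :: "(nat \<Rightarrow> nat) \<Rightarrow> 'v \<Rightarrow> ((nat \<Rightarrow> nat) \<Rightarrow> 'v) \<Rightarrow> bool" where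
  "chain c v \<Phi> \<longleftrightarrow> \<Phi> id = v \<and>
     (\<forall>g i. g permutes {1..d} \<longrightarrow> 1 \<le> i \<longrightarrow> i < d \<longrightarrow> ascent g i \<longrightarrow> \<Phi> (adj i \<circ> g) = \<phi> i (\<Phi> g)) \<and>
     (\<forall>g. g permutes {1..d} \<longrightarrow> eig (c \<circ> inv g) (\<Phi> g)) \<and>
     (\<forall>g. g permutes {1..d} \<longrightarrow>
       (v \<in> evn M \<longrightarrow> \<Phi> g \<in> evn M) \<and> (v \<in> odd_part M \<longrightarrow> \<Phi> g \<in> odd_part M))"

lemma chainD:
  assumes "chain c v \<Phi>"
  shows "\<Phi> id = v"
    "\<And>g i. g permutes {1..d} \<Longrightarrow> 1 \<le> i \<Longrightarrow> i < d \<Longrightarrow> ascent g i \<Longrightarrow> \<Phi> (adj i \<circ> g) = \<phi> i (\<Phi> g)"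
    "\<And>g. g permutes {1..d} \<Longrightarrow> eig (c \<circ> inv g) (\<Phi> g)"
    "\<And>g. g permutes {1..d} \<Longrightarrow>
       (v \<in> evn M \<longrightarrow> \<Phi> g \<in> evn M) \<and> (v \<in> odd_part M \<longrightarrow> \<Phi> g \<in> odd_part M)"
  using assms unfolding chain_def by blast+

text \<open>
  By the commutation and braid relations of the intertwiners, the vector reached along a path of ascents
  depends only on the permutation at its end.
\<close>

lemma intertwiner_family:
  assumes v: "eig c v"
  obtains \<Phi> where "chain c v \<Phi>"
proof -
  define V where "V = {u. \<exists>c. wt c u}"
  have "\<exists>\<Phi>. \<Phi> id = v \<and> (\<forall>g i. g permutes {1..d} \<longrightarrow> 1 \<le> i \<longrightarrow> i < d \<longrightarrow> ascent g i \<longrightarrow>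
      \<Phi> (adj i \<circ> g) = \<phi> i (\<Phi> g))"
  proof (rule exists_ascent_family[of v V d \<phi>])
    show "v \<in> V" using eig_wt[OF v] by (auto simp: V_def)
    show "\<phi> i u \<in> V" if "1 \<le> i" "i < d" "u \<in> V" for i u
      using wt_phi[OF _ that(1,2)] that(3) unfolding V_def by blast
    show "\<phi> i (\<phi> j u) = \<phi> j (\<phi> i u)" if "1 \<le> i" "Suc i < j" "j < d" "u \<in> V" for i j u
      using phi_phi_far[OF _ that(1-3)] wt_carr that(4) unfolding V_def by blast
    show "\<phi> i (\<phi> (Suc i) (\<phi> i u)) = \<phi> (Suc i) (\<phi> i (\<phi> (Suc i) u))"
      if "1 \<le> i" "Suc i < d" "u \<in> V" for i u
      using phi_braid[OF _ that(1,2)] that(3) unfolding V_def by blast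
    fix \<Phi> assume \<Phi>: "\<Phi> id = v" "\<And>g i. g permutes {1..d} \<Longrightarrow> 1 \<le> i \<Longrightarrow> i < d \<Longrightarrow> ascent g i \<Longrightarrow>
      \<Phi> (adj i \<circ> g) = \<phi> i (\<Phi> g)"
    show "\<exists>\<Phi>. \<Phi> id = v \<and> (\<forall>g i. g permutes {1..d} \<longrightarrow> 1 \<le> i \<longrightarrow> i < d \<longrightarrow> ascent g i \<longrightarrow>
      \<Phi> (adj i \<circ> g) = \<phi> i (\<Phi> g))"
      by (intro exI[of _ \<Phi>] conjI allI impI \<Phi>)
  qed
  then obtain \<Phi> where \<Phi>: "\<Phi> id = v"
    "\<And>g i. g permutes {1..d} \<Longrightarrow> 1 \<le> i \<Longrightarrow> i < d \<Longrightarrow> ascent g i \<Longrightarrow> \<Phi> (adj i \<circ> g) = \<phi> i (\<Phi> g)"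
    by blast
  have "eig (c \<circ> inv g) (\<Phi> g) \<and> (v \<in> evn M \<longrightarrow> \<Phi> g \<in> evn M) \<and> (v \<in> odd_part M \<longrightarrow> \<Phi> g \<in> odd_part M)"
    if "g permutes {1..d}" for g
    using that
  proof (induction rule: permutes_ascent_induct)
    case id
    have "c \<circ> inv id = c" by (simp only: inv_id comp_id)
    thus ?case using v \<Phi>(1) by metis
  next
    case (step g i)
    have "c \<circ> inv g \<circ> adj i = c \<circ> inv (adj i \<circ> g)"
      by (simp only: fun_eq_iff comp_apply inv_adj_comp[OF step(1)] simp_thms)
    moreover have "eig (c \<circ> inv g \<circ> adj i) (\<phi> i (\<Phi> g))"
      using eig_phi[OF _ step(2,3)] step(5) by blast
    ultimately show ?case
      using \<Phi>(2)[OF step(1-4)] step(5) phi_parity[OF step(2,3)] by metis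
  qed
  with \<Phi> have "chain c v \<Phi>" unfolding chain_def by blast
  thus thesis by (rule that)
qed

definition gens :: "((nat \<Rightarrow> nat) \<Rightarrow> 'v) \<Rightarrow> 'v set" where
  "gens \<Phi> = {cl A (\<Phi> g) | A g. A \<subseteq> {1..d} \<and> g permutes {1..d}}"

lemma span_invariant:
  assumes f: "lin f" and G: "G \<subseteq> carr M" "\<And>x. x \<in> G \<Longrightarrow> f x \<in> span G" and x: "x \<in> span G"
  shows "f x \<in> span G"
proof -
  have "x \<in> carr M \<and> f x \<in> span G"
    using x
  proof (induction rule: span_induct_alt)
    case base
    thus ?case by (simp add: lin_0[OF f] span_zero)
  next
    case (step a x y)
    thus ?case using G by (auto simp: lin_rules[OF f] subset_iff intro!: span_add span_scale)
  qed
  thus ?thesis by blast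
qed

text \<open>
  The vectors of the family generate, over the Clifford generators, a submodule: \<open>s\<^sub>i\<close> acts through
  \<open>\<phi>\<^sub>i\<close>, which moves along an ascent to the next vector and along a descent back to a multiple of
  the previous one.
\<close>

lemma family_spans:
  assumes irr: "irreducible_hc d M" and v: "eig c v" "v \<noteq> 0"
    and par: "v \<in> evn M \<or> v \<in> odd_part M"
    and chain: "chain c v \<Phi>"
  shows "carr M = span (gens \<Phi>)"
proof -
  note \<Phi> = chainD[OF chain]
  let ?G = "gens \<Phi>" and ?N = "span (gens \<Phi>)"
  have \<Phi>c: "\<Phi> g \<in> carr M" if "g permutes {1..d}" for g using \<Phi>(3)[OF that] eig_carr by blast
  have Gc: "?G \<subseteq> carr M" using \<Phi>c by (auto simp: gens_def)
  have Nc: "?N \<subseteq> carr M" using span_minimal[OF Gc subspace_carr] .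
  have clN: "cl A (\<Phi> g) \<in> ?N" if "A \<subseteq> {1..d}" "g permutes {1..d}" for A g
    using that by (intro span_base) (auto simp: gens_def)
  have \<Phi>N: "\<Phi> g \<in> ?N" if "g permutes {1..d}" for g using clN[of "{}" g] that by simp
  have N_C: "C j x \<in> ?N" if j: "1 \<le> j" "j \<le> d" and x: "x \<in> ?N" for j x
  proof (rule span_invariant[OF lin_C[OF j] Gc _ x])
    fix y assume "y \<in> ?G"
    then obtain A g where y: "y = cl A (\<Phi> g)" "A \<subseteq> {1..d}" "g permutes {1..d}"
      by (auto simp: gens_def)
    have "sym_diff {j} A \<subseteq> {1..d}" using y j by auto
    thus "C j y \<in> ?N"
      unfolding y(1) C_cl[OF \<Phi>c[OF y(3)] j y(2)] by (intro span_scale clN y(3))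
  qed
  have N_X: "X j x \<in> ?N" if j: "1 \<le> j" "j \<le> d" and x: "x \<in> ?N" for j x
  proof (rule span_invariant[OF lin_X[OF j] Gc _ x])
    fix y assume "y \<in> ?G"
    then obtain A g where y: "y = cl A (\<Phi> g)" "A \<subseteq> {1..d}" "g permutes {1..d}"
      by (auto simp: gens_def)
    have "X j (\<Phi> g) = smul M (kap ((c \<circ> inv g) j)) (\<Phi> g)"
      using \<Phi>(3)[OF y(3)] j by (simp add: eig_def)
    hence "cl A (X j (\<Phi> g)) = smul M (kap ((c \<circ> inv g) j)) (cl A (\<Phi> g))"
      using lin_cl[OF y(2), THEN lin_rules(3)] \<Phi>c[OF y(3)] by simp
    thus "X j y \<in> ?N"
      unfolding y(1) X_cl[OF \<Phi>c[OF y(3)] j y(2)] by (simp only:) (intro span_scale clN y)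
  qed
  have N_phi: "\<phi> i (\<Phi> g) \<in> ?N" if i: "1 \<le> i" "i < d" and g: "g permutes {1..d}" for i g
  proof (cases "ascent g i")
    case True
    thus ?thesis using \<Phi>N[OF adj_comp_permutes[OF g i]] \<Phi>(2)[OF g i] by simp
  next
    case False
    let ?h = "adj i \<circ> g"
    have h: "?h permutes {1..d}" "ascent ?h i"
      using adj_comp_permutes[OF g i] ascent_adj[OF g] False by auto
    have "\<Phi> g = \<phi> i (\<Phi> ?h)" using \<Phi>(2)[OF h(1) i h(2)] by (simp only: adj_adj_comp)
    hence "\<phi> i (\<Phi> g) = smul M (phi_square ((c \<circ> inv ?h) i) ((c \<circ> inv ?h) (Suc i))) (\<Phi> ?h)"
      using phi_phi[OF eig_wt[OF \<Phi>(3)[OF h(1)]] i] by simp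
    thus ?thesis using span_scale[OF \<Phi>N[OF h(1)]] by simp
  qed
  have N_foldr: "foldr C js x \<in> ?N" if "x \<in> ?N" "set js \<subseteq> {1..d}" for js x
    using that(2) by (induction js) (auto intro: N_C that(1))
  have N_S: "S i x \<in> ?N" if i: "1 \<le> i" "i < d" and x: "x \<in> ?N" for i x
  proof (rule span_invariant[OF lin_S[OF i] Gc _ x])
    fix y assume "y \<in> ?G"
    then obtain A g where y: "y = cl A (\<Phi> g)" "A \<subseteq> {1..d}" "g permutes {1..d}"
      by (auto simp: gens_def)
    let ?c = "c \<circ> inv g"
    have SN: "S i (\<Phi> g) \<in> ?N"
    proof (cases "\<Phi> g = 0")
      case True
      thus ?thesis using lin_0[OF lin_S[OF i]] span_zero by simp
    next
      case False
      have ne: "?c i \<noteq> ?c (Suc i)" using equal_entries[OF eig_wt[OF \<Phi>(3)[OF y(3)]] i] False by blast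
      show ?thesis
        unfolding S_eig[OF \<Phi>(3)[OF y(3)] i ne]
        using i y(3) by (intro span_add span_scale N_C N_phi \<Phi>N) auto
    qed
    have "finite A" by (rule finite_subset[OF y(2)]) simp
    hence fin: "set (sorted_list_of_set A) = A" by simp
    have "S i y = foldr C (map (adj i) (sorted_list_of_set A)) (S i (\<Phi> g))"
      unfolding y(1) cl_def using S_foldr[OF \<Phi>c[OF y(3)] i] fin y(2) by simp
    also have "\<dots> \<in> ?N"
    proof (rule N_foldr[OF SN])
      show "set (map (adj i) (sorted_list_of_set A)) \<subseteq> {1..d}"
        using adj_range[OF i] y(2) fin by auto
    qed
    finally show "S i y \<in> ?N" .
  qed
  have graded: "?N = {u + w | u w. u \<in> ?N \<inter> evn M \<and> w \<in> ?N \<inter> odd_part M}" (is "_ = ?D")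
  proof
    show "?D \<subseteq> ?N" by (auto intro: span_add)
    have D: "subspace ?D"
      by (intro subspace_sums subspace_inter[OF subspace_span] subspace_evn subspace_odd)
    have "?G \<subseteq> ?D"
    proof
      fix y assume y: "y \<in> ?G"
      then obtain A g where Ag: "y = cl A (\<Phi> g)" "A \<subseteq> {1..d}" "g permutes {1..d}"
        by (auto simp: gens_def)
      have "y \<in> evn M \<or> y \<in> odd_part M"
        using cl_parity[OF Ag(2), of "\<Phi> g"] \<Phi>(4)[OF Ag(3)] par Ag(1) by (auto split: if_splits)
      moreover have "y \<in> ?N" using y by (rule span_base)
      moreover have "0 \<in> ?N \<inter> evn M" "0 \<in> ?N \<inter> odd_part M"
        using span_zero subspace_0[OF subspace_evn] subspace_0[OF subspace_odd] by auto
      ultimately show "y \<in> ?D" by force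
    qed
    thus "?N \<subseteq> ?D" using span_minimal D by blast
  qed
  have "hc_submodule d M ?N"
    unfolding hc_submodule_def A_submodule_def graded_subspace_def x_invariant_def
    using Nc graded subspace_span N_X N_C N_S by auto
  hence "?N = {0} \<or> ?N = carr M" using irr by (simp add: irreducible_hc_def)
  moreover have "v \<in> ?N" using \<Phi>N[OF permutes_id] \<Phi>(1) by simp
  ultimately show ?thesis using v(2) by auto
qed

text \<open>
  A step that exchanges two equal entries would start at a vector with equal neighbouring entries,
  and such a vector is zero.
\<close>

lemma nonzero_family_monotone:
  assumes chain: "chain c v \<Phi>" and g: "g permutes {1..d}"
  shows "\<Phi> g \<noteq> 0 \<Longrightarrow> (p, r) \<in> Inversions d g \<Longrightarrow> c p \<noteq> c r"
  using g
proof (induction arbitrary: p r rule: permutes_ascent_induct)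
  case id
  thus ?case using Inversions_id by blast
next
  case (step g i)
  have nz: "\<Phi> g \<noteq> 0"
    using step.prems(1) chainD(2)[OF chain step.hyps(1-4)] lin_0[OF lin_phi[OF step.hyps(2,3)]] by metis
  have "(c \<circ> inv g) i \<noteq> (c \<circ> inv g) (Suc i)"
    using equal_entries[OF eig_wt[OF chainD(3)[OF chain step.hyps(1)]] step.hyps(2,3)] nz by blast
  moreover have "(p, r) \<in> insert (inv g i, inv g (Suc i)) (Inversions d g)"
    using step.prems(2) unfolding Inversions_adj(1)[OF step.hyps(1-4)] .
  ultimately show ?case using step.IH[OF nz] by auto
qed

text \<open>
  In an irreducible module the intertwiner vanishes between neighbouring contents. Otherwise its
  image \<open>u\<close> generates the module, and \<open>v\<close> is a combination of vectors obtained from \<open>u\<close>. By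
  weights, and because equal entries are never exchanged, only the permutation that undoes the
  exchange can contribute, but \<open>\<phi>\<^sub>i u\<close> is a multiple
  of \<open>v\<close> by the scalar \<open>\<phi>\<^sub>i\<^sup>2\<close>, which is zero.
\<close>

lemma phi_near_zero:
  assumes irr: "irreducible_hc d M" and v: "eig c v" and i: "1 \<le> i" "i < d"
    and near: "\<not> far (c i) (c (Suc i))"
  shows "\<phi> i v = 0"
proof -
  have hom: "\<phi> i v = 0" if v: "eig c v" and par: "v \<in> evn M \<or> v \<in> odd_part M" for v
  proof (rule ccontr)
    assume nz: "\<phi> i v \<noteq> 0"
    define u where "u = \<phi> i v"
    let ?c = "c \<circ> adj i"
    have v0: "v \<noteq> 0" using nz lin_0[OF lin_phi[OF i]] by auto
    have ne: "c i \<noteq> c (Suc i)" using equal_entries_eig[OF v i] v0 by blast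
    have u: "eig ?c u" "u \<noteq> 0" unfolding u_def using eig_phi[OF v i] nz by auto
    have pu: "u \<in> evn M \<or> u \<in> odd_part M" using phi_parity[OF i] par by (auto simp: u_def)
    obtain \<Phi> where chain: "chain ?c u \<Phi>" using intertwiner_family[OF u(1)] by blast
    note \<Phi> = chainD[OF chain]
    have span: "carr M = span (gens \<Phi>)" by (rule family_spans[OF irr u pu chain])
    define Pm where "Pm = {g. g permutes {1..d}}"
    have finP: "finite Pm" by (simp add: Pm_def finite_permutations)
    have "\<exists>h. x = sum h Pm \<and> (\<forall>g\<in>Pm. wt (?c \<circ> inv g) (h g) \<and> (\<Phi> g = 0 \<longrightarrow> h g = 0))"
      if "x \<in> span (gens \<Phi>)" for x
      using that
    proof (induction rule: span_induct_alt)
      case base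
      show ?case by (rule exI[of _ "\<lambda>_. 0"]) (simp add: wt_0)
    next
      case (step a x y)
      then obtain h where h: "y = sum h Pm" "\<forall>g\<in>Pm. wt (?c \<circ> inv g) (h g) \<and> (\<Phi> g = 0 \<longrightarrow> h g = 0)"
        by blast
      obtain A g where x: "x = cl A (\<Phi> g)" "A \<subseteq> {1..d}" "g permutes {1..d}"
        using step(1) by (auto simp: gens_def)
      define h' where "h' g' = (if g' = g then smul M a x else 0) + h g'" for g'
      have "sum h' Pm = smul M a x + y"
        using finP x(3) h(1) by (simp add: h'_def sum.distrib sum.delta Pm_def)
      moreover have wx: "wt (?c \<circ> inv g) x" unfolding x(1) by (intro wt_cl eig_wt \<Phi>(3) x)
      have x0: "x = 0" if "\<Phi> g = 0"
        unfolding x(1) that using lin_0[OF lin_cl[OF x(2)]] .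
      have "wt (?c \<circ> inv g') (h' g') \<and> (\<Phi> g' = 0 \<longrightarrow> h' g' = 0)" if g': "g' \<in> Pm" for g'
      proof (cases "g' = g")
        case True
        have "wt (?c \<circ> inv g') (smul M a x + h g')"
          using wt_add[OF wt_sm[OF wx]] h(2) g' True by blast
        thus ?thesis using True x0 h(2) g' by (simp add: h'_def)
      qed (use h(2) g' in \<open>simp add: h'_def\<close>)
      ultimately show ?case by metis
    qed
    then obtain h where h: "v = sum h Pm" "\<And>g. g \<in> Pm \<Longrightarrow> wt (?c \<circ> inv g) (h g)"
      "\<And>g. g \<in> Pm \<Longrightarrow> \<Phi> g = 0 \<Longrightarrow> h g = 0"
      using span eig_carr[OF v] by blast
    define F where "F = {g \<in> Pm. \<exists>j. 1 \<le> j \<and> j \<le> d \<and> (?c \<circ> inv g) j \<noteq> c j}"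
    have zero: "h g = 0" if g: "g \<in> Pm - F" for g
    proof (rule ccontr)
      assume "h g \<noteq> 0"
      hence \<Phi>g: "\<Phi> g \<noteq> 0" using h(3) g by blast
      have gp: "g permutes {1..d}" using g by (simp add: Pm_def)
      have cg: "(?c \<circ> inv g) j = c j" if "1 \<le> j" "j \<le> d" for j
        using g that by (auto simp: F_def)
      have "g = adj i"
      proof (rule monotone_on_classes_unique[OF gp adj_permutes[OF i]])
        fix k assume k: "k \<in> {1..d}"
        have "g k \<in> {1..d}" by (simp only: permutes_in_image[OF gp] k)
        thus "c (g k) = ?c k"
          using cg[of "g k"] permutes_inverses(2)[OF gp] by simp
        show "c (adj i k) = ?c k" by simp
      next
        fix p r assume pr: "p \<in> {1..d}" "r \<in> {1..d}" "p < r" "?c p = ?c r"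
        have "(p, r) \<notin> Inversions d g"
          using nonzero_family_monotone[OF chain gp \<Phi>g] pr(4) by blast
        moreover have "g p \<noteq> g r" using permutes_inj[OF gp] pr(3) by (auto simp: inj_eq)
        ultimately show "g p < g r" using pr by (auto simp: Inversions_def)
        show "adj i p < adj i r" using pr ne by (auto simp: transpose_def split: if_splits)
      qed
      hence "\<Phi> g = \<phi> i u"
        using \<Phi>(1) \<Phi>(2)[OF permutes_id i] by (simp add: ascent_def)
      also have "\<dots> = smul M (phi_square (c i) (c (Suc i))) v"
        unfolding u_def by (rule phi_phi[OF eig_wt[OF v] i])
      also have "\<dots> = 0" using phi_square_eq_0_iff[OF ne] near by simp
      finally show False using \<Phi>g by simp
    qed
    have "v = sum h F + sum h (Pm - F)"
      using h(1) sum.subset_diff[of F Pm h] finP by (simp add: F_def add.commute)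
    hence "v + (\<Sum>g\<in>F. smul M (- 1) (h g)) = 0"
      using zero by (simp add: sum_negf)
    hence "v + (\<Sum>g\<in>F. smul M (- 1) (h g)) \<in> {0}" by blast
    hence "v \<in> {0}"
    proof (rule weight_component[OF subspace_single_0, rotated -1])
      show "X j (X j u) \<in> {0}" if "1 \<le> j" "j \<le> d" "u \<in> {0}" for j u
        using that lin_0[OF lin_X] by simp
      show "finite F" using finP by (simp add: F_def)
      show "wt c v" by (rule eig_wt[OF v])
      show "wt (?c \<circ> inv g) (smul M (- 1) (h g))" if "g \<in> F" for g
        using that h(2) by (intro wt_sm) (simp add: F_def)
      show "\<exists>j. 1 \<le> j \<and> j \<le> d \<and> (?c \<circ> inv g) j \<noteq> c j" if "g \<in> F" for g
        using that by (simp add: F_def)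
    qed
    with v0 show False by simp
  qed
  obtain v0 v1 where "v0 \<in> evn M" "v1 \<in> odd_part M" "v = v0 + v1" "eig c v0" "eig c v1"
    using eig_parts[OF v] by blast
  with hom[of v0] hom[of v1] lin_phi[OF i, THEN lin_rules(2)] show ?thesis
    by (simp add: eig_carr)
qed

end

section \<open>The module on all standard fillings\<close>

(* Equations between elements of the module must not be split into their coordinates. *)
declare zero_fun_apply [simp del] plus_fun_apply [simp del] minus_apply [simp del] uminus_apply [simp del]

lemma hscale_apply: "hscale a f L S = a * f L S"
  by (simp add: hscale_def)

lemma sum_hvec_apply: "(sum F A :: hvec) L S = (\<Sum>a\<in>A. F a L S)"
  by (induction A rule: infinite_finite_induct) (simp_all add: zero_fun_apply plus_fun_apply)

lemma vector_space_hscale: "vector_space hscale"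
  by unfold_locales (simp_all add: fun_eq_iff hscale_apply plus_fun_apply algebra_simps)

interpretation HV: vector_space hscale
  by (rule vector_space_hscale)

definition hlin :: "(hvec \<Rightarrow> hvec) \<Rightarrow> bool" where
  "hlin F \<longleftrightarrow> (\<forall>f g. F (f + g) = F f + F g) \<and> (\<forall>a f. F (hscale a f) = hscale a (F f))"

lemma hlinD:
  assumes "hlin F"
  shows "F (f + g) = F f + F g" "F (hscale a f) = hscale a (F f)" "F 0 = 0" "F (- f) = - F f"
    "F (f - g) = F f - F g"
proof -
  show add: "F (f + g) = F f + F g" and sc: "F (hscale a f) = hscale a (F f)" for f g a
    using assms by (auto simp: hlin_def)
  show "F 0 = 0" using sc[of 0 0] by simp
  show neg: "F (- f) = - F f" for f using sc[of "-1" f] by simp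
  show "F (f - g) = F f - F g" using add[of f "- g"] neg[of g] by simp
qed

lemma hlin_sum: "hlin F \<Longrightarrow> F (sum g A) = (\<Sum>x\<in>A. F (g x))"
  by (induction A rule: infinite_finite_induct) (simp_all add: hlinD(1,3)[of F])

lemma hlin_id: "hlin (\<lambda>f. f)"
  and hlin_zero: "hlin (\<lambda>f. 0)"
  and hlin_comp: "hlin F \<Longrightarrow> hlin G \<Longrightarrow> hlin (\<lambda>f. F (G f))"
  and hlin_add: "hlin F \<Longrightarrow> hlin G \<Longrightarrow> hlin (\<lambda>f. F f + G f)"
  and hlin_diff: "hlin F \<Longrightarrow> hlin G \<Longrightarrow> hlin (\<lambda>f. F f - G f)"
  and hlin_neg: "hlin F \<Longrightarrow> hlin (\<lambda>f. - F f)"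
  and hlin_scale: "hlin F \<Longrightarrow> hlin (\<lambda>f. hscale a (F f))"
  by (auto simp: hlin_def HV.scale_right_distrib HV.scale_right_diff_distrib HV.scale_left_commute)

lemma hlin_lin_ext: "hlin (lin_ext d lam mu T)"
  unfolding hlin_def lin_ext_def
  by (auto simp: HV.scale_left_distrib sum.distrib HV.scale_sum_right hscale_apply plus_fun_apply)

lemma lin_ext_cv:
  assumes "standard_filling d lam mu L" "S \<subseteq> {1..d}"
  shows "lin_ext d lam mu T (cv S L) = T S L"
proof -
  have "lin_ext d lam mu T (cv S L) =
      (\<Sum>L'\<in>{L. standard_filling d lam mu L}. if L' = L then
        (\<Sum>S'\<in>Pow {1..d}. if S' = S then T S' L' else 0) else 0)"
  proof -
    have "hscale (cv S L L' S') (T S' L') = (if L' = L \<and> S' = S then T S L else 0)" for L' S'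
      by (simp add: cv_def)
    thus ?thesis unfolding lin_ext_def by (auto intro!: sum.cong)
  qed
  also have "\<dots> = (\<Sum>S'\<in>Pow {1..d}. if S' = S then T S' L else 0)"
    using assms(1) finite_standard_fillings by (subst sum.delta) simp_all
  also have "\<dots> = T S L"
    using assms(2) by (subst sum.delta) simp_all
  finally show ?thesis .
qed

text \<open>
  The coefficient of \<open>v\<^bsub>s\<^sub>i L\<^esub>\<close> in \<open>s\<^sub>i v\<^sub>L\<close> as a function of the two contents. Below, \<open>al\<close> and \<open>be\<close> are the
  coefficients of \<open>v\<^sub>L\<close> and \<open>c\<^sub>i c\<^bsub>i+1\<^esub> v\<^sub>L\<close>.
\<close>

definition ycf :: "nat \<Rightarrow> nat \<Rightarrow> complex" where
  "ycf a b = complex_of_real (sqrt (1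
     - 1 / (sqrt (real (b * Suc b)) - sqrt (real (a * Suc a)))\<^sup>2
     - 1 / (sqrt (real (b * Suc b)) + sqrt (real (a * Suc a)))\<^sup>2))"

lemma ycf_sym: "ycf a b = ycf b a"
  by (simp add: ycf_def power2_commute add.commute)

lemma ycf_square:
  assumes "a \<noteq> b"
  shows "(ycf a b)\<^sup>2 * (qc a - qc b)\<^sup>2 = - phi_square a b"
    and "(1 / (kap b - kap a))\<^sup>2 + (1 / (kap a + kap b))\<^sup>2 + (ycf a b)\<^sup>2 = 1"
proof -
  define x y where "x = sqrt (real (a * Suc a))" and "y = sqrt (real (b * Suc b))"
  have x2: "x\<^sup>2 = real (a * Suc a)" and y2: "y\<^sup>2 = real (b * Suc b)" by (simp_all add: x_def y_def del: mult_Suc_right)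
  have kx: "kap a = complex_of_real x" "kap b = complex_of_real y"
    unfolding kap_def x_def y_def by simp_all
  have qx: "qc a = complex_of_real (x\<^sup>2)" "qc b = complex_of_real (y\<^sup>2)"
    unfolding x2 y2 qc_def of_real_of_nat_eq by simp_all
  have nz: "y - x \<noteq> 0" "y + x \<noteq> 0"
    using assms kap_add_nonzero[OF assms] kap_eq_iff[of a b] unfolding kx
    by (auto simp: add.commute simp del: kap_eq_iff simp flip: of_real_add)
  define r where "r = 1 - 1 / (y - x)\<^sup>2 - 1 / (y + x)\<^sup>2"
  have r: "r * ((y - x) * (y + x))\<^sup>2 = ((y - x) * (y + x))\<^sup>2 - 2 * (x\<^sup>2 + y\<^sup>2)"
  proof -
    have "r * ((y - x) * (y + x))\<^sup>2 = (y - x)\<^sup>2 * (y + x)\<^sup>2 - (y + x)\<^sup>2 - (y - x)\<^sup>2"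
      using nz unfolding r_def power_mult_distrib by (simp add: field_simps)
    thus ?thesis by (simp add: power2_eq_square algebra_simps)
  qed
  have yx: "(y - x) * (y + x) = y\<^sup>2 - x\<^sup>2" by (simp add: power2_eq_square algebra_simps)
  have ps: "complex_of_real (r * (y\<^sup>2 - x\<^sup>2)\<^sup>2) = - phi_square a b"
    unfolding r[unfolded yx] phi_square_def qx
    by (simp add: power2_commute add.commute)
  have "r \<ge> 0"
  proof -
    have "r * (y\<^sup>2 - x\<^sup>2)\<^sup>2 = real_of_int (((int a - int b)\<^sup>2 - 1) * ((int a + int b + 1)\<^sup>2 - 1))"
      using ps unfolding phi_square_factor minus_minus by (metis of_real_eq_iff of_real_of_int_eq)
    moreover have "(int a - int b)\<^sup>2 > 0" "(int a + int b + 1)\<^sup>2 > 0"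
      using assms by simp_all
    hence "((int a - int b)\<^sup>2 - 1) * ((int a + int b + 1)\<^sup>2 - 1) \<ge> 0"
      by (intro mult_nonneg_nonneg) linarith+
    ultimately have "r * (y\<^sup>2 - x\<^sup>2)\<^sup>2 \<ge> 0" by (simp only: of_int_0_le_iff)
    moreover have "(y\<^sup>2 - x\<^sup>2)\<^sup>2 > 0" using nz unfolding yx[symmetric] by simp
    ultimately show ?thesis by (simp add: zero_le_mult_iff)
  qed
  hence y2': "(ycf a b)\<^sup>2 = complex_of_real r"
    unfolding ycf_def x_def[symmetric] y_def[symmetric] r_def[symmetric] of_real_power[symmetric] by simp
  have "(ycf a b)\<^sup>2 * (qc a - qc b)\<^sup>2 = complex_of_real (r * (y\<^sup>2 - x\<^sup>2)\<^sup>2)"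
    unfolding y2' qx by (simp add: power2_commute)
  thus "(ycf a b)\<^sup>2 * (qc a - qc b)\<^sup>2 = - phi_square a b" using ps by simp
  show "(1 / (kap b - kap a))\<^sup>2 + (1 / (kap a + kap b))\<^sup>2 + (ycf a b)\<^sup>2 = 1"
    unfolding y2' kx r_def by (simp add: power_one_over add.commute)
qed

lemma ycf_eq_0_iff:
  assumes "a \<noteq> b"
  shows "ycf a b = 0 \<longleftrightarrow> \<not> far a b"
proof -
  have "ycf a b = 0 \<longleftrightarrow> (ycf a b)\<^sup>2 * (qc a - qc b)\<^sup>2 = 0" using assms by simp
  thus ?thesis using ycf_square(1)[OF assms] phi_square_eq_0_iff[OF assms] by simp
qed

locale shape =
  fixes d :: nat and lam mu :: "nat list"
  assumes sk: "skew_pair lam mu"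
begin

abbreviation "H \<equiv> Hhat d lam mu"
abbreviation "std \<equiv> standard_filling d lam mu"
abbreviation "cn \<equiv> cont lam mu"
abbreviation "HS \<equiv> sact H"
abbreviation "HX \<equiv> xact H"
abbreviation "HC \<equiv> cact H"

lemma H_simps:
  "smul H = hscale" "carr H = supported d lam mu (\<lambda>L S. True)"
  "evn H = supported d lam mu (\<lambda>L S. even (card S))"
  "odd_part H = supported d lam mu (\<lambda>L S. odd (card S))"
  by (simp_all add: Hhat_def)

lemma H_ops: "HS i = lin_ext d lam mu (hat_s d lam mu i)" "HX i = lin_ext d lam mu (hat_x lam mu i)"
  "HC i = lin_ext d lam mu (hat_c i)"
  by (simp_all add: Hhat_def)

lemma hlin_ops: "hlin (HS i)" "hlin (HX i)" "hlin (HC i)"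
  by (simp_all add: H_ops hlin_lin_ext)

text \<open>
  Putting \<open>v\<^sub>L = 0\<close> for fillings that are not standard lets the formulas for the operators hold for every
  bijective filling.
\<close>

definition vv :: "filling \<Rightarrow> hvec" where
  "vv L = (if std L then cv {} L else 0)"

lemma kappa_eq:
  assumes "bij_filling d lam mu L" "i \<in> {1..d}"
  shows "complex_of_real (kappa lam mu L i) = kap (cn L i)"
    and "kappa lam mu L i = sqrt (real (cn L i * Suc (cn L i)))"
proof -
  have "real_of_int (q (int n)) = real (n * Suc n)" for n
  proof -
    have "q (int n) = int (n * Suc n)" by (simp add: q_def algebra_simps)
    thus ?thesis by (simp only: of_int_of_nat_eq)
  qed
  thus "kappa lam mu L i = sqrt (real (cn L i * Suc (cn L i)))"
    unfolding kappa_def content_box_of[OF assms] by simp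
  thus "complex_of_real (kappa lam mu L i) = kap (cn L i)"
    unfolding kap_def by simp
qed

lemma Ycoeff_eq:
  assumes "bij_filling d lam mu L" "1 \<le> i" "i < d"
  shows "complex_of_real (Ycoeff lam mu L i) = ycf (cn L i) (cn L (Suc i))"
  using kappa_eq(2)[OF assms(1), of i] kappa_eq(2)[OF assms(1), of "Suc i"] assms(2,3)
  by (simp add: Ycoeff_def ycf_def)

lemma HX_cv:
  assumes "std L" "S \<subseteq> {1..d}" "1 \<le> i" "i \<le> d"
  shows "HX i (cv S L) = hscale ((if i \<in> S then -1 else 1) * kap (cn L i)) (cv S L)"
  using assms kappa_eq(1)[OF standard_bij, of L i] by (simp add: H_ops lin_ext_cv hat_x_def)

lemma HC_cv:
  assumes "std L" "S \<subseteq> {1..d}" "1 \<le> i" "i \<le> d"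
  shows "HC i (cv S L) = hscale (csign i S) (cv (sym_diff {i} S) L)"
  using assms by (simp add: H_ops lin_ext_cv hat_c_def cl_sgn_left)

lemma cl_sgn_pair:
  assumes "finite S"
  shows "cl_sgn S {i, Suc i} = (if i \<in> S then -1 else 1)"
proof -
  let ?P = "{(a, b). a \<in> S \<and> b \<in> {i, Suc i} \<and> b < a}"
  have "?P = (\<lambda>a. (a, i)) ` {a \<in> S. i < a} \<union> (\<lambda>a. (a, Suc i)) ` {a \<in> S. Suc i < a}" by auto
  hence "card ?P = card ((\<lambda>a. (a, i)) ` {a \<in> S. i < a}) + card ((\<lambda>a. (a, Suc i)) ` {a \<in> S. Suc i < a})"
    using assms by (simp only:) (intro card_Un_disjoint; auto)
  also have "\<dots> = card {a \<in> S. i < a} + card {a \<in> S. Suc i < a}"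
    by (simp add: card_image inj_on_def)
  also have "card {a \<in> S. i < a} = card {a \<in> S. Suc i < a} + (if Suc i \<in> S then 1 else 0)"
  proof -
    have "{a \<in> S. i < a} = (if Suc i \<in> S then insert (Suc i) {a \<in> S. Suc i < a} else {a \<in> S. Suc i < a})"
      by (auto simp: Suc_lessI) (metis Suc_lessI)+
    thus ?thesis using assms by simp
  qed
  finally have P: "card ?P = 2 * card {a \<in> S. Suc i < a} + (if Suc i \<in> S then 1 else 0)" by simp
  have "S \<inter> {i, Suc i} = (if i \<in> S then {i} else {}) \<union> (if Suc i \<in> S then {Suc i} else {})" by auto
  hence "card (S \<inter> {i, Suc i}) = (if i \<in> S then 1 else 0) + (if Suc i \<in> S then 1 else 0)" by simp
  with P show ?thesis unfolding cl_sgn_def by (simp add: power_add power_mult)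
qed

lemma adj_eq_iff: "adj i x = adj i y \<longleftrightarrow> x = y"
  by (metis transpose_involutory)

lemma adj_image_mem: "k \<in> adj i ` S \<longleftrightarrow> adj i k \<in> S"
proof
  assume "adj i k \<in> S"
  hence "adj i (adj i k) \<in> adj i ` S" by (rule imageI)
  thus "k \<in> adj i ` S" by simp
qed auto

definition al :: "nat \<Rightarrow> nat \<Rightarrow> complex" where "al a b = 1 / (kap b - kap a)"
definition be :: "nat \<Rightarrow> nat \<Rightarrow> complex" where "be a b = 1 / (kap a + kap b)"

definition cvv :: "nat set \<Rightarrow> filling \<Rightarrow> hvec" where
  "cvv S L = (if std L then cv S L else 0)"

lemma HS_cv:
  assumes L: "std L" and S: "S \<subseteq> {1..d}" and i: "1 \<le> i" "i < d"
  shows "HS i (cv S L) = hscale (if i \<in> S \<and> Suc i \<in> S then -1 else 1)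
     (hscale (al (cn L i) (cn L (Suc i))) (cv (adj i ` S) L)
      + hscale (be (cn L i) (cn L (Suc i)) * (if Suc i \<in> S then -1 else 1))
          (cv (sym_diff (adj i ` S) {i, Suc i}) L)
      + hscale (ycf (cn L i) (cn L (Suc i))) (cvv (adj i ` S) (adj i \<circ> L)))"
proof -
  note bij = standard_bij[OF L]
  have k: "complex_of_real (kappa lam mu L i) = kap (cn L i)"
    "complex_of_real (kappa lam mu L (Suc i)) = kap (cn L (Suc i))"
    using kappa_eq(1)[OF bij] i by auto
  have fin: "finite (adj i ` S)" using S finite_subset by blast
  have mem: "i \<in> adj i ` S \<longleftrightarrow> Suc i \<in> S"
    by (simp add: adj_image_mem)
  show ?thesis
    unfolding H_ops lin_ext_cv[OF L S] hat_s_def Let_def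
    using k Ycoeff_eq[OF bij i] cl_sgn_pair[OF fin, of i] mem
    by (simp add: al_def be_def cvv_def swap_labels_eq add.commute)
qed

lemma cv_supported: "std L \<Longrightarrow> S \<subseteq> {1..d} \<Longrightarrow> P L S \<Longrightarrow> cv S L \<in> supported d lam mu P"
  by (auto simp: supported_def cv_def split: if_splits)

lemma cvv_supported: "(std L \<Longrightarrow> P L S) \<Longrightarrow> S \<subseteq> {1..d} \<Longrightarrow> cvv S L \<in> supported d lam mu P"
  by (auto simp: cvv_def cv_supported) (auto simp: supported_def zero_fun_apply)

lemma supported_subspace: "HV.subspace (supported d lam mu P)"
proof (rule HV.subspaceI)
  fix f g assume fg: "f \<in> supported d lam mu P" "g \<in> supported d lam mu P"
  show "f + g \<in> supported d lam mu P"
    unfolding supported_def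
  proof (intro CollectI allI impI)
    fix L S assume "(f + g) L S \<noteq> 0"
    hence "f L S \<noteq> 0 \<or> g L S \<noteq> 0" by (auto simp: plus_fun_apply)
    with fg show "std L \<and> S \<subseteq> {1..d} \<and> P L S" unfolding supported_def by blast
  qed
qed (auto simp: supported_def hscale_apply zero_fun_apply)

lemma supported_expand:
  assumes "f \<in> supported d lam mu P"
  shows "f = (\<Sum>(L, S)\<in>{(L, S). std L \<and> S \<subseteq> {1..d} \<and> P L S}. hscale (f L S) (cv S L))"
proof (intro ext)
  fix L S
  let ?I = "{(L, S). std L \<and> S \<subseteq> {1..d} \<and> P L S}"
  have fin: "finite ?I"
    by (rule finite_subset[of _ "{L. std L} \<times> Pow {1..d}"]) (auto simp: finite_standard_fillings)
  have "(\<Sum>(L', S')\<in>?I. hscale (f L' S') (cv S' L')) L S =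
      (\<Sum>p\<in>?I. if p = (L, S) then f L S else 0)"
    unfolding sum_hvec_apply by (rule sum.cong) (auto simp: cv_def hscale_apply split: if_splits)
  also have "\<dots> = f L S"
    using assms fin by (auto simp: sum.delta supported_def)
  finally show "f L S = (\<Sum>(L', S')\<in>?I. hscale (f L' S') (cv S' L')) L S" by simp
qed

lemma hlin_supported:
  assumes F: "hlin F" and W: "HV.subspace W"
    and b: "\<And>L S. std L \<Longrightarrow> S \<subseteq> {1..d} \<Longrightarrow> P L S \<Longrightarrow> F (cv S L) \<in> W"
    and f: "f \<in> supported d lam mu P"
  shows "F f \<in> W"
proof -
  have "F f = (\<Sum>p\<in>{(L, S). std L \<and> S \<subseteq> {1..d} \<and> P L S}. hscale (f (fst p) (snd p)) (F (cv (snd p) (fst p))))"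
    by (subst supported_expand[OF f]) (simp add: hlin_sum[OF F] hlinD(2)[OF F] case_prod_beta)
  also have "\<dots> \<in> W"
    using b by (intro HV.subspace_sum[OF W] HV.subspace_scale[OF W]) auto
  finally show ?thesis .
qed

lemma hlin_eq:
  assumes "hlin F" "hlin G" and "\<And>L S. std L \<Longrightarrow> S \<subseteq> {1..d} \<Longrightarrow> F (cv S L) = G (cv S L)"
    and f: "f \<in> carr H"
  shows "F f = G f"
proof -
  have "F f - G f \<in> {0}"
  proof (rule hlin_supported[OF hlin_diff[OF assms(1,2)] HV.subspace_single_0])
    show "f \<in> supported d lam mu (\<lambda>L S. True)" using f by (simp add: H_simps)
    show "F (cv S L) - G (cv S L) \<in> {0}" if "std L" "S \<subseteq> {1..d}" for L S
      unfolding assms(3)[OF that] by simp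
  qed
  thus ?thesis by simp
qed

lemma sym_diff_subset: "S \<subseteq> {1..d} \<Longrightarrow> 1 \<le> i \<Longrightarrow> i \<le> d \<Longrightarrow> sym_diff {i} S \<subseteq> {1..d}"
  by auto

lemma adj_image_subset: "S \<subseteq> {1..d} \<Longrightarrow> 1 \<le> i \<Longrightarrow> i < d \<Longrightarrow> adj i ` S \<subseteq> {1..d}"
  by (auto simp: transpose_def)

lemma card_adj_image: "card (adj i ` S) = card S"
  by (rule card_image) (simp add: inj_on_def adj_eq_iff)

lemma even_card_sym_diff:
  assumes "finite S"
  shows "even (card (sym_diff {i} S)) \<longleftrightarrow> odd (card S)"
proof (cases "i \<in> S")
  case True
  hence "sym_diff {i} S = S - {i}" by auto
  moreover have "card S > 0" using True assms card_gt_0_iff by blast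
  ultimately show ?thesis using True by (simp add: card_Diff_singleton)
next
  case False
  hence "sym_diff {i} S = insert i S" by auto
  thus ?thesis using False assms by simp
qed

lemma H_ops_supported:
  assumes W: "W = supported d lam mu P" and f: "f \<in> supported d lam mu Q"
  shows "1 \<le> i \<Longrightarrow> i \<le> d \<Longrightarrow> (\<And>L S. Q L S \<Longrightarrow> S \<subseteq> {1..d} \<Longrightarrow> P L S) \<Longrightarrow> HX i f \<in> W"
    and "1 \<le> i \<Longrightarrow> i \<le> d \<Longrightarrow> (\<And>L S. Q L S \<Longrightarrow> S \<subseteq> {1..d} \<Longrightarrow> P L (sym_diff {i} S)) \<Longrightarrow> HC i f \<in> W"
    and "1 \<le> i \<Longrightarrow> i < d \<Longrightarrow> (\<And>L S T. Q L S \<Longrightarrow> S \<subseteq> {1..d} \<Longrightarrow> T \<subseteq> {1..d} \<Longrightarrow>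
        even (card T) = even (card S) \<Longrightarrow> P L T \<and> P (adj i \<circ> L) T) \<Longrightarrow> HS i f \<in> W"
proof -
  note sub = supported_subspace[of P]
  show "HX i f \<in> W" if "1 \<le> i" "i \<le> d" "\<And>L S. Q L S \<Longrightarrow> S \<subseteq> {1..d} \<Longrightarrow> P L S"
    unfolding W using that
    by (intro hlin_supported[OF hlin_ops(2) sub _ f])
      (simp add: HX_cv HV.subspace_scale[OF sub] cv_supported)
  show "HC i f \<in> W" if "1 \<le> i" "i \<le> d" "\<And>L S. Q L S \<Longrightarrow> S \<subseteq> {1..d} \<Longrightarrow> P L (sym_diff {i} S)"
    unfolding W
  proof (rule hlin_supported[OF hlin_ops(3) sub _ f])
    fix L S assume LS: "std L" "S \<subseteq> {1..d}" "Q L S"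
    show "HC i (cv S L) \<in> supported d lam mu P"
      unfolding HC_cv[OF LS(1,2) that(1,2)]
      by (intro HV.subspace_scale[OF sub] cv_supported LS that sym_diff_subset)
  qed
  show "HS i f \<in> W" if i: "1 \<le> i" "i < d" and PQ: "\<And>L S T. Q L S \<Longrightarrow> S \<subseteq> {1..d} \<Longrightarrow> T \<subseteq> {1..d} \<Longrightarrow>
        even (card T) = even (card S) \<Longrightarrow> P L T \<and> P (adj i \<circ> L) T"
    unfolding W
  proof (rule hlin_supported[OF hlin_ops(1) sub _ f])
    fix L S assume LS: "std L" "S \<subseteq> {1..d}" "Q L S"
    have a: "adj i ` S \<subseteq> {1..d}" using adj_image_subset[OF LS(2) i] .
    hence fin: "finite (adj i ` S)" using finite_subset by blast
    have e: "sym_diff (adj i ` S) {i, Suc i} = sym_diff {i} (sym_diff {Suc i} (adj i ` S))" by auto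
    have e2: "even (card (sym_diff (adj i ` S) {i, Suc i})) = even (card S)"
      unfolding e using fin by (simp add: even_card_sym_diff card_adj_image)
    have sub2: "sym_diff (adj i ` S) {i, Suc i} \<subseteq> {1..d}" using a i by auto
    show "HS i (cv S L) \<in> supported d lam mu P"
      unfolding HS_cv[OF LS(1,2) i]
      using PQ[OF LS(3,2) a] PQ[OF LS(3,2) sub2 e2] a sub2 LS
      by (intro HV.subspace_scale[OF sub] HV.subspace_add[OF sub] cv_supported cvv_supported)
        (simp_all add: card_adj_image)
  qed
qed

lemma csign_sym_diff:
  assumes "finite S"
  shows "csign j (sym_diff {k} S) = (if k \<le> j then - csign j S else csign j S)"
proof (cases "k \<in> S")
  case True
  hence "sym_diff {k} S = S - {k}" "S = insert k (S - {k})" by auto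
  moreover have "csign j (insert k (S - {k})) = (if k \<le> j then - csign j (S - {k}) else csign j (S - {k}))"
    using assms by (intro csign_insert) auto
  ultimately show ?thesis by (auto split: if_splits)
next
  case False
  hence "sym_diff {k} S = insert k S" by auto
  thus ?thesis using csign_insert[OF False assms] by simp
qed

lemma csign_sq [simp]: "csign j S * csign j S = 1"
  unfolding csign_def power_mult_distrib[symmetric] by simp

lemma csign_Suc:
  assumes "finite S"
  shows "csign (Suc j) S = (if Suc j \<in> S then - csign j S else csign j S)"
proof -
  have "{a \<in> S. a \<le> Suc j} = (if Suc j \<in> S then insert (Suc j) {a \<in> S. a \<le> j} else {a \<in> S. a \<le> j})"
    by (auto simp: le_Suc_eq)
  thus ?thesis using assms by (simp add: csign_def)
qed

lemma csign_adj:
  assumes "finite S" "j \<noteq> i"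
  shows "csign j (adj i ` S) = csign j S"
proof -
  have le: "adj i a \<le> j \<longleftrightarrow> a \<le> j" for a using assms(2) by (auto simp: transpose_def)
  have "{a \<in> adj i ` S. a \<le> j} = adj i ` {a \<in> S. a \<le> j}" using le by auto
  thus ?thesis by (simp add: csign_def card_adj_image)
qed

lemma adj_image_sym_diff: "adj i ` sym_diff {k} S = sym_diff {adj i k} (adj i ` S)"
  by (auto simp: adj_image_mem adj_eq_iff)

end

context shape
begin

lemma cv_carr: "std L \<Longrightarrow> S \<subseteq> {1..d} \<Longrightarrow> cv S L \<in> carr H"
  by (simp add: H_simps cv_supported)

lemma vv_carr: "vv L \<in> carr H"
  by (simp add: vv_def cv_carr) (simp add: H_simps supported_def zero_fun_apply)

lemma carr_closed:
  "f \<in> carr H \<Longrightarrow> g \<in> carr H \<Longrightarrow> f + g \<in> carr H"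
  "f \<in> carr H \<Longrightarrow> hscale a f \<in> carr H"
  using HV.subspace_add[OF supported_subspace] HV.subspace_scale[OF supported_subspace]
  by (simp_all add: H_simps)

lemma H_even_map_X: "1 \<le> i \<Longrightarrow> i \<le> d \<Longrightarrow> even_map H H (HX i)"
  unfolding even_map_def linear_map_def H_simps
  by (auto simp: hlinD(1,2)[OF hlin_ops(2)] intro!: H_ops_supported(1)[OF refl])

lemma H_odd_map_C: "1 \<le> i \<Longrightarrow> i \<le> d \<Longrightarrow> odd_map H H (HC i)"
proof -
  assume i: "1 \<le> i" "i \<le> d"
  have e: "even (card (sym_diff {i} S)) \<longleftrightarrow> odd (card S)" if "S \<subseteq> {1..d}" for S
    by (rule even_card_sym_diff, rule finite_subset[OF that]) simp
  have "HC i f \<in> supported d lam mu (\<lambda>L S. odd (card S))"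
    if "f \<in> supported d lam mu (\<lambda>L S. even (card S))" for f
    by (rule H_ops_supported(2)[OF refl that i]) (simp only: e simp_thms not_not)
  moreover have "HC i f \<in> supported d lam mu (\<lambda>L S. even (card S))"
    if "f \<in> supported d lam mu (\<lambda>L S. odd (card S))" for f
    by (rule H_ops_supported(2)[OF refl that i]) (simp only: e simp_thms not_not)
  moreover have "HC i f \<in> supported d lam mu (\<lambda>L S. True)"
    if "f \<in> supported d lam mu (\<lambda>L S. True)" for f
    by (rule H_ops_supported(2)[OF refl that i]) (rule TrueI)
  ultimately show ?thesis
    unfolding odd_map_def linear_map_def H_simps
    by (auto simp: hlinD(1,2)[OF hlin_ops(3)])
qed

lemma H_even_map_S: "1 \<le> i \<Longrightarrow> i < d \<Longrightarrow> even_map H H (HS i)"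
proof -
  assume i: "1 \<le> i" "i < d"
  have "HS i f \<in> supported d lam mu (\<lambda>L S. even (card S))"
    if "f \<in> supported d lam mu (\<lambda>L S. even (card S))" for f
    by (rule H_ops_supported(3)[OF refl that i]) simp
  moreover have "HS i f \<in> supported d lam mu (\<lambda>L S. odd (card S))"
    if "f \<in> supported d lam mu (\<lambda>L S. odd (card S))" for f
    by (rule H_ops_supported(3)[OF refl that i]) simp
  moreover have "HS i f \<in> supported d lam mu (\<lambda>L S. True)"
    if "f \<in> supported d lam mu (\<lambda>L S. True)" for f
    by (rule H_ops_supported(3)[OF refl that i]) simp
  ultimately show ?thesis
    unfolding even_map_def linear_map_def H_simps
    by (auto simp: hlinD(1,2)[OF hlin_ops(1)])
qed

lemma C_carr: "1 \<le> i \<Longrightarrow> i \<le> d \<Longrightarrow> f \<in> carr H \<Longrightarrow> HC i f \<in> carr H"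
  using H_odd_map_C[of i] by (simp add: odd_map_def linear_map_def image_subset_iff)

lemma X_carr: "1 \<le> i \<Longrightarrow> i \<le> d \<Longrightarrow> f \<in> carr H \<Longrightarrow> HX i f \<in> carr H"
  using H_even_map_X[of i] by (simp add: even_map_def linear_map_def image_subset_iff)

lemma S_carr: "1 \<le> i \<Longrightarrow> i < d \<Longrightarrow> f \<in> carr H \<Longrightarrow> HS i f \<in> carr H"
  using H_even_map_S[of i] by (simp add: even_map_def linear_map_def image_subset_iff)

lemma H_super_space: "super_space H"
proof -
  let ?E = "supported d lam mu (\<lambda>L S. even (card S))"
  let ?O = "supported d lam mu (\<lambda>L S. odd (card S))"
  let ?V = "supported d lam mu (\<lambda>L S. True)"
  have int: "?E \<inter> ?O = {0}"
  proof
    show "?E \<inter> ?O \<subseteq> {0}"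
    proof
      fix f assume f: "f \<in> ?E \<inter> ?O"
      have "f L S = 0" for L S using f unfolding supported_def by blast
      hence "f = 0" by (intro ext) (simp add: zero_fun_apply)
      thus "f \<in> {0}" by simp
    qed
  qed (simp add: supported_def zero_fun_apply)
  have sum: "?V = {u + v | u v. u \<in> ?E \<and> v \<in> ?O}"
  proof
    show "{u + v | u v. u \<in> ?E \<and> v \<in> ?O} \<subseteq> ?V"
    proof clarify
      fix u v assume "u \<in> ?E" "v \<in> ?O"
      hence "u \<in> ?V" "v \<in> ?V" by (simp_all add: supported_def)
      thus "u + v \<in> ?V" by (rule HV.subspace_add[OF supported_subspace])
    qed
    show "?V \<subseteq> {u + v | u v. u \<in> ?E \<and> v \<in> ?O}"
    proof
      fix f assume f: "f \<in> ?V"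
      define u v :: hvec where "u L S = (if even (card S) then f L S else 0)"
        and "v L S = (if even (card S) then 0 else f L S)" for L S
      have "u \<in> ?E" "v \<in> ?O" using f by (auto simp: supported_def u_def v_def)
      moreover have "f = u + v" by (intro ext) (simp add: u_def v_def plus_fun_apply)
      ultimately show "f \<in> {u + v | u v. u \<in> ?E \<and> v \<in> ?O}" by blast
    qed
  qed
  let ?B = "(\<lambda>(L, S). cv S L) ` ({L. std L} \<times> Pow {1..d})"
  have finB: "finite ?B" by (intro finite_imageI finite_cartesian_product finite_standard_fillings) simp
  have "?V = HV.span ?B"
  proof
    show "HV.span ?B \<subseteq> ?V"
    proof (rule HV.span_minimal[OF _ supported_subspace], rule subsetI)
      fix x assume "x \<in> ?B"
      then obtain L S where "std L" "S \<subseteq> {1..d}" "x = cv S L" by auto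
      thus "x \<in> ?V" using cv_supported[of L S "\<lambda>L S. True"] by simp
    qed
    show "?V \<subseteq> HV.span ?B"
    proof
      fix f assume f: "f \<in> ?V"
      show "f \<in> HV.span ?B"
        by (rule hlin_supported[OF hlin_id HV.subspace_span _ f]) (auto intro!: HV.span_base)
    qed
  qed
  with finB have "\<exists>B. finite B \<and> ?V = HV.span B" by blast
  thus ?thesis
    unfolding super_space_def H_simps
    using vector_space_hscale supported_subspace int sum by simp
qed

subsection \<open>The defining relations\<close>

lemma sym_diff_twice: "sym_diff A (sym_diff A B) = B"
  and sym_diff_left_commute: "sym_diff A (sym_diff B D) = sym_diff B (sym_diff A D)"
  by auto

lemma scale_C: "HC i (hscale a f) = hscale a (HC i f)"
  and scale_X: "HX i (hscale a f) = hscale a (HX i f)"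
  and scale_S: "HS i (hscale a f) = hscale a (HS i f)"
  by (rule hlinD(2)[OF hlin_ops(3)], rule hlinD(2)[OF hlin_ops(2)], rule hlinD(2)[OF hlin_ops(1)])

lemma H_x_x:
  assumes "f \<in> carr H" "1 \<le> i" "i \<le> d" "1 \<le> j" "j \<le> d"
  shows "HX i (HX j f) = HX j (HX i f)"
proof (rule hlin_eq[OF hlin_comp[OF hlin_ops(2,2)] hlin_comp[OF hlin_ops(2,2)] _ assms(1)])
  fix L S assume LS: "std L" "S \<subseteq> {1..d}"
  show "HX i (HX j (cv S L)) = HX j (HX i (cv S L))"
    unfolding HX_cv[OF LS assms(2,3)] HX_cv[OF LS assms(4,5)] scale_X
    by (simp only: HX_cv[OF LS assms(2,3)] HX_cv[OF LS assms(4,5)] HV.scale_scale mult_ac)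
qed

lemma H_c_sq:
  assumes "f \<in> carr H" "1 \<le> i" "i \<le> d"
  shows "HC i (HC i f) = - f"
proof (rule hlin_eq[OF hlin_comp[OF hlin_ops(3,3)] hlin_neg[OF hlin_id] _ assms(1)])
  fix L S assume LS: "std L" "S \<subseteq> {1..d}"
  have fin: "finite S" by (rule finite_subset[OF LS(2)]) simp
  show "HC i (HC i (cv S L)) = - cv S L"
    unfolding HC_cv[OF LS assms(2,3)] scale_C
      HC_cv[OF LS(1) sym_diff_subset[OF LS(2) assms(2,3)] assms(2,3)] sym_diff_twice
    by (simp add: csign_sym_diff[OF fin])
qed

lemma H_c_c:
  assumes "f \<in> carr H" and i: "1 \<le> i" "i \<le> d" and j: "1 \<le> j" "j \<le> d" and "i \<noteq> j"
  shows "HC i (HC j f) = - HC j (HC i f)"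
proof (rule hlin_eq[OF hlin_comp[OF hlin_ops(3,3)] hlin_neg[OF hlin_comp[OF hlin_ops(3,3)]] _ assms(1)])
  fix L S assume LS: "std L" "S \<subseteq> {1..d}"
  have fin: "finite S" by (rule finite_subset[OF LS(2)]) simp
  show "HC i (HC j (cv S L)) = - HC j (HC i (cv S L))"
    unfolding HC_cv[OF LS i] HC_cv[OF LS j] scale_C
      HC_cv[OF LS(1) sym_diff_subset[OF LS(2) j] i] HC_cv[OF LS(1) sym_diff_subset[OF LS(2) i] j]
      sym_diff_left_commute[of "{i}" "{j}"]
    using \<open>i \<noteq> j\<close> by (simp add: csign_sym_diff[OF fin] mult.commute)
qed

lemma H_c_x:
  assumes "f \<in> carr H" and i: "1 \<le> i" "i \<le> d" and j: "1 \<le> j" "j \<le> d"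
  shows "HC j (HX i f) = (if i = j then - HX i (HC j f) else HX i (HC j f))"
proof -
  have "HC j (HX i f) = hscale (if i = j then -1 else 1) (HX i (HC j f))"
  proof (rule hlin_eq[OF hlin_comp[OF hlin_ops(3,2)] hlin_scale[OF hlin_comp[OF hlin_ops(2,3)]] _ assms(1)])
    fix L S assume LS: "std L" "S \<subseteq> {1..d}"
    show "HC j (HX i (cv S L)) = hscale (if i = j then -1 else 1) (HX i (HC j (cv S L)))"
      unfolding HC_cv[OF LS j] HX_cv[OF LS i] scale_C scale_X
        HX_cv[OF LS(1) sym_diff_subset[OF LS(2) j] i]
      by (auto simp: mult_ac)
  qed
  thus ?thesis by simp
qed

lemma H_s_c:
  assumes f: "f \<in> carr H" and i: "1 \<le> i" "i < d" and j: "1 \<le> j" "j \<le> d"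
  shows "HS i (HC j f) = HC (adj i j) (HS i f)"
proof (rule hlin_eq[OF hlin_comp[OF hlin_ops(1,3)] hlin_comp[OF hlin_ops(3,1)] _ f])
  fix L S assume LS: "std L" "S \<subseteq> {1..d}"
  let ?j = "adj i j" and ?T = "adj i ` S" and ?K = "adj i \<circ> L"
  let ?U = "sym_diff (adj i ` S) {i, Suc i}"
  have j': "1 \<le> ?j" "?j \<le> d" using i j by (auto simp: transpose_def)
  have T: "?T \<subseteq> {1..d}" using adj_image_subset[OF LS(2) i] .
  have U: "?U \<subseteq> {1..d}" using T i by auto
  have fS: "finite S" by (rule finite_subset[OF LS(2)]) simp
  hence fT: "finite ?T" by simp
  have Ue: "?U = sym_diff {i} (sym_diff {Suc i} ?T)" by auto
  have csU: "csign ?j ?U = (if ?j = i then - csign ?j ?T else csign ?j ?T)"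
    unfolding Ue using fT by (simp add: csign_sym_diff)
  have TjU: "sym_diff (sym_diff {?j} ?T) {i, Suc i} = sym_diff {?j} ?U" by auto
  have Cvv: "HC ?j (cvv ?T ?K) = hscale (csign ?j ?T) (cvv (sym_diff {?j} ?T) ?K)"
    using HC_cv[OF _ T j', of ?K] by (simp add: cvv_def hlinD(3)[OF hlin_ops(3)])
  define eS eJ hS hJ :: complex where "eS = (if i \<in> S \<and> Suc i \<in> S then -1 else 1)"
    and "eJ = (if i \<in> sym_diff {j} S \<and> Suc i \<in> sym_diff {j} S then -1 else 1)"
    and "hS = (if Suc i \<in> S then -1 else 1)" and "hJ = (if Suc i \<in> sym_diff {j} S then -1 else 1)"
  have E1: "csign j S * eJ = eS * csign ?j ?T"
  proof -
    consider "j = i" | "j = Suc i" | "j \<noteq> i" "j \<noteq> Suc i" by blast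
    thus ?thesis
    proof cases
      case 1
      have "csign (Suc i) ?T = csign (Suc i) S" using csign_adj[OF fS, of "Suc i" i] by simp
      thus ?thesis using 1 csign_Suc[OF fS, of i] by (auto simp: eS_def eJ_def)
    next
      case 2
      have "csign (Suc i) ?T = csign (Suc i) S" using csign_adj[OF fS, of "Suc i" i] by simp
      moreover have "csign (Suc i) ?T = (if i \<in> S then - csign i ?T else csign i ?T)"
        using csign_Suc[OF fT, of i] by (simp add: adj_image_mem)
      ultimately have "csign (Suc i) S = (if i \<in> S then - csign i ?T else csign i ?T)" by simp
      thus ?thesis using 2 by (simp add: eS_def eJ_def)
    next
      case 3
      thus ?thesis using csign_adj[OF fS, of j i] by (auto simp: eS_def eJ_def)
    qed
  qed
  have hh: "hJ = (if ?j = i then - hS else hS)"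
    by (auto simp: hS_def hJ_def transpose_def)
  have E2: "csign j S * eJ * hJ = eS * hS * csign ?j ?U"
    unfolding E1 hh csU by simp
  let ?al = "al (cn L i) (cn L (Suc i))" and ?be = "be (cn L i) (cn L (Suc i))"
  let ?y = "ycf (cn L i) (cn L (Suc i))"
  have lhs: "HS i (HC j (cv S L)) = hscale (csign j S) (hscale eJ
      (hscale ?al (cv (sym_diff {?j} ?T) L) + hscale (?be * hJ) (cv (sym_diff {?j} ?U) L)
       + hscale ?y (cvv (sym_diff {?j} ?T) ?K)))"
    unfolding HC_cv[OF LS j] scale_S HS_cv[OF LS(1) sym_diff_subset[OF LS(2) j] i]
      adj_image_sym_diff TjU eJ_def hJ_def ..
  have rhs: "HC ?j (HS i (cv S L)) = hscale eS
      (hscale ?al (hscale (csign ?j ?T) (cv (sym_diff {?j} ?T) L))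
       + hscale (?be * hS) (hscale (csign ?j ?U) (cv (sym_diff {?j} ?U) L))
       + hscale ?y (hscale (csign ?j ?T) (cvv (sym_diff {?j} ?T) ?K)))"
    unfolding HS_cv[OF LS i] eS_def[symmetric] hS_def[symmetric] scale_C hlinD(1)[OF hlin_ops(3)]
      HC_cv[OF LS(1) T j'] HC_cv[OF LS(1) U j'] Cvv ..
  have r: "csign j S * (eJ * ?al) = eS * (?al * csign ?j ?T)"
    "csign j S * (eJ * (?be * hJ)) = eS * (?be * hS * csign ?j ?U)"
    "csign j S * (eJ * ?y) = eS * (?y * csign ?j ?T)"
  proof -
    show "csign j S * (eJ * ?al) = eS * (?al * csign ?j ?T)"
      unfolding mult.assoc[symmetric] E1 by (simp only: mult_ac)
    show "csign j S * (eJ * ?y) = eS * (?y * csign ?j ?T)"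
      unfolding mult.assoc[symmetric] E1 by (simp only: mult_ac)
    have "csign j S * (eJ * (?be * hJ)) = csign j S * eJ * hJ * ?be" by (simp only: mult_ac)
    also have "\<dots> = eS * (?be * hS * csign ?j ?U)" unfolding E2 by (simp only: mult_ac)
    finally show "csign j S * (eJ * (?be * hJ)) = eS * (?be * hS * csign ?j ?U)" .
  qed
  show "HS i (HC j (cv S L)) = HC ?j (HS i (cv S L))"
    unfolding lhs rhs HV.scale_right_distrib HV.scale_scale r ..
qed

lemma H_s_x_other:
  assumes f: "f \<in> carr H" and i: "1 \<le> i" "i < d" and j: "1 \<le> j" "j \<le> d" "j \<noteq> i" "j \<noteq> Suc i"
  shows "HS i (HX j f) = HX j (HS i f)"
proof (rule hlin_eq[OF hlin_comp[OF hlin_ops(1,2)] hlin_comp[OF hlin_ops(2,1)] _ f])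
  fix L S assume LS: "std L" "S \<subseteq> {1..d}"
  let ?T = "adj i ` S" and ?K = "adj i \<circ> L"
  let ?U = "sym_diff (adj i ` S) {i, Suc i}"
  have T: "?T \<subseteq> {1..d}" using adj_image_subset[OF LS(2) i] .
  have U: "?U \<subseteq> {1..d}" using T i by auto
  have mem: "j \<in> ?T \<longleftrightarrow> j \<in> S" "j \<in> ?U \<longleftrightarrow> j \<in> S" using j by (auto simp: adj_image_mem)
  let ?e = "(if j \<in> S then -1 else 1) * kap (cn L j)"
  have "inv (adj i) j = j"
    using j by (metis inv_unique_comp transpose_apply_other transpose_comp_involutory)
  hence "cn ?K j = cn L j"
    using cont_comp[OF standard_bij[OF LS(1)] adj_permutes[OF i], of j] j by simp
  hence vv: "HX j (cvv ?T ?K) = hscale ?e (cvv ?T ?K)"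
    using HX_cv[OF _ T j(1,2), of ?K] mem by (simp add: cvv_def hlinD(3)[OF hlin_ops(2)])
  have 1: "HX j (cv ?T L) = hscale ?e (cv ?T L)" "HX j (cv ?U L) = hscale ?e (cv ?U L)"
    unfolding HX_cv[OF LS(1) T j(1,2)] HX_cv[OF LS(1) U j(1,2)] mem by (rule refl)+
  show "HS i (HX j (cv S L)) = HX j (HS i (cv S L))"
    unfolding HX_cv[OF LS j(1,2)] scale_S HS_cv[OF LS i] scale_X hlinD(1)[OF hlin_ops(2)] 1 vv
    by (simp only: HV.scale_right_distrib HV.scale_scale mult_ac)
qed

text \<open>Since the \<open>c\<^sub>S v\<^sub>L\<close> arise from the \<open>v\<^sub>L\<close> by Clifford generators, a relation that is compatible
  with these has to be checked on the \<open>v\<^sub>L\<close> only.\<close>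

lemma vanish_by_Clifford:
  assumes F: "hlin F" and step: "\<And>j f. 1 \<le> j \<Longrightarrow> j \<le> d \<Longrightarrow> f \<in> carr H \<Longrightarrow> F f = 0 \<Longrightarrow> F (HC j f) = 0"
    and base: "\<And>L. std L \<Longrightarrow> F (vv L) = 0" and f: "f \<in> carr H"
  shows "F f = 0"
proof (rule hlin_eq[OF F hlin_zero _ f])
  fix L S assume L: "std L" and S: "S \<subseteq> {1..d}"
  have "finite S" by (rule finite_subset[OF S]) simp
  thus "F (cv S L) = 0" using S
  proof (induction rule: finite_linorder_min_induct)
    case empty
    thus ?case using base[OF L] L by (simp add: vv_def)
  next
    case (insert b A)
    have b: "1 \<le> b" "b \<le> d" and A: "A \<subseteq> {1..d}" using insert by auto
    have "csign b A = 1" using csign_below insert.hyps by blast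
    moreover have "sym_diff {b} A = insert b A" using insert.hyps by auto
    ultimately have "cv (insert b A) L = HC b (cv A L)"
      using HC_cv[OF L A b] by simp
    moreover have "F (cv A L) = 0" using insert.IH A by blast
    ultimately show ?case using step[OF b cv_carr[OF L A]] by (simp only:)
  qed
qed

lemma cont_adj:
  assumes "bij_filling d lam mu L" "1 \<le> i" "i < d" "1 \<le> k" "k \<le> d"
  shows "cn (adj i \<circ> L) k = cn L (adj i k)"
proof -
  have "inv (adj i) = adj i" by (rule inv_unique_comp) (simp_all add: fun_eq_iff)
  thus ?thesis using cont_comp[OF assms(1) adj_permutes[OF assms(2,3)]] assms(4,5) by simp
qed

lemma HX_vv:
  assumes "bij_filling d lam mu L" "1 \<le> i" "i \<le> d"
  shows "HX i (vv L) = hscale (kap (cn L i)) (vv L)"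
  using HX_cv[of L "{}" i] assms by (simp add: vv_def hlinD(3)[OF hlin_ops(2)])

text \<open>Treating the vectors of nonstandard fillings as zero makes the formula uniform: where a
  swap leads back into the standard fillings the coefficient vanishes.\<close>

lemma HS_vv:
  assumes L: "bij_filling d lam mu L" and i: "1 \<le> i" "i < d"
  shows "HS i (vv L) = hscale (al (cn L i) (cn L (Suc i))) (vv L)
     + hscale (be (cn L i) (cn L (Suc i))) (HC i (HC (Suc i) (vv L)))
     + hscale (ycf (cn L i) (cn L (Suc i))) (vv (adj i \<circ> L))"
proof (cases "std L")
  case True
  have i': "i \<le> d" "1 \<le> Suc i" "Suc i \<le> d" using i by auto
  have "HC i (HC (Suc i) (cv {} L)) = cv {i, Suc i} L"
    using HC_cv[OF True _ i'(2,3), of "{}"] HC_cv[OF True _ i(1) i'(1), of "{Suc i}"] i i'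
      csign_below[of "{Suc i}" i] by (simp add: insert_commute)
  thus ?thesis
    using HS_cv[OF True _ i, of "{}"] True by (simp add: vv_def cvv_def)
next
  case False
  have "hscale (ycf (cn L i) (cn L (Suc i))) (vv (adj i \<circ> L)) = 0"
  proof (cases "std (adj i \<circ> L)")
    case True
    have "ycf (cn L i) (cn L (Suc i)) = 0"
      using nonstandard_swap[OF sk L i False True] ycf_eq_0_iff by blast
    thus ?thesis by simp
  qed (simp add: vv_def)
  with False show ?thesis
    by (simp add: vv_def hlinD(3)[OF hlin_ops(1)] hlinD(3)[OF hlin_ops(3)])
qed

text \<open>
  The off-diagonal terms cancel since \<open>al\<close> changes sign when the two contents are exchanged and
  \<open>c\<^sub>i c\<^bsub>i+1\<^esub>\<close> anticommutes with \<open>s\<^sub>i\<close>. What remains is the sum of the squares of the three coefficients,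
  which is one.
\<close>

lemma H_s_s:
  assumes f: "f \<in> carr H" and i: "1 \<le> i" "i < d"
  shows "HS i (HS i f) = f"
proof -
  have i': "i \<le> d" "1 \<le> Suc i" "Suc i \<le> d" using i by auto
  have "HS i (HS i f) - f = 0"
  proof (rule vanish_by_Clifford[OF hlin_diff[OF hlin_comp[OF hlin_ops(1,1)] hlin_id] _ _ f])
    fix j f assume j: "1 \<le> j" "j \<le> d" and f: "f \<in> carr H" "HS i (HS i f) - f = 0"
    have j': "1 \<le> adj i j" "adj i j \<le> d" using i j by (auto simp: transpose_def)
    have "HS i (HS i (HC j f)) = HC j (HS i (HS i f))"
      using H_s_c[OF f(1) i j] H_s_c[OF S_carr[OF i f(1)] i j'] by simp
    thus "HS i (HS i (HC j f)) - HC j f = 0" using f(2) by simp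
  next
    fix L assume L: "std L"
    let ?a = "cn L i" and ?b = "cn L (Suc i)" and ?K = "adj i \<circ> L"
    let ?P = "\<lambda>f. HC i (HC (Suc i) f)"
    note bij = standard_bij[OF L]
    have ne: "?a \<noteq> ?b" using standard_adjacent_contents[OF sk L i] .
    have K: "cn ?K i = ?b" "cn ?K (Suc i) = ?a" using cont_adj[OF bij i] i by auto
    have KK: "adj i \<circ> ?K = L" by (rule adj_adj_comp)
    have hP: "hlin ?P" by (rule hlin_comp[OF hlin_ops(3,3)])
    have PP: "?P (?P f) = - f" if "f \<in> carr H" for f
    proof -
      have c: "HC (Suc i) (HC i (HC (Suc i) f)) = HC i f"
        using H_c_c[OF C_carr[OF i'(2,3) that] i'(2,3) i(1) i'(1)] H_c_sq[OF that i'(2,3)]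
        by (simp add: hlinD(4)[OF hlin_ops(3)])
      show ?thesis unfolding c using H_c_sq[OF that i(1) i'(1)] .
    qed
    have SP: "HS i (?P f) = - ?P (HS i f)" if "f \<in> carr H" for f
      using H_s_c[OF C_carr[OF i'(2,3) that] i i(1) i'(1)] H_s_c[OF that i i'(2,3)]
        H_c_c[OF S_carr[OF i that] i'(2,3) i(1) i'(1)] by simp
    have SL: "HS i (vv L) = hscale (al ?a ?b) (vv L) + hscale (be ?a ?b) (?P (vv L)) + hscale (ycf ?a ?b) (vv ?K)"
      using HS_vv[OF bij i] .
    have SK: "HS i (vv ?K) = hscale (- al ?a ?b) (vv ?K) + hscale (be ?a ?b) (?P (vv ?K)) + hscale (ycf ?a ?b) (vv L)"
      using HS_vv[OF bij_filling_comp[OF bij adj_permutes[OF i]] i] unfolding K KK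
      by (simp add: al_def be_def ycf_sym[of ?b] add.commute minus_divide_right)
    have "HS i (HS i (vv L)) = hscale (al ?a ?b) (HS i (vv L)) - hscale (be ?a ?b) (?P (HS i (vv L)))
        + hscale (ycf ?a ?b) (HS i (vv ?K))"
      by (subst SL) (simp add: hlinD(1)[OF hlin_ops(1)] scale_S SP[OF vv_carr])
    also have "\<dots> = hscale ((al ?a ?b)\<^sup>2 + (be ?a ?b)\<^sup>2 + (ycf ?a ?b)\<^sup>2) (vv L)"
      unfolding SK unfolding SL hlinD(1)[OF hP] hlinD(2)[OF hP] PP[OF vv_carr]
      by (simp add: HV.scale_right_distrib HV.scale_right_diff_distrib HV.scale_left_distrib
          power2_eq_square mult_ac)
    also have "(al ?a ?b)\<^sup>2 + (be ?a ?b)\<^sup>2 + (ycf ?a ?b)\<^sup>2 = 1"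
      using ycf_square(2)[OF ne] by (simp add: al_def be_def)
    finally show "HS i (HS i (vv L)) - vv L = 0" by simp
  qed
  thus ?thesis by simp
qed

lemma H_s_x_left:
  assumes f: "f \<in> carr H" and i: "1 \<le> i" "i < d"
  shows "HS i (HX i f) = HX (Suc i) (HS i f) - f + HC i (HC (Suc i) f)"
proof -
  let ?j = "Suc i"
  have i': "1 \<le> i" "i \<le> d" and j: "1 \<le> ?j" "?j \<le> d" using i by auto
  note lC = hlinD(1)[OF hlin_ops(3)] hlinD(4)[OF hlin_ops(3)] hlinD(5)[OF hlin_ops(3)]
  let ?F = "\<lambda>f. HS i (HX i f) - (HX ?j (HS i f) - f + HC i (HC ?j f))"
  have hF: "hlin ?F"
    by (rule hlin_diff[OF hlin_comp[OF hlin_ops(1,2)] hlin_add[OF hlin_diff[OF hlin_comp[OF hlin_ops(2,1)] hlin_id]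
          hlin_comp[OF hlin_ops(3,3)]]])
  have "?F f = 0"
  proof (rule vanish_by_Clifford[OF hF _ _ f])
    fix k f assume k: "1 \<le> k" "k \<le> d" and f: "f \<in> carr H" "?F f = 0"
    have sf: "HS i f \<in> carr H" "HX i f \<in> carr H" "HC ?j f \<in> carr H"
      using f i i' j S_carr X_carr C_carr by auto
    have E: "HS i (HX i f) = HX ?j (HS i f) - f + HC i (HC ?j f)" using f(2) by simp
    have k': "1 \<le> adj i k" "adj i k \<le> d" using i k by (auto simp: transpose_def)
    have sxc: "HS i (HC k (HX i f)) = HC (adj i k) (HX ?j (HS i f) - f + HC i (HC ?j f))"
      unfolding H_s_c[OF sf(2) i k] E ..
    have xsc: "HX ?j (HS i (HC k f)) = HX ?j (HC (adj i k) (HS i f))"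
      unfolding H_s_c[OF f(1) i k] ..
    have cji: "HC ?j (HC i g) = - HC i (HC ?j g)" if "g \<in> carr H" for g
      using H_c_c[OF that j i'] by simp
    consider "k = i" | "k = ?j" | "k \<noteq> i" "k \<noteq> ?j" by blast
    thus "?F (HC k f) = 0"
    proof cases
      case 1
      have "HS i (HX i (HC i f)) = - HS i (HC i (HX i f))"
        using H_c_x[OF f(1) i' i'] by (simp add: hlinD(4)[OF hlin_ops(1)])
      also have "\<dots> = - HC ?j (HX ?j (HS i f)) + HC ?j f - HC ?j (HC i (HC ?j f))"
        using sxc 1 by (simp add: lC)
      also have "HC ?j (HC i (HC ?j f)) = HC i f"
        using cji[OF sf(3)] H_c_sq[OF f(1) j] by (simp add: lC)
      also have "HC ?j (HX ?j (HS i f)) = - HX ?j (HC ?j (HS i f))"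
        using H_c_x[OF sf(1) j j] by simp
      finally have A: "HS i (HX i (HC i f)) = HX ?j (HC ?j (HS i f)) + HC ?j f - HC i f" by simp
      have "HC i (HC ?j (HC i f)) = HC ?j f"
        using cji[OF f(1)] H_c_sq[OF sf(3) i'] by (simp add: lC)
      thus ?thesis using A xsc 1 by simp
    next
      case 2
      have "HS i (HX i (HC ?j f)) = HS i (HC ?j (HX i f))"
        using H_c_x[OF f(1) i' j] by simp
      also have "\<dots> = HC i (HX ?j (HS i f)) - HC i f + HC i (HC i (HC ?j f))"
        using sxc 2 by (simp add: lC)
      also have "HC i (HC i (HC ?j f)) = - HC ?j f" by (rule H_c_sq[OF sf(3) i'])
      also have "HC i (HX ?j (HS i f)) = HX ?j (HC i (HS i f))"
        using H_c_x[OF sf(1) j i'] by simp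
      finally have A: "HS i (HX i (HC ?j f)) = HX ?j (HC i (HS i f)) - HC i f - HC ?j f" by simp
      have "HC i (HC ?j (HC ?j f)) = - HC i f"
        using H_c_sq[OF f(1) j] by (simp add: lC)
      thus ?thesis using A xsc 2 by simp
    next
      case 3
      have "HS i (HX i (HC k f)) = HS i (HC k (HX i f))"
        using H_c_x[OF f(1) i' k] 3 by simp
      also have "\<dots> = HC k (HX ?j (HS i f)) - HC k f + HC k (HC i (HC ?j f))"
        using sxc 3 by (simp add: lC)
      also have "HC k (HX ?j (HS i f)) = HX ?j (HC k (HS i f))"
        using H_c_x[OF sf(1) j k] 3 by simp
      also have "HC k (HC i (HC ?j f)) = HC i (HC ?j (HC k f))"
        using H_c_c[OF sf(3) k i'] H_c_c[OF f(1) k j] 3 by (simp add: lC)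
      finally show ?thesis using xsc 3 by simp
    qed
  next
    fix L assume L: "std L"
    let ?a = "cn L i" and ?b = "cn L ?j" and ?K = "adj i \<circ> L" and ?P = "HC i (HC ?j (vv L))"
    note bij = standard_bij[OF L]
    note bijK = bij_filling_comp[OF bij adj_permutes[OF i]]
    have ne: "?a \<noteq> ?b" using standard_adjacent_contents[OF sk L i] .
    have K: "cn ?K ?j = ?a" using cont_adj[OF bij i] i by auto
    have SL: "HS i (vv L) = hscale (al ?a ?b) (vv L) + hscale (be ?a ?b) ?P + hscale (ycf ?a ?b) (vv ?K)"
      using HS_vv[OF bij i] .
    have XP: "HX ?j ?P = hscale (- kap ?b) ?P"
    proof -
      have cv: "HC ?j (vv L) \<in> carr H" using C_carr[OF j vv_carr] .
      have "HX ?j ?P = HC i (HX ?j (HC ?j (vv L)))" using H_c_x[OF cv j i'] by simp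
      also have "HX ?j (HC ?j (vv L)) = - HC ?j (HX ?j (vv L))" using H_c_x[OF vv_carr j j] by simp
      finally show ?thesis unfolding HX_vv[OF bij j] by (simp add: lC scale_C)
    qed
    let ?v = "vv L"
    have A: "HX ?j (HS i ?v) = hscale (al ?a ?b * kap ?b) ?v - hscale (be ?a ?b * kap ?b) ?P
        + hscale (ycf ?a ?b * kap ?a) (vv ?K)"
      unfolding SL using HX_vv[OF bij j] HX_vv[OF bijK j] XP K
      by (simp add: hlinD(1)[OF hlin_ops(2)] scale_X)
    have B: "HS i (HX i ?v) = hscale (al ?a ?b * kap ?a) ?v + hscale (be ?a ?b * kap ?a) ?P
        + hscale (ycf ?a ?b * kap ?a) (vv ?K)"
      unfolding HX_vv[OF bij i'] scale_S SL by (simp add: HV.scale_right_distrib mult.commute)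
    have C: "hscale (al ?a ?b * kap ?a) ?v - hscale (al ?a ?b * kap ?b) ?v = - ?v"
    proof -
      have "al ?a ?b * kap ?a - al ?a ?b * kap ?b = -1"
        using ne by (simp add: al_def divide_simps)
      thus ?thesis unfolding HV.scale_left_diff_distrib[symmetric] by simp
    qed
    have D: "hscale (be ?a ?b * kap ?a) ?P + hscale (be ?a ?b * kap ?b) ?P = ?P"
    proof -
      have "be ?a ?b * kap ?a + be ?a ?b * kap ?b = 1"
        using kap_add_nonzero[OF ne] by (simp add: be_def divide_simps)
      thus ?thesis unfolding HV.scale_left_distrib[symmetric] by simp
    qed
    have "?F ?v = (hscale (al ?a ?b * kap ?a) ?v - hscale (al ?a ?b * kap ?b) ?v)
        + (hscale (be ?a ?b * kap ?a) ?P + hscale (be ?a ?b * kap ?b) ?P) + ?v - ?P"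
      unfolding A B by (simp only: algebra_simps)
    also have "\<dots> = 0" unfolding C D by simp
    finally show "?F ?v = 0" .
  qed
  thus ?thesis by simp
qed

lemma H_s_far:
  assumes f: "f \<in> carr H" and ij: "1 \<le> i" "Suc i < j" "j < d"
  shows "HS i (HS j f) = HS j (HS i f)"
proof -
  have i: "1 \<le> i" "i < d" and j: "1 \<le> j" "j < d" using ij by auto
  have i': "i \<le> d" "1 \<le> Suc i" "Suc i \<le> d" and j': "j \<le> d" "1 \<le> Suc j" "Suc j \<le> d" using i j by auto
  have "HS i (HS j f) - HS j (HS i f) = 0"
  proof (rule vanish_by_Clifford[OF hlin_diff[OF hlin_comp[OF hlin_ops(1,1)] hlin_comp[OF hlin_ops(1,1)]] _ _ f])
    fix k f assume k: "1 \<le> k" "k \<le> d" and f: "f \<in> carr H" "HS i (HS j f) - HS j (HS i f) = 0"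
    have ki: "1 \<le> adj i k" "adj i k \<le> d" and kj: "1 \<le> adj j k" "adj j k \<le> d"
      using i j k by (auto simp: transpose_def)
    have "adj i (adj j k) = adj j (adj i k)" using ij by (auto simp: transpose_def)
    thus "HS i (HS j (HC k f)) - HS j (HS i (HC k f)) = 0"
      unfolding H_s_c[OF f(1) i k] H_s_c[OF f(1) j k]
        H_s_c[OF S_carr[OF j f(1)] i kj] H_s_c[OF S_carr[OF i f(1)] j ki]
      using f(2) by simp
  next
    fix L assume L: "std L"
    note bij = standard_bij[OF L]
    let ?I = "adj i \<circ> L" and ?J = "adj j \<circ> L"
    let ?P = "\<lambda>f. HC i (HC (Suc i) f)" and ?Q = "\<lambda>f. HC j (HC (Suc j) f)"
    have hP: "hlin ?P" and hQ: "hlin ?Q" by (rule hlin_comp[OF hlin_ops(3,3)])+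
    note bijI = bij_filling_comp[OF bij adj_permutes[OF i]]
      and bijJ = bij_filling_comp[OF bij adj_permutes[OF j]]
    have cI: "cn ?I j = cn L j" "cn ?I (Suc j) = cn L (Suc j)"
      using cont_adj[OF bij i] j ij by auto
    have cJ: "cn ?J i = cn L i" "cn ?J (Suc i) = cn L (Suc i)"
      using cont_adj[OF bij j] i ij by auto
    have IJ: "adj i \<circ> ?J = adj j \<circ> ?I" using adj_commute[OF ij(2)] .
    have cs: "HC k f \<in> carr H" if "f \<in> carr H" "1 \<le> k" "k \<le> d" for k f using C_carr that by blast
    have PQ: "?P (?Q f) = ?Q (?P f)" if f: "f \<in> carr H" for f
    proof -
      have sw: "HC k (?Q g) = ?Q (HC k g)" if "k = i \<or> k = Suc i" "g \<in> carr H" for k g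
      proof -
        have k: "1 \<le> k" "k \<le> d" "k \<noteq> j" "k \<noteq> Suc j" using that ij i by auto
        have "HC k (HC j (HC (Suc j) g)) = - HC j (HC k (HC (Suc j) g))"
          using H_c_c[OF cs[OF that(2) j'(2,3)] k(1,2) j(1) j'(1) k(3)] .
        also have "HC k (HC (Suc j) g) = - HC (Suc j) (HC k g)"
          using H_c_c[OF that(2) k(1,2) j'(2,3) k(4)] .
        finally show ?thesis by (simp add: hlinD(4)[OF hlin_ops(3)])
      qed
      show ?thesis
        using sw[of "Suc i" f] sw[of i "HC (Suc i) f"] f cs i' by simp
    qed
    have SP: "HS j (?P f) = ?P (HS j f)" if f: "f \<in> carr H" for f
      using H_s_c[OF cs[OF f i'(2,3)] j i(1) i'(1)] H_s_c[OF f j i'(2,3)] ij by simp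
    have SQ: "HS i (?Q f) = ?Q (HS i f)" if f: "f \<in> carr H" for f
      using H_s_c[OF cs[OF f j'(2,3)] i j(1) j'(1)] H_s_c[OF f i j'(2,3)] ij by simp
    let ?x = "al (cn L i) (cn L (Suc i))" and ?y = "be (cn L i) (cn L (Suc i))"
      and ?z = "ycf (cn L i) (cn L (Suc i))"
    let ?u = "al (cn L j) (cn L (Suc j))" and ?v = "be (cn L j) (cn L (Suc j))"
      and ?w = "ycf (cn L j) (cn L (Suc j))"
    have Si: "HS i (vv L) = hscale ?x (vv L) + hscale ?y (?P (vv L)) + hscale ?z (vv ?I)"
      using HS_vv[OF bij i] .
    have Sj: "HS j (vv L) = hscale ?u (vv L) + hscale ?v (?Q (vv L)) + hscale ?w (vv ?J)"
      using HS_vv[OF bij j] .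
    have SjI: "HS j (vv ?I) = hscale ?u (vv ?I) + hscale ?v (?Q (vv ?I)) + hscale ?w (vv (adj j \<circ> ?I))"
      using HS_vv[OF bijI j] unfolding cI .
    have SiJ: "HS i (vv ?J) = hscale ?x (vv ?J) + hscale ?y (?P (vv ?J)) + hscale ?z (vv (adj j \<circ> ?I))"
      using HS_vv[OF bijJ i] unfolding cJ IJ .
    have "HS i (HS j (vv L)) = hscale ?u (HS i (vv L)) + hscale ?v (?Q (HS i (vv L))) + hscale ?w (HS i (vv ?J))"
      by (subst Sj) (simp add: hlinD(1)[OF hlin_ops(1)] scale_S SQ[OF vv_carr])
    moreover have "HS j (HS i (vv L)) = hscale ?x (HS j (vv L)) + hscale ?y (?P (HS j (vv L))) + hscale ?z (HS j (vv ?I))"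
      by (subst Si) (simp add: hlinD(1)[OF hlin_ops(1)] scale_S SP[OF vv_carr])
    ultimately show "HS i (HS j (vv L)) - HS j (HS i (vv L)) = 0"
      unfolding SjI SiJ unfolding Si Sj hlinD(1)[OF hP] hlinD(2)[OF hP] hlinD(1)[OF hQ] hlinD(2)[OF hQ]
        PQ[OF vv_carr]
      by (simp add: HV.scale_right_distrib mult_ac add_ac)
  qed
  thus ?thesis by simp
qed

sublocale W: weak_hc d H rewrites "smul H = hscale"
proof -
  show "weak_hc d H"
  proof
    fix i j :: nat and v :: hvec
    show "super_space H" by (rule H_super_space)
    show "even_map H H (HS i)" if "1 \<le> i" "i < d" using H_even_map_S that .
    show "even_map H H (HX i)" if "1 \<le> i" "i \<le> d" using H_even_map_X that .
    show "odd_map H H (HC i)" if "1 \<le> i" "i \<le> d" using H_odd_map_C that .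
    show "HS i (HS i v) = v" if "v \<in> carr H" "1 \<le> i" "i < d" using H_s_s that .
    show "HS i (HS j v) = HS j (HS i v)" if "v \<in> carr H" "1 \<le> i" "Suc i < j" "j < d" using H_s_far that .
    show "HX i (HX j v) = HX j (HX i v)" if "v \<in> carr H" "1 \<le> i" "i \<le> d" "1 \<le> j" "j \<le> d"
      using H_x_x that .
    show "HC i (HC i v) = - v" if "v \<in> carr H" "1 \<le> i" "i \<le> d" using H_c_sq that .
    show "HC i (HC j v) = - HC j (HC i v)" if "v \<in> carr H" "1 \<le> i" "i \<le> d" "1 \<le> j" "j \<le> d" "i \<noteq> j"
      using H_c_c that .
    show "HS i (HC i v) = HC (Suc i) (HS i v)" if "v \<in> carr H" "1 \<le> i" "i < d"
      using H_s_c[OF that, of i] that by simp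
    show "HS i (HC (Suc i) v) = HC i (HS i v)" if "v \<in> carr H" "1 \<le> i" "i < d"
      using H_s_c[OF that, of "Suc i"] that by simp
    show "HS i (HC j v) = HC j (HS i v)"
      if "v \<in> carr H" "1 \<le> i" "i < d" "1 \<le> j" "j \<le> d" "j \<noteq> i" "j \<noteq> Suc i"
      using H_s_c[OF that(1-5)] that by simp
    show "HC i (HX i v) = - HX i (HC i v)" if "v \<in> carr H" "1 \<le> i" "i \<le> d"
      using H_c_x[OF that that(2,3)] by simp
    show "HC j (HX i v) = HX i (HC j v)" if "v \<in> carr H" "1 \<le> i" "i \<le> d" "1 \<le> j" "j \<le> d" "i \<noteq> j"
      using H_c_x[OF that(1-5)] that by simp
    show "HS i (HX i v) = HX (Suc i) (HS i v) - v + HC i (HC (Suc i) v)" if "v \<in> carr H" "1 \<le> i" "i < d"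
      using H_s_x_left that .
    show "HS i (HX j v) = HX j (HS i v)"
      if "v \<in> carr H" "1 \<le> i" "i < d" "1 \<le> j" "j \<le> d" "j \<noteq> i" "j \<noteq> Suc i"
      using H_s_x_other that .
  qed
  show "smul H = hscale" by (simp add: H_simps)
qed

end

context shape
begin

subsection \<open>The braid relation\<close>

lemma vv_eig:
  assumes "std L"
  shows "W.eig (cn L) (vv L)"
  using HX_vv[OF standard_bij[OF assms]] vv_carr by (simp add: W.eig_def)

text \<open>
  The coefficient of \<open>v\<^bsub>s\<^sub>i L\<^esub>\<close> in \<open>\<phi>\<^sub>i v\<^sub>L\<close>. Unlike the coefficient in \<open>s\<^sub>i v\<^sub>L\<close> it is antisymmetric, whence the sign in
  \<open>yc a b * yc a b = - phi_square a b\<close>.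
\<close>

definition yc :: "nat \<Rightarrow> nat \<Rightarrow> complex" where
  "yc a b = ycf a b * (qc a - qc b)"

lemma yc_swap: "yc b a = - yc a b"
  by (simp add: yc_def ycf_sym[of b a] algebra_simps)

lemma yc_square: "a \<noteq> b \<Longrightarrow> yc a b * yc a b = - phi_square a b"
  using ycf_square(1)[of a b] by (simp add: yc_def power2_eq_square mult_ac)

lemma yc_eq_0_iff: "a \<noteq> b \<Longrightarrow> yc a b = 0 \<longleftrightarrow> \<not> far a b"
  using ycf_eq_0_iff[of a b] by (simp add: yc_def)

lemma phi_vv:
  assumes L: "bij_filling d lam mu L" and i: "1 \<le> i" "i < d"
  shows "W.\<phi> i (vv L) = hscale (yc (cn L i) (cn L (Suc i))) (vv (adj i \<circ> L))"
proof (cases "std L")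
  case True
  let ?a = "cn L i" and ?b = "cn L (Suc i)"
  have ne: "?a \<noteq> ?b" using standard_adjacent_contents[OF sk True i] .
  have "hscale (1 / (qc ?a - qc ?b)) (W.\<phi> i (vv L)) = hscale (ycf ?a ?b) (vv (adj i \<circ> L))"
    using W.S_eig[OF vv_eig[OF True] i ne] HS_vv[OF L i] by (simp add: al_def be_def)
  hence "hscale (qc ?a - qc ?b) (hscale (1 / (qc ?a - qc ?b)) (W.\<phi> i (vv L))) =
      hscale (qc ?a - qc ?b) (hscale (ycf ?a ?b) (vv (adj i \<circ> L)))" by simp
  thus ?thesis using ne by (simp add: yc_def mult.commute)
next
  case False
  have "hscale (yc (cn L i) (cn L (Suc i))) (vv (adj i \<circ> L)) = 0"
  proof (cases "std (adj i \<circ> L)")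
    case True
    show ?thesis using nonstandard_swap[OF sk L i False True] yc_eq_0_iff by simp
  qed (simp add: vv_def)
  thus ?thesis using False W.lin_0[OF W.lin_phi[OF i]] by (simp add: vv_def)
qed

text \<open>
  Both paths exchange each pair of the three contents once, so they collect the same three
  coefficients.
\<close>

lemma phi_vv_braid:
  assumes L: "bij_filling d lam mu L" and i: "1 \<le> i" "Suc i < d"
  shows "W.\<phi> i (W.\<phi> (Suc i) (W.\<phi> i (vv L))) = W.\<phi> (Suc i) (W.\<phi> i (W.\<phi> (Suc i) (vv L)))"
proof -
  let ?j = "Suc i"
  have i': "1 \<le> i" "i < d" and j: "1 \<le> ?j" "?j < d" using i by auto
  note b1 = bij_filling_comp[OF L adj_permutes[OF i']]
  note b2 = bij_filling_comp[OF b1 adj_permutes[OF j]]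
  note b3 = bij_filling_comp[OF L adj_permutes[OF j]]
  note b4 = bij_filling_comp[OF b3 adj_permutes[OF i']]
  note lp = W.lin_phi[OF i', THEN W.lin_rules(3)] W.lin_phi[OF j, THEN W.lin_rules(3)]
  have c: "cn (adj i \<circ> L) ?j = cn L i" "cn (adj i \<circ> L) (Suc ?j) = cn L (Suc ?j)"
    "cn (adj ?j \<circ> (adj i \<circ> L)) i = cn L ?j" "cn (adj ?j \<circ> (adj i \<circ> L)) ?j = cn L (Suc ?j)"
    "cn (adj ?j \<circ> L) i = cn L i" "cn (adj ?j \<circ> L) ?j = cn L (Suc ?j)"
    "cn (adj i \<circ> (adj ?j \<circ> L)) ?j = cn L i" "cn (adj i \<circ> (adj ?j \<circ> L)) (Suc ?j) = cn L ?j"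
    using cont_adj[OF L i'] cont_adj[OF b1 j] cont_adj[OF L j] cont_adj[OF b3 i'] i
    by (simp_all add: transpose_def)
  have K: "adj i \<circ> (adj ?j \<circ> (adj i \<circ> L)) = adj ?j \<circ> (adj i \<circ> (adj ?j \<circ> L))" by (rule adj_braid)
  have A: "W.\<phi> i (W.\<phi> ?j (W.\<phi> i (vv L))) =
      hscale (yc (cn L i) (cn L ?j) * (yc (cn L i) (cn L (Suc ?j)) * yc (cn L ?j) (cn L (Suc ?j))))
        (vv (adj i \<circ> (adj ?j \<circ> (adj i \<circ> L))))"
    unfolding phi_vv[OF L i'] lp(2)[OF vv_carr] phi_vv[OF b1 j] c
      lp(1)[OF W.V_sm[OF vv_carr]] lp(1)[OF vv_carr] phi_vv[OF b2 i'] HV.scale_scale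
    by (simp only: mult_ac)
  have B: "W.\<phi> ?j (W.\<phi> i (W.\<phi> ?j (vv L))) =
      hscale (yc (cn L ?j) (cn L (Suc ?j)) * (yc (cn L i) (cn L (Suc ?j)) * yc (cn L i) (cn L ?j)))
        (vv (adj ?j \<circ> (adj i \<circ> (adj ?j \<circ> L))))"
    unfolding phi_vv[OF L j] lp(1)[OF vv_carr] phi_vv[OF b3 i'] c
      lp(2)[OF W.V_sm[OF vv_carr]] lp(2)[OF vv_carr] phi_vv[OF b4 j] HV.scale_scale
    by (simp only: mult_ac)
  show ?thesis unfolding A B K by (simp only: mult_ac)
qed

text \<open>
  For three different contents the braid relation for the intertwiners suffices. Otherwise the contents
  are \<open>0, 1, 0\<close>, both generators act on \<open>v\<^sub>L\<close> by Clifford elements, and their coefficients \<open>\<plusminus>1/\<kappa>\<close> satisfy the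
  equation between third powers.
\<close>

lemma H_braid:
  assumes f: "f \<in> carr H" and i: "1 \<le> i" "Suc i < d"
  shows "W.defect i f = 0"
proof (rule vanish_by_Clifford[OF _ _ _ f])
  let ?j = "Suc i" and ?m = "Suc (Suc i)"
  have i': "1 \<le> i" "i < d" "i \<le> d" and j: "1 \<le> ?j" "?j < d" "?j \<le> d" and m: "1 \<le> ?m" "?m \<le> d"
    using i by auto
  interpret R: rank3_ops "carr H" hscale "HS i" "HS ?j" "HX i" "HX ?j" "HX ?m" "HC i" "HC ?j" "HC ?m"
    by (rule W.rank3[OF i])
  have dR: "W.defect i = R.braid_defect"
    by (intro ext) (simp only: W.defect_def R.braid_defect_def)
  show "hlin (W.defect i)"
    unfolding W.defect_def[abs_def]
    by (rule hlin_diff[OF hlin_comp[OF hlin_ops(1) hlin_comp[OF hlin_ops(1,1)]]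
          hlin_comp[OF hlin_ops(1) hlin_comp[OF hlin_ops(1,1)]]])
  fix k f assume k: "1 \<le> k" "k \<le> d" and f: "f \<in> carr H" "W.defect i f = 0"
  have C0: "HC l 0 = 0" for l by (rule hlinD(3)[OF hlin_ops(3)])
  consider "k = i" | "k = ?j" | "k = ?m" | "k \<noteq> i" "k \<noteq> ?j" "k \<noteq> ?m" by blast
  thus "W.defect i (HC k f) = 0"
  proof cases
    case 1
    thus ?thesis using R.braid_defect_c[OF f(1)] f(2) C0 by (simp only: dR)
  next
    case 2
    thus ?thesis using R.braid_defect_e[OF f(1)] f(2) C0 by (simp only: dR)
  next
    case 3
    thus ?thesis using R.braid_defect_f[OF f(1)] f(2) C0 by (simp only: dR)
  next
    case 4
    have s: "HS i (HC k g) = HC k (HS i g)" "HS ?j (HC k g) = HC k (HS ?j g)" if "g \<in> carr H" for g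
      using H_s_c[OF that i'(1,2) k] H_s_c[OF that j(1,2) k] 4 by auto
    have "W.defect i (HC k f) = HC k (W.defect i f)"
      unfolding W.defect_def using f(1) i' j by (simp add: s S_carr hlinD(5)[OF hlin_ops(3)])
    thus ?thesis using f(2) C0 by simp
  qed
next
  let ?j = "Suc i" and ?m = "Suc (Suc i)"
  have i': "1 \<le> i" "i < d" "i \<le> d" and j: "1 \<le> ?j" "?j < d" "?j \<le> d" and m: "1 \<le> ?m" "?m \<le> d"
    using i by auto
  interpret R: rank3_ops "carr H" hscale "HS i" "HS ?j" "HX i" "HX ?j" "HX ?m" "HC i" "HC ?j" "HC ?m"
    by (rule W.rank3[OF i])
  fix L assume L: "std L"
  note bij = standard_bij[OF L]
  have ne: "cn L i \<noteq> cn L ?j" "cn L ?j \<noteq> cn L ?m"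
    using standard_adjacent_contents[OF sk L] i' j by auto
  show "W.defect i (vv L) = 0"
  proof (cases "cn L i = cn L ?m")
    case False
    thus ?thesis
      using W.braid_iff[OF W.eig_wt[OF vv_eig[OF L]] i ne(1) False ne(2)] phi_vv_braid[OF bij i] by simp
  next
    case True
    have c: "cn L i = 0" "cn L ?j = 1" "cn L ?m = 0"
      using standard_repeated_contents[OF sk L i True] True by auto
    have y: "ycf 0 1 = 0" "ycf 1 0 = 0" using ycf_eq_0_iff[of 0 1] ycf_sym[of 1 0] by (auto simp: far_def)
    let ?a = "al 0 1"
    have ab: "be 0 1 = ?a" "be 1 0 = ?a" by (simp_all add: al_def be_def)
    have al: "al 1 0 = - ?a" unfolding al_def by (metis minus_diff_eq minus_divide_right)
    have s: "HS i (vv L) = hscale ?a (vv L) + hscale ?a (HC i (HC ?j (vv L)))"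
      using HS_vv[OF bij i'(1,2)] unfolding c y ab by simp
    have t: "HS ?j (vv L) = - hscale ?a (vv L) + hscale ?a (HC ?j (HC ?m (vv L)))"
      using HS_vv[OF bij j(1,2)] unfolding c y ab al by simp
    show ?thesis
      using R.braid_defect_Clifford[OF vv_carr s t] by (simp add: W.defect_def R.braid_defect_def)
  qed
qed

lemma XX_coord:
  assumes f: "f \<in> carr H" and i: "1 \<le> i" "i \<le> d"
  shows "HX i (HX i f) L S = qc (cn L i) * f L S"
proof -
  define D :: "hvec \<Rightarrow> hvec" where "D f = (\<lambda>L S. qc (cn L i) * f L S)" for f
  have "HX i (HX i f) = D f"
  proof (rule hlin_eq[OF hlin_comp[OF hlin_ops(2,2)] _ _ f])
    show "hlin D"
      by (auto simp: hlin_def D_def fun_eq_iff plus_fun_apply hscale_apply algebra_simps)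
    fix L S assume LS: "std L" "S \<subseteq> {1..d}"
    have "HX i (HX i (cv S L)) = hscale (qc (cn L i)) (cv S L)"
      unfolding HX_cv[OF LS i] scale_X HV.scale_scale by (simp add: kap_sq)
    also have "\<dots> = D (cv S L)" by (intro ext) (auto simp: D_def hscale_apply cv_def)
    finally show "HX i (HX i (cv S L)) = D (cv S L)" .
  qed
  thus ?thesis by (simp add: D_def)
qed

lemma qc_is_q: "qc n = of_int (q (int n))"
proof -
  have "q (int n) = int (n * Suc n)" by (simp add: q_def algebra_simps)
  thus ?thesis by (simp only: qc_def of_int_of_nat_eq)
qed

lemma H_integral: "integral_hc d H"
  unfolding integral_hc_def
proof (intro ballI allI impI)
  fix i z n f
  assume i: "i \<in> {1..d}" and f: "f \<in> carr H"
    and H: "f \<noteq> 0 \<and> ((\<lambda>u. HX i (HX i u) - smul H z u) ^^ n) f = 0"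
  let ?T = "\<lambda>u. HX i (HX i u) - smul H z u"
  have i': "1 \<le> i" "i \<le> d" using i by auto
  have pow: "(?T ^^ n) f \<in> carr H \<and> (?T ^^ n) f L S = (qc (cn L i) - z) ^ n * f L S" for L S
  proof (induction n)
    case (Suc n)
    let ?g = "(?T ^^ n) f"
    have g: "?g \<in> carr H" using Suc by blast
    have "?T ?g \<in> carr H"
      using X_carr[OF i' X_carr[OF i' g]] carr_closed(2)[OF g] W.V_diff by (simp add: H_simps(1))
    moreover have "(HX i (HX i ?g) - hscale z ?g) L S = (qc (cn L i) - z) * ?g L S"
      using XX_coord[OF g i'] by (simp add: minus_apply hscale_apply algebra_simps)
    ultimately show ?case using Suc by (simp add: H_simps(1))
  qed (simp add: f)
  obtain L S where LS: "f L S \<noteq> 0" using H by (metis zero_fun_apply ext)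
  have "(qc (cn L i) - z) ^ n * f L S = 0" using pow[of L S] H by (simp add: zero_fun_apply)
  hence "z = qc (cn L i)" using LS by simp
  thus "\<exists>a. z = of_int (q a)" using qc_is_q by blast
qed

lemma H_hc: "hc d H"
  by (intro hc.intro hc_axioms.intro W.weak_hc_axioms H_braid)

end

lemma hc_relationsD:
  assumes "hc_relations d M" "v \<in> carr M"
  shows
    "\<forall>i\<in>{1..<d}. sact M i (sact M i v) = v"
    "\<forall>i. 1 \<le> i \<and> i + 1 < d \<longrightarrow>
      sact M i (sact M (i+1) (sact M i v)) = sact M (i+1) (sact M i (sact M (i+1) v))"
    "\<forall>i\<in>{1..<d}. \<forall>j\<in>{1..<d}. i + 1 < j \<or> j + 1 < i \<longrightarrow>
      sact M i (sact M j v) = sact M j (sact M i v)"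
    "\<forall>i\<in>{1..d}. \<forall>j\<in>{1..d}. xact M i (xact M j v) = xact M j (xact M i v)"
    "\<forall>i\<in>{1..d}. cact M i (cact M i v) = - v"
    "\<forall>i\<in>{1..d}. \<forall>j\<in>{1..d}. i \<noteq> j \<longrightarrow> cact M i (cact M j v) = - cact M j (cact M i v)"
    "\<forall>i\<in>{1..<d}. sact M i (cact M i v) = cact M (i+1) (sact M i v)"
    "\<forall>i\<in>{1..<d}. sact M i (cact M (i+1) v) = cact M i (sact M i v)"
    "\<forall>i\<in>{1..<d}. \<forall>j\<in>{1..d}. j \<noteq> i \<and> j \<noteq> i + 1 \<longrightarrow>
      sact M i (cact M j v) = cact M j (sact M i v)"
    "\<forall>i\<in>{1..d}. cact M i (xact M i v) = - xact M i (cact M i v)"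
    "\<forall>i\<in>{1..d}. \<forall>j\<in>{1..d}. i \<noteq> j \<longrightarrow> cact M j (xact M i v) = xact M i (cact M j v)"
    "\<forall>i\<in>{1..<d}. sact M i (xact M i v) = xact M (i+1) (sact M i v) - v + cact M i (cact M (i+1) v)"
    "\<forall>i\<in>{1..<d}. \<forall>j\<in>{1..d}. j \<noteq> i \<and> j \<noteq> i + 1 \<longrightarrow>
      sact M i (xact M j v) = xact M j (sact M i v)"
  by (insert bspec[OF assms(1)[unfolded hc_relations_def] assms(2)]) ((elim conjE, assumption)+)

lemma hc_imp_relations:
  assumes "hc d M"
  shows "hc_relations d M"
  unfolding hc_relations_def
proof
  interpret hc d M by (rule assms)
  fix v assume v: "v \<in> carr M"
  have far': "sact M i (sact M j v) = sact M j (sact M i v)"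
    if "1 \<le> i" "i < d" "1 \<le> j" "j < d" "i + 1 < j \<or> j + 1 < i" for i j
    using s_far[OF v, of i j] s_far[OF v, of j i] that by auto
  have braid': "sact M i (sact M (Suc i) (sact M i v)) = sact M (Suc i) (sact M i (sact M (Suc i) v))"
    if "1 \<le> i" "Suc i < d" for i
    using braid[OF v that] by (simp add: defect_def)
  have r1: "\<forall>i\<in>{1..<d}. sact M i (sact M i v) = v"
    using s_s[OF v] by simp
  have r2: "\<forall>i. 1 \<le> i \<and> i + 1 < d \<longrightarrow>
      sact M i (sact M (i+1) (sact M i v)) = sact M (i+1) (sact M i (sact M (i+1) v))"
    using braid' by simp
  have r3: "\<forall>i\<in>{1..<d}. \<forall>j\<in>{1..<d}. i + 1 < j \<or> j + 1 < i \<longrightarrow>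
      sact M i (sact M j v) = sact M j (sact M i v)"
    by (intro ballI impI far') auto
  have r4: "\<forall>i\<in>{1..d}. \<forall>j\<in>{1..d}. xact M i (xact M j v) = xact M j (xact M i v)"
    by (intro ballI impI x_x[OF v]) auto
  have r5: "\<forall>i\<in>{1..d}. cact M i (cact M i v) = - v"
    using c_sq[OF v] by simp
  have r6: "\<forall>i\<in>{1..d}. \<forall>j\<in>{1..d}. i \<noteq> j \<longrightarrow> cact M i (cact M j v) = - cact M j (cact M i v)"
    by (intro ballI impI c_c[OF v]) auto
  have r7: "\<forall>i\<in>{1..<d}. sact M i (cact M i v) = cact M (i+1) (sact M i v)"
    using s_c_left[OF v] by simp
  have r8: "\<forall>i\<in>{1..<d}. sact M i (cact M (i+1) v) = cact M i (sact M i v)"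
    using s_c_right[OF v] by simp
  have r9: "\<forall>i\<in>{1..<d}. \<forall>j\<in>{1..d}. j \<noteq> i \<and> j \<noteq> i + 1 \<longrightarrow>
      sact M i (cact M j v) = cact M j (sact M i v)"
    by (intro ballI impI s_c_other[OF v]) auto
  have r10: "\<forall>i\<in>{1..d}. cact M i (xact M i v) = - xact M i (cact M i v)"
    using c_x_same[OF v] by simp
  have r11: "\<forall>i\<in>{1..d}. \<forall>j\<in>{1..d}. i \<noteq> j \<longrightarrow> cact M j (xact M i v) = xact M i (cact M j v)"
    by (intro ballI impI c_x_other[OF v]) auto
  have r12: "\<forall>i\<in>{1..<d}. sact M i (xact M i v) = xact M (i+1) (sact M i v) - v + cact M i (cact M (i+1) v)"
    using s_x_left[OF v] by simp
  have r13: "\<forall>i\<in>{1..<d}. \<forall>j\<in>{1..d}. j \<noteq> i \<and> j \<noteq> i + 1 \<longrightarrow>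
      sact M i (xact M j v) = xact M j (sact M i v)"
    by (intro ballI impI s_x_other[OF v]) auto
  show "(\<forall>i\<in>{1..<d}. sact M i (sact M i v) = v) \<and>
     (\<forall>i. 1 \<le> i \<and> i + 1 < d \<longrightarrow>
      sact M i (sact M (i+1) (sact M i v)) = sact M (i+1) (sact M i (sact M (i+1) v))) \<and>
     (\<forall>i\<in>{1..<d}. \<forall>j\<in>{1..<d}. i + 1 < j \<or> j + 1 < i \<longrightarrow>
      sact M i (sact M j v) = sact M j (sact M i v)) \<and>
     (\<forall>i\<in>{1..d}. \<forall>j\<in>{1..d}. xact M i (xact M j v) = xact M j (xact M i v)) \<and>
     (\<forall>i\<in>{1..d}. cact M i (cact M i v) = - v) \<and>
     (\<forall>i\<in>{1..d}. \<forall>j\<in>{1..d}. i \<noteq> j \<longrightarrow> cact M i (cact M j v) = - cact M j (cact M i v)) \<and>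
     (\<forall>i\<in>{1..<d}. sact M i (cact M i v) = cact M (i+1) (sact M i v)) \<and>
     (\<forall>i\<in>{1..<d}. sact M i (cact M (i+1) v) = cact M i (sact M i v)) \<and>
     (\<forall>i\<in>{1..<d}. \<forall>j\<in>{1..d}. j \<noteq> i \<and> j \<noteq> i + 1 \<longrightarrow>
      sact M i (cact M j v) = cact M j (sact M i v)) \<and>
     (\<forall>i\<in>{1..d}. cact M i (xact M i v) = - xact M i (cact M i v)) \<and>
     (\<forall>i\<in>{1..d}. \<forall>j\<in>{1..d}. i \<noteq> j \<longrightarrow> cact M j (xact M i v) = xact M i (cact M j v)) \<and>
     (\<forall>i\<in>{1..<d}. sact M i (xact M i v) = xact M (i+1) (sact M i v) - v + cact M i (cact M (i+1) v)) \<and>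
     (\<forall>i\<in>{1..<d}. \<forall>j\<in>{1..d}. j \<noteq> i \<and> j \<noteq> i + 1 \<longrightarrow>
      sact M i (xact M j v) = xact M j (sact M i v))"
    by (intro conjI r1 r2 r3 r4 r5 r6 r7 r8 r9 r10 r11 r12 r13)
qed

lemma hc_moduleI:
  assumes "hc d M" "integral_hc d M"
  shows "hc_module d M"
proof -
  interpret hc d M by (rule assms)
  show ?thesis
    unfolding hc_module_def using super s_even x_even c_odd hc_imp_relations[OF assms(1)] assms(2) by simp
qed

lemma hc_module_imp_hc:
  assumes "hc_module d M"
  shows "hc d M"
proof -
  have rel: "hc_relations d M" using assms by (simp add: hc_module_def)
  note D = hc_relationsD[OF rel]
  have w: "weak_hc d M"
  proof
    show "super_space M" using assms by (simp add: hc_module_def)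
    fix i j :: nat
    show "even_map M M (sact M i)" if "1 \<le> i" "i < d" using assms that by (simp add: hc_module_def)
    show "even_map M M (xact M i)" if "1 \<le> i" "i \<le> d" using assms that by (simp add: hc_module_def)
    show "odd_map M M (cact M i)" if "1 \<le> i" "i \<le> d" using assms that by (simp add: hc_module_def)
    fix v assume v: "v \<in> carr M"
    show "sact M i (sact M i v) = v" if "1 \<le> i" "i < d" using D(1)[OF v] that by simp
    show "sact M i (sact M j v) = sact M j (sact M i v)" if "1 \<le> i" "Suc i < j" "j < d"
      by (rule D(3)[OF v, rule_format]) (use that in auto)
    show "xact M i (xact M j v) = xact M j (xact M i v)" if "1 \<le> i" "i \<le> d" "1 \<le> j" "j \<le> d"
      by (rule D(4)[OF v, rule_format]) (use that in auto)
    show "cact M i (cact M i v) = - v" if "1 \<le> i" "i \<le> d" using D(5)[OF v] that by simp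
    show "cact M i (cact M j v) = - cact M j (cact M i v)" if "1 \<le> i" "i \<le> d" "1 \<le> j" "j \<le> d" "i \<noteq> j"
      by (rule D(6)[OF v, rule_format]) (use that in auto)
    show "sact M i (cact M i v) = cact M (Suc i) (sact M i v)" if "1 \<le> i" "i < d"
      using D(7)[OF v] that by simp
    show "sact M i (cact M (Suc i) v) = cact M i (sact M i v)" if "1 \<le> i" "i < d"
      using D(8)[OF v] that by simp
    show "sact M i (cact M j v) = cact M j (sact M i v)"
      if "1 \<le> i" "i < d" "1 \<le> j" "j \<le> d" "j \<noteq> i" "j \<noteq> Suc i"
      by (rule D(9)[OF v, rule_format]) (use that in auto)
    show "cact M i (xact M i v) = - xact M i (cact M i v)" if "1 \<le> i" "i \<le> d"
      using D(10)[OF v] that by simp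
    show "cact M j (xact M i v) = xact M i (cact M j v)"
      if "1 \<le> i" "i \<le> d" "1 \<le> j" "j \<le> d" "i \<noteq> j"
      by (rule D(11)[OF v, rule_format]) (use that in auto)
    show "sact M i (xact M i v) = xact M (Suc i) (sact M i v) - v + cact M i (cact M (Suc i) v)"
      if "1 \<le> i" "i < d" using D(12)[OF v] that by simp
    show "sact M i (xact M j v) = xact M j (sact M i v)"
      if "1 \<le> i" "i < d" "1 \<le> j" "j \<le> d" "j \<noteq> i" "j \<noteq> Suc i"
      by (rule D(13)[OF v, rule_format]) (use that in auto)
  qed
  interpret weak_hc d M by (rule w)
  show ?thesis
  proof
    fix v i assume "v \<in> carr M" "1 \<le> i" "Suc i < d"
    thus "defect i v = 0" using D(2)[of v] by (simp add: defect_def)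
  qed
qed

section \<open>Submodules\<close>

context vector_space
begin

lemma subspace_finite_dim:
  assumes W: "subspace W" and B: "finite B" "W \<subseteq> span B"
  obtains b where "finite b" "independent b" "W = span b" "card b = dim W"
proof -
  obtain b where b: "b \<subseteq> W" "independent b" "W \<subseteq> span b" "card b = dim W"
    by (rule basis_exists)
  have "b \<subseteq> span B" using b(1) B(2) by blast
  hence "finite b" using independent_span_bound[OF B(1) b(2)] by simp
  moreover have "W = span b" by (rule subset_antisym[OF b(3) span_minimal[OF b(1) W]])
  ultimately show thesis by (rule that[OF _ b(2) _ b(4)])
qed

lemma dim_strict_mono:
  assumes W: "subspace W" "subspace W'" "W \<subset> W'" and B: "finite B" "W' \<subseteq> span B"
  shows "dim W < dim W'"
proof -
  have WB: "W \<subseteq> span B" using W(3) B(2) by blast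
  obtain b where b: "finite b" "independent b" "W = span b" "card b = dim W"
    using subspace_finite_dim[OF W(1) B(1) WB] .
  obtain b' where b': "finite b'" "independent b'" "W' = span b'" "card b' = dim W'"
    using subspace_finite_dim[OF W(2) B] .
  obtain x where x: "x \<in> W'" "x \<notin> W" using W(3) by blast
  have "x \<notin> span b" using x b(3) by simp
  hence ind: "independent (insert x b)" using b(2) by (simp add: independent_insert)
  have "b \<subseteq> W" using span_superset[of b] b(3) by simp
  hence "insert x b \<subseteq> span b'" using x(1) W(3) unfolding b'(3)[symmetric] by blast
  hence "card (insert x b) \<le> card b'" using independent_span_bound[OF b'(1) ind] by simp
  moreover have "x \<notin> b" using \<open>x \<notin> span b\<close> span_base by blast
  ultimately show ?thesis using b b' by simp
qed

end

context weak_hc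
begin

lemma evn_odd_unique:
  assumes "e \<in> evn M" "r \<in> odd_part M" "e' \<in> evn M" "r' \<in> odd_part M" "e + r = e' + r'"
  shows "e = e'" "r = r'"
proof -
  have "e - e' = r' - r" using assms(5) by (simp add: algebra_simps)
  moreover have "e - e' \<in> evn M" "r' - r \<in> odd_part M"
    using assms subspace_diff[OF subspace_evn] subspace_diff[OF subspace_odd] by auto
  ultimately have "e - e' \<in> evn M \<inter> odd_part M" by simp
  hence "e - e' = 0" unfolding evn_odd by simp
  thus "e = e'" "r = r'" using assms(5) by auto
qed

text \<open>
  A nonzero submodule of least dimension.
\<close>

lemma irreducible_A_submodule_exists:
  assumes W: "A_submodule d M W" "W \<noteq> {0}"
  obtains U where "U \<subseteq> W" "irreducible_A_submodule d M U"
proof -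
  define Q where "Q U \<longleftrightarrow> A_submodule d M U \<and> U \<noteq> {0} \<and> U \<subseteq> W" for U
  obtain U where U: "Q U" "\<And>U'. Q U' \<Longrightarrow> dim U \<le> dim U'"
    using ex_has_least_nat[of Q W dim] W by (auto simp: Q_def)
  obtain B where B: "finite B" "carr M = span B" using finite_dim by blast
  have "W' = {0} \<or> W' = U" if W': "A_submodule d M W'" "W' \<subseteq> U" for W'
  proof (rule ccontr)
    assume "\<not> (W' = {0} \<or> W' = U)"
    hence "Q W'" and lt: "W' \<subset> U" using W' U(1) by (auto simp: Q_def)
    have "subspace W'" "subspace U" "U \<subseteq> span B"
      using W' U(1) B(2) by (auto simp: Q_def A_submodule_def graded_subspace_def)
    hence "dim W' < dim U" using dim_strict_mono[OF _ _ lt B(1)] by simp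
    with U(2)[OF \<open>Q W'\<close>] show False by simp
  qed
  with U(1) that show thesis by (auto simp: Q_def irreducible_A_submodule_def)
qed

end

lemma ball_subset: "\<forall>x\<in>B. P x \<Longrightarrow> A \<subseteq> B \<Longrightarrow> \<forall>x\<in>A. P x"
  by blast

lemma restrict_simps [simp]:
  "smul (restrict_to M W) = smul M" "carr (restrict_to M W) = W"
  "evn (restrict_to M W) = W \<inter> evn M" "odd_part (restrict_to M W) = W \<inter> odd_part M"
  "sact (restrict_to M W) = sact M" "xact (restrict_to M W) = xact M" "cact (restrict_to M W) = cact M"
  by (simp_all add: restrict_to_def)

lemma hc_module_restrict:
  assumes M: "hc_module d M" and W: "hc_submodule d M W"
  shows "hc_module d (restrict_to M W)"
proof -
  interpret hc d M by (rule hc_module_imp_hc[OF M])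
  have sub: "W \<subseteq> carr M" "subspace W" "W = {u + v | u v. u \<in> W \<inter> evn M \<and> v \<in> W \<inter> odd_part M}"
    using W by (auto simp: hc_submodule_def A_submodule_def graded_subspace_def)
  have clS: "S i v \<in> W" if "i \<in> {1..<d}" "v \<in> W" for i v
    using W that by (auto simp: hc_submodule_def image_subset_iff)
  have clX: "X i v \<in> W" and clC: "C i v \<in> W" if "i \<in> {1..d}" "v \<in> W" for i v
    using W that by (auto simp: hc_submodule_def A_submodule_def x_invariant_def image_subset_iff)
  have zero: "W \<inter> evn M \<inter> (W \<inter> odd_part M) = {0}"
    using evn_odd subspace_0[OF sub(2)] by blast
  obtain B where B: "finite B" "carr M = span B" using finite_dim by blast
  have fin: "\<exists>B. finite B \<and> W = span B"
    using subspace_finite_dim[OF sub(2) B(1)] sub(1) B(2) by metis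
  have ss: "super_space (restrict_to M W)"
    unfolding super_space_def
    using vector_space_smul subspace_inter[OF sub(2) subspace_evn] subspace_inter[OF sub(2) subspace_odd]
      zero sub(3) fin by simp
  have em: "even_map (restrict_to M W) (restrict_to M W) f"
    if "even_map M M f" "\<And>v. v \<in> W \<Longrightarrow> f v \<in> W" for f
    using that sub(1) by (auto simp: even_map_def linear_map_def image_subset_iff subset_iff)
  have om: "odd_map (restrict_to M W) (restrict_to M W) f"
    if "odd_map M M f" "\<And>v. v \<in> W \<Longrightarrow> f v \<in> W" for f
    using that sub(1) by (auto simp: odd_map_def linear_map_def image_subset_iff subset_iff)
  have rel: "hc_relations d (restrict_to M W)"
  proof -
    have "hc_relations d M" using M by (simp add: hc_module_def)
    from this[unfolded hc_relations_def] show ?thesis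
      unfolding hc_relations_def restrict_simps by (rule ball_subset[OF _ sub(1)])
  qed
  have int: "integral_hc d (restrict_to M W)"
    unfolding integral_hc_def restrict_simps
  proof (intro ballI allI impI)
    fix i z n v
    assume i: "i \<in> {1..d}" and v: "v \<in> W"
      and H: "v \<noteq> 0 \<and> ((\<lambda>u. X i (X i u) - smul M z u) ^^ n) v = 0"
    have "integral_hc d M" using M by (simp add: hc_module_def)
    with i v H sub(1) show "\<exists>a. z = of_int (q a)" unfolding integral_hc_def by (meson subsetD)
  qed
  show ?thesis
    unfolding hc_module_def
  proof (intro conjI ballI)
    show "even_map (restrict_to M W) (restrict_to M W) (sact (restrict_to M W) i)"
      if "i \<in> {1..<d}" for i
      using em[of "S i"] s_even[of i] clS that by simp
    show "even_map (restrict_to M W) (restrict_to M W) (xact (restrict_to M W) i)"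
      if "i \<in> {1..d}" for i
      using em[of "X i"] x_even[of i] clX that by simp
    show "odd_map (restrict_to M W) (restrict_to M W) (cact (restrict_to M W) i)"
      if "i \<in> {1..d}" for i
      using om[of "C i"] c_odd[of i] clC that by simp
  qed (use ss rel int in auto)
qed

section \<open>The irreducible submodules\<close>

context shape
begin

lemma cv_cl:
  assumes L: "std L" and S: "S \<subseteq> {1..d}"
  shows "cv S L = W.cl S (vv L)"
proof -
  have "finite S" by (rule finite_subset[OF S]) simp
  thus ?thesis using S
  proof (induction rule: finite_linorder_min_induct)
    case empty
    show ?case using L by (simp add: vv_def)
  next
    case (insert b A)
    have b: "1 \<le> b" "b \<le> d" and A: "A \<subseteq> {1..d}" using insert by auto
    have "csign b A = 1" using csign_below insert.hyps by blast
    moreover have "sym_diff {b} A = insert b A" using insert.hyps by auto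
    ultimately have "cv (insert b A) L = HC b (cv A L)"
      using HC_cv[OF L A b] by simp
    also have "\<dots> = W.cl (insert b A) (vv L)"
      using insert A by (subst W.cl_insert_min) auto
    finally show ?case .
  qed
qed

lemma Clv_expand: "Cl_v d lam mu L = supported d lam mu (\<lambda>L' S. L' = L)"
  by (simp add: Cl_v_def)

lemma Clv_carr: "Cl_v d lam mu L \<subseteq> carr H"
  by (auto simp: Clv_expand H_simps supported_def)

lemma Clv_A_submodule: "A_submodule d H (Cl_v d lam mu L)"
proof -
  let ?V = "Cl_v d lam mu L"
  have X: "HX i f \<in> ?V" and C: "HC i f \<in> ?V" if "i \<in> {1..d}" "f \<in> ?V" for i f
    using H_ops_supported(1)[OF refl that(2)[unfolded Clv_expand], of i "\<lambda>L' S. L' = L"]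
      H_ops_supported(2)[OF refl that(2)[unfolded Clv_expand], of i "\<lambda>L' S. L' = L"] that(1)
    by (auto simp: Clv_expand)
  have "?V = {u + v | u v. u \<in> ?V \<inter> evn H \<and> v \<in> ?V \<inter> odd_part H}" (is "_ = ?D")
  proof
    show "?D \<subseteq> ?V" using HV.subspace_add[OF supported_subspace] by (auto simp: Clv_expand)
    show "?V \<subseteq> ?D"
    proof
      fix f assume f: "f \<in> ?V"
      define u v :: hvec where "u L S = (if even (card S) then f L S else 0)"
        and "v L S = (if even (card S) then 0 else f L S)" for L S
      have "u \<in> ?V \<inter> evn H" "v \<in> ?V \<inter> odd_part H"
        using f by (auto simp: Clv_expand H_simps supported_def u_def v_def)
      moreover have "f = u + v" by (intro ext) (simp add: u_def v_def plus_fun_apply)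
      ultimately show "f \<in> ?D" by blast
    qed
  qed
  moreover have "HV.subspace ?V" unfolding Clv_expand by (rule supported_subspace)
  ultimately show ?thesis
    unfolding A_submodule_def graded_subspace_def x_invariant_def
    using Clv_carr X C by (auto simp: H_simps(1))
qed

lemma H_choice_exists:
  assumes "std L"
  shows "\<exists>U. H_choice d lam mu L U"
proof -
  have "cv {} L \<in> Cl_v d lam mu L" unfolding Clv_expand using assms by (intro cv_supported) auto
  moreover have "cv {} L \<noteq> 0"
  proof
    assume "cv {} L = 0"
    hence "cv {} L L {} = 0" by (simp add: zero_fun_apply)
    thus False by (simp add: cv_def)
  qed
  ultimately have "Cl_v d lam mu L \<noteq> {0}" by auto
  then obtain U where "U \<subseteq> Cl_v d lam mu L" "irreducible_A_submodule d H U"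
    using W.irreducible_A_submodule_exists[OF Clv_A_submodule] by blast
  thus ?thesis using assms by (auto simp: H_choice_def)
qed

end

locale based_shape = shape +
  fixes L :: filling
  assumes L: "std L"
begin

lemmas bijL = standard_bij[OF L]

text \<open>The permutation \<open>g\<close> acts on \<open>Cl(d) v\<^sub>L\<close> by permuting the Clifford generators and the labels;
  a scalar multiple of this is the intertwiner \<open>\<phi>\<^sub>g\<close>.\<close>

definition T :: "(nat \<Rightarrow> nat) \<Rightarrow> hvec \<Rightarrow> hvec" where
  "T g f = (\<Sum>S\<in>Pow {1..d}. hscale (f L S) (W.clp g S (vv (g \<circ> L))))"

lemma hlin_T: "hlin (T g)"
  unfolding hlin_def T_def
  by (auto simp: plus_fun_apply hscale_apply HV.scale_left_distrib sum.distrib HV.scale_sum_right)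

lemma T_cv:
  assumes S: "S \<subseteq> {1..d}"
  shows "T g (cv S L) = W.clp g S (vv (g \<circ> L))"
proof -
  have "T g (cv S L) = (\<Sum>S'\<in>Pow {1..d}. if S' = S then W.clp g S (vv (g \<circ> L)) else 0)"
    unfolding T_def by (rule sum.cong) (auto simp: cv_def)
  thus ?thesis using S by (simp add: sum.delta)
qed

abbreviation "V \<equiv> Cl_v d lam mu L"

lemma V_eq:
  assumes "hlin F" "hlin G" "\<And>S. S \<subseteq> {1..d} \<Longrightarrow> F (cv S L) = G (cv S L)" and f: "f \<in> V"
  shows "F f = G f"
proof -
  have "F f - G f \<in> {0}"
  proof (rule hlin_supported[OF hlin_diff[OF assms(1,2)] HV.subspace_single_0])
    show "f \<in> supported d lam mu (\<lambda>L' S. L' = L)" using f by (simp add: Clv_expand)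
    show "F (cv S L') - G (cv S L') \<in> {0}" if "S \<subseteq> {1..d}" "L' = L" for L' S
      using assms(3)[OF that(1)] that(2) by simp
  qed
  thus ?thesis by simp
qed

lemma g_range: "g permutes {1..d} \<Longrightarrow> g ` {1..d} \<subseteq> {1..d}"
  by (simp add: permutes_image)

lemma g_mem: "g permutes {1..d} \<Longrightarrow> 1 \<le> j \<Longrightarrow> j \<le> d \<Longrightarrow> 1 \<le> g j \<and> g j \<le> d"
  using permutes_in_image[of g "{1..d}" j] by simp

lemma T_id: "f \<in> V \<Longrightarrow> T id f = f"
proof (rule V_eq[OF hlin_T hlin_id])
  fix S assume S: "S \<subseteq> {1..d}"
  have "T id (cv S L) = W.clp id S (vv (id \<circ> L))" by (rule T_cv[OF S])
  also have "id \<circ> L = L" by (rule id_comp)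
  also have "W.clp id S (vv L) = cv S L" unfolding cv_cl[OF L S] W.clp_ident[symmetric] id_def ..
  finally show "T id (cv S L) = cv S L" .
qed

lemma T_C:
  assumes g: "g permutes {1..d}" and j: "1 \<le> j" "j \<le> d" and f: "f \<in> V"
  shows "HC (g j) (T g f) = T g (HC j f)"
proof (rule V_eq[OF hlin_comp[OF hlin_ops(3) hlin_T] hlin_comp[OF hlin_T hlin_ops(3)] _ f])
  fix S assume S: "S \<subseteq> {1..d}"
  show "HC (g j) (T g (cv S L)) = T g (HC j (cv S L))"
    unfolding T_cv[OF S] HC_cv[OF L S j] hlinD(2)[OF hlin_T] T_cv[OF sym_diff_subset[OF S j]]
    by (rule W.C_clp[OF vv_carr g_range[OF g] permutes_inj[OF g] j S])
qed

lemma sorted_list_map: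
  assumes g: "g permutes {1..d}" and S: "S \<subseteq> {1..d}"
  shows "set (map g (sorted_list_of_set S)) \<subseteq> {1..d}" "distinct (map g (sorted_list_of_set S))"
    "j \<in> {1..d} \<Longrightarrow> g j \<in> set (map g (sorted_list_of_set S)) \<longleftrightarrow> j \<in> S"
    "length (map g (sorted_list_of_set S)) = card S"
proof -
  have fin: "finite S" by (rule finite_subset[OF S]) simp
  show "set (map g (sorted_list_of_set S)) \<subseteq> {1..d}"
    using order_trans[OF image_mono[OF S] g_range[OF g]] by (simp add: fin)
  show "distinct (map g (sorted_list_of_set S))"
    by (simp add: distinct_map inj_on_subset[OF permutes_inj[OF g]])
  show "g j \<in> set (map g (sorted_list_of_set S)) \<longleftrightarrow> j \<in> S"
    by (simp add: fin inj_image_mem_iff[OF permutes_inj[OF g]])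
  show "length (map g (sorted_list_of_set S)) = card S" by simp
qed

lemma bij_gL: "g permutes {1..d} \<Longrightarrow> bij_filling d lam mu (g \<circ> L)"
  by (rule bij_filling_comp[OF bijL])

lemma cn_gL: "g permutes {1..d} \<Longrightarrow> 1 \<le> k \<Longrightarrow> k \<le> d \<Longrightarrow> cn (g \<circ> L) k = cn L (inv g k)"
  using cont_comp[OF bijL] by simp

lemma T_X:
  assumes g: "g permutes {1..d}" and j: "1 \<le> j" "j \<le> d" and f: "f \<in> V"
  shows "HX (g j) (T g f) = T g (HX j f)"
proof (rule V_eq[OF hlin_comp[OF hlin_ops(2) hlin_T] hlin_comp[OF hlin_T hlin_ops(2)] _ f])
  fix S assume S: "S \<subseteq> {1..d}"
  note sl = sorted_list_map[OF g S]
  have gj: "1 \<le> g j" "g j \<le> d" using g_mem[OF g j] by auto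
  have "cn (g \<circ> L) (g j) = cn L j" using cn_gL[OF g gj] permutes_inverses(2)[OF g] by simp
  hence x: "HX (g j) (vv (g \<circ> L)) = hscale (kap (cn L j)) (vv (g \<circ> L))"
    using HX_vv[OF bij_gL[OF g] gj] by simp
  have mem: "g j \<in> set (map g (sorted_list_of_set S)) \<longleftrightarrow> j \<in> S" using sl(3)[of j] j by simp
  have "HX (g j) (T g (cv S L)) =
      hscale (if j \<in> S then -1 else 1) (foldr HC (map g (sorted_list_of_set S)) (hscale (kap (cn L j)) (vv (g \<circ> L))))"
    unfolding T_cv[OF S] W.clp_def W.X_foldr[OF vv_carr gj sl(1,2)] mem x ..
  also have "foldr HC (map g (sorted_list_of_set S)) (hscale (kap (cn L j)) (vv (g \<circ> L)))
      = hscale (kap (cn L j)) (T g (cv S L))"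
    unfolding T_cv[OF S] W.clp_def using W.lin_foldr_C[OF sl(1), THEN W.lin_rules(3)] vv_carr by simp
  finally show "HX (g j) (T g (cv S L)) = T g (HX j (cv S L))"
    unfolding HX_cv[OF L S j] hlinD(2)[OF hlin_T] HV.scale_scale .
qed

lemma T_phi:
  assumes g: "g permutes {1..d}" and i: "1 \<le> i" "i < d" and f: "f \<in> V"
  shows "W.\<phi> i (T g f) = hscale (yc (cn (g \<circ> L) i) (cn (g \<circ> L) (Suc i))) (T (adj i \<circ> g) f)"
proof -
  have hphi: "hlin (W.\<phi> i)"
    unfolding phi_def[abs_def]
    by (rule hlin_diff[OF hlin_add[OF hlin_comp[OF hlin_ops(1) hlin_diff[OF hlin_comp[OF hlin_ops(2,2)]
              hlin_comp[OF hlin_ops(2,2)]]] hlin_add[OF hlin_ops(2,2)]]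
          hlin_comp[OF hlin_ops(3) hlin_comp[OF hlin_ops(3) hlin_diff[OF hlin_ops(2,2)]]]])
  show ?thesis
  proof (rule V_eq[OF hlin_comp[OF hphi hlin_T] hlin_scale[OF hlin_T] _ f])
    fix S assume S: "S \<subseteq> {1..d}"
    note sl = sorted_list_map[OF g S]
    note h = adj_comp_permutes[OF g i]
    have m: "map (adj i) (map g (sorted_list_of_set S)) = map (adj i \<circ> g) (sorted_list_of_set S)"
      by (rule map_map)
    show "W.\<phi> i (T g (cv S L)) = hscale (yc (cn (g \<circ> L) i) (cn (g \<circ> L) (Suc i))) (T (adj i \<circ> g) (cv S L))"
      unfolding T_cv[OF S] W.clp_def W.phi_foldr[OF vv_carr i sl(1)] m phi_vv[OF bij_gL[OF g] i]
        adj_apply_comp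
      using W.lin_foldr_C[OF sorted_list_map(1)[OF h S], THEN W.lin_rules(3)] vv_carr by simp
  qed
qed

lemma T_carr: "g permutes {1..d} \<Longrightarrow> f \<in> V \<Longrightarrow> T g f \<in> carr H"
  unfolding T_def
proof (rule W.carr_sum)
  fix S assume g: "g permutes {1..d}" and S: "S \<in> Pow {1..d}"
  show "hscale (f L S) (W.clp g S (vv (g \<circ> L))) \<in> carr H"
    using W.lin_clp[OF _ g_range[OF g], THEN W.lin_rules(1), of S] S vv_carr by (intro carr_closed(2)) auto
qed

lemma T_nonstandard: "\<not> std (g \<circ> L) \<Longrightarrow> g permutes {1..d} \<Longrightarrow> T g f = 0"
  unfolding T_def
proof (rule sum.neutral, rule ballI)
  fix S assume ns: "\<not> std (g \<circ> L)" and g: "g permutes {1..d}" and S: "S \<in> Pow {1..d}"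
  have "W.clp g S 0 = 0" using W.lin_0[OF W.lin_clp[OF _ g_range[OF g]]] S by simp
  thus "hscale (f L S) (W.clp g S (vv (g \<circ> L))) = 0" using ns by (simp add: vv_def)
qed

lemma T_wt:
  assumes g: "g permutes {1..d}" and f: "f \<in> V"
  shows "W.wt (cn (g \<circ> L)) (T g f)"
proof -
  have "W.wt (cn (g \<circ> L)) (foldr HC js (vv (g \<circ> L)))" if "set js \<subseteq> {1..d}" for js
    using that
  proof (induction js)
    case Nil
    have "W.wt (cn (g \<circ> L)) (vv (g \<circ> L))"
    proof (cases "std (g \<circ> L)")
      case True
      thus ?thesis by (intro W.eig_wt vv_eig)
    next
      case False
      hence "vv (g \<circ> L) = 0" unfolding vv_def by (rule if_not_P)
      thus ?thesis by (simp only: W.wt_0)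
    qed
    thus ?case by (simp only: foldr.simps id_apply)
  next
    case (Cons j js)
    thus ?case using W.wt_C by simp
  qed
  thus ?thesis
    unfolding T_def W.clp_def using sorted_list_map(1)[OF g]
    by (intro W.wt_sum W.wt_sm) auto
qed

lemma T_parity:
  assumes g: "g permutes {1..d}" and f: "f \<in> V"
  shows "f \<in> evn H \<Longrightarrow> T g f \<in> evn H" "f \<in> odd_part H \<Longrightarrow> T g f \<in> odd_part H"
proof -
  have vv: "vv (g \<circ> L) \<in> evn H"
    using cv_supported[of "g \<circ> L" "{}" "\<lambda>L S. even (card S)"] W.subspace_0[OF W.subspace_evn]
    by (auto simp: vv_def H_simps)
  have p: "foldr HC js (vv (g \<circ> L)) \<in> (if even (length js) then evn H else odd_part H)"
    if "set js \<subseteq> {1..d}" for js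
    using that
  proof (induction js)
    case (Cons j js)
    thus ?case using W.c_odd[of j] by (auto simp: odd_map_def image_subset_iff split: if_splits)
  qed (simp add: vv)
  have q: "W.clp g S (vv (g \<circ> L)) \<in> (if even (card S) then evn H else odd_part H)" if "S \<subseteq> {1..d}" for S
    unfolding W.clp_def using p[OF sorted_list_map(1)[OF g that]] by simp
  show "T g f \<in> evn H" if "f \<in> evn H"
    unfolding T_def
  proof (rule W.subspace_sum[OF W.subspace_evn])
    fix S assume S: "S \<in> Pow {1..d}"
    have "f L S = 0 \<or> even (card S)" using that by (auto simp: H_simps supported_def)
    thus "hscale (f L S) (W.clp g S (vv (g \<circ> L))) \<in> evn H"
      using q[of S] S W.subspace_scale[OF W.subspace_evn] W.subspace_0[OF W.subspace_evn] by auto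
  qed
  show "T g f \<in> odd_part H" if "f \<in> odd_part H"
    unfolding T_def
  proof (rule W.subspace_sum[OF W.subspace_odd])
    fix S assume S: "S \<in> Pow {1..d}"
    have "f L S = 0 \<or> odd (card S)" using that by (auto simp: H_simps supported_def)
    thus "hscale (f L S) (W.clp g S (vv (g \<circ> L))) \<in> odd_part H"
      using q[of S] S W.subspace_scale[OF W.subspace_odd] W.subspace_0[OF W.subspace_odd] by auto
  qed
qed

text \<open>
  The scalar by which \<open>\<phi>\<^sub>g\<close> differs from \<open>T g\<close>. Each ascent on the way to \<open>g\<close> contributes the coefficient of one
  inversion, so the product depends only on \<open>g\<close>.
\<close>

definition m :: "(nat \<Rightarrow> nat) \<Rightarrow> complex" where
  "m g = (\<Prod>(p, r)\<in>Inversions d g. yc (cn L p) (cn L r))"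

lemma m_id: "m id = 1"
  unfolding m_def Inversions_id by simp

lemma m_step:
  assumes g: "g permutes {1..d}" and i: "1 \<le> i" "i < d" and asc: "ascent g i"
  shows "m (adj i \<circ> g) = yc (cn (g \<circ> L) i) (cn (g \<circ> L) (Suc i)) * m g"
  unfolding m_def Inversions_adj(1)[OF g i asc]
  using Inversions_adj(2)[OF g i asc] finite_Inversions cn_gL[OF g] i by simp

text \<open>
  The labels inverted by \<open>g\<close> belong to boxes with far contents, where the coefficients do not vanish.
\<close>

lemma m_nonzero:
  assumes g: "g permutes {1..d}" and std: "std (g \<circ> L)"
  shows "m g \<noteq> 0"
proof -
  have "yc (cn L p) (cn L r) \<noteq> 0" if "(p, r) \<in> Inversions d g" for p r
  proof -
    have "far (cn L p) (cn L r)" using standard_inversions_far[OF sk L g std that] .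
    moreover from this have "cn L p \<noteq> cn L r" by (auto simp: far_def)
    ultimately show ?thesis using yc_eq_0_iff by simp
  qed
  thus ?thesis unfolding m_def using finite_Inversions by (auto simp: prod_zero_iff)
qed

lemma phi_word_tight:
  assumes "set ws \<subseteq> {1..<d}" "length ws = card (Inversions d (word_perm ws))" and f: "f \<in> V"
  shows "phi_word H ws f = hscale (m (word_perm ws)) (T (word_perm ws) f)"
  using assms(1,2)
proof (induction ws)
  case Nil
  show ?case unfolding word_perm_Nil m_id T_id[OF f] by (simp add: phi_word_def)
next
  case (Cons i ws)
  have i: "1 \<le> i" "i < d" using Cons.prems by auto
  have ws: "set ws \<subseteq> {1..<d}" using Cons.prems by simp
  note t = tight_word_Cons[OF Cons.prems]
  note g = word_perm_permutes[OF ws]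
  have "phi_word H (i # ws) f = W.\<phi> i (phi_word H ws f)" by (simp add: phi_word_def)
  also have "\<dots> = hscale (m (word_perm ws)) (W.\<phi> i (T (word_perm ws) f))"
    unfolding Cons.IH[OF ws t(2)]
    using W.lin_phi[OF i, THEN W.lin_rules(3)] T_carr[OF g f] by simp
  also have "\<dots> = hscale (m (word_perm (i # ws))) (T (word_perm (i # ws)) f)"
    unfolding T_phi[OF g i f] word_perm_Cons m_step[OF g i t(1)] HV.scale_scale
    by (simp only: mult.commute)
  finally show ?case .
qed

lemma phi_perm_eq:
  assumes g: "g permutes {1..d}" and f: "f \<in> V"
  shows "phi_perm d H g f = hscale (m g) (T g f)"
  unfolding phi_perm_def
  using phi_word_tight[OF chosen_reduced_word(1)[OF g] _ f] chosen_reduced_word(2,3)[OF g] by simp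

end

locale chosen_module = based_shape +
  fixes U :: "hvec set"
  assumes UV: "U \<subseteq> V" and Uirr: "irreducible_A_submodule d H U"
begin

text \<open>
  The permutations that lead from \<open>L\<close> to a standard filling; the others contribute nothing to the
  submodule \<open>N\<close> generated by \<open>U\<close>.
\<close>

definition G :: "(nat \<Rightarrow> nat) set" where
  "G = {g. g permutes {1..d} \<and> std (g \<circ> L)}"

definition N :: "hvec set" where
  "N = {\<Sum>g\<in>G. T g (u g) | u. \<forall>g. u g \<in> U}"

lemma N_I: "(\<And>g. u g \<in> U) \<Longrightarrow> f = (\<Sum>g\<in>G. T g (u g)) \<Longrightarrow> f \<in> N"
  unfolding N_def by (rule CollectI, rule exI[of _ u]) simp

lemma G_permutes: "g \<in> G \<Longrightarrow> g permutes {1..d}"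
  and G_std: "g \<in> G \<Longrightarrow> std (g \<circ> L)"
  by (simp_all add: G_def)

lemma finite_G: "finite G"
  by (rule finite_subset[of _ "{g. g permutes {1..d}}"]) (auto simp: G_def finite_permutations)

lemma U_A: "A_submodule d H U"
  using Uirr by (simp add: irreducible_A_submodule_def)

lemma U_subspace: "HV.subspace U"
  and U_graded: "U = {e + r | e r. e \<in> U \<inter> evn H \<and> r \<in> U \<inter> odd_part H}"
  using U_A by (auto simp: A_submodule_def graded_subspace_def H_simps(1))

lemma U_X: "1 \<le> j \<Longrightarrow> j \<le> d \<Longrightarrow> u \<in> U \<Longrightarrow> HX j u \<in> U"
  and U_C: "1 \<le> j \<Longrightarrow> j \<le> d \<Longrightarrow> u \<in> U \<Longrightarrow> HC j u \<in> U"
  using U_A by (simp_all add: A_submodule_def x_invariant_def image_subset_iff)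

lemma U_zero: "0 \<in> U"
  by (rule HV.subspace_0[OF U_subspace])

lemma T_zero [simp]: "T g 0 = 0"
  by (rule hlinD(3)[OF hlin_T])

lemma Hmod_eq: "Hmod d lam mu U = restrict_to H N"
proof -
  have "{\<Sum>w\<in>{w. w permutes {1..d}}. phi_perm d H w (u w) | u. \<forall>w. u w \<in> U} = N"
  proof (intro subset_antisym subsetI)
    fix f assume "f \<in> {\<Sum>w\<in>{w. w permutes {1..d}}. phi_perm d H w (u w) | u. \<forall>w. u w \<in> U}"
    then obtain u where u: "\<And>w. u w \<in> U" "f = (\<Sum>w\<in>{w. w permutes {1..d}}. phi_perm d H w (u w))"
      by blast
    have "f = (\<Sum>w\<in>G. T w (hscale (m w) (u w)))"
      unfolding u(2)
    proof (rule sum.mono_neutral_cong_right)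
      show "finite {w. w permutes {1..d}}" by (rule finite_permutations) simp
      show "G \<subseteq> {w. w permutes {1..d}}" by (auto simp: G_def)
      have e: "phi_perm d H w (u w) = T w (hscale (m w) (u w))" if "w permutes {1..d}" for w
        using phi_perm_eq[OF that] u(1) UV by (auto simp: hlinD(2)[OF hlin_T])
      show "\<forall>w\<in>{w. w permutes {1..d}} - G. phi_perm d H w (u w) = 0"
        using e T_nonstandard by (simp add: G_def)
      show "phi_perm d H w (u w) = T w (hscale (m w) (u w))" if "w \<in> G" for w
        using e that by (simp add: G_def)
    qed
    thus "f \<in> N" by (rule N_I[rotated]) (rule HV.subspace_scale[OF U_subspace u(1)])
  next
    fix f assume "f \<in> N"
    then obtain u where u: "\<And>w. u w \<in> U" "f = (\<Sum>w\<in>G. T w (u w))" unfolding N_def by blast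
    define u' where "u' w = hscale (1 / m w) (u w)" for w
    have u': "u' w \<in> U" for w unfolding u'_def using u(1) HV.subspace_scale[OF U_subspace] by blast
    have "(\<Sum>w\<in>{w. w permutes {1..d}}. phi_perm d H w (u' w)) = f"
      unfolding u(2)
    proof (rule sum.mono_neutral_cong_right)
      show "finite {w. w permutes {1..d}}" by (rule finite_permutations) simp
      show "G \<subseteq> {w. w permutes {1..d}}" by (auto simp: G_def)
      have e: "phi_perm d H w (u' w) = hscale (m w) (T w (u' w))" if "w permutes {1..d}" for w
        using phi_perm_eq[OF that] u' UV by blast
      show "\<forall>w\<in>{w. w permutes {1..d}} - G. phi_perm d H w (u' w) = 0"
        using e T_nonstandard by (simp add: G_def)
      show "phi_perm d H w (u' w) = T w (u w)" if "w \<in> G" for w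
        using e[OF G_permutes[OF that]] m_nonzero[OF G_permutes[OF that] G_std[OF that]]
        by (simp add: u'_def hlinD(2)[OF hlin_T])
    qed
    with u' show "f \<in> {\<Sum>w\<in>{w. w permutes {1..d}}. phi_perm d H w (u w) | u. \<forall>w. u w \<in> U}" by blast
  qed
  thus ?thesis unfolding Hmod_def by simp
qed

lemma N_subspace: "HV.subspace N"
proof (rule HV.subspaceI)
  have "0 = (\<Sum>g\<in>G. T g 0)" by simp
  thus "0 \<in> N" by (rule N_I[rotated]) (rule U_zero)
next
  fix x y assume "x \<in> N" "y \<in> N"
  then obtain u w where u: "\<And>g. u g \<in> U" "x = (\<Sum>g\<in>G. T g (u g))"
    and w: "\<And>g. w g \<in> U" "y = (\<Sum>g\<in>G. T g (w g))" unfolding N_def by blast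
  have "x + y = (\<Sum>g\<in>G. T g (u g + w g))"
    unfolding u(2) w(2) hlinD(1)[OF hlin_T] by (rule sum.distrib[symmetric])
  thus "x + y \<in> N" by (rule N_I[rotated]) (rule HV.subspace_add[OF U_subspace u(1) w(1)])
next
  fix a x assume "x \<in> N"
  then obtain u where u: "\<And>g. u g \<in> U" "x = (\<Sum>g\<in>G. T g (u g))" unfolding N_def by blast
  have "hscale a x = (\<Sum>g\<in>G. T g (hscale a (u g)))"
    unfolding u(2) hlinD(2)[OF hlin_T] by (rule HV.scale_sum_right)
  thus "hscale a x \<in> N" by (rule N_I[rotated]) (rule HV.subspace_scale[OF U_subspace u(1)])
qed

lemma T_in_N:
  assumes g: "g permutes {1..d}" and u: "u \<in> U"
  shows "T g u \<in> N"
proof (cases "std (g \<circ> L)")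
  case True
  define w where "w h = (if h = g then u else 0)" for h
  have "(\<Sum>h\<in>G. T h (w h)) = (\<Sum>h\<in>G. if h = g then T g u else 0)"
    by (rule sum.cong) (auto simp: w_def)
  also have "\<dots> = T g u" using True g finite_G by (simp add: sum.delta G_def)
  finally have "T g u = (\<Sum>h\<in>G. T h (w h))" by simp
  thus ?thesis by (rule N_I[rotated]) (simp add: w_def u U_zero)
next
  case False
  thus ?thesis using T_nonstandard[OF False g] HV.subspace_0[OF N_subspace] by simp
qed

lemma N_closed:
  assumes F: "hlin F" and gen: "\<And>g u. g \<in> G \<Longrightarrow> u \<in> U \<Longrightarrow> F (T g u) \<in> N" and f: "f \<in> N"
  shows "F f \<in> N"
proof -
  obtain u where u: "\<And>g. u g \<in> U" "f = (\<Sum>g\<in>G. T g (u g))" using f unfolding N_def by blast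
  show ?thesis
    unfolding u(2) hlin_sum[OF F] by (rule HV.subspace_sum[OF N_subspace], rule gen[OF _ u(1)])
qed

lemma N_C:
  assumes j: "1 \<le> j" "j \<le> d" and f: "f \<in> N"
  shows "HC j f \<in> N"
proof (rule N_closed[OF hlin_ops(3) _ f])
  fix g u assume g: "g \<in> G" and u: "u \<in> U"
  note gp = G_permutes[OF g]
  have k: "1 \<le> inv g j" "inv g j \<le> d" using permutes_inv_mem[OF gp, of j] j by auto
  have "HC j (T g u) = T g (HC (inv g j) u)"
    using T_C[OF gp k, of u] u UV permutes_inverses(1)[OF gp] by auto
  thus "HC j (T g u) \<in> N" using T_in_N[OF gp U_C[OF k u]] by simp
qed

lemma N_X:
  assumes j: "1 \<le> j" "j \<le> d" and f: "f \<in> N"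
  shows "HX j f \<in> N"
proof (rule N_closed[OF hlin_ops(2) _ f])
  fix g u assume g: "g \<in> G" and u: "u \<in> U"
  note gp = G_permutes[OF g]
  have k: "1 \<le> inv g j" "inv g j \<le> d" using permutes_inv_mem[OF gp, of j] j by auto
  have "HX j (T g u) = T g (HX (inv g j) u)"
    using T_X[OF gp k, of u] u UV permutes_inverses(1)[OF gp] by auto
  thus "HX j (T g u) \<in> N" using T_in_N[OF gp U_X[OF k u]] by simp
qed

lemma N_S:
  assumes i: "1 \<le> i" "i < d" and f: "f \<in> N"
  shows "HS i f \<in> N"
proof (rule N_closed[OF hlin_ops(1) _ f])
  fix g u assume g: "g \<in> G" and u: "u \<in> U"
  note gp = G_permutes[OF g]
  have uV: "u \<in> V" using u UV by blast
  have z: "T g u \<in> N" using T_in_N[OF gp u] .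
  have i': "1 \<le> i" "i \<le> d" and j: "1 \<le> Suc i" "Suc i \<le> d" using i by auto
  have "W.\<phi> i (T g u) \<in> N"
    unfolding T_phi[OF gp i uV]
    by (rule HV.subspace_scale[OF N_subspace T_in_N[OF adj_comp_permutes[OF gp i] u]])
  moreover have "W.lower i (T g u) \<in> N"
    unfolding W.lower_def
    by (intro HV.subspace_diff[OF N_subspace] HV.subspace_add[OF N_subspace] N_C i' j
        N_X[OF i' z] N_X[OF j z])
  ultimately show "HS i (T g u) \<in> N"
    unfolding W.S_eq[OF T_wt[OF gp uV] i standard_adjacent_contents[OF sk G_std[OF g] i]]
    by (intro HV.subspace_scale[OF N_subspace] HV.subspace_diff[OF N_subspace])
qed

lemma N_carr: "N \<subseteq> carr H"
proof
  fix f assume "f \<in> N"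
  then obtain u where u: "\<And>g. u g \<in> U" "f = (\<Sum>g\<in>G. T g (u g))" unfolding N_def by blast
  show "f \<in> carr H"
    unfolding u(2) using T_carr[OF G_permutes] u(1) UV by (intro W.carr_sum) blast
qed

lemma N_graded: "N = {e + r | e r. e \<in> N \<inter> evn H \<and> r \<in> N \<inter> odd_part H}" (is "_ = ?D")
proof
  show "?D \<subseteq> N" using HV.subspace_add[OF N_subspace] by blast
  show "N \<subseteq> ?D"
  proof
    fix f assume "f \<in> N"
    then obtain u where u: "\<And>g. u g \<in> U" "f = (\<Sum>g\<in>G. T g (u g))" unfolding N_def by blast
    have "\<exists>e r. e \<in> U \<inter> evn H \<and> r \<in> U \<inter> odd_part H \<and> u g = e + r" for g
    proof -
      have "u g \<in> {e + r | e r. e \<in> U \<inter> evn H \<and> r \<in> U \<inter> odd_part H}"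
        using u(1)[of g] unfolding U_graded[symmetric] .
      thus ?thesis by blast
    qed
    then obtain e r where er: "\<And>g. e g \<in> U \<inter> evn H" "\<And>g. r g \<in> U \<inter> odd_part H"
      "\<And>g. u g = e g + r g" by metis
    have "f = (\<Sum>g\<in>G. T g (e g)) + (\<Sum>g\<in>G. T g (r g))"
      unfolding u(2) er(3) hlinD(1)[OF hlin_T] by (rule sum.distrib)
    moreover have "(\<Sum>g\<in>G. T g (e g)) \<in> N \<inter> evn H"
    proof
      show "(\<Sum>g\<in>G. T g (e g)) \<in> N"
        using T_in_N[OF G_permutes] er(1) by (intro HV.subspace_sum[OF N_subspace]) blast
      show "(\<Sum>g\<in>G. T g (e g)) \<in> evn H"
        using T_parity(1)[OF G_permutes] er(1) UV by (intro W.subspace_sum[OF W.subspace_evn]) blast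
    qed
    moreover have "(\<Sum>g\<in>G. T g (r g)) \<in> N \<inter> odd_part H"
    proof
      show "(\<Sum>g\<in>G. T g (r g)) \<in> N"
        using T_in_N[OF G_permutes] er(2) by (intro HV.subspace_sum[OF N_subspace]) blast
      show "(\<Sum>g\<in>G. T g (r g)) \<in> odd_part H"
        using T_parity(2)[OF G_permutes] er(2) UV by (intro W.subspace_sum[OF W.subspace_odd]) blast
    qed
    ultimately show "f \<in> ?D" by blast
  qed
qed

lemma N_submodule: "hc_submodule d H N"
  unfolding hc_submodule_def A_submodule_def graded_subspace_def x_invariant_def
  using N_carr N_subspace N_graded N_X N_C N_S by (simp add: H_simps(1) image_subset_iff)

lemma U_in_N: "U \<subseteq> N"
proof
  fix u assume u: "u \<in> U"
  have "T id u \<in> N" by (rule T_in_N[OF permutes_id u])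
  thus "u \<in> N" using T_id[of u] u UV by auto
qed

text \<open>
  A nonzero submodule contains a nonzero weight component \<open>T g u\<close>; the elements of \<open>U\<close> that
  \<open>T g\<close> carries into the submodule form a submodule over the \<open>x\<^sub>j\<close> and \<open>c\<^sub>j\<close>, hence all of \<open>U\<close>. The
  intertwiners then spread this to all other standard fillings.
\<close>

theorem Hmod_irreducible: "irreducible_hc d (Hmod d lam mu U)"
proof -
  have mod: "hc_module d (restrict_to H N)"
    by (rule hc_module_restrict[OF hc_moduleI[OF H_hc H_integral] N_submodule])
  have nz: "N \<noteq> {0}"
    using U_in_N Uirr U_zero by (auto simp: irreducible_A_submodule_def)
  have "W1 = {0} \<or> W1 = N" if W1: "hc_submodule d (restrict_to H N) W1" for W1
  proof (rule ccontr)
    assume neg: "\<not> (W1 = {0} \<or> W1 = N)"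
    have sub: "W1 \<subseteq> N" "HV.subspace W1"
      and gr: "W1 = {e + r | e r. e \<in> W1 \<inter> (N \<inter> evn H) \<and> r \<in> W1 \<inter> (N \<inter> odd_part H)}"
      using W1 by (auto simp: hc_submodule_def A_submodule_def graded_subspace_def H_simps(1))
    have X: "HX j f \<in> W1" and C: "HC j f \<in> W1" if "1 \<le> j" "j \<le> d" "f \<in> W1" for j f
      using W1 that by (simp_all add: hc_submodule_def A_submodule_def x_invariant_def image_subset_iff)
    have S: "HS i f \<in> W1" if "1 \<le> i" "i < d" "f \<in> W1" for i f
      using W1 that by (simp add: hc_submodule_def image_subset_iff)
    obtain f where f: "f \<in> W1" "f \<noteq> 0" using neg HV.subspace_0[OF sub(2)] by blast
    obtain u where u: "\<And>g. u g \<in> U" "f = (\<Sum>g\<in>G. T g (u g))"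
      using f(1) sub(1) unfolding N_def by blast
    obtain g where g: "g \<in> G" "T g (u g) \<noteq> 0"
    proof -
      have "\<exists>g\<in>G. T g (u g) \<noteq> 0"
      proof (rule ccontr)
        assume "\<not> (\<exists>g\<in>G. T g (u g) \<noteq> 0)"
        hence "(\<Sum>g\<in>G. T g (u g)) = 0" by (intro sum.neutral) auto
        thus False using f(2) unfolding u(2) by (rule notE[rotated])
      qed
      thus thesis using that by blast
    qed
    have Tg: "T g (u g) \<in> W1"
    proof (rule W.weight_component[where F = "G - {g}" and f = "\<lambda>h. T h (u h)" and c = "\<lambda>h. cn (h \<circ> L)"
          and ?c0.0 = "cn (g \<circ> L)"])
      show "HV.subspace W1" by (rule sub(2))
      show "HX j (HX j v) \<in> W1" if "1 \<le> j" "j \<le> d" "v \<in> W1" for j v using X that by blast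
      show "finite (G - {g})" using finite_G by simp
      show "W.wt (cn (g \<circ> L)) (T g (u g))" using T_wt[OF G_permutes[OF g(1)]] u(1) UV by blast
      show "W.wt (cn (h \<circ> L)) (T h (u h))" if "h \<in> G - {g}" for h
        using T_wt[OF G_permutes] that u(1) UV by blast
      show "\<exists>j. 1 \<le> j \<and> j \<le> d \<and> cn (h \<circ> L) j \<noteq> cn (g \<circ> L) j" if h: "h \<in> G - {g}" for h
      proof (rule ccontr)
        assume "\<nexists>j. 1 \<le> j \<and> j \<le> d \<and> cn (h \<circ> L) j \<noteq> cn (g \<circ> L) j"
        hence eq: "\<And>k. k \<in> {1..d} \<Longrightarrow> cn (h \<circ> L) k = cn (g \<circ> L) k" by auto
        have hG: "h \<in> G" using h by blast
        have "h \<circ> L = g \<circ> L"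
          by (rule filling_determined_by_contents[OF sk G_std[OF hG] G_std[OF g(1)] eq])
        hence "h = g" by (rule comp_filling_inj[OF bijL G_permutes[OF hG] G_permutes[OF g(1)]])
        with h show False by blast
      qed
      show "T g (u g) + (\<Sum>h\<in>G - {g}. T h (u h)) \<in> W1"
        using f(1) sum.remove[OF finite_G g(1), of "\<lambda>h. T h (u h)"] u(2) by simp
    qed
    note gp = G_permutes[OF g(1)]
    define K where "K = {v \<in> U. T g v \<in> W1}"
    have gm: "1 \<le> g j \<and> g j \<le> d" if "1 \<le> j" "j \<le> d" for j using g_mem[OF gp that] .
    have "A_submodule d H K"
      unfolding A_submodule_def graded_subspace_def x_invariant_def
    proof (intro conjI ballI)
      show "K \<subseteq> carr H" using UV Clv_carr by (auto simp: K_def)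
      show "module.subspace (smul H) K"
        unfolding H_simps(1)
        by (rule HV.subspaceI) (auto simp: K_def U_zero HV.subspace_0[OF sub(2)] hlinD(1,2)[OF hlin_T]
            intro: HV.subspace_add[OF U_subspace] HV.subspace_add[OF sub(2)]
              HV.subspace_scale[OF U_subspace] HV.subspace_scale[OF sub(2)])
      show "HX j ` K \<subseteq> K" if "j \<in> {1..d}" for j
      proof (rule image_subsetI)
        fix v assume v: "v \<in> K"
        have j: "1 \<le> j" "j \<le> d" using that by auto
        have "HX (g j) (T g v) \<in> W1" using X gm[OF j] v by (simp add: K_def)
        moreover have "HX (g j) (T g v) = T g (HX j v)" using T_X[OF gp j] v UV by (auto simp: K_def)
        ultimately show "HX j v \<in> K" using U_X[OF j] v by (simp add: K_def)
      qed
      show "HC j ` K \<subseteq> K" if "j \<in> {1..d}" for j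
      proof (rule image_subsetI)
        fix v assume v: "v \<in> K"
        have j: "1 \<le> j" "j \<le> d" using that by auto
        have "HC (g j) (T g v) \<in> W1" using C gm[OF j] v by (simp add: K_def)
        moreover have "HC (g j) (T g v) = T g (HC j v)" using T_C[OF gp j] v UV by (auto simp: K_def)
        ultimately show "HC j v \<in> K" using U_C[OF j] v by (simp add: K_def)
      qed
      show "K = {e + r | e r. e \<in> K \<inter> evn H \<and> r \<in> K \<inter> odd_part H}" (is "_ = ?D")
      proof
        show "?D \<subseteq> K"
          using HV.subspace_add[OF U_subspace] HV.subspace_add[OF sub(2)]
          by (auto simp: K_def hlinD(1)[OF hlin_T])
        show "K \<subseteq> ?D"
        proof
          fix v assume v: "v \<in> K"
          hence "v \<in> {e + r | e r. e \<in> U \<inter> evn H \<and> r \<in> U \<inter> odd_part H}"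
            unfolding U_graded[symmetric] by (simp add: K_def)
          then obtain e r where er: "e \<in> U" "e \<in> evn H" "r \<in> U" "r \<in> odd_part H" "v = e + r" by blast
          have eV: "e \<in> V" "r \<in> V" using er UV by auto
          have "T g v \<in> W1" using v by (simp add: K_def)
          hence "T g v \<in> {e + r | e r. e \<in> W1 \<inter> (N \<inter> evn H) \<and> r \<in> W1 \<inter> (N \<inter> odd_part H)}"
            unfolding gr[symmetric] .
          then obtain e' r' where er': "e' \<in> W1" "e' \<in> evn H" "r' \<in> W1" "r' \<in> odd_part H" "T g v = e' + r'"
            by blast
          have "T g e + T g r = e' + r'" using er'(5) er(5) hlinD(1)[OF hlin_T] by simp
          hence "T g e = e'" "T g r = r'"
            using W.evn_odd_unique[OF T_parity(1)[OF gp eV(1) er(2)] T_parity(2)[OF gp eV(2) er(4)] er'(2,4)]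
            by auto
          thus "v \<in> ?D" using er er' by (auto simp: K_def)
        qed
      qed
    qed
    moreover have "K \<subseteq> U" by (auto simp: K_def)
    ultimately have "K = {0} \<or> K = U" using Uirr unfolding irreducible_A_submodule_def by blast
    moreover have "u g \<in> K" "u g \<noteq> 0" using Tg u(1) g(2) by (auto simp: K_def)
    ultimately have "K = U" by blast
    hence TgU: "T g v \<in> W1" if "v \<in> U" for v using that by (auto simp: K_def)
    have phiW: "W.\<phi> i v \<in> W1" if i: "1 \<le> i" "i < d" and v: "v \<in> W1" for i v
    proof -
      have r: "1 \<le> i" "i \<le> d" "1 \<le> i + 1" "i + 1 \<le> d" using i by auto
      show ?thesis
        unfolding phi_def
        using v r i by (intro HV.subspace_diff[OF sub(2)] HV.subspace_add[OF sub(2)] S C X)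
    qed
    have move: "(\<forall>v\<in>U. T h v \<in> W1) \<longleftrightarrow> (\<forall>v\<in>U. T (adj i \<circ> h) v \<in> W1)"
      if h: "h permutes {1..d}" and i: "1 \<le> i" "i < d"
        and far: "far (cn (h \<circ> L) i) (cn (h \<circ> L) (Suc i))" for h i
    proof -
      let ?y = "yc (cn (h \<circ> L) i) (cn (h \<circ> L) (Suc i))"
      have "cn (h \<circ> L) i \<noteq> cn (h \<circ> L) (Suc i)" using far by (auto simp: far_def)
      hence y: "?y \<noteq> 0" using yc_eq_0_iff far by simp
      note hi = adj_comp_permutes[OF h i]
      have c: "cn ((adj i \<circ> h) \<circ> L) i = cn (h \<circ> L) (Suc i)" "cn ((adj i \<circ> h) \<circ> L) (Suc i) = cn (h \<circ> L) i"
        unfolding adj_apply_comp[symmetric] using cont_adj[OF bij_gL[OF h] i] i by auto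
      have hh: "adj i \<circ> (adj i \<circ> h) = h" by (rule adj_adj_comp)
      have e1: "T (adj i \<circ> h) v = hscale (1 / ?y) (W.\<phi> i (T h v))"
        and e2: "T h v = hscale (- 1 / ?y) (W.\<phi> i (T (adj i \<circ> h) v))" if "v \<in> U" for v
      proof -
        have vV: "v \<in> V" using that UV by blast
        show "T (adj i \<circ> h) v = hscale (1 / ?y) (W.\<phi> i (T h v))"
          unfolding T_phi[OF h i vV] using y by simp
        show "T h v = hscale (- 1 / ?y) (W.\<phi> i (T (adj i \<circ> h) v))"
          unfolding T_phi[OF hi i vV] c yc_swap[of "cn (h \<circ> L) (Suc i)" "cn (h \<circ> L) i"] hh
          using y by simp
      qed
      have d1: "T (adj i \<circ> h) v \<in> W1" if "v \<in> U" "T h v \<in> W1" for v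
        unfolding e1[OF that(1)] by (rule HV.subspace_scale[OF sub(2) phiW[OF i that(2)]])
      have d2: "T h v \<in> W1" if "v \<in> U" "T (adj i \<circ> h) v \<in> W1" for v
        unfolding e2[OF that(1)] by (rule HV.subspace_scale[OF sub(2) phiW[OF i that(2)]])
      show ?thesis using d1 d2 by blast
    qed
    have conn: "(\<forall>v\<in>U. T id v \<in> W1) \<longleftrightarrow> (\<forall>v\<in>U. T h v \<in> W1)" if h: "h \<in> G" for h
      using sk L G_permutes[OF h] G_std[OF h]
    proof (induction rule: standard_fillings_induct)
      case id
      show ?case by (rule refl)
    next
      case (step h i)
      show ?case
        by (rule trans[OF step(8) move[OF step(1,2,3,7)]])
    qed
    have all: "\<forall>v\<in>U. T h v \<in> W1" if "h \<in> G" for h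
      using conn[OF that] conn[OF g(1)] TgU by blast
    have "N \<subseteq> W1"
    proof
      fix x assume "x \<in> N"
      then obtain w where w: "\<And>h. w h \<in> U" "x = (\<Sum>h\<in>G. T h (w h))" unfolding N_def by blast
      show "x \<in> W1" unfolding w(2) using all w(1) by (intro HV.subspace_sum[OF sub(2)]) blast
    qed
    with sub(1) neg show False by blast
  qed
  with mod nz show ?thesis unfolding Hmod_eq irreducible_hc_def by simp
qed

end

section \<open>Homomorphisms into a calibrated module\<close>

text \<open>
  A homogeneous weight vector \<open>v\<close> of weight \<open>c(L)\<close> in an irreducible calibrated module determines a
  homomorphism from the module on all standard fillings that takes \<open>v\<^sub>L\<close> to \<open>v\<close>. The vector \<open>v\<^sub>K\<close> with
  \<open>K = g L\<close> must go to the multiple of \<open>\<phi>\<^sub>g v\<close> that has the same factor as in the source. The number \<open>sg\<close> is the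
  sign with which the homomorphism passes odd elements.
\<close>

locale weight_hom = based_shape d lam mu L + M: calibrated_hc d M
  for d lam mu L and M :: "('v::ab_group_add) hc_data" +
  fixes v :: 'v and \<Phi> :: "(nat \<Rightarrow> nat) \<Rightarrow> 'v" and sg :: complex
  assumes irr: "irreducible_hc d M" and v: "M.eig (cn L) v"
    and parity: "sg = 1 \<and> v \<in> evn M \<or> sg = -1 \<and> v \<in> odd_part M"
    and chain: "M.chain (cn L) v \<Phi>"
begin

definition w :: "filling \<Rightarrow> 'v" where
  "w K = (if std K then let g = (THE g. g permutes {1..d} \<and> K = g \<circ> L) in smul M (1 / m g) (\<Phi> g) else 0)"

lemma w_comp:
  assumes g: "g permutes {1..d}" and std: "std (g \<circ> L)"
  shows "w (g \<circ> L) = smul M (1 / m g) (\<Phi> g)"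
proof -
  have "(THE h. h permutes {1..d} \<and> g \<circ> L = h \<circ> L) = g"
  proof (rule the_equality)
    show "h = g" if "h permutes {1..d} \<and> g \<circ> L = h \<circ> L" for h
      using comp_filling_inj[OF bijL g, of h] that by simp
  qed (use g in simp)
  thus ?thesis using std by (simp add: w_def)
qed

lemma obtain_perm:
  assumes "std K"
  obtains g where "g permutes {1..d}" "K = g \<circ> L"
  using fillings_differ_by_permutation[OF bijL standard_bij[OF assms]] .

lemma w_L: "w L = v"
proof -
  have "w (id \<circ> L) = smul M (1 / m id) (\<Phi> id)"
    by (rule w_comp[OF permutes_id]) (simp add: L)
  thus ?thesis by (simp add: m_id M.chainD(1)[OF chain])
qed

lemma w_eig:
  assumes K: "std K"
  shows "M.eig (cn K) (w K)"
proof -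
  obtain g where g: "g permutes {1..d}" and Kg: "K = g \<circ> L" using obtain_perm[OF K] .
  have e: "M.eig (cn L \<circ> inv g) (w K)"
    using M.eig_sm[OF M.chainD(3)[OF chain g]] w_comp[OF g] K Kg by simp
  show ?thesis
    by (rule M.eig_cong[OF _ e]) (simp add: Kg cn_gL[OF g])
qed

lemma w_carr: "w K \<in> carr M"
proof (cases "std K")
  case True
  show ?thesis by (rule M.eig_carr[OF w_eig[OF True]])
qed (simp add: w_def)

lemma w_parity: "w K \<in> (if sg = 1 then evn M else odd_part M)"
proof (cases "std K")
  case True
  obtain g where g: "g permutes {1..d}" and Kg: "K = g \<circ> L" using obtain_perm[OF True] .
  have "\<Phi> g \<in> (if sg = 1 then evn M else odd_part M)"
    using M.chainD(4)[OF chain g] parity by auto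
  thus ?thesis
    using w_comp[OF g] True Kg M.subspace_scale[OF M.subspace_evn] M.subspace_scale[OF M.subspace_odd] by auto
next
  case False
  thus ?thesis
    using M.subspace_0[OF M.subspace_evn] M.subspace_0[OF M.subspace_odd] by (simp add: w_def)
qed

lemma phi_w_ascent:
  assumes g: "g permutes {1..d}" and K: "std (g \<circ> L)" and i: "1 \<le> i" "i < d"
    and far: "far (cn (g \<circ> L) i) (cn (g \<circ> L) (Suc i))" and asc: "ascent g i"
  shows "M.\<phi> i (w (g \<circ> L)) =
    smul M (yc (cn (g \<circ> L) i) (cn (g \<circ> L) (Suc i))) (w (adj i \<circ> (g \<circ> L)))"
proof -
  let ?y = "yc (cn (g \<circ> L) i) (cn (g \<circ> L) (Suc i))"
  have "cn (g \<circ> L) i \<noteq> cn (g \<circ> L) (Suc i)" using far by (auto simp: far_def)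
  hence y: "?y \<noteq> 0" using yc_eq_0_iff far by simp
  have K': "std ((adj i \<circ> g) \<circ> L)"
    using standard_swap_iff_far[OF sk K i] far by (simp only: adj_apply_comp)
  have "\<Phi> g \<in> carr M" by (rule M.eig_carr[OF M.chainD(3)[OF chain g]])
  hence "M.\<phi> i (w (g \<circ> L)) = smul M (1 / m g) (M.\<phi> i (\<Phi> g))"
    unfolding w_comp[OF g K] by (rule M.lin_rules(3)[OF M.lin_phi[OF i]])
  also have "\<dots> = smul M ?y (smul M (1 / m (adj i \<circ> g)) (\<Phi> (adj i \<circ> g)))"
    using y by (simp add: m_step[OF g i asc] M.chainD(2)[OF chain g i asc])
  also have "\<dots> = smul M ?y (w (adj i \<circ> (g \<circ> L)))"
    unfolding adj_apply_comp w_comp[OF adj_comp_permutes[OF g i] K'] ..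
  finally show ?thesis .
qed

text \<open>
  For a descent the formula follows from the one for the ascent because both \<open>\<phi>\<^sub>i\<^sup>2\<close> and the product of
  the two coefficients are minus the same square. If the contents are adjacent, the swapped filling is
  not standard, and \<open>\<phi>\<^sub>i\<close> vanishes on the weight vector since the module is irreducible.
\<close>

lemma phi_w:
  assumes K: "std K" and i: "1 \<le> i" "i < d"
  shows "M.\<phi> i (w K) = smul M (yc (cn K i) (cn K (Suc i))) (w (adj i \<circ> K))"
proof -
  obtain g where g: "g permutes {1..d}" and Kg: "K = g \<circ> L" using obtain_perm[OF K] .
  have ne: "cn K i \<noteq> cn K (Suc i)" by (rule standard_adjacent_contents[OF sk K i])
  consider (near) "\<not> far (cn K i) (cn K (Suc i))" | (asc) "far (cn K i) (cn K (Suc i))" "ascent g i"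
    | (desc) "far (cn K i) (cn K (Suc i))" "\<not> ascent g i" by blast
  thus ?thesis
  proof cases
    case near
    have "yc (cn K i) (cn K (Suc i)) = 0" using yc_eq_0_iff[OF ne] near by simp
    moreover have "M.\<phi> i (w K) = 0" by (rule M.phi_near_zero[OF irr w_eig[OF K] i near])
    ultimately show ?thesis by simp
  next
    case asc
    show ?thesis using phi_w_ascent[OF g _ i] asc K unfolding Kg by simp
  next
    case desc
    let ?h = "adj i \<circ> g" and ?K = "adj i \<circ> K"
    let ?y = "yc (cn K (Suc i)) (cn K i)"
    note h = adj_comp_permutes[OF g i]
    have Kh: "?h \<circ> L = ?K" unfolding Kg adj_apply_comp ..
    have K': "std ?K" using standard_swap_iff_far[OF sk K i] desc(1) by simp
    have cn: "cn ?K i = cn K (Suc i)" "cn ?K (Suc i) = cn K i"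
      using cont_adj[OF standard_bij[OF K] i] i by auto
    have fr: "far (cn K (Suc i)) (cn K i)" using desc(1) by (simp add: far_sym)
    have asc: "ascent ?h i" using desc(2) ascent_adj[OF g] by simp
    have "adj i \<circ> ?K = K" by (rule adj_adj_comp)
    hence up: "M.\<phi> i (w ?K) = smul M ?y (w K)"
      using phi_w_ascent[OF h _ i _ asc] K' fr unfolding Kh cn by simp
    have y: "?y \<noteq> 0" using yc_eq_0_iff[OF ne[symmetric]] fr by simp
    have "smul M ?y (M.\<phi> i (w K)) = M.\<phi> i (M.\<phi> i (w ?K))"
      unfolding up by (rule M.lin_rules(3)[OF M.lin_phi[OF i] w_carr, symmetric])
    also have "\<dots> = smul M (phi_square (cn K (Suc i)) (cn K i)) (w ?K)"
      using M.phi_phi[OF M.eig_wt[OF w_eig[OF K']] i] unfolding cn .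
    also have "phi_square (cn K (Suc i)) (cn K i) = ?y * yc (cn K i) (cn K (Suc i))"
      using yc_square[OF ne[symmetric]] yc_swap[of "cn K i" "cn K (Suc i)"] by simp
    finally have "smul M ?y (M.\<phi> i (w K)) = smul M ?y (smul M (yc (cn K i) (cn K (Suc i))) (w ?K))"
      by (simp only: M.scale_scale)
    thus ?thesis using y by (simp only: M.scale_cancel_left simp_thms)
  qed
qed

definition hom :: "hvec \<Rightarrow> 'v" where
  "hom f = (\<Sum>(K, A)\<in>{K. std K} \<times> Pow {1..d}. smul M (f K A * sg ^ card A) (M.cl A (w K)))"

lemma sg_sq: "sg * sg = 1"
  using parity by auto

lemma sg_pow: "sg ^ n = (if even n then 1 else sg)"
  by (induction n) (auto simp: sg_sq)

lemma finite_basis: "finite ({K. std K} \<times> Pow {1..d})"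
  by (intro finite_cartesian_product finite_standard_fillings) simp

lemma hom_add: "hom (f + g) = hom f + hom g"
  and hom_scale: "hom (hscale a f) = smul M a (hom f)"
  by (simp_all add: hom_def plus_fun_apply hscale_apply distrib_right M.scale_left_distrib sum.distrib
      case_prod_beta M.scale_sum_right mult.assoc)

lemma hom_zero: "hom 0 = 0"
  by (simp add: hom_def zero_fun_apply)

lemma hom_cv:
  assumes "std K" "A \<subseteq> {1..d}"
  shows "hom (cv A K) = smul M (sg ^ card A) (M.cl A (w K))"
proof -
  have "hom (cv A K) = (\<Sum>p\<in>{K. std K} \<times> Pow {1..d}.
      if p = (K, A) then smul M (sg ^ card A) (M.cl A (w K)) else 0)"
    unfolding hom_def by (rule sum.cong) (simp_all add: cv_def case_prod_beta prod_eq_iff split: if_split)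
  also have "\<dots> = smul M (sg ^ card A) (M.cl A (w K))"
    using assms finite_basis by (simp add: sum.delta)
  finally show ?thesis .
qed

lemma hom_vv: "hom (vv K) = w K"
  by (cases "std K") (simp_all add: vv_def hom_cv hom_zero w_def)

lemma hom_carr: "hom f \<in> carr M"
  unfolding hom_def case_prod_beta
  by (rule M.carr_sum) (auto intro!: M.subspace_scale[OF M.subspace_carr] M.cl_carr w_carr)

lemma hom_eq_on:
  assumes sub: "HV.subspace E" and b: "\<And>K A. std K \<Longrightarrow> A \<subseteq> {1..d} \<Longrightarrow> P K A \<Longrightarrow> cv A K \<in> E"
    and f: "f \<in> supported d lam mu P"
  shows "f \<in> E"
  using hlin_supported[OF hlin_id sub b f] .

lemma sign_card_sym_diff:
  assumes "A \<subseteq> {1..d}"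
  shows "sg ^ card (sym_diff {j} A) = sg * sg ^ card A"
  using even_card_sym_diff[OF finite_subset[OF assms], of j] by (simp add: sg_pow sg_sq)

lemma hom_C:
  assumes j: "1 \<le> j" "j \<le> d" and f: "f \<in> carr H"
  shows "hom (HC j f) = smul M sg (M.C j (hom f))"
proof -
  let ?E = "{f. hom (HC j f) = smul M sg (M.C j (hom f))}"
  have "HV.subspace ?E"
    by (rule HV.subspaceI)
      (simp_all add: hlinD[OF hlin_ops(3)] hom_zero hom_add hom_scale M.lin_0[OF M.lin_C[OF j]] hom_carr
        M.lin_rules(2,3)[OF M.lin_C[OF j]] M.scale_right_distrib mult.commute)
  moreover have "cv A K \<in> ?E" if K: "std K" and A: "A \<subseteq> {1..d}" for K A
  proof -
    have A': "sym_diff {j} A \<subseteq> {1..d}" by (rule sym_diff_subset[OF A j])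
    have "hom (HC j (cv A K)) = smul M (sg * sg ^ card A) (smul M (csign j A) (M.cl (sym_diff {j} A) (w K)))"
      unfolding HC_cv[OF K A j] hom_scale hom_cv[OF K A'] sign_card_sym_diff[OF A] by (simp add: mult_ac)
    also have "\<dots> = smul M sg (M.C j (hom (cv A K)))"
      unfolding hom_cv[OF K A] M.C_cl[OF w_carr j A, symmetric]
      using A by (simp add: M.lin_rules(3)[OF M.lin_C[OF j]] w_carr)
    finally show ?thesis by simp
  qed
  ultimately have "f \<in> ?E" using f unfolding H_simps(2) by (rule hom_eq_on)
  thus ?thesis by simp
qed

lemma hom_X:
  assumes j: "1 \<le> j" "j \<le> d" and f: "f \<in> carr H"
  shows "hom (HX j f) = M.X j (hom f)"
proof -
  let ?E = "{f. hom (HX j f) = M.X j (hom f)}"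
  have "HV.subspace ?E"
    by (rule HV.subspaceI)
      (simp_all add: hlinD[OF hlin_ops(2)] hom_zero hom_add hom_scale M.lin_0[OF M.lin_X[OF j]] hom_carr
        M.lin_rules(2,3)[OF M.lin_X[OF j]])
  moreover have "cv A K \<in> ?E" if K: "std K" and A: "A \<subseteq> {1..d}" for K A
  proof -
    have "M.X j (w K) = smul M (kap (cn K j)) (w K)"
      using w_eig[OF K] j by (simp add: M.eig_def)
    hence "M.X j (M.cl A (w K)) = smul M ((if j \<in> A then -1 else 1) * kap (cn K j)) (M.cl A (w K))"
      unfolding M.X_cl[OF w_carr j A] by (simp add: M.lin_rules(3)[OF M.lin_cl[OF A]] w_carr)
    thus ?thesis
      using A by (simp add: HX_cv[OF K A j] hom_scale hom_cv[OF K A] M.lin_rules(3)[OF M.lin_X[OF j]] w_carr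
          mult_ac)
  qed
  ultimately have "f \<in> ?E" using f unfolding H_simps(2) by (rule hom_eq_on)
  thus ?thesis by simp
qed

lemma hom_S_vv:
  assumes K: "std K" and i: "1 \<le> i" "i < d"
  shows "hom (HS i (vv K)) = M.S i (w K)"
proof -
  have r: "1 \<le> i" "i \<le> d" "1 \<le> Suc i" "Suc i \<le> d" using i by auto
  have ne: "cn K i \<noteq> cn K (Suc i)" by (rule standard_adjacent_contents[OF sk K i])
  have "hom (HC i (HC (Suc i) (vv K))) = M.C i (M.C (Suc i) (w K))"
    using r by (simp add: hom_C C_carr vv_carr hom_vv M.lin_rules(3)[OF M.lin_C] w_carr sg_sq)
  moreover have "smul M (1 / (qc (cn K i) - qc (cn K (Suc i)))) (M.\<phi> i (w K)) =
      smul M (ycf (cn K i) (cn K (Suc i))) (w (adj i \<circ> K))"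
    using ne by (simp add: phi_w[OF K i] yc_def)
  ultimately show ?thesis
    unfolding HS_vv[OF standard_bij[OF K] i] M.S_eig[OF w_eig[OF K] i ne] hom_add hom_scale hom_vv al_def be_def
    by simp
qed

lemma hom_S:
  assumes i: "1 \<le> i" "i < d" and f: "f \<in> carr H"
  shows "hom (HS i f) = M.S i (hom f)"
proof -
  let ?E = "{f. f \<in> carr H \<and> hom (HS i f) = M.S i (hom f)}"
  have "HV.subspace ?E"
    by (rule HV.subspaceI)
      (simp_all add: hlinD[OF hlin_ops(1)] hom_zero hom_add hom_scale M.lin_0[OF M.lin_S[OF i]] hom_carr
        M.lin_rules(2,3)[OF M.lin_S[OF i]] carr_closed)
  moreover have "cv A K \<in> ?E" if K: "std K" and A: "A \<subseteq> {1..d}" for K A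
  proof -
    have C: "HC j f \<in> ?E" if f: "f \<in> ?E" and j: "1 \<le> j" "j \<le> d" for f j
    proof -
      have a: "1 \<le> adj i j" "adj i j \<le> d" using M.adj_range[OF i j] by auto
      have fc: "f \<in> carr H" and fS: "hom (HS i f) = M.S i (hom f)" using f by auto
      have "hom (HS i (HC j f)) = smul M sg (M.C (adj i j) (hom (HS i f)))"
        unfolding H_s_c[OF fc i j] by (rule hom_C[OF a S_carr[OF i fc]])
      also have "\<dots> = M.S i (hom (HC j f))"
        unfolding fS hom_C[OF j fc] M.S_C[OF hom_carr i j, symmetric]
        by (rule M.lin_rules(3)[OF M.lin_S[OF i] M.C_carr[OF j hom_carr], symmetric])
      finally show ?thesis using C_carr[OF j fc] by simp
    qed
    have "foldr HC js (vv K) \<in> ?E" if "set js \<subseteq> {1..d}" for js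
      using that
    proof (induction js)
      case Nil
      show ?case using hom_S_vv[OF K i] by (simp add: vv_carr hom_vv)
    next
      case (Cons j js)
      show ?case unfolding foldr.simps o_apply using Cons by (intro C) auto
    qed
    moreover have "set (sorted_list_of_set A) \<subseteq> {1..d}"
      using A finite_subset[OF A] by simp
    ultimately show ?thesis unfolding cv_cl[OF K A] W.cl_def by blast
  qed
  ultimately have "f \<in> ?E" using f unfolding H_simps(2) by (rule hom_eq_on)
  thus ?thesis by simp
qed

lemma hom_parity:
  shows "f \<in> evn H \<Longrightarrow> hom f \<in> (if sg = 1 then evn M else odd_part M)"
    and "f \<in> odd_part H \<Longrightarrow> hom f \<in> (if sg = 1 then odd_part M else evn M)"
proof -
  have par: "hom f \<in> E" if E: "M.subspace E" and f: "f \<in> supported d lam mu P"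
      and b: "\<And>K A. std K \<Longrightarrow> A \<subseteq> {1..d} \<Longrightarrow> P K A \<Longrightarrow> M.cl A (w K) \<in> E" for f E P
  proof -
    have "HV.subspace {f. hom f \<in> E}"
      by (rule HV.subspaceI)
        (simp_all add: hom_zero hom_add hom_scale M.subspace_0[OF E] M.subspace_add[OF E] M.subspace_scale[OF E])
    moreover have "cv A K \<in> {f. hom f \<in> E}" if "std K" "A \<subseteq> {1..d}" "P K A" for K A
      using that b M.subspace_scale[OF E] by (simp add: hom_cv)
    ultimately have "f \<in> {f. hom f \<in> E}" using f by (rule hom_eq_on)
    thus ?thesis by simp
  qed
  have wp: "M.cl A (w K) \<in> (if sg = 1 then evn M else odd_part M)" if "A \<subseteq> {1..d}" "even (card A)" for A K
    using M.cl_parity[OF that(1), of "w K"] that(2) w_parity[of K] by (auto split: if_splits)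
  have wp': "M.cl A (w K) \<in> (if sg = 1 then odd_part M else evn M)" if "A \<subseteq> {1..d}" "odd (card A)" for A K
    using M.cl_parity[OF that(1), of "w K"] that(2) w_parity[of K] by (auto split: if_splits)
  have sub: "M.subspace (if sg = 1 then evn M else odd_part M)" "M.subspace (if sg = 1 then odd_part M else evn M)"
    using M.subspace_evn M.subspace_odd by auto
  show "hom f \<in> (if sg = 1 then evn M else odd_part M)" if "f \<in> evn H"
    using par[OF sub(1) that[unfolded H_simps(3)]] wp by blast
  show "hom f \<in> (if sg = 1 then odd_part M else evn M)" if "f \<in> odd_part H"
    using par[OF sub(2) that[unfolded H_simps(4)]] wp' by blast
qed

end

section \<open>Detecting a vector of the induced module\<close>

context weak_hc
begin

definition annihilates :: "(nat \<Rightarrow> nat) \<Rightarrow> (nat set \<Rightarrow> complex) \<Rightarrow> bool" where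
  "annihilates c a \<longleftrightarrow> (\<forall>v. eig c v \<longrightarrow> (\<Sum>A\<in>Pow {1..d}. smul M (a A) (cl A v)) = 0)"

text \<open>
  If \<open>x\<^sub>j v = \<kappa> v\<close> with \<open>\<kappa> \<noteq> 0\<close>, the operator \<open>x\<^sub>j\<close> separates the monomials \<open>c\<^sub>A v\<close> with \<open>j \<in> A\<close> from the
  others. If \<open>\<kappa> = 0\<close>, then \<open>c\<^sub>j v\<close> is an eigenvector for the same weight and the action of \<open>c\<^sub>j\<close> achieves the
  same.
\<close>

lemma annihilates_sign:
  assumes a: "annihilates c a" and hom: "\<And>A. a A \<noteq> 0 \<Longrightarrow> (-1) ^ card A = (t::complex)" and j: "1 \<le> j" "j \<le> d"
  shows "annihilates c (\<lambda>A. (if j \<in> A then -1 else 1) * a A)"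
  unfolding annihilates_def
proof (intro allI impI)
  fix v assume v: "eig c v"
  have vc: "v \<in> carr M" by (rule eig_carr[OF v])
  have cc: "smul M (a A) (cl A u) \<in> carr M" if "u \<in> carr M" "A \<in> Pow {1..d}" for A u
    using that by (intro subspace_scale[OF subspace_carr] cl_carr) auto
  show "(\<Sum>A\<in>Pow {1..d}. smul M ((if j \<in> A then -1 else 1) * a A) (cl A v)) = 0"
  proof (cases "kap (c j) = 0")
    case False
    have Xv: "X j v = smul M (kap (c j)) v" using v j by (simp add: eig_def)
    have "0 = X j (\<Sum>A\<in>Pow {1..d}. smul M (a A) (cl A v))"
      using a v lin_0[OF lin_X[OF j]] by (simp add: annihilates_def)
    also have "\<dots> = (\<Sum>A\<in>Pow {1..d}. X j (smul M (a A) (cl A v)))"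
      by (rule lin_sum[OF lin_X[OF j] cc[OF vc]])
    also have "\<dots> = (\<Sum>A\<in>Pow {1..d}. smul M (kap (c j)) (smul M ((if j \<in> A then -1 else 1) * a A) (cl A v)))"
    proof (rule sum.cong[OF refl])
      fix A assume "A \<in> Pow {1..d}"
      hence A: "A \<subseteq> {1..d}" by simp
      show "X j (smul M (a A) (cl A v)) = smul M (kap (c j)) (smul M ((if j \<in> A then -1 else 1) * a A) (cl A v))"
        using A vc by (simp add: lin_rules(3)[OF lin_X[OF j]] X_cl[OF vc j A] Xv lin_rules(3)[OF lin_cl[OF A]] mult_ac)
    qed
    finally have "smul M (kap (c j)) (\<Sum>A\<in>Pow {1..d}. smul M ((if j \<in> A then -1 else 1) * a A) (cl A v)) = 0"
      by (simp only: scale_sum_right)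
    with False show ?thesis by (simp only: scale_eq_0_iff simp_thms)
  next
    case True
    have Cv: "C j v \<in> carr M" using j vc by simp
    have Xj: "X j v = 0" using v j True by (simp add: eig_def)
    have "eig c (C j v)"
      unfolding eig_def
    proof (intro conjI allI impI)
      fix k assume k: "1 \<le> k \<and> k \<le> d"
      show "X k (C j v) = smul M (kap (c k)) (C j v)"
      proof (cases "k = j")
        case eq: True
        have "X j (C j v) = - C j (X j v)" using c_x_same[OF vc j] by simp
        also have "\<dots> = 0" unfolding Xj using lin_0[OF lin_C[OF j]] by simp
        finally show ?thesis using eq True by simp
      next
        case False
        have "X k (C j v) = C j (X k v)" using c_x_other[OF vc _ _ j False] k by simp
        thus ?thesis using v k by (simp add: eig_def lin_rules(3)[OF lin_C[OF j]])
      qed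
    qed (rule Cv)
    hence "0 = C j (\<Sum>A\<in>Pow {1..d}. smul M (a A) (cl A (C j v)))"
      using a lin_0[OF lin_C[OF j]] by (simp add: annihilates_def)
    also have "\<dots> = (\<Sum>A\<in>Pow {1..d}. C j (smul M (a A) (cl A (C j v))))"
      by (rule lin_sum[OF lin_C[OF j] cc[OF Cv]])
    also have "\<dots> = (\<Sum>A\<in>Pow {1..d}. smul M (- t) (smul M ((if j \<in> A then -1 else 1) * a A) (cl A v)))"
    proof (rule sum.cong[OF refl])
      fix A assume "A \<in> Pow {1..d}"
      hence A: "A \<subseteq> {1..d}" by simp
      have m: "cl A (- v) = - cl A v" by (rule lin_rules(4)[OF lin_cl[OF A] vc])
      have "C j (smul M (a A) (cl A (C j v))) =
          smul M (a A) (smul M ((-1) ^ card A * (if j \<in> A then -1 else 1)) (- cl A v))"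
        using A by (simp only: lin_rules(3)[OF lin_C[OF j] cl_carr[OF A Cv]] cl_C[OF Cv j A] c_sq[OF vc j] m)
      also have "\<dots> = smul M (- t) (smul M ((if j \<in> A then -1 else 1) * a A) (cl A v))"
      proof (cases "a A = 0")
        case False
        show ?thesis by (simp add: hom[OF False] mult_ac)
      qed simp
      finally show "C j (smul M (a A) (cl A (C j v))) =
          smul M (- t) (smul M ((if j \<in> A then -1 else 1) * a A) (cl A v))" .
    qed
    finally have z: "smul M (- t) (\<Sum>A\<in>Pow {1..d}. smul M ((if j \<in> A then -1 else 1) * a A) (cl A v)) = 0"
      by (simp only: scale_sum_right)
    show ?thesis
    proof (cases "\<exists>A. a A \<noteq> 0")
      case True
      then obtain A where "a A \<noteq> 0" by blast
      from hom[OF this] have "t \<noteq> 0" by auto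
      with z show ?thesis by (simp only: scale_eq_0_iff neg_equal_0_iff_equal simp_thms)
    qed simp
  qed
qed

lemma annihilates_project:
  assumes a: "annihilates c a" and hom: "\<And>A. a A \<noteq> 0 \<Longrightarrow> (-1) ^ card A = (t::complex)" and j: "1 \<le> j" "j \<le> d"
  shows "annihilates c (\<lambda>A. if j \<in> A \<longleftrightarrow> j \<in> A0 then a A else 0)"
  unfolding annihilates_def
proof (intro allI impI)
  fix v assume v: "eig c v"
  define r :: complex where "r = (if j \<in> A0 then -1 else 1)"
  have "(\<Sum>A\<in>Pow {1..d}. smul M (if j \<in> A \<longleftrightarrow> j \<in> A0 then a A else 0) (cl A v)) =
     (\<Sum>A\<in>Pow {1..d}. smul M (1/2) (smul M (a A) (cl A v))
        + smul M (r / 2) (smul M ((if j \<in> A then -1 else 1) * a A) (cl A v)))"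
    by (rule sum.cong[OF refl]) (simp add: r_def scale_left_distrib[symmetric] field_simps)
  also have "\<dots> = 0"
    using a annihilates_sign[OF a hom j] v
    by (simp add: sum.distrib scale_sum_right[symmetric] annihilates_def del: scale_scale)
  finally show "(\<Sum>A\<in>Pow {1..d}. smul M (if j \<in> A \<longleftrightarrow> j \<in> A0 then a A else 0) (cl A v)) = 0" .
qed

text \<open>
  Splitting the combination according to \<open>j \<in> A\<close> for every \<open>j\<close> in turn isolates the single term \<open>c\<^bsub>A0\<^esub> v\<close>, which
  vanishes only for \<open>v = 0\<close>. Homogeneity makes the signs of the case \<open>\<kappa> = 0\<close> equal for all terms.
\<close>

lemma homogeneous_combination_detected:
  assumes v0: "eig c v0" "v0 \<noteq> 0" and A0: "A0 \<subseteq> {1..d}" "a A0 \<noteq> 0"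
    and hom: "\<And>A. a A \<noteq> 0 \<Longrightarrow> (-1) ^ card A = (t::complex)"
  obtains v where "eig c v" "v \<in> evn M \<or> v \<in> odd_part M"
    "(\<Sum>A\<in>Pow {1..d}. smul M (a A) (cl A v)) \<noteq> 0"
proof (rule ccontr)
  note detect = that
  assume no: "\<not> thesis"
  have z: "(\<Sum>A\<in>Pow {1..d}. smul M (a A) (cl A v)) = 0" if "eig c v" "v \<in> evn M \<or> v \<in> odd_part M" for v
    using no detect[OF that] by blast
  have a: "annihilates c a"
    unfolding annihilates_def
  proof (intro allI impI)
    fix v assume "eig c v"
    then obtain e r where er: "e \<in> evn M" "r \<in> odd_part M" "v = e + r" "eig c e" "eig c r" by (rule eig_parts)
    have "(\<Sum>A\<in>Pow {1..d}. smul M (a A) (cl A v)) =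
        (\<Sum>A\<in>Pow {1..d}. smul M (a A) (cl A e) + smul M (a A) (cl A r))"
      unfolding er(3)
      by (rule sum.cong[OF refl])
        (simp add: lin_rules(2)[OF lin_cl eig_carr[OF er(4)] eig_carr[OF er(5)]] scale_right_distrib)
    thus "(\<Sum>A\<in>Pow {1..d}. smul M (a A) (cl A v)) = 0"
      using z[OF er(4)] z[OF er(5)] er(1,2) by (simp add: sum.distrib)
  qed
  have "annihilates c (\<lambda>A. if \<forall>j. 1 \<le> j \<and> j \<le> n \<longrightarrow> (j \<in> A \<longleftrightarrow> j \<in> A0) then a A else 0)" if "n \<le> d" for n
    using that
  proof (induction n)
    case 0
    show ?case using a by simp
  next
    case (Suc n)
    let ?b = "\<lambda>A. if \<forall>j. 1 \<le> j \<and> j \<le> n \<longrightarrow> (j \<in> A \<longleftrightarrow> j \<in> A0) then a A else 0"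
    have "annihilates c (\<lambda>A. if Suc n \<in> A \<longleftrightarrow> Suc n \<in> A0 then ?b A else 0)"
    proof (rule annihilates_project[where t = t])
      show "(-1) ^ card A = (t::complex)" if "?b A \<noteq> 0" for A using hom[of A] that by (auto split: if_splits)
    qed (use Suc in auto)
    moreover have "(if Suc n \<in> A \<longleftrightarrow> Suc n \<in> A0 then ?b A else 0) =
        (if \<forall>j. 1 \<le> j \<and> j \<le> Suc n \<longrightarrow> (j \<in> A \<longleftrightarrow> j \<in> A0) then a A else 0)" for A
      by (auto simp: le_Suc_eq)
    ultimately show ?case by (simp only:)
  qed
  from this[of d] v0(1)
  have "(\<Sum>A\<in>Pow {1..d}. smul M (if \<forall>j. 1 \<le> j \<and> j \<le> d \<longrightarrow> (j \<in> A \<longleftrightarrow> j \<in> A0) then a A else 0) (cl A v0)) = 0"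
    by (simp add: annihilates_def)
  moreover have "(\<Sum>A\<in>Pow {1..d}. smul M (if \<forall>j. 1 \<le> j \<and> j \<le> d \<longrightarrow> (j \<in> A \<longleftrightarrow> j \<in> A0) then a A else 0) (cl A v0)) =
      (\<Sum>A\<in>Pow {1..d}. if A = A0 then smul M (a A0) (cl A0 v0) else 0)"
  proof (rule sum.cong[OF refl])
    fix A assume "A \<in> Pow {1..d}"
    hence "(\<forall>j. 1 \<le> j \<and> j \<le> d \<longrightarrow> (j \<in> A \<longleftrightarrow> j \<in> A0)) \<longleftrightarrow> A = A0"
      using A0(1) by (auto simp: subset_iff set_eq_iff)
    thus "smul M (if \<forall>j. 1 \<le> j \<and> j \<le> d \<longrightarrow> (j \<in> A \<longleftrightarrow> j \<in> A0) then a A else 0) (cl A v0) =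
        (if A = A0 then smul M (a A0) (cl A0 v0) else 0)" by simp
  qed
  ultimately have "smul M (a A0) (cl A0 v0) = 0" using A0(1) by (simp add: sum.delta)
  hence "cl A0 v0 = 0" using A0(2) by (simp only: scale_eq_0_iff simp_thms)
  thus False using cl_inj[OF eig_carr[OF v0(1)] A0(1)] v0(2) by blast
qed

end

section \<open>Schur's lemma\<close>

text \<open>
  Even and odd homomorphisms are treated together: an odd one is a parity-reversing map with \<open>sg = -1\<close>.
\<close>

definition signed_hom :: "nat \<Rightarrow> ('w::ab_group_add) hc_data \<Rightarrow> ('v::ab_group_add) hc_data \<Rightarrow> complex \<Rightarrow> ('w \<Rightarrow> 'v) \<Rightarrow> bool" where
  "signed_hom d P M sg f \<longleftrightarrow> (sg = 1 \<or> sg = -1) \<and> linear_map P M f \<and>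
     f ` evn P \<subseteq> (if sg = 1 then evn M else odd_part M) \<and>
     f ` odd_part P \<subseteq> (if sg = 1 then odd_part M else evn M) \<and>
     (\<forall>v\<in>carr P. (\<forall>i\<in>{1..<d}. f (sact P i v) = sact M i (f v)) \<and>
        (\<forall>i\<in>{1..d}. f (xact P i v) = xact M i (f v)) \<and>
        (\<forall>i\<in>{1..d}. f (cact P i v) = smul M sg (cact M i (f v))))"

text \<open>
  Kernel and image are graded submodules because the homomorphism either preserves or exchanges the
  parities.
\<close>

lemma schur:
  fixes P :: "('w::ab_group_add) hc_data" and M :: "('v::ab_group_add) hc_data"
  assumes irrP: "irreducible_hc d P" and irrM: "irreducible_hc d M"
    and f: "signed_hom d P M sg f" and x: "x \<in> carr P" "f x \<noteq> 0"
  shows "hc_iso d M P"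
proof -
  interpret P: hc d P using irrP hc_module_imp_hc by (auto simp: irreducible_hc_def)
  interpret M: hc d M using irrM hc_module_imp_hc by (auto simp: irreducible_hc_def)
  have sg: "sg = 1 \<or> sg = -1" using f by (simp add: signed_hom_def)
  hence sg2: "sg * sg = 1" by auto
  have fc: "f y \<in> carr M" and fsc: "f (smul P a y) = smul M a (f y)" if "y \<in> carr P" for y a
    using f that by (auto simp: signed_hom_def linear_map_def)
  have fadd: "f (y + z) = f y + f z" if "y \<in> carr P" "z \<in> carr P" for y z
    using f that by (auto simp: signed_hom_def linear_map_def)
  have f0: "f 0 = 0" using fsc[OF P.carr_0, of 0] by simp
  have fS: "f (P.S i y) = M.S i (f y)" if "y \<in> carr P" "1 \<le> i" "i < d" for i y
    using f that by (simp add: signed_hom_def)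
  have fX: "f (P.X i y) = M.X i (f y)" and fC: "f (P.C i y) = smul M sg (M.C i (f y))"
    if "y \<in> carr P" "1 \<le> i" "i \<le> d" for i y
    using f that by (simp_all add: signed_hom_def)
  have fe: "f e \<in> (if sg = 1 then evn M else odd_part M)" if "e \<in> evn P" for e
    using f that by (auto simp: signed_hom_def image_subset_iff)
  have fo: "f r \<in> (if sg = 1 then odd_part M else evn M)" if "r \<in> odd_part P" for r
    using f that by (auto simp: signed_hom_def image_subset_iff)
  have split: "\<exists>e r. e \<in> evn P \<and> r \<in> odd_part P \<and> y = e + r" if "y \<in> carr P" for y
    using that unfolding P.carr_eq by blast
  have ec: "e \<in> carr P" if "e \<in> evn P" for e
    unfolding P.carr_eq using that P.subspace_0[OF P.subspace_odd] by force
  have oc: "r \<in> carr P" if "r \<in> odd_part P" for r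
    unfolding P.carr_eq using that P.subspace_0[OF P.subspace_evn] by force
  have uniq: "f e = (if sg = 1 then u else w)" "f r = (if sg = 1 then w else u)"
    if "e \<in> evn P" "r \<in> odd_part P" "u \<in> evn M" "w \<in> odd_part M" "f e + f r = u + w" for e r u w
  proof -
    show "f e = (if sg = 1 then u else w)"
      using M.evn_odd_unique[of "f e" "f r" u w] M.evn_odd_unique[of "f r" "f e" u w] fe[OF that(1)] fo[OF that(2)] that(3-5)
      by (simp add: add.commute split: if_splits)
    show "f r = (if sg = 1 then w else u)"
      using M.evn_odd_unique[of "f e" "f r" u w] M.evn_odd_unique[of "f r" "f e" u w] fe[OF that(1)] fo[OF that(2)] that(3-5)
      by (simp add: add.commute split: if_splits)
  qed
  note zM = M.subspace_0[OF M.subspace_evn] M.subspace_0[OF M.subspace_odd]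
  define K where "K = {y \<in> carr P. f y = 0}"
  have "hc_submodule d P K"
    unfolding hc_submodule_def A_submodule_def graded_subspace_def x_invariant_def
  proof (intro conjI ballI)
    show "K \<subseteq> carr P" by (auto simp: K_def)
    show subK: "module.subspace (smul P) K"
      by (rule P.subspaceI) (simp_all add: K_def f0 fadd fsc P.subspace_add[OF P.subspace_carr] P.subspace_scale[OF P.subspace_carr])
    show "K = {u + v | u v. u \<in> K \<inter> evn P \<and> v \<in> K \<inter> odd_part P}" (is "_ = ?D")
    proof
      show "?D \<subseteq> K" using P.subspace_add[OF subK] by auto
      show "K \<subseteq> ?D"
      proof
        fix y assume y: "y \<in> K"
        hence "y \<in> carr P" by (simp add: K_def)
        then obtain e r where er: "e \<in> evn P" "r \<in> odd_part P" "y = e + r" using split by blast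
        have "f e + f r = 0 + 0" using y er fadd[OF ec[OF er(1)] oc[OF er(2)]] by (simp add: K_def)
        from uniq[OF er(1,2) zM this] have "f e = 0" "f r = 0" by auto
        thus "y \<in> ?D" using er ec oc by (auto simp: K_def)
      qed
    qed
    show "P.X i ` K \<subseteq> K" if "i \<in> {1..d}" for i
      using that by (auto simp: K_def fX M.lin_0[OF M.lin_X])
    show "P.C i ` K \<subseteq> K" if "i \<in> {1..d}" for i
      using that by (auto simp: K_def fC M.lin_0[OF M.lin_C])
    show "P.S i ` K \<subseteq> K" if "i \<in> {1..<d}" for i
      using that by (auto simp: K_def fS M.lin_0[OF M.lin_S])
  qed
  hence "K = {0} \<or> K = carr P" using irrP by (simp add: irreducible_hc_def)
  hence K0: "K = {0}" using x by (auto simp: K_def)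
  have inj: "inj_on f (carr P)"
  proof (rule inj_onI)
    fix y z assume yz: "y \<in> carr P" "z \<in> carr P" "f y = f z"
    have nz: "smul P (- 1) z \<in> carr P" by (rule P.subspace_scale[OF P.subspace_carr yz(2)])
    have "f (y + smul P (-1) z) = 0" unfolding fadd[OF yz(1) nz] fsc[OF yz(2)] using yz(3) by simp
    hence "y + smul P (-1) z \<in> K" using P.subspace_add[OF P.subspace_carr yz(1) nz] by (simp add: K_def)
    thus "y = z" unfolding K0 by simp
  qed
  define I where "I = f ` carr P"
  have "hc_submodule d M I"
    unfolding hc_submodule_def A_submodule_def graded_subspace_def x_invariant_def
  proof (intro conjI ballI)
    show "I \<subseteq> carr M" using fc by (auto simp: I_def)
    show subI: "module.subspace (smul M) I"
    proof (rule M.subspaceI)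
      show "0 \<in> I" unfolding I_def using f0 P.carr_0 by (metis imageI)
      show "u + w \<in> I" if "u \<in> I" "w \<in> I" for u w
        using that P.subspace_add[OF P.subspace_carr] by (force simp: I_def fadd[symmetric])
      show "smul M a u \<in> I" if "u \<in> I" for a u
        using that P.subspace_scale[OF P.subspace_carr] by (force simp: I_def fsc[symmetric])
    qed
    show "I = {u + v | u v. u \<in> I \<inter> evn M \<and> v \<in> I \<inter> odd_part M}" (is "_ = ?D")
    proof
      show "?D \<subseteq> I" using M.subspace_add[OF subI] by auto
      show "I \<subseteq> ?D"
      proof
        fix u assume "u \<in> I"
        then obtain y where y: "y \<in> carr P" "u = f y" by (auto simp: I_def)
        then obtain e r where er: "e \<in> evn P" "r \<in> odd_part P" "y = e + r" using split by blast
        have u: "u = f e + f r" "u = f r + f e"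
          using y er fadd[OF ec[OF er(1)] oc[OF er(2)]] by (simp_all add: add.commute)
        have I': "f e \<in> I" "f r \<in> I" using er ec oc by (auto simp: I_def)
        show "u \<in> ?D"
        proof (cases "sg = 1")
          case True
          hence "f e \<in> evn M" "f r \<in> odd_part M" using fe[OF er(1)] fo[OF er(2)] by auto
          thus ?thesis using I' u(1) by blast
        next
          case False
          hence "f e \<in> odd_part M" "f r \<in> evn M" using fe[OF er(1)] fo[OF er(2)] by auto
          thus ?thesis using I' u(2) by blast
        qed
      qed
    qed
    show "M.X i ` I \<subseteq> I" if "i \<in> {1..d}" for i
      using that by (force simp: I_def fX[symmetric])
    show "M.C i ` I \<subseteq> I" if i: "i \<in> {1..d}" for i
    proof (rule image_subsetI)
      fix u assume "u \<in> I"
      then obtain y where y: "y \<in> carr P" "u = f y" by (auto simp: I_def)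
      have Cy: "P.C i y \<in> carr P" using y i by simp
      have "M.C i u = f (smul P sg (P.C i y))"
        unfolding fsc[OF Cy] using fC[OF y(1), of i] y(2) i by (simp add: sg2)
      thus "M.C i u \<in> I" using P.subspace_scale[OF P.subspace_carr Cy] by (auto simp: I_def)
    qed
    show "M.S i ` I \<subseteq> I" if "i \<in> {1..<d}" for i
      using that by (force simp: I_def fS[symmetric])
  qed
  hence "I = {0} \<or> I = carr M" using irrM by (simp add: irreducible_hc_def)
  moreover have "f x \<in> I" using x by (simp add: I_def)
  ultimately have I: "f ` carr P = carr M" using x by (auto simp: I_def)
  define g where "g = inv_into (carr P) f"
  have gf: "g (f y) = y" if "y \<in> carr P" for y unfolding g_def by (rule inv_into_f_f[OF inj that])
  have bij: "bij_betw g (carr M) (carr P)"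
    unfolding g_def by (rule bij_betw_inv_into) (simp add: bij_betw_def inj I)
  have pre: "\<exists>y\<in>carr P. u = f y" if "u \<in> carr M" for u using that I by blast
  have lin: "linear_map M P g"
    unfolding linear_map_def
  proof (intro conjI ballI allI)
    show "g ` carr M \<subseteq> carr P" using bij by (simp add: bij_betw_def)
    fix u a assume "u \<in> carr M"
    then obtain y where y: "y \<in> carr P" "u = f y" using pre by blast
    show "g (smul M a u) = smul P a (g u)"
      unfolding y(2) fsc[OF y(1), symmetric] using y P.subspace_scale[OF P.subspace_carr] by (simp add: gf)
    fix w assume "w \<in> carr M"
    then obtain z where z: "z \<in> carr P" "w = f z" using pre by blast
    show "g (u + w) = g u + g w"
      unfolding y(2) z(2) fadd[OF y(1) z(1), symmetric] using y z P.subspace_add[OF P.subspace_carr] by (simp add: gf)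
  qed
  have zero: "y = 0" if "y \<in> carr P" "f y = 0" for y using that K0 by (auto simp: K_def)
  have ge: "g u \<in> (if sg = 1 then evn P else odd_part P)" if u: "u \<in> evn M" for u
  proof -
    have "u \<in> carr M" unfolding M.carr_eq using u zM by force
    then obtain y where y: "y \<in> carr P" "u = f y" using pre by blast
    then obtain e r where er: "e \<in> evn P" "r \<in> odd_part P" "y = e + r" using split by blast
    have "f e + f r = u + 0" using y er fadd[OF ec[OF er(1)] oc[OF er(2)]] by simp
    note un = uniq[OF er(1,2) u zM(2) this]
    have gu: "g u = e + r" unfolding y(2) gf[OF y(1)] by (rule er(3))
    show ?thesis
    proof (cases "sg = 1")
      case True
      have "r = 0" by (rule zero) (use un True ec[OF er(1)] oc[OF er(2)] in simp_all)
      thus ?thesis unfolding gu using er(1,2) True by simp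
    next
      case False
      have "e = 0" by (rule zero) (use un False ec[OF er(1)] oc[OF er(2)] in simp_all)
      thus ?thesis unfolding gu using er(1,2) False by simp
    qed
  qed
  have go: "g u \<in> (if sg = 1 then odd_part P else evn P)" if u: "u \<in> odd_part M" for u
  proof -
    have "u \<in> carr M" unfolding M.carr_eq using u zM by force
    then obtain y where y: "y \<in> carr P" "u = f y" using pre by blast
    then obtain e r where er: "e \<in> evn P" "r \<in> odd_part P" "y = e + r" using split by blast
    have "f e + f r = 0 + u" using y er fadd[OF ec[OF er(1)] oc[OF er(2)]] by simp
    note un = uniq[OF er(1,2) zM(1) u this]
    have gu: "g u = e + r" unfolding y(2) gf[OF y(1)] by (rule er(3))
    show ?thesis
    proof (cases "sg = 1")
      case True
      have "e = 0" by (rule zero) (use un True ec[OF er(1)] oc[OF er(2)] in simp_all)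
      thus ?thesis unfolding gu using er(1,2) True by simp
    next
      case False
      have "r = 0" by (rule zero) (use un False ec[OF er(1)] oc[OF er(2)] in simp_all)
      thus ?thesis unfolding gu using er(1,2) False by simp
    qed
  qed
  have gS: "g (M.S i u) = P.S i (g u)" if "u \<in> carr M" "i \<in> {1..<d}" for i u
    using pre[OF that(1)] that(2) by (auto simp: fS[symmetric] gf)
  have gX: "g (M.X i u) = P.X i (g u)" if "u \<in> carr M" "i \<in> {1..d}" for i u
    using pre[OF that(1)] that(2) by (auto simp: fX[symmetric] gf)
  have gC: "g (M.C i u) = smul P sg (P.C i (g u))" if u: "u \<in> carr M" and i: "i \<in> {1..d}" for i u
  proof -
    obtain y where y: "y \<in> carr P" "u = f y" using pre[OF u] by blast
    have Cy: "P.C i y \<in> carr P" using y i by simp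
    have "M.C i u = f (smul P sg (P.C i y))"
      unfolding fsc[OF Cy] using fC[OF y(1), of i] y(2) i by (simp add: sg2)
    thus ?thesis using gf[OF P.subspace_scale[OF P.subspace_carr Cy]] gf[OF y(1)] y(2) by simp
  qed
  have "even_hom d M P g \<or> odd_hom d M P g"
    using sg
  proof
    assume 1: "sg = 1"
    have "even_hom d M P g"
      unfolding even_hom_def even_map_def using lin ge go gS gX gC by (auto simp: 1)
    thus ?thesis ..
  next
    assume 1: "sg = -1"
    have "odd_hom d M P g"
      unfolding odd_hom_def odd_map_def using lin ge go gS gX gC by (auto simp: 1)
    thus ?thesis ..
  qed
  thus ?thesis unfolding hc_iso_def using bij by blast
qed

section \<open>Classification\<close>

context chosen_module
begin

text \<open>
  Since \<open>U\<close> is graded, it contains a nonzero homogeneous element; all its Clifford monomials have degrees of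
  the same parity.
\<close>

lemma U_homogeneous:
  "\<exists>f A0 t. f \<in> U \<and> A0 \<subseteq> {1..d} \<and> f L A0 \<noteq> 0 \<and> (\<forall>A. f L A \<noteq> 0 \<longrightarrow> (-1) ^ card A = (t::complex))"
proof -
  have "U \<noteq> {0}" using Uirr by (simp add: irreducible_A_submodule_def)
  then obtain y where y: "y \<in> U" "y \<noteq> 0" using U_zero by blast
  obtain e r where er: "e \<in> U" "e \<in> evn H" "r \<in> U" "r \<in> odd_part H" "y = e + r"
    using y(1) U_graded by blast
  have nz: "\<exists>A0. A0 \<subseteq> {1..d} \<and> f L A0 \<noteq> 0" if f: "f \<in> U" "f \<noteq> 0" for f
  proof -
    have "\<exists>K A. f K A \<noteq> 0"
    proof (rule ccontr)
      assume "\<not> (\<exists>K A. f K A \<noteq> 0)"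
      hence "f = 0" by (intro ext) (simp add: zero_fun_apply)
      with f show False by blast
    qed
    then obtain K A where KA: "f K A \<noteq> 0" by blast
    have "f \<in> V" using f UV by blast
    with KA have "K = L" "A \<subseteq> {1..d}" by (auto simp: Clv_expand supported_def)
    with KA show ?thesis by blast
  qed
  show ?thesis
  proof (cases "e = 0")
    case True
    hence "r \<noteq> 0" using y er by simp
    then obtain A0 where "A0 \<subseteq> {1..d}" "r L A0 \<noteq> 0" using nz er by blast
    moreover have "(-1) ^ card A = (-1::complex)" if "r L A \<noteq> 0" for A
      using that er(4) by (simp add: H_simps(4) supported_def)
    ultimately show ?thesis using er(3) by blast
  next
    case False
    then obtain A0 where "A0 \<subseteq> {1..d}" "e L A0 \<noteq> 0" using nz er by blast
    moreover have "(-1) ^ card A = (1::complex)" if "e L A \<noteq> 0" for A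
      using that er(2) by (simp add: H_simps(3) supported_def)
    ultimately show ?thesis using er(1) by blast
  qed
qed

text \<open>
  The homogeneous element of \<open>U\<close> is not killed by the homomorphism belonging to a suitable \<open>v\<close>. On the even
  or odd part of \<open>Cl(d) v\<^sub>L\<close> the signs \<open>sg ^ card A\<close> agree, so they do not affect this.
\<close>

lemma iso_of_weight:
  fixes M :: "('v::ab_group_add) hc_data"
  assumes M: "calibrated_hc d M" and irrM: "irreducible_hc d M"
    and v0: "weak_hc.eig d M (cn L) v0" "v0 \<noteq> 0"
  shows "hc_iso d M (Hmod d lam mu U)"
proof -
  interpret M: calibrated_hc d M by (rule M)
  obtain f A0 t where f: "f \<in> U" "A0 \<subseteq> {1..d}" "f L A0 \<noteq> 0"
    and t: "\<And>A. f L A \<noteq> 0 \<Longrightarrow> (-1) ^ card A = (t::complex)" using U_homogeneous by blast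
  obtain v where v: "M.eig (cn L) v" "v \<in> evn M \<or> v \<in> odd_part M"
    "(\<Sum>A\<in>Pow {1..d}. smul M (f L A) (M.cl A v)) \<noteq> 0"
    by (rule M.homogeneous_combination_detected[where a = "f L", OF v0 f(2,3) t])
  obtain \<Phi> where chain: "M.chain (cn L) v \<Phi>" by (rule M.intertwiner_family[OF v(1)])
  define sg :: complex where "sg = (if v \<in> evn M then 1 else -1)"
  interpret F: weight_hom d lam mu L M v \<Phi> sg
    by unfold_locales (use irrM v chain in \<open>auto simp: sg_def\<close>)
  have ne: "F.hom f \<noteq> 0"
  proof -
    have "F.hom f = (\<Sum>(K, A)\<in>{L} \<times> Pow {1..d}. smul M (f K A * sg ^ card A) (M.cl A (F.w K)))"
      unfolding F.hom_def
    proof (rule sum.mono_neutral_right[OF F.finite_basis])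
      show "{L} \<times> Pow {1..d} \<subseteq> {K. std K} \<times> Pow {1..d}" using L by auto
      have off: "K = L" if "f K A \<noteq> 0" for K A
        using that f(1) UV by (auto simp: Clv_expand supported_def subset_iff)
      show "\<forall>p\<in>{K. std K} \<times> Pow {1..d} - {L} \<times> Pow {1..d}.
          (case p of (K, A) \<Rightarrow> smul M (f K A * sg ^ card A) (M.cl A (F.w K))) = 0" by (auto intro: off)
    qed
    also have "\<dots> = (\<Sum>A\<in>Pow {1..d}. smul M (f L A * sg ^ card A) (M.cl A v))"
      unfolding sum.cartesian_product[symmetric] by (simp add: F.w_L)
    also have "\<dots> = (\<Sum>A\<in>Pow {1..d}. smul M (if sg = 1 then 1 else t) (smul M (f L A) (M.cl A v)))"
    proof (rule sum.cong[OF refl])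
      fix A :: "nat set"
      have "f L A * sg ^ card A = (if sg = 1 then 1 else t) * f L A"
        using t[of A] by (cases "f L A = 0") (auto simp: sg_def)
      thus "smul M (f L A * sg ^ card A) (M.cl A v) =
          smul M (if sg = 1 then 1 else t) (smul M (f L A) (M.cl A v))" by (simp only: M.scale_scale)
    qed
    also have "\<dots> = smul M (if sg = 1 then 1 else t) (\<Sum>A\<in>Pow {1..d}. smul M (f L A) (M.cl A v))"
      by (rule M.scale_sum_right[symmetric])
    finally have e: "F.hom f = smul M (if sg = 1 then 1 else t) (\<Sum>A\<in>Pow {1..d}. smul M (f L A) (M.cl A v))" .
    have "t \<noteq> 0" using t[OF f(3)] by auto
    thus ?thesis unfolding e using v(3) by (simp only: M.scale_eq_0_iff split: if_split) simp
  qed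
  show ?thesis
  proof (rule schur[OF Hmod_irreducible irrM])
    have sgc: "sg = 1 \<or> sg = -1" by (simp add: sg_def)
    have NH: "y \<in> carr H" if "y \<in> N" for y using that N_carr by blast
    show "signed_hom d (Hmod d lam mu U) M sg F.hom"
      unfolding signed_hom_def linear_map_def Hmod_eq restrict_simps H_simps(1)
      using sgc F.hom_parity F.hom_carr F.hom_add F.hom_scale
        F.hom_S[OF _ _ NH] F.hom_X[OF _ _ NH] F.hom_C[OF _ _ NH]
      by (simp add: image_subset_iff)
    show "f \<in> carr (Hmod d lam mu U)" using U_in_N f(1) by (auto simp: Hmod_eq)
    show "F.hom f \<noteq> 0" by (rule ne)
  qed
qed

end

text \<open>
  Swaps between standard fillings exchange far contents, and there the intertwiners are injective.
\<close>

lemma (in shape) weight_of_other_filling: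
  fixes M :: "('v::ab_group_add) hc_data"
  assumes M: "weak_hc d M" and v: "weak_hc.eig d M (cn L) v" "v \<noteq> 0"
    and L: "std L" and L': "std L'"
  shows "\<exists>v'. weak_hc.eig d M (cn L') v' \<and> v' \<noteq> 0"
proof -
  interpret M: weak_hc d M by (rule M)
  obtain g where g: "g permutes {1..d}" "L' = g \<circ> L"
    using fillings_differ_by_permutation[OF standard_bij[OF L] standard_bij[OF L']] .
  have "std (g \<circ> L)" using L' g(2) by simp
  with sk L g(1) have "\<exists>v'. M.eig (cn (g \<circ> L)) v' \<and> v' \<noteq> 0"
  proof (induction rule: standard_fillings_induct)
    case id
    have "id \<circ> L = L" by (rule id_comp)
    thus ?case using v by (simp only:) blast
  next
    case (step h i)
    then obtain u where u: "M.eig (cn (h \<circ> L)) u" "u \<noteq> 0" by blast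
    note i = step(2,3)
    have "M.eig (cn (h \<circ> L) \<circ> adj i) (M.\<phi> i u)" by (rule M.eig_phi[OF u(1) i])
    hence "M.eig (cn ((adj i \<circ> h) \<circ> L)) (M.\<phi> i u)"
      by (rule M.eig_cong[rotated])
        (simp only: adj_apply_comp[symmetric] cont_adj[OF standard_bij[OF step(5)] i] o_apply)
    moreover have "M.\<phi> i u \<noteq> 0" by (rule M.phi_nonzero[OF M.eig_wt[OF u(1)] u(2) i step(7)])
    ultimately show ?case by blast
  qed
  thus ?thesis unfolding g(2) .
qed

text \<open>An isomorphism preserves the eigenvalues of the \<open>x\<^sub>j\<^sup>2\<close>, and in the target these are read off the
  fillings.\<close>

lemma (in chosen_module) weight_is_filling:
  fixes M :: "('v::ab_group_add) hc_data"
  assumes M: "weak_hc d M" and v: "weak_hc.eig d M c v" "v \<noteq> 0"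
    and iso: "hc_iso d M (Hmod d lam mu U)"
  obtains K where "std K" "\<And>j. j \<in> {1..d} \<Longrightarrow> cn K j = c j"
proof -
  interpret M: weak_hc d M by (rule M)
  obtain f where f: "even_hom d M (restrict_to H N) f \<or> odd_hom d M (restrict_to H N) f"
    and bij: "bij_betw f (carr M) N"
    using iso unfolding hc_iso_def Hmod_eq restrict_simps by blast
  have lin: "linear_map M (restrict_to H N) f"
    using f by (auto simp: even_hom_def odd_hom_def even_map_def odd_map_def)
  have sc: "f (smul M a y) = hscale a (f y)" if "y \<in> carr M" for a y
    using lin that by (simp add: linear_map_def H_simps(1))
  have fX: "f (M.X j y) = HX j (f y)" if "y \<in> carr M" "j \<in> {1..d}" for j y
    using f that by (auto simp: even_hom_def odd_hom_def)
  have vc: "v \<in> carr M" by (rule M.eig_carr[OF v(1)])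
  have "f 0 = 0" using sc[OF M.carr_0, of 0] by simp
  hence fv: "f v \<noteq> 0" using bij vc v(2) M.carr_0 by (metis bij_betw_inv_into_left)
  have fN: "f v \<in> carr H" using bij vc N_carr by (auto simp: bij_betw_def)
  have "\<exists>K A. f v K A \<noteq> 0"
  proof (rule ccontr)
    assume "\<not> (\<exists>K A. f v K A \<noteq> 0)"
    hence "f v = 0" by (intro ext) (simp add: zero_fun_apply)
    with fv show False by blast
  qed
  then obtain K A where KA: "f v K A \<noteq> 0" by blast
  have "std K" using fN KA by (auto simp: H_simps(2) supported_def)
  moreover have "cn K j = c j" if j: "j \<in> {1..d}" for j
  proof -
    have j': "1 \<le> j" "j \<le> d" using j by auto
    have "HX j (HX j (f v)) = f (M.X j (M.X j v))" using fX j vc M.X_carr[OF j' vc] by simp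
    also have "M.X j (M.X j v) = smul M (qc (c j)) v"
      using M.eig_wt[OF v(1)] j' by (simp add: M.wt_def)
    also have "f \<dots> = hscale (qc (c j)) (f v)" by (rule sc[OF vc])
    finally have "HX j (HX j (f v)) K A = hscale (qc (c j)) (f v) K A" by simp
    hence "qc (cn K j) * f v K A = qc (c j) * f v K A"
      unfolding XX_coord[OF fN j'] hscale_apply .
    thus ?thesis using KA by simp
  qed
  ultimately show thesis using that by blast
qed

lemma chosen_moduleI:
  assumes "shape_with_boxes d lam mu" "H_choice d lam mu L U"
  shows "chosen_module d lam mu L U"
  by unfold_locales (use assms in \<open>auto simp: shape_with_boxes_def H_choice_def\<close>)

theorem theorem5p1p3:
  fixes d :: nat
  assumes "d \<ge> 1"
  shows
    "(\<forall>lam mu. shape_with_boxes d lam mu \<longrightarrow>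
        (\<exists>L U. H_choice d lam mu L U) \<and>
        (\<forall>L U. H_choice d lam mu L U \<longrightarrow> irreducible_hc d (Hmod d lam mu U)))
     \<and>
     (\<forall>M :: ('v::ab_group_add) hc_data. irreducible_hc d M \<and> calibrated d M \<longrightarrow>
        (\<exists>lam mu L U. shape_with_boxes d lam mu \<and> H_choice d lam mu L U \<and>
           hc_iso d M (Hmod d lam mu U) \<and>
           (\<forall>lam' mu' L' U'. shape_with_boxes d lam' mu' \<and> H_choice d lam' mu' L' U' \<longrightarrow>
              (hc_iso d M (Hmod d lam' mu' U') \<longleftrightarrow> same_shape lam' mu' lam mu))))"
proof (intro conjI allI impI)
  fix lam mu assume sh: "shape_with_boxes d lam mu"
  obtain L where L: "standard_filling d lam mu L" using standard_filling_exists[OF sh] .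
  interpret shape d lam mu by unfold_locales (use sh in \<open>simp add: shape_with_boxes_def\<close>)
  show "\<exists>L U. H_choice d lam mu L U" using H_choice_exists[OF L] by blast
next
  fix lam mu L U assume "shape_with_boxes d lam mu" "H_choice d lam mu L U"
  then interpret chosen_module d lam mu L U by (rule chosen_moduleI)
  show "irreducible_hc d (Hmod d lam mu U)" by (rule Hmod_irreducible)
next
  fix M :: "'v hc_data"
  assume "irreducible_hc d M \<and> calibrated d M"
  hence irr: "irreducible_hc d M" and cal: "calibrated d M" by auto
  have hM: "hc d M" using irr hc_module_imp_hc by (auto simp: irreducible_hc_def)
  have cM: "calibrated_hc d M"
    using hM irr cal by (simp add: calibrated_hc_def calibrated_hc_axioms_def irreducible_hc_def hc_module_def)
  interpret M: calibrated_hc d M by (rule cM)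
  have wM: "weak_hc d M" by unfold_locales
  have "carr M \<noteq> {0}" using irr by (simp add: irreducible_hc_def)
  then obtain c v where v: "M.eig c v" "v \<noteq> 0" by (rule M.weight_exists)
  obtain lam mu L where sh: "shape_with_boxes d lam mu" and L: "standard_filling d lam mu L"
    and c: "\<And>k. k \<in> {1..d} \<Longrightarrow> cont lam mu L k = c k"
    using admissible_sequence_shape[OF M.weight_admissible[OF v]] by blast
  interpret A: shape d lam mu by unfold_locales (use sh in \<open>simp add: shape_with_boxes_def\<close>)
  obtain U where U: "H_choice d lam mu L U" using A.H_choice_exists[OF L] by blast
  have vL: "M.eig (cont lam mu L) v" by (rule M.eig_cong[OF _ v(1)]) (simp add: c)
  have iso: "hc_iso d M (Hmod d lam mu U)"
    by (rule chosen_module.iso_of_weight[OF chosen_moduleI[OF sh U] cM irr vL v(2)])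
  have "hc_iso d M (Hmod d lam' mu' U') \<longleftrightarrow> same_shape lam' mu' lam mu"
    if sh': "shape_with_boxes d lam' mu'" and U': "H_choice d lam' mu' L' U'" for lam' mu' L' U'
  proof
    interpret B: chosen_module d lam' mu' L' U' by (rule chosen_moduleI[OF sh' U'])
    show "same_shape lam' mu' lam mu" if iso': "hc_iso d M (Hmod d lam' mu' U')"
    proof -
      obtain K where K: "standard_filling d lam' mu' K" "\<And>j. j \<in> {1..d} \<Longrightarrow> cont lam' mu' K j = cont lam mu L j"
        using B.weight_is_filling[OF wM vL v(2) iso'] by blast
      show ?thesis
        by (rule same_contents_same_shape[OF B.sk K(1) A.sk L]) (simp add: K(2))
    qed
    show "hc_iso d M (Hmod d lam' mu' U')" if ss: "same_shape lam' mu' lam mu"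
    proof -
      obtain K where K: "standard_filling d lam mu K" "\<And>k. k \<in> {1..d} \<Longrightarrow> cont lam mu K k = cont lam' mu' L' k"
        using same_shape_transfer_filling[OF B.sk A.sk ss B.L] by blast
      obtain v' where v': "M.eig (cont lam mu K) v'" "v' \<noteq> 0"
        using A.weight_of_other_filling[OF wM vL v(2) L K(1)] by blast
      have "M.eig (cont lam' mu' L') v'" by (rule M.eig_cong[OF _ v'(1)]) (simp add: K(2))
      thus ?thesis by (rule B.iso_of_weight[OF cM irr _ v'(2)])
    qed
  qed
  thus "\<exists>lam mu L U. shape_with_boxes d lam mu \<and> H_choice d lam mu L U \<and>
           hc_iso d M (Hmod d lam mu U) \<and>
           (\<forall>lam' mu' L' U'. shape_with_boxes d lam' mu' \<and> H_choice d lam' mu' L' U' \<longrightarrow>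
              (hc_iso d M (Hmod d lam' mu' U') \<longleftrightarrow> same_shape lam' mu' lam mu))"
    using sh U iso by blast
qed

end
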